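(* There exists $\lambda_0>0$ such that for all $\lambda<\lambda_0$ (where $\lambda>0$) the following holds, with a constant $c>0$ depending only on $\lambda$. Let $\mu$ be the $\lambda$-weighted (Gibbs) distribution on the triangulations of $\Lambda^0_{m,n}$, and, for $x\in\Lambda_{m,n}$ and a configuration $\sigma_x$ of the edge at $x$, let $\mu^{\sigma_x}$ be the distribution $\mu$ conditional on the edge at $x$ having configuration $\sigma_x$. Then the variation distance between $\mu$ and $\mu^{\sigma_x}$ at any set of midpoints $A\subseteq\Lambda_{m,n}$ satisfies $$\|\mu-\mu^{\sigma_x}\|_A\le |A|\,\exp\bigl(-c\,d(A,\sigma_x)\bigr).$$
   Context: Triangulations. For integers $m,n\ge1$, $\Lambda^0_{m,n}=\{0,1,\dots,m\}\times\{0,1,\dots,n\}\subset\mathbb{Z}^2$. An edge is a straight segment joining two points of $\Lambda^0_{m,n}$ and passing through no other integer point. Two edges cross if they are distinct and meet at a point that is not a common endpoint. A (full) triangulation of $\Lambda^0_{m,n}$ is a maximal set of pairwise noncrossing edges. In every triangulation the set of midpoints of the edges is exactly $\Lambda_{m,n}=\bigl(\{0,\frac12,1,\dots,m\}\times\{0,\frac12,1,\dots,n\}\bigr)\setminus\Lambda^0_{m,n}$, each midpoint occurring once; so a triangulation is written $\sigma=\{\sigma_x\}_{x\in\Lambda_{m,n}}$, where $\sigma_x$ is the edge with midpoint $x$. A unit diagonal is a diagonal of a unit lattice square. $|\sigma_x|$ is the $\ell_1$ length of $\sigma_x$, $|\sigma|=\sum_x|\sigma_x|$, and the $\lambda$-weighted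 distribution is $\mu(\sigma)=\lambda^{|\sigma|}/\sum_{\tau}\lambda^{|\tau|}$, the sum being over all triangulations $\tau$ of $\Lambda^0_{m,n}$. Ground states. A ground state triangulation is one of minimum total length; it is unique up to flipping of unit diagonals. Fix one, $\bar\sigma=\{\bar\sigma_x\}$. A ground state region is a (not necessarily connected) region of $\mathbb{R}^2$ bounded by ground state edges. For $\sigma_x\neq\bar\sigma_x$, the influence region $\Upsilon(\sigma_x)$ is the smallest ground state region containing $\sigma_x$; when $\sigma_x=\bar\sigma_x$, $\Upsilon(\sigma_x)$ is defined to be empty. Let $\bar\sigma(\sigma_x)=\{\bar\sigma_z(\sigma_x)\}_z$ be the ground state (minimum-length) triangulation among those containing the edge $\sigma_x$; apart from $\Upsilon(\sigma_x)$ it coincides with $\bar\sigma$ (up to the choice of flippable unit diagonals). Distance. Let $\mathcal{G}(\sigma_x)$ be the graph whose vertices are the triangles of $\bar\sigma(\sigma_x)$, two being neighbors iff they share an edge. $d(A,\sigma_x)$ is the graph distance in $\mathcal{G}(\sigma_x)$ between the influence region $\Upsilon(\sigma_x)$ (the set of triangles it contains) and the set of all triangles of $\bar\sigma(\sigma_x)$ containing an edge $\bar\sigma_z(\sigma_x)$ with $z\in A$, where the distance between two sets of vertices is the minimum distance between a pair of vertices, one from each set (no separate convention is specified for the case where one of the sets is empty). $\|\mu-\mu^{\sigma_x}\|_A$ is the total variation distance between the marginals of $\mu$ and $\mu^{\sigma_x}$ on the edges with midpoints in $A$; $|A|$ is the cardinality of $A$.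
   Formalization: When σ_x is the fixed ground state edge its influence region is empty and d(A,σ_x) is undefined (infinite distance would make the claim false, e.g. A={x}, m=n=1); the distance is then taken to be 0, so the bound is the trivial |A| in that case. *)

theory Defs
  imports "HOL-Probability.Probability"
begin

section \<open>Edges and triangulations\<close>

type_synonym point = "real \<times> real"

text \<open>
  An edge is represented by the two-element set of its endpoints; the straight segment it denotes
  is its convex hull.
\<close>

type_synonym edge = "point set"

definition lattice_points :: "nat \<Rightarrow> nat \<Rightarrow> point set" where
  "lattice_points m n = {(real i, real j) | i j. i \<le> m \<and> j \<le> n}"

definition midpoints :: "nat \<Rightarrow> nat \<Rightarrow> point set" where
  "midpoints m n = {(real i / 2, real j / 2) | i j. i \<le> 2 * m \<and> j \<le> 2 * n} - lattice_points m n"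

definition lattice_edges :: "nat \<Rightarrow> nat \<Rightarrow> edge set" where
  "lattice_edges m n =
     {{p, q} | p q. p \<in> lattice_points m n \<and> q \<in> lattice_points m n \<and> p \<noteq> q \<and>
        closed_segment p q \<inter> (\<int> \<times> \<int>) = {p, q}}"

definition crosses :: "edge \<Rightarrow> edge \<Rightarrow> bool" where
  "crosses e f \<longleftrightarrow> e \<noteq> f \<and> (\<exists>p \<in> convex hull e \<inter> convex hull f. p \<notin> e \<inter> f)"

definition noncrossing :: "edge set \<Rightarrow> bool" where
  "noncrossing T \<longleftrightarrow> (\<forall>e\<in>T. \<forall>f\<in>T. \<not> crosses e f)"

definition triangulation :: "nat \<Rightarrow> nat \<Rightarrow> edge set \<Rightarrow> bool" where
  "triangulation m n T \<longleftrightarrow> T \<subseteq> lattice_edges m n \<and> noncrossing T \<and>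
     (\<forall>T'. T' \<subseteq> lattice_edges m n \<and> noncrossing T' \<and> T \<subseteq> T' \<longrightarrow> T' = T)"

definition edge_mid :: "edge \<Rightarrow> point" where
  "edge_mid e = (THE x. \<exists>p q. e = {p, q} \<and> x = midpoint p q)"

definition edge_length :: "edge \<Rightarrow> real" where
  "edge_length e = (THE l. \<exists>p q. e = {p, q} \<and> l = \<bar>fst p - fst q\<bar> + \<bar>snd p - snd q\<bar>)"

definition total_length :: "edge set \<Rightarrow> real" where
  "total_length T = (\<Sum>e\<in>T. edge_length e)"

text \<open>The edge \<open>\<sigma>\<^sub>x\<close> of a triangulation \<open>\<sigma>\<close>:\<close>

definition edge_at :: "edge set \<Rightarrow> point \<Rightarrow> edge" where
  "edge_at T x = (THE e. e \<in> T \<and> edge_mid e = x)"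

lemma edge_mid_doubleton: "edge_mid {p, q} = midpoint p q"
  unfolding edge_mid_def
  by (rule the_equality) (blast, metis doubleton_eq_iff midpoint_sym)

lemma edge_length_doubleton: "edge_length {p, q} = \<bar>fst p - fst q\<bar> + \<bar>snd p - snd q\<bar>"
  unfolding edge_length_def
  by (rule the_equality) (blast, metis doubleton_eq_iff abs_minus_commute)

lemma finite_lattice_edges: "finite (lattice_edges m n)"
proof -
  have "lattice_points m n = (\<lambda>(i, j). (real i, real j)) ` ({..m} \<times> {..n})"
    by (auto simp: lattice_points_def)
  then have "finite (lattice_points m n)"
    by simp
  then show ?thesis
    by (rule finite_subset[OF _ finite_Pow_iff[THEN iffD2], rotated])
       (auto simp: lattice_edges_def)
qed

lemma finite_triangulations: "finite (Collect (triangulation m n))"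
  by (rule finite_subset[of _ "Pow (lattice_edges m n)"])
     (auto simp: triangulation_def finite_lattice_edges)

lemma noncrossing_extends:
  assumes "T0 \<subseteq> lattice_edges m n" "noncrossing T0"
  shows "\<exists>T. triangulation m n T \<and> T0 \<subseteq> T"
proof -
  let ?F = "{T. T \<subseteq> lattice_edges m n \<and> noncrossing T}"
  have "finite ?F"
    by (rule finite_subset[of _ "Pow (lattice_edges m n)"]) (auto simp: finite_lattice_edges)
  moreover have "T0 \<in> ?F"
    using assms by simp
  ultimately obtain T where "T \<in> ?F" "T0 \<subseteq> T" "\<forall>T'\<in>?F. T \<subseteq> T' \<longrightarrow> T = T'"
    by (meson finite_has_maximal2)
  then show ?thesis
    unfolding triangulation_def by blast
qed

lemma triangulation_exists: "\<exists>T. triangulation m n T"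
  using noncrossing_extends[of "{}" m n] by (auto simp: noncrossing_def)

lemma triangulation_containing_exists:
  assumes "e \<in> lattice_edges m n"
  shows "\<exists>T. triangulation m n T \<and> e \<in> T"
  using noncrossing_extends[of "{e}" m n] assms by (auto simp: noncrossing_def crosses_def)

lemma edge_at_eqI:
  assumes T: "triangulation m n T" and e: "e \<in> T"
  shows "edge_at T (edge_mid e) = e"
  unfolding edge_at_def
proof (rule the_equality)
  fix f assume f: "f \<in> T \<and> edge_mid f = edge_mid e"
  show "f = e"
  proof (rule ccontr)
    assume ne: "f \<noteq> e"
    have mid: "edge_mid g \<in> convex hull g \<and> edge_mid g \<notin> g" if "g \<in> T" for g
    proof -
      from that T have "g \<in> lattice_edges m n"
        by (auto simp: triangulation_def)
      then obtain p q where g: "g = {p, q}" "p \<noteq> q"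
        by (auto simp: lattice_edges_def)
      then show ?thesis
        by (simp add: edge_mid_doubleton flip: segment_convex_hull)
    qed
    have "crosses f e"
      using mid[of e] mid[of f] e f ne unfolding crosses_def by auto
    then show False
      using T e f unfolding triangulation_def noncrossing_def by blast
  qed
qed (use e in auto)


section \<open>The weighted distribution\<close>

definition gibbs :: "nat \<Rightarrow> nat \<Rightarrow> real \<Rightarrow> edge set pmf" where
  "gibbs m n lam = embed_pmf (\<lambda>T. if triangulation m n T
     then lam powr total_length T / (\<Sum>T' | triangulation m n T'. lam powr total_length T') else 0)"

definition gibbs_cond :: "nat \<Rightarrow> nat \<Rightarrow> real \<Rightarrow> point \<Rightarrow> edge \<Rightarrow> edge set pmf" where
  "gibbs_cond m n lam x e = cond_pmf (gibbs m n lam) {T. edge_at T x = e}"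

definition marginal :: "point set \<Rightarrow> edge set pmf \<Rightarrow> (point \<Rightarrow> edge) pmf" where
  "marginal A P = map_pmf (\<lambda>T. restrict (edge_at T) A) P"

definition tv_dist :: "'a pmf \<Rightarrow> 'a pmf \<Rightarrow> real" where
  "tv_dist P Q = (SUP E. \<bar>measure_pmf.prob P E - measure_pmf.prob Q E\<bar>)"

lemma pmf_gibbs:
  assumes "lam > 0"
  shows "pmf (gibbs m n lam) T = (if triangulation m n T
     then lam powr total_length T / (\<Sum>T' | triangulation m n T'. lam powr total_length T') else 0)"
    (is "_ = ?f T")
proof -
  let ?Z = "\<Sum>T' | triangulation m n T'. lam powr total_length T'"
  have Z: "?Z > 0"
    using assms triangulation_exists[of m n] by (intro sum_pos finite_triangulations) auto
  have "(\<integral>\<^sup>+T. ennreal (?f T) \<partial>count_space UNIV)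
      = (\<Sum>T | triangulation m n T. ennreal (?f T))"
    by (rule nn_integral_count_space') (auto simp: finite_triangulations)
  also have "\<dots> = ennreal (\<Sum>T | triangulation m n T. ?f T)"
    using Z by (intro sum_ennreal) auto
  also have "(\<Sum>T | triangulation m n T. ?f T)
      = (\<Sum>T | triangulation m n T. lam powr total_length T / ?Z)"
    by (rule sum.cong) auto
  also have "\<dots> = ?Z / ?Z"
    by (rule sum_divide_distrib[symmetric])
  also have "\<dots> = 1"
    using Z by simp
  finally show ?thesis
    unfolding gibbs_def using Z by (intro pmf_embed_pmf) auto
qed

lemma gibbs_cond_event:
  assumes "lam > 0" "e \<in> lattice_edges m n"
  shows "set_pmf (gibbs m n lam) \<inter> {T. edge_at T (edge_mid e) = e} \<noteq> {}"
proof -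
  obtain T where T: "triangulation m n T" "e \<in> T"
    using triangulation_containing_exists[OF assms(2)] by blast
  have "(\<Sum>T' | triangulation m n T'. lam powr total_length T') > 0"
    using assms T by (intro sum_pos finite_triangulations) auto
  then have "T \<in> set_pmf (gibbs m n lam)"
    using T assms by (simp add: set_pmf_iff pmf_gibbs)
  with T edge_at_eqI[OF T] show ?thesis
    by blast
qed


section \<open>Ground states and influence regions\<close>

definition ground_state :: "nat \<Rightarrow> nat \<Rightarrow> edge set \<Rightarrow> bool" where
  "ground_state m n G \<longleftrightarrow> is_arg_min total_length (triangulation m n) G"

text \<open>\<open>S\<close> is a choice of the triangulation written \<open>\<sigma>\<close>-bar\<open>(\<sigma>\<^sub>x)\<close>, for the edge \<open>e = \<sigma>\<^sub>x\<close>:\<close>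

definition ground_state_with :: "nat \<Rightarrow> nat \<Rightarrow> edge \<Rightarrow> edge set \<Rightarrow> bool" where
  "ground_state_with m n e S \<longleftrightarrow> is_arg_min total_length (\<lambda>T. triangulation m n T \<and> e \<in> T) S"

text \<open>
  A region is a bounded set that is the closure of its interior; thus ground state regions are the
  unions of (closed) triangles of the ground state \<open>G\<close>.
\<close>

definition ground_state_region :: "edge set \<Rightarrow> point set \<Rightarrow> bool" where
  "ground_state_region G R \<longleftrightarrow>
     bounded R \<and> closure (interior R) = R \<and> frontier R \<subseteq> (\<Union>g\<in>G. convex hull g)"

definition influence_region :: "edge set \<Rightarrow> edge \<Rightarrow> point set" where
  "influence_region G e =
     (if edge_at G (edge_mid e) = e then {}
      else (LEAST R. ground_state_region G R \<and> convex hull e \<subseteq> R))"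


section \<open>Distance in the graph of triangles\<close>

text \<open>
  Triangles are represented by their vertex sets. The last condition is needed because three edges
  of a triangulation may form a closed circuit that is not a face (there are lattice points inside).
\<close>

definition triangles :: "edge set \<Rightarrow> point set set" where
  "triangles S = {{a, b, c} | a b c. {a, b} \<in> S \<and> {b, c} \<in> S \<and> {a, c} \<in> S \<and>
     (\<forall>g\<in>S. convex hull g \<inter> interior (convex hull {a, b, c}) = {})}"

definition triangle_adj :: "edge set \<Rightarrow> (point set \<times> point set) set" where
  "triangle_adj S = {(t, t'). t \<in> triangles S \<and> t' \<in> triangles S \<and> t \<noteq> t' \<and>
     (\<exists>g\<in>S. g \<subseteq> t \<and> g \<subseteq> t')}"

text \<open>The distance to or from the empty set is taken to be \<open>0\<close>.\<close>

definition triangle_set_dist :: "edge set \<Rightarrow> point set set \<Rightarrow> point set set \<Rightarrow> nat" where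
  "triangle_set_dist S X Y =
     (if X = {} \<or> Y = {} then 0 else LEAST k. \<exists>t\<in>X. \<exists>t'\<in>Y. (t, t') \<in> triangle_adj S ^^ k)"

text \<open>
  \<open>d(A, \<sigma>\<^sub>x)\<close> for \<open>e = \<sigma>\<^sub>x\<close>, with respect to the ground state \<open>G\<close> and the minimum-length
  triangulation \<open>S\<close> containing \<open>e\<close>.
\<close>

definition influence_dist :: "edge set \<Rightarrow> edge set \<Rightarrow> point set \<Rightarrow> edge \<Rightarrow> nat" where
  "influence_dist G S A e =
     triangle_set_dist S
       {t \<in> triangles S. convex hull t \<subseteq> influence_region G e}
       {t \<in> triangles S. \<exists>z\<in>A. edge_at S z \<subseteq> t}"

end

theory Submission
  imports Defs "HOL-Number_Theory.Cong"
begin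

text \<open>
  The distance between \<open>\<mu>\<close> and its conditional version is bounded by coupling through an exchange.
  Take \<open>\<sigma>\<close> from \<open>\<mu>\<close> and \<open>\<tau>\<close> from \<open>\<mu>\<close> conditioned on \<open>e\<close>, independently. Call a unit edge missing when it does
  not belong to both. Two adjacent unit squares are joined when the edge between them is missing. If an
  edge of \<open>\<sigma>\<close> or \<open>\<tau>\<close> runs through several squares, then the unit edges that it crosses are
  missing, so these squares are joined to each other. The zone consists of the midpoints in the squares
  that are joined to a square met by \<open>e\<close>, except for those at which both triangulations have a unit edge.
  An edge of \<open>\<sigma>\<close> at a midpoint of the zone never crosses an edge of \<open>\<tau>\<close> at a midpoint outside, or
  conversely (\<open>zone_closed\<close>). Exchanging \<open>\<sigma>\<close> and \<open>\<tau>\<close> outside the zone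
  therefore yields two triangulations; it keeps \<open>e\<close> in the second one, keeps the total length, keeps
  the zone, and is an involution. After the exchange the second triangulation agrees with \<open>\<sigma>\<close> off the zone, so the
  distance on \<open>A\<close> is at most the probability that the zone meets \<open>A\<close> (\<open>tv_zone\<close>).

  If the zone reaches \<open>A\<close> and \<open>d\<close> is the distance in the statement, then there is a chain of at least
  \<open>d / 4\<close> distinct missing unit edges that starts near a point of \<open>A\<close> and whose members do not cross \<open>e\<close>
  (\<open>zone_chain\<close>). Such edges belong to the ground state and to the minimal triangulation containing \<open>e\<close>.
  A Peierls argument shows that \<open>k\<close> given edges of a minimal triangulation are all replaced by longer
  ones with probability at most \<open>64\<^sup>-\<^sup>k\<close> (\<open>peierls\<close>), so \<open>k\<close> given unit edges not crossing \<open>e\<close> are all missing with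
  probability at most \<open>32\<^sup>-\<^sup>k\<close>, because each is missing from \<open>\<sigma>\<close> or from \<open>\<tau>\<close>. There are at most
  \<open>25\<^sup>k\<close> chains of length \<open>k\<close> from a given point, and \<open>25 / 32 < 1\<close>.

  The Peierls bound rests on a planar fact, \<open>shadow\<close>. An edge \<open>f\<close> that is neither horizontal nor vertical
  is the long diagonal of a parallelogram of area one whose other corners are lattice points. An
  edge that crosses a side or the short diagonal of this parallelogram, but does not cross \<open>f\<close>, is longer than \<open>f\<close>, and
  it is crossed by every edge that crosses \<open>f\<close> in a direction outside the cone spanned by two
  sides. This makes local replacements possible: every noncrossing set extends to a triangulation
  with an edge at every midpoint, and in a minimal triangulation containing prescribed edges every
  edge is a shortest one among the edges with its midpoint that respect the prescribed
  ones (\<open>compatible_coordinates\<close>). Long edges can thus be replaced by ground state edges one cluster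
  at a time. The clusters are connected in a graph of bounded degree, because an edge cutting through a
  triangulation crosses consecutive edges of common triangles, which is why each edge is shown to have a
  triangle of area one half on each side inside the rectangle (\<open>apex_exists\<close>).

  The length of the chain is compared with the graph of triangles as follows. The influence region is the
  union of the ground state triangles whose interior is met by \<open>e\<close> (\<open>influence_region_U\<close>). A triangle of the minimal
  triangulation containing \<open>e\<close> lies in this region unless it is half of a unit square
  (\<open>utri_small_or_influenced\<close>). A square not met by \<open>e\<close> consists of two adjacent triangles, so each step of
  the chain costs at most two steps between triangles.
\<close>

section \<open>Segments crossing a unit parallelogram\<close>

definition det :: "int \<times> int \<Rightarrow> int \<times> int \<Rightarrow> int" where
  "det a b = fst a * snd b - snd a * fst b"

definition orient :: "int \<times> int \<Rightarrow> int \<times> int \<Rightarrow> int \<times> int \<Rightarrow> int" where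
  "orient p q r = det (q - p) (r - p)"

definition xcross :: "int \<times> int \<Rightarrow> int \<times> int \<Rightarrow> int \<times> int \<Rightarrow> int \<times> int \<Rightarrow> bool" where
  "xcross p q r s \<longleftrightarrow> orient p q r * orient p q s < 0 \<and> orient r s p * orient r s q < 0"

lemma orient_Pair:
  "orient (p1, p2) (q1, q2) (r1, r2) = (q1 - p1) * (r2 - p2) - (q2 - p2) * (r1 - p1)"
  by (simp add: orient_def det_def)

lemma orient_swap: "orient q p r = - orient p q r"
  by (cases p; cases q; cases r) (simp add: orient_Pair algebra_simps)

lemma xcross_rev: "xcross q p r s = xcross p q r s" "xcross p q s r = xcross p q r s"
  by (auto simp: xcross_def orient_swap[of q p] orient_swap[of s r] mult.commute)

text \<open>
  The segment from \<open>s\<close> to \<open>t\<close> runs through the unit square from lower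
  left to upper right, below the diagonal and above the corner \<open>(1,0)\<close>. In
  \<open>highpass\<close> it runs above the diagonal and below \<open>(0,1)\<close>.
\<close>

definition lowpass :: "int \<times> int \<Rightarrow> int \<times> int \<Rightarrow> bool" where
  "lowpass s t \<longleftrightarrow> fst s \<le> 0 \<and> snd s \<le> 0 \<and> fst t \<ge> 1 \<and> snd t \<ge> 1 \<and>
     orient s t (0,0) \<ge> 0 \<and> orient s t (1,1) \<ge> 0 \<and> orient s t (1,0) < 0"

definition highpass :: "int \<times> int \<Rightarrow> int \<times> int \<Rightarrow> bool" where
  "highpass s t \<longleftrightarrow> fst s \<le> 0 \<and> snd s \<le> 0 \<and> fst t \<ge> 1 \<and> snd t \<ge> 1 \<and>
     orient s t (0,0) \<le> 0 \<and> orient s t (1,1) \<le> 0 \<and> orient s t (0,1) > 0"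

text \<open>
  If the segment crossed the line of the diagonal inside the square, it would cross the diagonal
  itself; so it leaves the diagonal on one side, and integrality of the end points forces them
  into the two quadrants.
\<close>

lemma lowpass_bottom:
  assumes x: "xcross s t (0,0) (1,0)" and n: "\<not> xcross s t (0,0) (1,1)" and "snd s < 0"
  shows "lowpass s t"
proof -
  obtain s1 s2 t1 t2 where st: "s = (s1,s2)" "t = (t1,t2)" by (cases s; cases t) auto
  define h1 h2 where "h1 = t1 - s1" and "h2 = t2 - s2"
  define d0 where "d0 = h2 * s1 - h1 * s2"
  have d: "orient s t (0,0) = d0" "orient s t (1,0) = d0 - h2" "orient s t (1,1) = d0 + h1 - h2"
    by (auto simp: st orient_Pair d0_def h1_def h2_def algebra_simps)
  have s2: "s2 \<le> -1" using assms(3) st by simp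
  have "s2 * t2 < 0" using x by (simp add: xcross_def st orient_Pair)
  then have t2: "t2 \<ge> 1" using s2 by (smt (verit) mult_nonpos_nonpos)
  have h2: "h2 \<ge> 2" using s2 t2 by (simp add: h2_def)
  have "d0 * (d0 - h2) < 0" using x by (simp add: xcross_def d)
  then have d0: "d0 > 0" "d0 < h2" using h2 by (smt (verit) mult_nonneg_nonneg mult_nonpos_nonpos)+
  have d0': "d0 = h2 * t1 - h1 * t2" by (simp add: d0_def h1_def h2_def algebra_simps)
  have d1: "d0 + h1 - h2 \<ge> 0"
  proof (rule ccontr)
    assume neg: "\<not> ?thesis"
    have a: "h2 * (t2 - t1) = t2 * (h2 - h1) - d0" by (simp add: d0' algebra_simps)
    have b: "h2 * (s2 - s1) = s2 * (h2 - h1) - d0" by (simp add: d0_def algebra_simps)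
    have "t2 * (h2 - h1) \<ge> 1 * (h2 - h1)" using t2 neg d0 by (intro mult_right_mono) auto
    then have "h2 * (t2 - t1) > 0" using a neg by simp
    then have p: "t2 - t1 > 0" using h2 by (simp add: zero_less_mult_iff)
    have "s2 * (h2 - h1) \<le> 0" using s2 neg d0 by (intro mult_nonpos_nonneg) auto
    then have "h2 * (s2 - s1) < 0" using b d0 by simp
    then have q: "s2 - s1 < 0" using h2 by (simp add: mult_less_0_iff)
    have e: "orient (0,0) (1,1) s = s2 - s1" "orient (0,0) (1,1) t = t2 - t1"
      by (simp_all add: st orient_Pair)
    have "xcross s t (0,0) (1,1)" unfolding xcross_def d e
      using p q neg d0 by (auto simp: mult_less_0_iff)
    with n show False ..
  qed
  have h1: "h1 > 0" using d1 d0 by simp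
  have "h1 * s2 \<le> h1 * (-1)" using h1 s2 by (intro mult_left_mono) auto
  then have "h2 * s1 \<le> d0 - h1" by (simp add: d0_def)
  then have "h2 * s1 < h2 * 1" using d0 h1 by linarith
  then have "s1 < 1" using h2 by (simp only: mult_less_cancel_left_pos)
  then have s1: "s1 \<le> 0" by simp
  have "h1 * t2 \<ge> h1 * 1" using h1 t2 by (intro mult_left_mono) auto
  then have "h2 * t1 \<ge> h2 * 1" using d0' d1 by simp
  then have t1: "t1 \<ge> 1" using h2 by (simp add: mult_le_cancel_left)
  show ?thesis unfolding lowpass_def d using s1 s2 t1 t2 d0 d1 by (simp add: st)
qed

lemma pass_anti:
  assumes x: "xcross s t (1,0) (0,1)" and n: "\<not> xcross s t (0,0) (1,1)"
    and lt: "fst s + snd s < 1"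
  shows "lowpass s t \<or> highpass s t"
proof -
  obtain s1 s2 t1 t2 where st: "s = (s1,s2)" "t = (t1,t2)" by (cases s; cases t) auto
  define h1 h2 where "h1 = t1 - s1" and "h2 = t2 - s2"
  define d0 where "d0 = h2 * s1 - h1 * s2"
  have d: "orient s t (0,0) = d0" "orient s t (1,0) = d0 - h2" "orient s t (1,1) = d0 + h1 - h2"
     "orient s t (0,1) = d0 + h1"
    by (auto simp: st orient_Pair d0_def h1_def h2_def algebra_simps)
  have d0': "d0 = h2 * t1 - h1 * t2" by (simp add: d0_def h1_def h2_def algebra_simps)
  have s: "s1 + s2 \<le> 0" using lt st by simp
  have "(1 - (s1 + s2)) * (1 - (t1 + t2)) < 0" using x by (simp add: xcross_def st orient_Pair algebra_simps)
  then have t: "t1 + t2 \<ge> 2" using s by (smt (verit) mult_nonneg_nonneg)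
  have h: "h1 + h2 \<ge> 2" using s t by (simp add: h1_def h2_def)
  have "(d0 - h2) * (d0 + h1) < 0" using x by (simp add: xcross_def d)
  then have d1: "d0 - h2 < 0" "d0 + h1 > 0" using h by (smt (verit) mult_nonneg_nonneg mult_nonpos_nonpos)+
  have a: "(h1 + h2) * (t2 - t1) = (t1 + t2) * (h2 - h1) - 2 * d0" by (simp add: d0' algebra_simps)
  have b: "(h1 + h2) * (s2 - s1) = (s1 + s2) * (h2 - h1) - 2 * d0" by (simp add: d0_def algebra_simps)
  have e: "orient (0,0) (1,1) s = s2 - s1" "orient (0,0) (1,1) t = t2 - t1"
    by (simp_all add: st orient_Pair)
  consider "d0 \<ge> 0" "d0 + h1 - h2 \<ge> 0" | "d0 \<le> 0" "d0 + h1 - h2 \<le> 0"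
    | "d0 > 0" "d0 + h1 - h2 < 0" | "d0 < 0" "d0 + h1 - h2 > 0" by linarith
  then show ?thesis
  proof cases
    case 1
    have h2: "h2 > 0" using 1 d1 by simp
    have h1: "h1 > 0" using 1 d1 by simp
    have s2: "s2 \<le> 0"
    proof (rule ccontr)
      assume "\<not> ?thesis"
      then have "s1 \<le> -1" "s2 \<ge> 1" using s by auto
      then have "h2 * s1 < 0" "h1 * s2 > 0" using h1 h2 by (auto simp: mult_less_0_iff)
      then show False using 1 d0_def by simp
    qed
    have s1: "s1 \<le> 0"
    proof (rule ccontr)
      assume "\<not> ?thesis"
      then have "s1 \<ge> 1" "s2 \<le> -1" using s by auto
      then have "h2 * s1 \<ge> h2 * 1" "h1 * s2 < 0" using h1 h2 by (auto simp: mult_less_0_iff)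
      then show False using d1 d0_def by simp
    qed
    have t1: "t1 \<ge> 1"
    proof (rule ccontr)
      assume "\<not> ?thesis"
      then have "h2 * t1 \<le> 0" "h1 * t2 \<ge> h1 * 1" using t h1 h2 by (auto simp: mult_le_0_iff)
      then show False using 1 d0' d1 h2 by simp
    qed
    have t2: "t2 \<ge> 1"
    proof (rule ccontr)
      assume "\<not> ?thesis"
      then have "h2 * 2 \<le> h2 * t1" "h1 * t2 \<le> 0" using t h1 h2
        by (intro mult_left_mono, auto simp: mult_le_0_iff)
      then show False using 1 d0' d1 h2 by linarith
    qed
    show ?thesis using 1 d1 s1 s2 t1 t2 unfolding lowpass_def d by (simp add: st)
  next
    case 2
    have h2: "h2 > 0" using 2 d1 by simp
    have h1: "h1 > 0" using 2 d1 by simp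
    have s2: "s1 \<le> 0"
    proof (rule ccontr)
      assume "\<not> ?thesis"
      then have "h2 * s1 > 0" "h1 * s2 < 0" using s h1 h2 by (auto simp: mult_less_0_iff)
      then show False using 2 d0_def by simp
    qed
    have s1: "s2 \<le> 0"
    proof (rule ccontr)
      assume "\<not> ?thesis"
      then have "h2 * s1 < 0" "h1 * s2 \<ge> h1 * 1" using s h1 h2 by (auto simp: mult_less_0_iff)
      then show False using d1 d0_def by simp
    qed
    have t1: "t2 \<ge> 1"
    proof (rule ccontr)
      assume "\<not> ?thesis"
      then have "h2 * t1 > 0" "h1 * t2 \<le> 0" using t h1 h2 by (auto simp: mult_le_0_iff)
      then show False using 2 d0' by linarith
    qed
    have t2: "t1 \<ge> 1"
    proof (rule ccontr)
      assume "\<not> ?thesis"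
      then have "h2 * t1 \<le> 0" "h1 * 2 \<le> h1 * t2" using t h1 h2
        by (auto simp: mult_le_0_iff intro: mult_left_mono)
      then show False using 2 d0' d1 h1 by linarith
    qed
    show ?thesis using 2 d1 s1 s2 t1 t2 unfolding highpass_def d by (simp add: st)
  next
    case 3
    have "(t1 + t2) * (h2 - h1) \<ge> 2 * (h2 - h1)" using 3 t by (intro mult_right_mono) auto
    then have "(h1 + h2) * (t2 - t1) > 0" using a 3 by simp
    then have p: "t2 - t1 > 0" using h by (simp add: zero_less_mult_iff)
    have "(s1 + s2) * (h2 - h1) \<le> 0" using 3 s by (intro mult_nonpos_nonneg) auto
    then have "(h1 + h2) * (s2 - s1) < 0" using b 3 by simp
    then have q: "s2 - s1 < 0" using h by (simp add: mult_less_0_iff)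
    have "xcross s t (0,0) (1,1)" unfolding xcross_def d e
      using p q 3 by (auto simp: mult_less_0_iff)
    with n show ?thesis ..
  next
    case 4
    have "(t1 + t2) * (h2 - h1) \<le> 2 * (h2 - h1)" using 4 t by (intro mult_right_mono_neg) auto
    then have "(h1 + h2) * (t2 - t1) < 0" using a 4 by simp
    then have p: "t2 - t1 < 0" using h by (simp add: mult_less_0_iff)
    have "(s1 + s2) * (h2 - h1) \<ge> 0" using 4 s by (intro mult_nonpos_nonpos) auto
    then have "(h1 + h2) * (s2 - s1) > 0" using b 4 by simp
    then have q: "s2 - s1 > 0" using h by (simp add: zero_less_mult_iff)
    have "xcross s t (0,0) (1,1)" unfolding xcross_def d e
      using p q 4 by (auto simp: mult_less_0_iff)
    with n show ?thesis ..
  qed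
qed

text \<open>
  The reflections that exchange the coordinates and that turn the unit square upside down reduce
  the four sides to the bottom side.
\<close>

abbreviation tr :: "int \<times> int \<Rightarrow> int \<times> int" where "tr a \<equiv> (snd a, fst a)"
abbreviation rf :: "int \<times> int \<Rightarrow> int \<times> int" where "rf a \<equiv> (1 - fst a, 1 - snd a)"

lemma orient_tr: "orient (tr p) (tr q) (tr r) = - orient p q r"
  by (cases p; cases q; cases r) (simp add: orient_Pair)
lemma orient_rf: "orient (rf p) (rf q) (rf r) = orient p q r"
  by (cases p; cases q; cases r) (simp add: orient_Pair algebra_simps)
lemma xcross_tr: "xcross (tr p) (tr q) (tr r) (tr s) = xcross p q r s"
  unfolding xcross_def orient_tr by simp
lemma xcross_rf: "xcross (rf p) (rf q) (rf r) (rf s) = xcross p q r s"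
  unfolding xcross_def orient_rf by simp

lemma lowpass_tr: "lowpass (tr s) (tr t) = highpass s t"
  using orient_tr[of s t "(0,0)"] orient_tr[of s t "(1,1)"] orient_tr[of s t "(0,1)"]
  by (auto simp: lowpass_def highpass_def)
lemma lowpass_rf: "lowpass (rf s) (rf t) = highpass t s"
  using orient_rf[of s t "(1,1)"] orient_rf[of s t "(0,0)"] orient_rf[of s t "(0,1)"]
  by (auto simp: lowpass_def highpass_def orient_swap[of t s])

lemma pass_bottom:
  assumes "xcross s t (0,0) (1,0)" "\<not> xcross s t (0,0) (1,1)"
  shows "lowpass s t \<or> lowpass t s"
proof -
  have "snd s * snd t < 0" using assms(1) by (cases s; cases t) (simp add: xcross_def orient_Pair)
  then have "snd s < 0 \<or> snd t < 0" by (simp add: mult_less_0_iff) auto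
  then show ?thesis using lowpass_bottom[of s t] lowpass_bottom[of t s] assms by (auto simp: xcross_rev)
qed

lemma pass_square:
  assumes n: "\<not> xcross s t (0,0) (1,1)"
    and x: "xcross s t (0,0) (1,0) \<or> xcross s t (1,0) (1,1) \<or> xcross s t (0,1) (1,1) \<or>
            xcross s t (0,0) (0,1) \<or> xcross s t (1,0) (0,1)"
  shows "lowpass s t \<or> highpass s t \<or> lowpass t s \<or> highpass t s"
  using x
proof (elim disjE)
  assume "xcross s t (0,0) (1,0)"
  then show ?thesis using pass_bottom n by blast
next
  assume "xcross s t (0,0) (0,1)"
  then have "xcross (tr s) (tr t) (0,0) (1,0)" using xcross_tr[of s t "(0,0)" "(0,1)"] by simp
  moreover have "\<not> xcross (tr s) (tr t) (0,0) (1,1)" using n xcross_tr[of s t "(0,0)" "(1,1)"] by simp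
  ultimately show ?thesis using pass_bottom[of "tr s" "tr t"] lowpass_tr by blast
next
  assume "xcross s t (0,1) (1,1)"
  then have "xcross (rf s) (rf t) (0,0) (1,0)" using xcross_rf[of s t "(0,1)" "(1,1)"] by (simp add: xcross_rev)
  moreover have "\<not> xcross (rf s) (rf t) (0,0) (1,1)" using n xcross_rf[of s t "(0,0)" "(1,1)"] by (simp add: xcross_rev)
  ultimately show ?thesis using pass_bottom[of "rf s" "rf t"] lowpass_rf by blast
next
  assume "xcross s t (1,0) (1,1)"
  then have "xcross (rf (tr s)) (rf (tr t)) (0,0) (1,0)"
    using xcross_rf[of "tr s" "tr t" "tr (1,0)" "tr (1,1)"] xcross_tr[of s t "(1,0)" "(1,1)"] by (simp add: xcross_rev)
  moreover have "\<not> xcross (rf (tr s)) (rf (tr t)) (0,0) (1,1)"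
    using n xcross_rf[of "tr s" "tr t" "tr (0,0)" "tr (1,1)"] xcross_tr[of s t "(0,0)" "(1,1)"] by (simp add: xcross_rev)
  ultimately have "lowpass (rf (tr s)) (rf (tr t)) \<or> lowpass (rf (tr t)) (rf (tr s))"
    using pass_bottom by blast
  then have "highpass (tr t) (tr s) \<or> highpass (tr s) (tr t)" using lowpass_rf by blast
  then show ?thesis using lowpass_tr[of "tr t" "tr s"] lowpass_tr[of "tr s" "tr t"] by auto
next
  assume a: "xcross s t (1,0) (0,1)"
  then have "(1 - (fst s + snd s)) * (1 - (fst t + snd t)) < 0"
    by (cases s; cases t) (simp add: xcross_def orient_Pair algebra_simps)
  then have "fst s + snd s < 1 \<or> fst t + snd t < 1" by (auto simp: mult_less_0_iff)
  then show ?thesis using pass_anti[of s t] pass_anti[of t s] a n by (auto simp: xcross_rev)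
qed

text \<open>
  A segment that crosses the diagonal while falling has one end above and to the left of the
  square and the other below and to the right, so it also cuts a segment that runs close to the
  diagonal.
\<close>

lemma lowpass_blocks:
  assumes l: "lowpass s t" and x: "xcross (0,0) (1,1) w v"
    and g: "fst v - fst w \<ge> 0" "snd v - snd w \<le> 0"
  shows "xcross s t w v"
proof -
  obtain s1 s2 t1 t2 w1 w2 v1 v2 where st: "s = (s1,s2)" "t = (t1,t2)" "w = (w1,w2)" "v = (v1,v2)"
    by (cases s; cases t; cases v; cases w) auto
  define h1 h2 g1 g2 where "h1 = t1 - s1" and "h2 = t2 - s2" and "g1 = v1 - w1" and "g2 = w2 - v2"
  have g12: "g1 \<ge> 0" "g2 \<ge> 0" using g by (auto simp: st g1_def g2_def)
  have l': "s1 \<le> 0" "s2 \<le> 0" "t1 \<ge> 1" "t2 \<ge> 1" "orient s t (0,0) \<ge> 0" "orient s t (1,0) < 0"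
    using l by (auto simp: lowpass_def st)
  have h12: "h1 > 0" "h2 > 0" using l' by (auto simp: h1_def h2_def)
  have "(w2 - w1) * (v2 - v1) < 0" using x by (simp add: xcross_def st orient_Pair)
  then have wv: "w2 - w1 > 0" "v2 - v1 < 0"
    using g12 by (auto simp: mult_less_0_iff g1_def g2_def)
  have o: "orient w v r = g1 * (snd r - w2) + g2 * (fst r - w1)" for r
    by (cases r) (simp add: st orient_Pair g1_def g2_def algebra_simps)
  have oo: "orient w v (0,0) * orient w v (1,1) < 0" using x by (simp add: xcross_def)
  have "orient w v (1,1) = orient w v (0,0) + (g1 + g2)" by (simp add: o algebra_simps)
  then have o0: "orient w v (0,0) < 0" "orient w v (1,1) > 0"
    using oo g12 by (smt (verit) mult_nonneg_nonneg mult_nonpos_nonpos)+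
  have "orient w v s \<le> orient w v (0,0)" unfolding o using g12 l'
    by (intro add_mono mult_left_mono) (auto simp: st)
  moreover have "orient w v t \<ge> orient w v (1,1)" unfolding o using g12 l'
    by (intro add_mono mult_left_mono) (auto simp: st)
  ultimately have A: "orient w v s * orient w v t < 0" using o0 by (simp add: mult_less_0_iff)
  have o0': "g1 * w2 + g2 * w1 > 0" "g1 * (1 - w2) + g2 * (1 - w1) > 0"
    using o0 by (auto simp: o algebra_simps)
  have w1: "w1 \<le> 0"
  proof (rule ccontr)
    assume "\<not> ?thesis"
    then have "g1 * (1 - w2) \<le> 0" "g2 * (1 - w1) \<le> 0" using g12 wv
      by (auto intro!: mult_nonneg_nonpos)
    then show False using o0' by simp
  qed
  have w2: "w2 \<ge> 1"
  proof (rule ccontr)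
    assume "\<not> ?thesis"
    then have "g1 * w2 \<le> 0" "g2 * w1 \<le> 0" using g12 wv
      by (auto intro!: mult_nonneg_nonpos)
    then show False using o0' by simp
  qed
  have o0'': "g1 * v2 + g2 * v1 > 0" "g1 * (1 - v2) + g2 * (1 - v1) > 0"
    using o0' by (auto simp: g1_def g2_def algebra_simps)
  have v1: "v1 \<ge> 1"
  proof (rule ccontr)
    assume "\<not> ?thesis"
    then have "g1 * v2 \<le> 0" "g2 * v1 \<le> 0" using g12 wv
      by (auto intro!: mult_nonneg_nonpos)
    then show False using o0'' by simp
  qed
  have v2: "v2 \<le> 0"
  proof (rule ccontr)
    assume "\<not> ?thesis"
    then have "g1 * (1 - v2) \<le> 0" "g2 * (1 - v1) \<le> 0" using g12 wv
      by (auto intro!: mult_nonneg_nonpos)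
    then show False using o0'' by simp
  qed
  have "orient s t v = orient s t (1,0) + h1 * v2 - h2 * (v1 - 1)"
    by (simp add: st orient_Pair h1_def h2_def algebra_simps)
  moreover have "h1 * v2 \<le> 0" "h2 * (v1 - 1) \<ge> 0" using h12 v1 v2
    by (auto intro: mult_nonneg_nonpos)
  ultimately have B: "orient s t v < 0" using l' by simp
  have "orient s t w = orient s t (0,0) + h1 * w2 - h2 * w1"
    by (simp add: st orient_Pair h1_def h2_def algebra_simps)
  moreover have "h1 * w2 > 0" "h2 * w1 \<le> 0" using h12 w1 w2
    by (auto intro: mult_nonneg_nonpos)
  ultimately have C: "orient s t w > 0" using l' by simp
  show ?thesis unfolding xcross_def using A B C by (simp add: mult_less_0_iff)
qed

lemma pass_blocks:
  assumes l: "lowpass s t \<or> highpass s t \<or> lowpass t s \<or> highpass t s" and x: "xcross (0,0) (1,1) w v"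
    and g: "(fst v - fst w) * (snd v - snd w) \<le> 0"
  shows "xcross s t w v"
proof -
  have *: "xcross s t w v" if l: "lowpass s t" and x: "xcross (0,0) (1,1) w v"
    and g: "(fst v - fst w) * (snd v - snd w) \<le> 0" for s t w v
  proof -
    have "(fst v - fst w \<ge> 0 \<and> snd v - snd w \<le> 0) \<or> (fst w - fst v \<ge> 0 \<and> snd w - snd v \<le> 0)"
      using g by (auto simp: mult_le_0_iff)
    then show ?thesis using lowpass_blocks[OF l x] lowpass_blocks[OF l, of v w] x by (auto simp: xcross_rev)
  qed
  have **: "xcross s t w v" if l: "highpass s t" and x: "xcross (0,0) (1,1) w v"
    and g: "(fst v - fst w) * (snd v - snd w) \<le> 0" for s t w v
  proof -
    have "xcross (tr s) (tr t) (tr w) (tr v)"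
      using *[of "tr s" "tr t" "tr w" "tr v"] l x g xcross_tr[of "(0,0)" "(1,1)" w v]
      by (simp add: lowpass_tr mult.commute)
    then show ?thesis using xcross_tr by blast
  qed
  show ?thesis using l *[of s t w v] *[of t s w v] **[of s t w v] **[of t s w v] x g
    by (auto simp: xcross_rev)
qed

text \<open>
  Affine lattice coordinates with origin \<open>p\<close> and basis \<open>a\<close>,
  \<open>b\<close>; if \<open>det a b = 1\<close>, they preserve orientation, crossing and the
  lattice, so statements about a parallelogram of area one reduce to the unit square.
\<close>

definition aff :: "int \<times> int \<Rightarrow> int \<times> int \<Rightarrow> int \<times> int \<Rightarrow> int \<times> int \<Rightarrow> int \<times> int" where
  "aff p a b x = (fst p + fst x * fst a + snd x * fst b, snd p + fst x * snd a + snd x * snd b)"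

definition len :: "int \<times> int \<Rightarrow> int" where "len a = \<bar>fst a\<bar> + \<bar>snd a\<bar>"

definition same_quadrant :: "int \<times> int \<Rightarrow> int \<times> int \<Rightarrow> bool" where
  "same_quadrant a b \<longleftrightarrow> fst a * fst b \<ge> 0 \<and> snd a * snd b \<ge> 0"

lemma orient_aff: "orient (aff p a b x) (aff p a b y) (aff p a b z) = det a b * orient x y z"
  by (cases p; cases a; cases b; cases x; cases y; cases z) (simp add: orient_def det_def aff_def algebra_simps)

lemma xcross_aff:
  assumes "det a b = 1"
  shows "xcross (aff p a b x) (aff p a b y) (aff p a b z) (aff p a b w) = xcross x y z w"
  by (simp add: xcross_def orient_aff assms)

lemma aff_surj:
  assumes "det a b = 1"
  obtains x where "r = aff p a b x"
proof
  obtain r1 r2 p1 p2 a1 a2 b1 b2 where rp: "r = (r1,r2)" "p = (p1,p2)" "a = (a1,a2)" "b = (b1,b2)"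
    by (cases r; cases p; cases a; cases b) auto
  have d: "a1 * b2 - a2 * b1 = 1" using assms by (simp add: rp det_def)
  have "p1 + ((r1 - p1) * b2 - (r2 - p2) * b1) * a1 + (a1 * (r2 - p2) - a2 * (r1 - p1)) * b1
      = p1 + (r1 - p1) * (a1 * b2 - a2 * b1)" by (simp add: algebra_simps)
  moreover have "p2 + ((r1 - p1) * b2 - (r2 - p2) * b1) * a2 + (a1 * (r2 - p2) - a2 * (r1 - p1)) * b2
      = p2 + (r2 - p2) * (a1 * b2 - a2 * b1)" by (simp add: algebra_simps)
  ultimately show "r = aff p a b (det (r - p) b, det a (r - p))"
    unfolding d by (simp add: rp aff_def det_def)
qed

lemma aff_basis: "aff p a b (0,0) = p" "aff p a b (1,0) = p + a" "aff p a b (0,1) = p + b"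
  "aff p a b (1,1) = p + a + b"
  by (simp_all add: aff_def prod_eq_iff)

lemma len_nonneg: "len a \<ge> 0" by (simp add: len_def)
lemma len_minus: "len (a - b) = len (b - a)" by (simp add: len_def)
lemma len_pos: "a \<noteq> 0 \<Longrightarrow> len a \<ge> 1" by (cases a) (auto simp: len_def zero_prod_def)

lemma abs_comb:
  fixes x y c d :: int
  assumes "x * y \<ge> 0" "c * d \<ge> 0"
  shows "\<bar>x * c + y * d\<bar> = \<bar>x\<bar> * \<bar>c\<bar> + \<bar>y\<bar> * \<bar>d\<bar>"
proof -
  have *: "\<bar>X + Y\<bar> = \<bar>X\<bar> + \<bar>Y\<bar>" if "X * Y \<ge> 0" for X Y :: int
    using that by (auto simp: zero_le_mult_iff abs_if)
  have "(x * c) * (y * d) = (x * y) * (c * d)" by simp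
  also have "\<dots> \<ge> 0" using assms by simp
  finally have "\<bar>x * c + y * d\<bar> = \<bar>x * c\<bar> + \<bar>y * d\<bar>"
    by (rule *)
  then show ?thesis by (simp add: abs_mult)
qed

lemma len_comb:
  assumes "same_quadrant a b" "x * y \<ge> 0"
  shows "len (x * fst a + y * fst b, x * snd a + y * snd b) = \<bar>x\<bar> * len a + \<bar>y\<bar> * len b"
  using assms by (simp add: len_def abs_comb same_quadrant_def algebra_simps)

lemma len_add: "same_quadrant a b \<Longrightarrow> len (a + b) = len a + len b"
  using len_comb[of a b 1 1] by (simp add: plus_prod_def)

lemma det_nonzero: "det a b = 1 \<Longrightarrow> len a \<ge> 1 \<and> len b \<ge> 1"
  by (auto intro!: len_pos simp: det_def)

lemma len_diff_less:
  assumes "same_quadrant a b" "det a b = 1" "len (a + b) \<ge> 3"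
  shows "len (a - b) < len (a + b)"
proof -
  obtain a1 a2 b1 b2 where ab: "a = (a1,a2)" "b = (b1,b2)" by (cases a; cases b) auto
  have *: "\<bar>x - y\<bar> \<le> \<bar>x + y\<bar> \<and> (\<bar>x - y\<bar> = \<bar>x + y\<bar> \<longrightarrow> x * y = 0)" if "x * y \<ge> 0" for x y :: int
    using that by (auto simp: zero_le_mult_iff abs_if)
  have sq: "a1 * b1 \<ge> 0" "a2 * b2 \<ge> 0" using assms by (auto simp: same_quadrant_def ab)
  show ?thesis
  proof (rule ccontr)
    assume "\<not> ?thesis"
    then have "a1 * b1 = 0" "a2 * b2 = 0" using *[OF sq(1)] *[OF sq(2)] by (auto simp: len_def ab)
    moreover have "a1 * b2 - a2 * b1 = 1" using assms by (simp add: det_def ab)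
    ultimately have "(a1 = 0 \<and> b2 = 0 \<and> a2 * b1 = -1) \<or> (b1 = 0 \<and> a2 = 0 \<and> a1 * b2 = 1)"
      by auto
    then have "len (a + b) = 2"
      by (auto simp: len_def ab zmult_eq_1_iff minus_equation_iff[of "_ * _"] zmult_eq_neg1_iff)
    then show False using assms by simp
  qed
qed

lemma bezout_pos:
  fixes u v :: int
  assumes "coprime u v" "u > 0" "v > 0"
  shows "\<exists>a1 a2. a1 * v - a2 * u = 1 \<and> 0 \<le> a1 \<and> a1 \<le> u \<and> 0 \<le> a2 \<and> a2 \<le> v"
proof -
  obtain x y where xy: "x * u + y * v = 1"
    using assms(1) bezout_int[of u v] by auto
  define a2 where "a2 = (- x) mod v"
  have "[1 + a2 * u = 1 + (- x) * u] (mod v)" unfolding a2_def cong_def by (metis mod_add_right_eq mod_mult_left_eq)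
  also have "1 + (- x) * u = y * v" using xy by simp
  finally have "v dvd 1 + a2 * u" by (simp add: cong_def mod_eq_0_iff_dvd)
  then obtain a1 where a1: "1 + a2 * u = v * a1" by (elim dvdE)
  have a2: "0 \<le> a2" "a2 \<le> v - 1" using assms by (auto simp: a2_def zle_diff1_eq)
  have "v * a1 > 0" using a1 a2 assms by (smt (verit) mult_nonneg_nonneg)
  then have "a1 > 0" using assms by (simp add: zero_less_mult_iff)
  have "a2 * u \<le> (v - 1) * u" using a2 assms by (intro mult_right_mono) auto
  moreover have "(v - 1) * u = v * u - u" by (simp add: algebra_simps)
  ultimately have "v * a1 \<le> v * u" using a1 assms by linarith
  then have "a1 \<le> u" using assms by simp
  then show ?thesis using a1 a2 \<open>a1 > 0\<close> by (intro exI[of _ a1] exI[of _ a2]) (auto simp: algebra_simps)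
qed

text \<open>
  The Bezout coefficients of the coordinates give the two sides; choosing them between
  \<open>0\<close> and the coordinates makes both sides point into the quadrant of
  \<open>w\<close>, so that lengths add up.
\<close>

lemma unimodular_decomposition:
  assumes "coprime (fst w) (snd w)" "fst w \<noteq> 0" "snd w \<noteq> 0"
  obtains a b where "w = a + b" "det a b = 1" "same_quadrant a b"
proof -
  obtain u v where w: "w = (u,v)" by (cases w)
  have "coprime \<bar>u\<bar> \<bar>v\<bar>" using assms w by simp
  then obtain a1 a2 where a: "a1 * \<bar>v\<bar> - a2 * \<bar>u\<bar> = 1" "0 \<le> a1" "a1 \<le> \<bar>u\<bar>" "0 \<le> a2" "a2 \<le> \<bar>v\<bar>"
    using bezout_pos[of "\<bar>u\<bar>" "\<bar>v\<bar>"] assms w by auto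
  define A B where "A = (sgn u * a1, sgn v * a2)" and "B = (sgn u * (\<bar>u\<bar> - a1), sgn v * (\<bar>v\<bar> - a2))"
  have sg: "sgn u * sgn u = 1" "sgn v * sgn v = 1" using assms w by (auto simp: sgn_if)
  have s: "A + B = w" by (simp add: A_def B_def w right_diff_distrib sgn_mult_abs)
  have "det A B = (sgn u * sgn v) * (a1 * (\<bar>v\<bar> - a2) - a2 * (\<bar>u\<bar> - a1))"
    by (simp add: det_def A_def B_def algebra_simps)
  also have "a1 * (\<bar>v\<bar> - a2) - a2 * (\<bar>u\<bar> - a1) = 1" using a by (simp add: algebra_simps)
  finally have d: "det A B = sgn u * sgn v" by simp
  have "(sgn u * sgn u) * (a1 * (\<bar>u\<bar> - a1)) \<ge> 0" "(sgn v * sgn v) * (a2 * (\<bar>v\<bar> - a2)) \<ge> 0"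
    unfolding sg using a by auto
  then have q: "same_quadrant A B" by (simp add: same_quadrant_def A_def B_def mult.assoc mult.left_commute)
  have "det A B = 1 \<or> det A B = -1" using d assms w by (auto simp: sgn_if)
  then show ?thesis
  proof
    assume "det A B = 1" then show ?thesis using that s q by metis
  next
    assume "det A B = -1"
    then have "det B A = 1" by (simp add: det_def algebra_simps)
    moreover have "same_quadrant B A" using q by (simp add: same_quadrant_def mult.commute)
    ultimately show ?thesis using that[of B A] s by (simp add: add.commute)
  qed
qed

text \<open>
  In the coordinates of the parallelogram the edge passes through the unit square next to its
  diagonal. Both coordinates of its direction are then nonzero of equal sign and not both of
  absolute value one, which makes it longer; and it stands in the way of every edge crossing the
  diagonal from the other two quadrants.
\<close>

lemma shadow:
  assumes ab: "det a b = 1" "same_quadrant a b"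
    and ne: "{s,t} \<noteq> {p, p + a + b}"
    and n: "\<not> xcross s t p (p + a + b)"
    and x: "xcross s t p (p + a) \<or> xcross s t (p + a) (p + a + b) \<or> xcross s t (p + b) (p + a + b) \<or>
            xcross s t p (p + b) \<or> xcross s t (p + a) (p + b)"
  shows "len (t - s) > len (a + b)"
    and "\<And>w v. xcross p (p + a + b) w v \<Longrightarrow> \<not> xcross s t w v \<Longrightarrow>
           \<exists>g1 g2. g1 * g2 > 0 \<and> v - w = (g1 * fst a + g2 * fst b, g1 * snd a + g2 * snd b)"
proof -
  obtain s' where s: "s = aff p a b s'" using aff_surj[OF ab(1)] .
  obtain t' where t: "t = aff p a b t'" using aff_surj[OF ab(1)] .
  note X = xcross_aff[OF ab(1), of p]
  have x': "xcross s t p (p + a) = xcross s' t' (0,0) (1,0)"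
    "xcross s t (p + a) (p + a + b) = xcross s' t' (1,0) (1,1)"
    "xcross s t (p + b) (p + a + b) = xcross s' t' (0,1) (1,1)"
    "xcross s t p (p + b) = xcross s' t' (0,0) (0,1)"
    "xcross s t (p + a) (p + b) = xcross s' t' (1,0) (0,1)"
    "xcross s t p (p + a + b) = xcross s' t' (0,0) (1,1)"
    using X[of s' t' "(0,0)" "(1,0)"] X[of s' t' "(1,0)" "(1,1)"] X[of s' t' "(0,1)" "(1,1)"]
      X[of s' t' "(0,0)" "(0,1)"] X[of s' t' "(1,0)" "(0,1)"] X[of s' t' "(0,0)" "(1,1)"]
    unfolding aff_basis s t by simp_all
  have L: "lowpass s' t' \<or> highpass s' t' \<or> lowpass t' s' \<or> highpass t' s'"
    using x n unfolding x' by (intro pass_square)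
  have diff: "aff p a b y - aff p a b z = ((fst y - fst z) * fst a + (snd y - snd z) * fst b,
     (fst y - fst z) * snd a + (snd y - snd z) * snd b)" for y z
    by (simp add: aff_def prod_eq_iff algebra_simps)
  have ne': "\<not> (s' = (0,0) \<and> t' = (1,1))" "\<not> (t' = (0,0) \<and> s' = (1,1))"
    using ne aff_basis(1,4)[of p a b] s t by auto
  define h1 h2 where "h1 = fst t' - fst s'" and "h2 = snd t' - snd s'"
  have h: "(h1 \<ge> 1 \<and> h2 \<ge> 1 \<and> (h1 \<noteq> 1 \<or> h2 \<noteq> 1)) \<or> (h1 \<le> -1 \<and> h2 \<le> -1 \<and> (h1 \<noteq> -1 \<or> h2 \<noteq> -1))"
  proof -
    consider "fst s' \<le> 0 \<and> snd s' \<le> 0 \<and> fst t' \<ge> 1 \<and> snd t' \<ge> 1"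
      | "fst t' \<le> 0 \<and> snd t' \<le> 0 \<and> fst s' \<ge> 1 \<and> snd s' \<ge> 1"
      using L unfolding lowpass_def highpass_def by blast
    then show ?thesis using ne' unfolding h1_def h2_def prod_eq_iff fst_conv snd_conv by cases linarith+
  qed
  then have "h1 * h2 \<ge> 0" by (auto simp: zero_le_mult_iff)
  then have "len (t - s) = \<bar>h1\<bar> * len a + \<bar>h2\<bar> * len b"
    unfolding s t diff h1_def[symmetric] h2_def[symmetric] by (rule len_comb[OF ab(2)])
  moreover have "(\<bar>h1\<bar> \<ge> 2 \<and> \<bar>h2\<bar> \<ge> 1) \<or> (\<bar>h1\<bar> \<ge> 1 \<and> \<bar>h2\<bar> \<ge> 2)" using h by auto
  then have "\<bar>h1\<bar> * len a + \<bar>h2\<bar> * len b > len a + len b"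
  proof
    assume "\<bar>h1\<bar> \<ge> 2 \<and> \<bar>h2\<bar> \<ge> 1"
    then have "2 * len a \<le> \<bar>h1\<bar> * len a" "1 * len b \<le> \<bar>h2\<bar> * len b"
      using mult_right_mono[OF _ len_nonneg, of 2 "\<bar>h1\<bar>" a] mult_right_mono[OF _ len_nonneg, of 1 "\<bar>h2\<bar>" b]
      by blast+
    then show ?thesis using det_nonzero[OF ab(1)] by linarith
  next
    assume "\<bar>h1\<bar> \<ge> 1 \<and> \<bar>h2\<bar> \<ge> 2"
    then have "1 * len a \<le> \<bar>h1\<bar> * len a" "2 * len b \<le> \<bar>h2\<bar> * len b"
      using mult_right_mono[OF _ len_nonneg, of 1 "\<bar>h1\<bar>" a] mult_right_mono[OF _ len_nonneg, of 2 "\<bar>h2\<bar>" b]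
      by blast+
    then show ?thesis using det_nonzero[OF ab(1)] by linarith
  qed
  ultimately show "len (t - s) > len (a + b)" using len_add[OF ab(2)] by simp
  fix w v assume wv: "xcross p (p + a + b) w v" "\<not> xcross s t w v"
  obtain w' where w: "w = aff p a b w'" using aff_surj[OF ab(1)] .
  obtain v' where v: "v = aff p a b v'" using aff_surj[OF ab(1)] .
  have "xcross (0,0) (1,1) w' v'"
    using wv(1) X[of "(0,0)" "(1,1)" w' v'] unfolding w v aff_basis by simp
  moreover have "\<not> xcross s' t' w' v'" using wv(2) unfolding s t w v by (simp only: xcross_aff[OF ab(1)] not_False_eq_True)
  ultimately have "(fst v' - fst w') * (snd v' - snd w') > 0"
    using pass_blocks[OF L, of w' v'] by linarith
  then show "\<exists>g1 g2. g1 * g2 > 0 \<and> v - w = (g1 * fst a + g2 * fst b, g1 * snd a + g2 * snd b)"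
    unfolding w v diff by blast
qed

section \<open>Lattice edges\<close>

text \<open>
  Lattice points are handled as pairs of integers; \<open>rp\<close> embeds them into the plane,
  and \<open>E p q\<close> is the edge with end points \<open>rp p\<close> and \<open>rp
  q\<close>.
\<close>

definition rp :: "int \<times> int \<Rightarrow> point" where "rp p = (real_of_int (fst p), real_of_int (snd p))"
definition E :: "int \<times> int \<Rightarrow> int \<times> int \<Rightarrow> edge" where "E p q = {rp p, rp q}"
definition inbox :: "nat \<Rightarrow> nat \<Rightarrow> int \<times> int \<Rightarrow> bool" where
  "inbox m n p \<longleftrightarrow> 0 \<le> fst p \<and> fst p \<le> int m \<and> 0 \<le> snd p \<and> snd p \<le> int n"
abbreviation prim :: "int \<times> int \<Rightarrow> bool" where "prim a \<equiv> coprime (fst a) (snd a)"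

lemma rp_inject[simp]: "rp p = rp q \<longleftrightarrow> p = q"
  by (simp add: rp_def prod_eq_iff)

lemma E_eq_iff: "E p q = E r s \<longleftrightarrow> (p = r \<and> q = s) \<or> (p = s \<and> q = r)"
  unfolding E_def by (simp add: doubleton_eq_iff)

lemma E_commute: "E p q = E q p" by (auto simp: E_def)

lemma lattice_points_iff: "x \<in> lattice_points m n \<longleftrightarrow> (\<exists>p. inbox m n p \<and> x = rp p)"
proof
  assume "x \<in> lattice_points m n"
  then obtain i j where "x = (real i, real j)" "i \<le> m" "j \<le> n" by (auto simp: lattice_points_def)
  then show "\<exists>p. inbox m n p \<and> x = rp p"
    by (intro exI[of _ "(int i, int j)"]) (auto simp: inbox_def rp_def)
next
  assume "\<exists>p. inbox m n p \<and> x = rp p"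
  then obtain i j where "x = rp (i,j)" "inbox m n (i,j)" by auto
  then have "x = (real (nat i), real (nat j)) \<and> nat i \<le> m \<and> nat j \<le> n"
    by (auto simp: inbox_def rp_def)
  then show "x \<in> lattice_points m n" unfolding lattice_points_def by blast
qed

lemma prim_parallel:
  assumes "prim w" "det w c = 0"
  shows "\<exists>k. c = (k * fst w, k * snd w)"
proof -
  obtain u v c1 c2 where w: "w = (u,v)" "c = (c1,c2)" by (cases w; cases c) auto
  obtain x y where xy: "x * u + y * v = 1" using assms(1) bezout_int[of u v] w by auto
  have d: "u * c2 = v * c1" using assms(2) w by (simp add: det_def)
  have "c1 = (x * u + y * v) * c1" using xy by simp
  also have "\<dots> = x * u * c1 + y * (v * c1)" by (simp add: algebra_simps)
  also have "\<dots> = (x * c1 + y * c2) * u" using d by (simp add: d[symmetric] algebra_simps)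
  finally have 1: "c1 = (x * c1 + y * c2) * u" .
  have "c2 = (x * u + y * v) * c2" using xy by simp
  also have "\<dots> = x * (u * c2) + y * v * c2" by (simp add: algebra_simps)
  also have "\<dots> = (x * c1 + y * c2) * v" using d by (simp add: algebra_simps)
  finally have "c2 = (x * c1 + y * c2) * v" .
  with 1 show ?thesis unfolding w by auto
qed

lemma ZxZ_iff: "x \<in> \<int> \<times> \<int> \<longleftrightarrow> (\<exists>c. x = rp c)"
  by (cases x) (auto simp: rp_def Ints_def)

lemma segment_lattice_prim:
  assumes "prim (q - p)"
  shows "closed_segment (rp p) (rp q) \<inter> (\<int> \<times> \<int>) = {rp p, rp q}"
proof -
  have "x \<in> {rp p, rp q}" if xs: "x \<in> closed_segment (rp p) (rp q)" and xz: "x \<in> \<int> \<times> \<int>" for x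
  proof -
    obtain c where x: "x = rp c" using xz ZxZ_iff by blast
    obtain u where u: "0 \<le> u" "u \<le> 1" "rp c = (1 - u) *\<^sub>R rp p + u *\<^sub>R rp q"
      using xs x by (auto simp: in_segment)
    have c: "real_of_int (fst c - fst p) = u * real_of_int (fst q - fst p)"
      "real_of_int (snd c - snd p) = u * real_of_int (snd q - snd p)"
      using u(3) by (auto simp: rp_def algebra_simps)
    have "real_of_int (det (q - p) (c - p)) = 0"
      using c by (simp add: det_def)
    then have "det (q - p) (c - p) = 0" by simp
    then obtain k where k: "c - p = (k * fst (q - p), k * snd (q - p))"
      using prim_parallel[OF assms] by blast
    have "fst (q - p) \<noteq> 0 \<or> snd (q - p) \<noteq> 0" using assms by auto
    moreover have "real_of_int k * real_of_int (fst q - fst p) = u * real_of_int (fst q - fst p)"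
      "real_of_int k * real_of_int (snd q - snd p) = u * real_of_int (snd q - snd p)"
      unfolding c[symmetric] using k by (simp_all add: prod_eq_iff)
    ultimately have "u = k" by auto
    then have "k = 0 \<or> k = 1" using u by auto
    then have "c = p \<or> c = q" using k by (auto simp: prod_eq_iff)
    then show ?thesis using x by auto
  qed
  moreover have "rp p \<in> \<int> \<times> \<int>" "rp q \<in> \<int> \<times> \<int>" using ZxZ_iff by blast+
  ultimately show ?thesis by blast
qed

lemma prim_segment_lattice:
  assumes "closed_segment (rp p) (rp q) \<inter> (\<int> \<times> \<int>) = {rp p, rp q}" "p \<noteq> q"
  shows "prim (q - p)"
proof -
  obtain u v where w: "q - p = (u,v)" by (cases "q - p")
  define g where "g = gcd u v"
  have g: "g > 0" using assms(2) w by (auto simp: g_def prod_eq_iff)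
  obtain u' v' where uv: "u = g * u'" "v = g * v'" unfolding g_def by (meson gcd_dvd1 gcd_dvd2 dvd_def)
  define c where "c = p + (u', v')"
  have q: "fst q = fst p + g * u'" "snd q = snd p + g * v'" using w uv by (auto simp: prod_eq_iff)
  have "rp c = (1 - 1 / real_of_int g) *\<^sub>R rp p + (1 / real_of_int g) *\<^sub>R rp q"
    using g by (simp add: rp_def c_def q field_simps)
  then have "rp c \<in> closed_segment (rp p) (rp q)"
    using g by (auto simp: in_segment intro!: exI[of _ "1 / real_of_int g"])
  then have "rp c \<in> {rp p, rp q}" using assms(1) ZxZ_iff by blast
  then have "c = p \<or> c = q" by auto
  then have "(u' = 0 \<and> v' = 0) \<or> g = 1"
    using g q by (auto simp: c_def prod_eq_iff)
  then have "g = 1" using uv assms(2) w by (auto simp: prod_eq_iff)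
  then show ?thesis using w by (simp add: g_def coprime_iff_gcd_eq_1)
qed

lemma lattice_edge_iff:
  "e \<in> lattice_edges m n \<longleftrightarrow> (\<exists>p q. e = E p q \<and> inbox m n p \<and> inbox m n q \<and> prim (q - p))"
proof
  assume "e \<in> lattice_edges m n"
  then show "\<exists>p q. e = E p q \<and> inbox m n p \<and> inbox m n q \<and> prim (q - p)"
    unfolding lattice_edges_def E_def
    by (smt (verit, best) lattice_points_iff mem_Collect_eq prim_segment_lattice)
next
  assume "\<exists>p q. e = E p q \<and> inbox m n p \<and> inbox m n q \<and> prim (q - p)"
  then obtain p q where *: "e = E p q" "inbox m n p" "inbox m n q" "prim (q - p)" by blast
  then have "p \<noteq> q" by auto
  then show "e \<in> lattice_edges m n"
    unfolding lattice_edges_def using * segment_lattice_prim[OF *(4)] rp_inject[of p q]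
    unfolding mem_Collect_eq E_def lattice_points_iff by blast
qed

lemma lattice_edgeE:
  assumes "e \<in> lattice_edges m n"
  obtains p q where "e = E p q" "inbox m n p" "inbox m n q" "prim (q - p)"
  using assms lattice_edge_iff by blast

lemma E_lattice_iff: "E p q \<in> lattice_edges m n \<longleftrightarrow> inbox m n p \<and> inbox m n q \<and> prim (q - p)"
proof -
  have "prim (q - p) \<longleftrightarrow> prim (p - q)" by (metis coprime_minus_left_iff coprime_minus_right_iff fst_diff minus_diff_eq snd_diff)
  then show ?thesis unfolding lattice_edge_iff E_eq_iff by metis
qed

lemma edge_length_E: "edge_length (E p q) = real_of_int (len (q - p))"
  by (simp add: E_def edge_length_doubleton rp_def len_def)

lemma edge_mid_E: "edge_mid (E p q) = (real_of_int (fst p + fst q) / 2, real_of_int (snd p + snd q) / 2)"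
  by (simp add: E_def edge_mid_doubleton rp_def midpoint_def)

text \<open>
  Twice the signed area of a triangle in the real plane; on lattice points it is
  \<open>orient\<close>.
\<close>

definition orientR :: "point \<Rightarrow> point \<Rightarrow> point \<Rightarrow> real" where
  "orientR p q r = (fst q - fst p) * (snd r - snd p) - (snd q - snd p) * (fst r - fst p)"

lemma orientR_rp: "orientR (rp p) (rp q) (rp r) = real_of_int (orient p q r)"
  by (simp add: orientR_def rp_def orient_def det_def)

lemma orientR_comb:
  "orientR p q ((1 - u) *\<^sub>R r + u *\<^sub>R s) = (1 - u) * orientR p q r + u * orientR p q s"
  by (cases p; cases q; cases r; cases s) (simp add: orientR_def algebra_simps)

lemma orientR_on: "orientR p q ((1 - u) *\<^sub>R p + u *\<^sub>R q) = 0"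
  by (cases p; cases q) (simp add: orientR_def algebra_simps)

lemma xcross_point:
  assumes "xcross p q r s"
  obtains u v where "0 < u" "u < 1" "0 < v" "v < 1"
    "(1 - u) *\<^sub>R rp p + u *\<^sub>R rp q = (1 - v) *\<^sub>R rp r + v *\<^sub>R rp s"
proof -
  define A B C F where "A = real_of_int (orient r s p)" and "B = real_of_int (orient r s q)"
    and "C = real_of_int (orient p q r)" and "F = real_of_int (orient p q s)"
  have "real_of_int (orient r s p * orient r s q) < 0" "real_of_int (orient p q r * orient p q s) < 0"
    using assms unfolding xcross_def by linarith+
  then have neg: "A * B < 0" "C * F < 0" by (simp_all add: A_def B_def C_def F_def)
  define u v where "u = A / (A - B)" and "v = C / (C - F)"
  have "u > 0" "u < 1" using neg(1) by (auto simp: u_def mult_less_0_iff divide_simps)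
  moreover have "v > 0" "v < 1" using neg(2) by (auto simp: v_def mult_less_0_iff divide_simps)
  moreover have "(1 - u) *\<^sub>R rp p + u *\<^sub>R rp q = (1 - v) *\<^sub>R rp r + v *\<^sub>R rp s"
  proof -
    have AB: "A - B \<noteq> 0" "C - F \<noteq> 0" using neg by (auto simp: mult_less_0_iff)
    obtain p1 p2 q1 q2 r1 r2 s1 s2 where pq: "p = (p1,p2)" "q = (q1,q2)" "r = (r1,r2)" "s = (s1,s2)"
      by (cases p; cases q; cases r; cases s) auto
    have CF: "C - F = - (A - B)" by (simp add: A_def B_def C_def F_def pq orient_Pair algebra_simps)
    have uv: "u * (A - B) = A" "v * (A - B) = - C"
    proof -
      show "u * (A - B) = A" using AB by (simp add: u_def)
      have "v * (C - F) = C" using AB by (simp add: v_def)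
      then show "v * (A - B) = - C" unfolding CF by (simp add: algebra_simps)
    qed
    have "(A - B) * ((1 - u) * p1 + u * q1) = (A - B) * p1 + (u * (A - B)) * (q1 - p1)" by (simp add: algebra_simps)
    also have "\<dots> = (A - B) * r1 + (v * (A - B)) * (s1 - r1)" unfolding uv
      by (simp add: A_def B_def C_def F_def pq orient_Pair algebra_simps)
    also have "\<dots> = (A - B) * ((1 - v) * r1 + v * s1)" by (simp add: algebra_simps)
    finally have 1: "(1 - u) * p1 + u * q1 = (1 - v) * r1 + v * s1" using AB by simp
    have "(A - B) * ((1 - u) * p2 + u * q2) = (A - B) * p2 + (u * (A - B)) * (q2 - p2)" by (simp add: algebra_simps)
    also have "\<dots> = (A - B) * r2 + (v * (A - B)) * (s2 - r2)" unfolding uv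
      by (simp add: A_def B_def C_def F_def pq orient_Pair algebra_simps)
    also have "\<dots> = (A - B) * ((1 - v) * r2 + v * s2)" by (simp add: algebra_simps)
    finally have 2: "(1 - u) * p2 + u * q2 = (1 - v) * r2 + v * s2" using AB by simp
    show ?thesis using 1 2 by (simp add: rp_def pq)
  qed
  ultimately show ?thesis using that by blast
qed

lemma rp_in_prim_segment:
  assumes "prim (q - p)" "rp c \<in> closed_segment (rp p) (rp q)"
  shows "c = p \<or> c = q"
proof -
  have "rp c \<in> closed_segment (rp p) (rp q) \<inter> (\<int> \<times> \<int>)" using assms(2) ZxZ_iff[of "rp c"] by blast
  then show ?thesis unfolding segment_lattice_prim[OF assms(1)] by auto
qed

text \<open>
  Two primitive segments contain no lattice points but their end points, so they can only meet
  in a common end point or properly, that is, with strict sign changes.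
\<close>

lemma crosses_iff_xcross:
  assumes pq: "prim (q - p)" and rs: "prim (s - r)"
  shows "crosses (E p q) (E r s) \<longleftrightarrow> xcross p q r s"
proof
  assume "xcross p q r s"
  then obtain u v where uv: "0 < u" "u < 1" "0 < v" "v < 1"
    "(1 - u) *\<^sub>R rp p + u *\<^sub>R rp q = (1 - v) *\<^sub>R rp r + v *\<^sub>R rp s" (is "?x = _") by (rule xcross_point)
  have ne: "E p q \<noteq> E r s" using \<open>xcross p q r s\<close> by (auto simp: E_eq_iff xcross_def orient_def det_def)
  have "p \<noteq> q" using pq by auto
  then have pq0: "rp q - rp p \<noteq> 0" by simp
  have "?x = rp p + u *\<^sub>R (rp q - rp p)" "?x = rp q - (1 - u) *\<^sub>R (rp q - rp p)" by (simp_all add: algebra_simps)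
  then have "?x \<noteq> rp p" "?x \<noteq> rp q" using uv(1,2) pq0 by (metis add_cancel_right_right less_irrefl scaleR_eq_0_iff,
    metis diff_zero diff_eq_diff_eq less_irrefl right_minus_eq scaleR_eq_0_iff add_diff_cancel_left' cancel_comm_monoid_add_class.diff_cancel diff_add_cancel)
  moreover have "?x \<in> convex hull E p q" unfolding E_def segment_convex_hull[symmetric] in_segment
    using uv(1,2) by (intro exI[of _ u]) auto
  moreover have "?x \<in> convex hull E r s" unfolding E_def segment_convex_hull[symmetric] in_segment uv(5)
    using uv by (intro exI[of _ v]) auto
  ultimately show "crosses (E p q) (E r s)" unfolding crosses_def using ne by (auto simp: E_def)
next
  assume "crosses (E p q) (E r s)"
  then obtain x where x: "E p q \<noteq> E r s" "x \<in> closed_segment (rp p) (rp q)" "x \<in> closed_segment (rp r) (rp s)"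
    "x \<notin> E p q \<inter> E r s" unfolding crosses_def E_def segment_convex_hull[symmetric] by blast
  have nl: "x \<noteq> rp c" for c
  proof
    assume "x = rp c"
    then have "c = p \<or> c = q" "c = r \<or> c = s" using rp_in_prim_segment pq rs x by blast+
    then show False using x(4) \<open>x = rp c\<close> by (auto simp: E_def)
  qed
  obtain u where u: "0 \<le> u" "u \<le> 1" "x = (1 - u) *\<^sub>R rp p + u *\<^sub>R rp q" using x(2) by (auto simp: in_segment)
  obtain v where v: "0 \<le> v" "v \<le> 1" "x = (1 - v) *\<^sub>R rp r + v *\<^sub>R rp s" using x(3) by (auto simp: in_segment)
  have "u \<noteq> 0" using nl[of p] u(3) by (cases "u = 0") (simp_all del: split_paired_All)
  moreover have "u \<noteq> 1" using nl[of q] u(3) by (cases "u = 1") (simp_all del: split_paired_All)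
  moreover have "v \<noteq> 0" using nl[of r] v(3) by (cases "v = 0") (simp_all del: split_paired_All)
  moreover have "v \<noteq> 1" using nl[of s] v(3) by (cases "v = 1") (simp_all del: split_paired_All)
  ultimately have "u \<noteq> 0" "u \<noteq> 1" "v \<noteq> 0" "v \<noteq> 1" by blast+
  then have uv: "0 < u" "u < 1" "0 < v" "v < 1" using u v by auto
  have o1: "(1 - v) * real_of_int (orient p q r) + v * real_of_int (orient p q s) = 0"
    using orientR_on[of "rp p" "rp q" u] orientR_comb[of "rp p" "rp q" v "rp r" "rp s"] u(3) v(3)
    by (simp add: orientR_rp)
  have o2: "(1 - u) * real_of_int (orient r s p) + u * real_of_int (orient r s q) = 0"
    using orientR_on[of "rp r" "rp s" v] orientR_comb[of "rp r" "rp s" u "rp p" "rp q"] u(3) v(3)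
    by (simp add: orientR_rp)
  have zero: "a * b < 0 \<or> (a = 0 \<and> b = 0)" if "(1 - w) * real_of_int a + w * real_of_int b = 0" "0 < w" "w < 1"
    for a b w
  proof -
    have *: "w * real_of_int b = - ((1 - w) * real_of_int a)" using that by simp
    consider "a = 0" | "a > 0" | "a < 0" by linarith
    then show ?thesis
    proof cases
      case 1 then show ?thesis using * that by simp
    next
      case 2 then have "(1 - w) * real_of_int a > 0" using that by simp
      then have "w * real_of_int b < 0" using * by linarith
      then show ?thesis using 2 that by (simp add: mult_less_0_iff)
    next
      case 3 then have "(1 - w) * real_of_int a < 0" using that by (simp add: mult_less_0_iff)
      then have "w * real_of_int b > 0" using * by linarith
      then show ?thesis using 3 that by (simp add: mult_less_0_iff zero_less_mult_iff)
    qed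
  qed
  have ncol: False if c1: "orient p q r = 0" and c2: "orient p q s = 0"
  proof -
    obtain k where k: "r - p = (k * fst (q - p), k * snd (q - p))"
      using prim_parallel[OF pq, of "r - p"] c1 by (auto simp: orient_def)
    obtain l where l: "s - p = (l * fst (q - p), l * snd (q - p))"
      using prim_parallel[OF pq, of "s - p"] c2 by (auto simp: orient_def)
    have "fst (s - r) = (l - k) * fst (q - p)" "snd (s - r) = (l - k) * snd (q - p)"
      using k l by (auto simp: prod_eq_iff algebra_simps)
    then have "(l - k) dvd fst (s - r)" "(l - k) dvd snd (s - r)" by auto
    then have "is_unit (l - k)" using rs coprime_common_divisor by blast
    then have lk: "l - k = 1 \<or> l - k = -1" by (auto simp: zdvd1_eq)
    have "x = rp p + u *\<^sub>R (rp q - rp p)" using u by (simp add: algebra_simps)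
    moreover have "rp r = rp p + real_of_int k *\<^sub>R (rp q - rp p)" "rp s = rp p + real_of_int l *\<^sub>R (rp q - rp p)"
      using k l by (auto simp: rp_def prod_eq_iff algebra_simps simp flip: of_int_mult of_int_add of_int_diff)
    then have "x = (1 - v) *\<^sub>R (rp p + real_of_int k *\<^sub>R (rp q - rp p)) + v *\<^sub>R (rp p + real_of_int l *\<^sub>R (rp q - rp p))"
      using v(3) by simp
    then have "x = rp p + ((1 - v) * k + v * l) *\<^sub>R (rp q - rp p)" by (simp add: algebra_simps)
    moreover have "rp q - rp p \<noteq> 0" using pq by auto
    ultimately have "u = (1 - v) * k + v * l" by simp
    then have "u = k + v * (l - k)" by (simp add: algebra_simps)
    have "(k = 0 \<and> l = 1) \<or> (k = 1 \<and> l = 0)" using lk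
    proof
      assume 1: "l - k = 1"
      then have "u = k + v" using \<open>u = k + v * (l - k)\<close> by simp
      then have "real_of_int k > -1" "real_of_int k < 1" using uv by linarith+
      then have "k = 0" by linarith
      then show ?thesis using 1 by simp
    next
      assume 1: "l - k = -1"
      then have "u = k - v" using \<open>u = k + v * (l - k)\<close> by simp
      then have "real_of_int k > 0" "real_of_int k < 2" using uv by linarith+
      then have "k = 1" by linarith
      then show ?thesis using 1 by simp
    qed
    then have "E p q = E r s" using k l by (auto simp: E_eq_iff prod_eq_iff)
    with x(1) show False ..
  qed
  have 1: "orient p q r * orient p q s < 0" using zero[OF o1] uv ncol by blast
  have "orient r s p = 0 \<and> orient r s q = 0 \<longrightarrow> det (q - p) (s - r) = 0"
    by (cases p; cases q; cases r; cases s) (auto simp: orient_def det_def algebra_simps)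
  moreover have "orient p q s - orient p q r = det (q - p) (s - r)"
    by (cases p; cases q; cases r; cases s) (auto simp: orient_def det_def algebra_simps)
  ultimately have "\<not> (orient r s p = 0 \<and> orient r s q = 0)" using 1 by (auto simp: mult_less_0_iff)
  then show "xcross p q r s" unfolding xcross_def using 1 zero[OF o2] uv by blast
qed

declare split_paired_All[simp del] split_paired_Ex[simp del]

section \<open>Every triangulation has an edge at every midpoint\<close>

text \<open>
  Midpoints of lattice edges have half-integer coordinates; \<open>mp c\<close> is the midpoint
  with doubled coordinates \<open>c\<close>.
\<close>

definition mp :: "int \<times> int \<Rightarrow> point" where
  "mp c = (real_of_int (fst c) / 2, real_of_int (snd c) / 2)"

text \<open>
  On lattice edges the length is a natural number; \<open>elen\<close> is that number.
\<close>

definition elen :: "edge \<Rightarrow> nat" where "elen e = nat \<lfloor>edge_length e\<rfloor>"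

definition small :: "edge \<Rightarrow> bool" where
  "small e \<longleftrightarrow> (\<exists>p q. e = E p q \<and> \<bar>fst (q - p)\<bar> \<le> 1 \<and> \<bar>snd (q - p)\<bar> \<le> 1)"

definition full :: "nat \<Rightarrow> nat \<Rightarrow> edge set \<Rightarrow> bool" where
  "full m n T \<longleftrightarrow> (\<forall>x\<in>midpoints m n. \<exists>e\<in>T. edge_mid e = x)"

lemma mp_inject[simp]: "mp c = mp d \<longleftrightarrow> c = d"
  by (auto simp: mp_def prod_eq_iff)

lemma edge_mid_mp: "edge_mid (E p q) = mp (p + q)"
  by (simp add: edge_mid_E mp_def)

lemma elen_E: "elen (E p q) = nat (len (q - p))"
  by (simp add: elen_def edge_length_E)

lemma edge_length_elen:
  assumes "e \<in> lattice_edges m n" shows "edge_length e = real (elen e)"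
  using assms by (auto elim!: lattice_edgeE simp: elen_E edge_length_E len_nonneg)

lemma small_E: "small (E p q) \<longleftrightarrow> \<bar>fst (q - p)\<bar> \<le> 1 \<and> \<bar>snd (q - p)\<bar> \<le> 1"
proof
  assume "small (E p q)"
  then obtain r s where "E p q = E r s" "\<bar>fst (s - r)\<bar> \<le> 1" "\<bar>snd (s - r)\<bar> \<le> 1" by (auto simp: small_def)
  then show "\<bar>fst (q - p)\<bar> \<le> 1 \<and> \<bar>snd (q - p)\<bar> \<le> 1" by (auto simp: E_eq_iff)
qed (auto simp: small_def)

lemma midpoints_iff:
  "x \<in> midpoints m n \<longleftrightarrow> (\<exists>c. x = mp c \<and> inbox (2*m) (2*n) c \<and> \<not> (even (fst c) \<and> even (snd c)))"
proof
  assume x: "x \<in> midpoints m n"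
  then obtain i j where ij: "x = (real i / 2, real j / 2)" "i \<le> 2*m" "j \<le> 2*n" "x \<notin> lattice_points m n"
    unfolding midpoints_def by blast
  have "\<not> (even i \<and> even j)"
  proof
    assume "even i \<and> even j"
    then obtain a b where "i = 2 * a" "j = 2 * b" by (auto elim!: evenE)
    then have "x = (real a, real b)" "a \<le> m" "b \<le> n" using ij by auto
    then show False using ij(4) by (auto simp: lattice_points_def)
  qed
  then show "\<exists>c. x = mp c \<and> inbox (2*m) (2*n) c \<and> \<not> (even (fst c) \<and> even (snd c))"
    using ij by (intro exI[of _ "(int i, int j)"]) (auto simp: mp_def inbox_def)
next
  assume "\<exists>c. x = mp c \<and> inbox (2*m) (2*n) c \<and> \<not> (even (fst c) \<and> even (snd c))"
  then obtain c where c: "x = mp c" "inbox (2*m) (2*n) c" "\<not> (even (fst c) \<and> even (snd c))" by blast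
  have "x \<notin> lattice_points m n"
  proof
    assume "x \<in> lattice_points m n"
    then obtain p where "mp c = rp p" using c lattice_points_iff by auto
    then have "real_of_int (fst c) = real_of_int (2 * fst p)" "real_of_int (snd c) = real_of_int (2 * snd p)"
      by (auto simp: mp_def rp_def)
    then show False using c(3) by (simp only: of_int_eq_iff) simp
  qed
  moreover have "x = (real (nat (fst c)) / 2, real (nat (snd c)) / 2) \<and> nat (fst c) \<le> 2*m \<and> nat (snd c) \<le> 2*n"
    using c by (auto simp: mp_def inbox_def)
  ultimately show "x \<in> midpoints m n" unfolding midpoints_def by blast
qed

lemma edge_mid_in_midpoints:
  assumes "e \<in> lattice_edges m n" shows "edge_mid e \<in> midpoints m n"
proof -
  obtain p q where e: "e = E p q" "inbox m n p" "inbox m n q" "prim (q - p)" using assms by (rule lattice_edgeE)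
  have "\<not> (even (fst (p + q)) \<and> even (snd (p + q)))"
  proof
    assume "even (fst (p + q)) \<and> even (snd (p + q))"
    then have "even (fst (q - p))" "even (snd (q - p))" by auto
    then show False using coprime_common_divisor[OF e(4), of 2] by simp
  qed
  then show ?thesis unfolding e(1) edge_mid_mp midpoints_iff using e
    by (intro exI[of _ "p + q"]) (auto simp: inbox_def)
qed

lemma same_mid_crosses:
  assumes "e \<in> lattice_edges m n" "f \<in> lattice_edges m n" "edge_mid e = edge_mid f" "e \<noteq> f"
  shows "crosses e f"
proof -
  have mid: "edge_mid g \<in> convex hull g \<and> edge_mid g \<notin> g" if "g \<in> lattice_edges m n" for g
  proof -
    obtain p q where g: "g = {p, q}" "p \<noteq> q"
      using \<open>g \<in> lattice_edges m n\<close> by (auto simp: lattice_edges_def)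
    then show ?thesis
      by (simp add: edge_mid_doubleton flip: segment_convex_hull)
  qed
  show ?thesis using mid[OF assms(1)] mid[OF assms(2)] assms(3,4) unfolding crosses_def by auto
qed

lemma crosses_commute: "crosses e f \<longleftrightarrow> crosses f e"
  unfolding crosses_def by (metis inf_commute)

lemma finite_midpoints: "finite (midpoints m n)"
proof -
  have "midpoints m n \<subseteq> (\<lambda>(i,j). (real i / 2, real j / 2)) ` ({..2*m} \<times> {..2*n})"
    by (auto simp: midpoints_def)
  then show ?thesis by (rule finite_subset) auto
qed

text \<open>
  A unit edge, or a rising unit diagonal, with the given doubled midpoint.
\<close>

definition default_edge :: "int \<times> int \<Rightarrow> edge" where
  "default_edge c = E (fst c div 2, snd c div 2) (fst c div 2 + fst c mod 2, snd c div 2 + snd c mod 2)"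

lemma default_edge:
  assumes "inbox (2*m) (2*n) c" "\<not> (even (fst c) \<and> even (snd c))"
  shows "default_edge c \<in> lattice_edges m n" "small (default_edge c)" "edge_mid (default_edge c) = mp c"
proof -
  obtain x y where c: "c = (x,y)" by (cases c)
  have xy: "0 \<le> x" "x \<le> 2 * int m" "0 \<le> y" "y \<le> 2 * int n" using assms(1) by (auto simp: inbox_def c)
  have mods: "x mod 2 = 0 \<or> x mod 2 = 1" "y mod 2 = 0 \<or> y mod 2 = 1" by auto
  have odd: "x mod 2 = 1 \<or> y mod 2 = 1" using assms(2) by (auto simp: c odd_iff_mod_2_eq_one)
  have "x div 2 + x mod 2 \<le> int m" "y div 2 + y mod 2 \<le> int n" "0 \<le> x div 2" "0 \<le> y div 2"
    "x div 2 \<le> int m" "y div 2 \<le> int n" "0 \<le> x div 2 + x mod 2" "0 \<le> y div 2 + y mod 2"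
    using xy by presburger+
  moreover have "coprime (x mod 2) (y mod 2)" using mods odd by auto
  ultimately show "default_edge c \<in> lattice_edges m n"
    by (simp add: default_edge_def E_lattice_iff inbox_def c)
  show "small (default_edge c)" using mods by (auto simp: default_edge_def small_E c)
  have "2 * (x div 2) + x mod 2 = x" "2 * (y div 2) + y mod 2 = y" by simp_all
  then show "edge_mid (default_edge c) = mp c" by (simp add: default_edge_def edge_mid_mp c)
qed

lemma opposite_signs_gap:
  fixes a b :: int assumes "a * b < 0" shows "\<bar>a - b\<bar> \<ge> 2"
  using assms by (auto simp: mult_less_0_iff)

lemma xcross_det:
  assumes "xcross p q r s"
  shows "\<bar>det (q - p) (s - r)\<bar> \<ge> 2"
proof -
  have "orient p q r - orient p q s = - det (q - p) (s - r)"
    by (cases p; cases q; cases r; cases s) (auto simp: orient_def det_def algebra_simps)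
  then show ?thesis using opposite_signs_gap assms unfolding xcross_def by (metis abs_minus_cancel)
qed

text \<open>
  The determinant of two properly crossing lattice segments has absolute value at least two,
  since it is a difference of integers of opposite signs; against a unit vector it is a
  coordinate.
\<close>

lemma xcross_unit:
  assumes "xcross p q r s" "prim (q - p)" "len (s - r) = 1"
  shows "fst (q - p) \<noteq> 0" "snd (q - p) \<noteq> 0" "len (q - p) \<ge> 3"
proof -
  obtain u v where w: "q - p = (u,v)" by (cases "q - p")
  obtain g1 g2 where g: "s - r = (g1,g2)" by (cases "s - r")
  have gg: "(g1 = 0 \<and> \<bar>g2\<bar> = 1) \<or> (g2 = 0 \<and> \<bar>g1\<bar> = 1)" using assms(3) g by (auto simp: len_def)
  have "\<bar>u * g2 - v * g1\<bar> \<ge> 2" using xcross_det[OF assms(1)] by (simp add: w g det_def)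
  then have "\<bar>u\<bar> \<ge> 2 \<or> \<bar>v\<bar> \<ge> 2" using gg by (auto simp: abs_mult)
  then have "u \<noteq> 0 \<and> v \<noteq> 0" using assms(2) w by auto
  then show "fst (q - p) \<noteq> 0" "snd (q - p) \<noteq> 0" "len (q - p) \<ge> 3"
    using \<open>\<bar>u\<bar> \<ge> 2 \<or> \<bar>v\<bar> \<ge> 2\<close> w by (auto simp: len_def)
qed

lemma small_crosses_mid:
  assumes x: "xcross p q r s" and sm: "\<bar>fst (q - p)\<bar> \<le> 1" "\<bar>snd (q - p)\<bar> \<le> 1"
    "\<bar>fst (s - r)\<bar> \<le> 1" "\<bar>snd (s - r)\<bar> \<le> 1"
  shows "p + q = r + s"
proof -
  obtain u v where w: "q - p = (u,v)" by (cases "q - p")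
  obtain g1 g2 where g: "s - r = (g1,g2)" by (cases "s - r")
  obtain d1 d2 where d: "r - p = (d1,d2)" by (cases "r - p")
  have o: "orient p q r = u * d2 - v * d1" "orient p q s = u * (d2 + g2) - v * (d1 + g1)"
    "orient r s p = - g1 * d2 + g2 * d1" "orient r s q = g1 * (v - d2) - g2 * (u - d1)"
    using w g d by (auto simp: orient_def det_def prod_eq_iff algebra_simps)
  have D: "\<bar>u * g2 - v * g1\<bar> \<ge> 2" using xcross_det[OF x] by (simp add: w g det_def)
  have b: "\<bar>u\<bar> \<le> 1" "\<bar>v\<bar> \<le> 1" "\<bar>g1\<bar> \<le> 1" "\<bar>g2\<bar> \<le> 1" using sm w g by auto
  have "\<bar>u * g2\<bar> \<le> 1 * 1" "\<bar>v * g1\<bar> \<le> 1 * 1" unfolding abs_mult mult_1_left using b by (auto intro!: mult_le_one)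
  then have D2: "\<bar>u * g2\<bar> = 1" "\<bar>v * g1\<bar> = 1" using D by auto
  then have ab: "\<bar>u\<bar> = 1" "\<bar>v\<bar> = 1" "\<bar>g1\<bar> = 1" "\<bar>g2\<bar> = 1" using b by (auto simp: abs_mult zmult_eq_1_iff)
  have sg: "u = 1 \<or> u = -1" "v = 1 \<or> v = -1" "g1 = 1 \<or> g1 = -1" "g2 = 1 \<or> g2 = -1" using ab by auto
  have x2: "orient p q r * orient p q s < 0" "orient r s p * orient r s q < 0" using x by (auto simp: xcross_def)
  have "2 * d1 = u - g1 \<and> 2 * d2 = v - g2"
    using sg D x2 unfolding o by (elim disjE; simp add: mult_less_0_iff; linarith)
  then show ?thesis using w g d by (auto simp: prod_eq_iff)
qed

lemma crosses_unit_wide: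
  assumes pq: "prim (q - p)" and u: "fst (q - p) \<ge> 2" and box: "inbox m n p" "inbox m n q"
  shows "\<exists>r s. xcross p q r s \<and> inbox m n r \<and> inbox m n s \<and> len (s - r) = 1"
proof -
  obtain p1 p2 u v where w: "p = (p1,p2)" "q = (p1 + u, p2 + v)"
    by (metis add_diff_cancel_left' diff_add_cancel prod.exhaust_sel add.commute fst_add snd_add)
  have u2: "u \<ge> 2" "coprime u v" using assms w by auto
  define y where "y = v div u"
  have vm: "v = u * y + v mod u" by (simp add: y_def)
  have "v mod u \<noteq> 0"
  proof
    assume "v mod u = 0"
    then have "u dvd v" by auto
    then show False using u2 by (metis coprime_absorb_left not_is_unit_0 zdvd1_eq abs_of_nonneg numeral_le_one_iff order_trans semiring_norm(69) zero_le_numeral)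
  qed
  moreover have "0 \<le> v mod u" "v mod u < u" using u2 by auto
  ultimately have vmod: "0 < v mod u" "v mod u < u" by auto
  define r s where "r = (p1 + 1, p2 + y)" and "s = (p1 + 1, p2 + y + 1)"
  have o: "orient p q r = - (v mod u)" "orient p q s = u - v mod u" "orient r s p = 1" "orient r s q = 1 - u"
    using vm by (auto simp: w r_def s_def orient_Pair algebra_simps)
  have "xcross p q r s" unfolding xcross_def o using vmod u2 by (auto simp: mult_less_0_iff)
  moreover have "0 \<le> y \<and> y + 1 \<le> v \<or> v \<le> y \<and> y + 1 \<le> 0"
  proof (cases "v \<ge> 0")
    case True
    then have "y \<ge> 0" using u2 by (simp add: y_def pos_imp_zdiv_nonneg_iff)
    moreover from this have "1 * y \<le> u * y" using u2 by (intro mult_right_mono) auto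
    ultimately show ?thesis using vm vmod by linarith
  next
    case False
    then have "y < 0" using u2 by (simp add: y_def neg_imp_zdiv_neg_iff pos_imp_zdiv_neg_iff)
    moreover have "(u - 1) * y \<le> (u - 1) * (-1)" using \<open>y < 0\<close> u2 by (intro mult_left_mono) auto
    then have "u * y \<le> y - (u - 1)" by (simp add: algebra_simps)
    ultimately show ?thesis using vm vmod \<open>y < 0\<close> by linarith
  qed
  then have "inbox m n r" "inbox m n s" using box u2 by (auto simp: inbox_def r_def s_def w)
  moreover have "len (s - r) = 1" by (simp add: r_def s_def len_def)
  ultimately show ?thesis by blast
qed

text \<open>
  An edge that is longer than a unit diagonal in one direction passes strictly between two
  lattice points at distance one.
\<close>

lemma crosses_unit_edge:
  assumes "e \<in> lattice_edges m n" "\<not> small e"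
  obtains g where "g \<in> lattice_edges m n" "elen g = 1" "crosses e g"
proof -
  obtain p q where e: "e = E p q" "inbox m n p" "inbox m n q" "prim (q - p)" using assms(1) by (rule lattice_edgeE)
  have "\<exists>r s. xcross p q r s \<and> inbox m n r \<and> inbox m n s \<and> len (s - r) = 1"
  proof -
    have c: "prim (p - q)" using e(4) by (metis E_lattice_iff E_commute e(2,3))
    consider "fst (q - p) \<ge> 2" | "fst (p - q) \<ge> 2" | "snd (q - p) \<ge> 2" | "snd (p - q) \<ge> 2"
      using assms(2) unfolding e(1) small_E by fastforce
    then show ?thesis
    proof cases
      case 1 then show ?thesis using crosses_unit_wide e by blast
    next
      case 2 then show ?thesis using crosses_unit_wide[OF c] e xcross_rev by blast
    next
      case 3
      have "prim (tr q - tr p)" "fst (tr q - tr p) \<ge> 2" "inbox n m (tr p)" "inbox n m (tr q)"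
        using 3 e by (auto simp: inbox_def coprime_commute)
      from crosses_unit_wide[OF this] obtain r s where "xcross (tr p) (tr q) r s" "inbox n m r" "inbox n m s" "len (s - r) = 1"
        by blast
      then show ?thesis using xcross_tr[of "tr p" "tr q" r s]
        by (intro exI[of _ "tr r"] exI[of _ "tr s"]) (auto simp: inbox_def len_def)
    next
      case 4
      have "prim (tr p - tr q)" "fst (tr p - tr q) \<ge> 2" "inbox n m (tr q)" "inbox n m (tr p)"
        using 4 e c by (auto simp: inbox_def coprime_commute)
      from crosses_unit_wide[OF this] obtain r s where "xcross (tr q) (tr p) r s" "inbox n m r" "inbox n m s" "len (s - r) = 1"
        by blast
      then show ?thesis using xcross_tr[of "tr q" "tr p" r s]
        by (intro exI[of _ "tr r"] exI[of _ "tr s"]) (auto simp: inbox_def len_def xcross_rev)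
    qed
  qed
  then obtain r s where rs: "xcross p q r s" "inbox m n r" "inbox m n s" "len (s - r) = 1" by blast
  have "prim (s - r)"
  proof -
    have "\<bar>fst (s - r)\<bar> = 1 \<or> \<bar>snd (s - r)\<bar> = 1" using rs(4) unfolding len_def by linarith
    then show ?thesis by (metis coprime_abs_left_iff coprime_abs_right_iff coprime_1_left coprime_1_right)
  qed
  then show ?thesis using that[of "E r s"] rs e crosses_iff_xcross[OF e(4), of s r]
    by (simp add: E_lattice_iff elen_E)
qed

lemma small_noncrossing:
  assumes "e \<in> lattice_edges m n" "f \<in> lattice_edges m n" "small e" "small f" "crosses e f"
  shows "edge_mid e = edge_mid f"
proof -
  obtain p q where e: "e = E p q" "prim (q - p)" using assms(1) by (rule lattice_edgeE)
  obtain r s where f: "f = E r s" "prim (s - r)" using assms(2) by (rule lattice_edgeE)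
  show ?thesis using small_crosses_mid[of p q r s] crosses_iff_xcross[OF e(2) f(2)] assms(3-5)
    unfolding e f small_E edge_mid_mp by simp
qed

lemma det_prim: "det a b = 1 \<Longrightarrow> prim a \<and> prim b"
  unfolding det_def coprime_iff_gcd_eq_1
  by (metis coprime_iff_gcd_eq_1 coprimeI dvd_diff dvd_mult dvd_mult2 mult.commute)

lemma inbox_between:
  assumes "inbox m n p" "inbox m n (p + a + b)" "same_quadrant a b"
  shows "inbox m n (p + a)" "inbox m n (p + b)"
  using assms by (auto simp: inbox_def same_quadrant_def zero_le_mult_iff)

lemma lowpass_crosses_side:
  assumes "lowpass s t" "prim (t - s)" "\<not> (s = (0,0) \<and> t = (1,1))"
  shows "xcross s t (0,0) (1,0) \<or> xcross s t (1,0) (1,1)"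
proof -
  obtain s1 s2 t1 t2 where st: "s = (s1,s2)" "t = (t1,t2)" by (cases s; cases t) auto
  have l: "s1 \<le> 0" "s2 \<le> 0" "t1 \<ge> 1" "t2 \<ge> 1" "orient s t (0,0) \<ge> 0" "orient s t (1,1) \<ge> 0" "orient s t (1,0) < 0"
    using assms(1) by (auto simp: lowpass_def st)
  have d0: "orient s t (0,0) = (t2 - s2) * s1 - (t1 - s1) * s2" by (simp add: st orient_Pair algebra_simps)
  show ?thesis
  proof (cases "orient s t (0,0) = 0")
    case False
    have "s2 < 0"
    proof (rule ccontr)
      assume "\<not> s2 < 0"
      then have "s2 = 0" using l by simp
      then have "orient s t (0,0) \<le> 0" using l d0 by (simp add: mult_nonneg_nonpos)
      then show False using False l by simp
    qed
    have "orient (0,0) (1,0) s = s2" "orient (0,0) (1,0) t = t2" by (simp_all add: st orient_Pair)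
    then have "xcross s t (0,0) (1,0)" using \<open>s2 < 0\<close> l False by (simp add: xcross_def mult_less_0_iff)
    then show ?thesis ..
  next
    case True
    have "det (t - s) s = 0" using True by (simp add: orient_def det_def st algebra_simps)
    then obtain k where k: "s = (k * (t1 - s1), k * (t2 - s2))" using prim_parallel[OF assms(2)] st by auto
    have "k = 0"
    proof (rule ccontr)
      assume "k \<noteq> 0"
      have kk: "s1 = k * (t1 - s1)" using k st by simp
      then have "k \<le> 0" using l by (smt (verit) mult_pos_pos)
      then have "k \<le> -1" using \<open>k \<noteq> 0\<close> by simp
      then have "k * (t1 - s1) \<le> -1 * (t1 - s1)" using l by (intro mult_right_mono) auto
      then have "s1 \<le> -1 * (t1 - s1)" unfolding kk[symmetric] .
      then show False using l by simp
    qed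
    then have s0: "s1 = 0" "s2 = 0" using k st by auto
    have o: "orient s t (1,1) = t1 - t2" by (simp add: st s0 orient_Pair)
    have "t1 \<noteq> t2"
    proof
      assume "t1 = t2"
      then have "is_unit t1" using assms(2) st s0 by simp
      then show False using assms(3) l st s0 \<open>t1 = t2\<close> by auto
    qed
    then have "t1 > 1" "orient s t (1,1) > 0" using l o by auto
    moreover have "orient (1,0) (1,1) s = 1" "orient (1,0) (1,1) t = 1 - t1" by (simp_all add: st s0 orient_Pair)
    ultimately have "xcross s t (1,0) (1,1)" using l by (simp add: xcross_def mult_less_0_iff)
    then show ?thesis ..
  qed
qed

text \<open>
  A primitive segment crossing the long diagonal enters and leaves the square; the only one that
  does so without crossing a side is the other diagonal, because the square contains only four
  lattice points.
\<close>

lemma crosses_diagonal: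
  assumes x: "xcross s t (0,0) (1,1)" and pr: "prim (t - s)" and ne: "{s,t} \<noteq> {(1,0),(0,1)}"
  shows "xcross s t (0,0) (1,0) \<or> xcross s t (1,0) (1,1) \<or> xcross s t (0,1) (1,1) \<or>
            xcross s t (0,0) (0,1) \<or> xcross s t (1,0) (0,1)"
proof (rule ccontr)
  assume no: "\<not> ?thesis"
  define fl :: "int \<times> int \<Rightarrow> int \<times> int" where "fl a = (1 - fst a, snd a)" for a
  have ofl: "orient (fl p) (fl q) (fl r) = - orient p q r" for p q r
    by (cases p; cases q; cases r) (simp add: orient_Pair fl_def algebra_simps)
  have X: "xcross (fl p) (fl q) (fl r) (fl v) = xcross p q r v" for p q r v
    unfolding xcross_def ofl by simp
  have fls: "fl (0,0) = (1,0)" "fl (1,0) = (0,0)" "fl (0,1) = (1,1)" "fl (1,1) = (0,1)" by (simp_all add: fl_def)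
  define s' t' where "s' = fl s" and "t' = fl t"
  have st: "s = fl s'" "t = fl t'" by (simp_all add: s'_def t'_def fl_def)
  have pr': "prim (t' - s')" "prim (s' - t')"
  proof -
    show "prim (t' - s')" using pr by (simp add: s'_def t'_def fl_def) (metis coprime_minus_left_iff minus_diff_eq)
    then show "prim (s' - t')" by (metis coprime_minus_left_iff coprime_minus_right_iff fst_diff minus_diff_eq snd_diff)
  qed
  have a: "xcross s' t' (1,0) (0,1)" using x X[of s' t' "(1,0)" "(0,1)"] by (simp add: st fls xcross_rev)
  have b: "\<not> xcross s' t' (0,0) (1,1)" using no X[of s' t' "(0,0)" "(1,1)"] by (simp add: st fls xcross_rev)
  have c: "\<not> xcross s' t' (0,0) (1,0)" "\<not> xcross s' t' (1,0) (1,1)" "\<not> xcross s' t' (0,1) (1,1)" "\<not> xcross s' t' (0,0) (0,1)"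
    using no X[of s' t' "(0,0)" "(1,0)"] X[of s' t' "(1,0)" "(1,1)"] X[of s' t' "(0,1)" "(1,1)"] X[of s' t' "(0,0)" "(0,1)"]
    by (simp_all add: st fls xcross_rev)
  have d: "\<not> (s' = (0,0) \<and> t' = (1,1))" "\<not> (t' = (0,0) \<and> s' = (1,1))" using ne by (auto simp: st fls)
  have L: "lowpass s' t' \<or> highpass s' t' \<or> lowpass t' s' \<or> highpass t' s'" using pass_square[OF b] a by blast
  have low: False if "lowpass y z" "prim (z - y)" "\<not> (y = (0,0) \<and> z = (1,1))"
     "\<not> xcross y z (0,0) (1,0)" "\<not> xcross y z (1,0) (1,1)" for y z
    using lowpass_crosses_side that by blast
  have high: False if "highpass y z" "prim (z - y)" "\<not> (y = (0,0) \<and> z = (1,1))"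
     "\<not> xcross y z (0,0) (0,1)" "\<not> xcross y z (0,1) (1,1)" for y z
  proof (rule low[of "tr y" "tr z"])
    show "lowpass (tr y) (tr z)" using that lowpass_tr by blast
    show "prim (tr z - tr y)" using that by (simp add: coprime_commute)
    show "\<not> (tr y = (0,0) \<and> tr z = (1,1))" using that by (auto simp: prod_eq_iff)
    show "\<not> xcross (tr y) (tr z) (0,0) (1,0)" using that xcross_tr[of y z "(0,0)" "(0,1)"] by simp
    show "\<not> xcross (tr y) (tr z) (1,0) (1,1)" using that xcross_tr[of y z "(0,1)" "(1,1)"] by simp
  qed
  show False using L low[of s' t'] low[of t' s'] high[of s' t'] high[of t' s'] pr' c d
    by (auto simp: xcross_rev)
qed

text \<open>
  The vector with coordinates \<open>x\<close>, \<open>y\<close> in the basis \<open>a\<close>,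
  \<open>b\<close>, in contrast to the point \<open>aff p a b (x,y)\<close>.
\<close>

definition comb :: "int \<times> int \<Rightarrow> int \<times> int \<Rightarrow> int \<Rightarrow> int \<Rightarrow> int \<times> int" where
  "comb a b x y = (x * fst a + y * fst b, x * snd a + y * snd b)"

definition sides :: "int \<times> int \<Rightarrow> int \<times> int \<Rightarrow> int \<times> int \<Rightarrow> edge set" where
  "sides p a b = {E p (p + a), E (p + a) (p + a + b), E (p + b) (p + a + b), E p (p + b)}"

lemma prim_commute: "prim (p - q) \<longleftrightarrow> prim (q - p)"
proof -
  have "fst (p - q) = - fst (q - p)" "snd (p - q) = - snd (q - p)" by simp_all
  then show ?thesis by (simp only: coprime_minus_left_iff coprime_minus_right_iff)
qed

lemma parallelogram_lattice:
  assumes "det a b = 1" "same_quadrant a b" "E p (p + a + b) \<in> lattice_edges m n"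
  shows "sides p a b \<subseteq> lattice_edges m n" "E (p + a) (p + b) \<in> lattice_edges m n"
proof -
  have box: "inbox m n p" "inbox m n (p + a)" "inbox m n (p + b)" "inbox m n (p + a + b)"
    using assms(3) inbox_between[OF _ _ assms(2)] unfolding E_lattice_iff by blast+
  have pr: "prim a" "prim b" using det_prim assms(1) by blast+
  have "det (b - a) (- a) = 1" using assms(1) by (simp add: det_def algebra_simps)
  then have "prim (b - a)" using det_prim by blast
  then show "E (p + a) (p + b) \<in> lattice_edges m n" using box by (simp add: E_lattice_iff)
  have "p + a + b - (p + a) = b" "p + a + b - (p + b) = a" by (simp_all add: algebra_simps)
  then show "sides p a b \<subseteq> lattice_edges m n"
    using box pr by (simp add: sides_def E_lattice_iff del: fst_diff snd_diff)
qed

lemma crosses_E: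
  assumes "E p q \<in> lattice_edges m n" "E r s \<in> lattice_edges m n"
  shows "crosses (E p q) (E r s) \<longleftrightarrow> xcross p q r s"
  using assms crosses_iff_xcross by (simp add: E_lattice_iff)

text \<open>
  This is \<open>shadow\<close> for lattice edges; \<open>comb a b g1 g2\<close> with \<open>g1
  * g2 > 0\<close> is a direction inside the cone spanned by the sides or its opposite.
\<close>

lemma shadow_edge:
  assumes ab: "det a b = 1" "same_quadrant a b" and f: "f = E p (p + a + b)" "f \<in> lattice_edges m n"
    and h: "h \<in> lattice_edges m n" "h \<noteq> f" "\<not> crosses h f"
    and x: "x \<in> insert (E (p + a) (p + b)) (sides p a b)" "crosses h x"
  shows "elen h > elen f"
    and "\<And>g. g \<in> lattice_edges m n \<Longrightarrow> crosses f g \<Longrightarrow> \<not> crosses h g \<Longrightarrow>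
      \<exists>w v g1 g2. g = E w v \<and> g1 * g2 > 0 \<and> v - w = comb a b g1 g2"
proof -
  obtain s t where st: "h = E s t" using h(1) by (rule lattice_edgeE)
  note lat = parallelogram_lattice[OF ab, of p m n]
  have xl: "x \<in> lattice_edges m n" using x lat f by auto
  have ne: "{s,t} \<noteq> {p, p + a + b}" using h(2) f st by (auto simp: E_eq_iff doubleton_eq_iff)
  have n: "\<not> xcross s t p (p + a + b)" using h f st crosses_E by metis
  have X: "xcross s t p (p + a) \<or> xcross s t (p + a) (p + a + b) \<or> xcross s t (p + b) (p + a + b) \<or>
            xcross s t p (p + b) \<or> xcross s t (p + a) (p + b)"
  proof -
    have "crosses (E s t) (E r v) \<Longrightarrow> E r v \<in> lattice_edges m n \<Longrightarrow> xcross s t r v" for r v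
      using crosses_E h(1) st by metis
    then show ?thesis using x xl unfolding st sides_def by blast
  qed
  show "elen h > elen f" using shadow(1)[OF ab ne n X] len_nonneg[of "a + b"]
    unfolding st f elen_E by (simp add: add.assoc)
  fix g assume g: "g \<in> lattice_edges m n" "crosses f g" "\<not> crosses h g"
  obtain w v where wv: "g = E w v" using g(1) by (rule lattice_edgeE)
  have "xcross p (p + a + b) w v" using g f crosses_E unfolding wv by metis
  moreover have "\<not> xcross s t w v" using g h(1) crosses_E unfolding wv st by metis
  ultimately show "\<exists>w v g1 g2. g = E w v \<and> g1 * g2 > 0 \<and> v - w = comb a b g1 g2"
    using shadow(2)[OF ab ne n X] wv unfolding comb_def by blast
qed

lemma len_comb':
  "same_quadrant a b \<Longrightarrow> x * y \<ge> 0 \<Longrightarrow> len (comb a b x y) = \<bar>x\<bar> * len a + \<bar>y\<bar> * len b"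
  unfolding comb_def by (rule len_comb)

text \<open>
  An edge crossing \<open>f\<close> in a direction inside the cone is at least as long as
  \<open>f\<close>, with an excess that bounds its coordinates; this is what bounds the number
  of competitors.
\<close>

lemma len_comb_ge:
  assumes "same_quadrant a b" "det a b = 1" "x * y > 0"
  shows "len (comb a b x y) \<ge> len (a + b) + (\<bar>x\<bar> - 1) + (\<bar>y\<bar> - 1)"
proof -
  have xy: "\<bar>x\<bar> \<ge> 1" "\<bar>y\<bar> \<ge> 1" using assms(3) by (auto simp: zero_less_mult_iff)
  have l: "len a \<ge> 1" "len b \<ge> 1" using det_nonzero[OF assms(2)] by auto
  have "(\<bar>x\<bar> - 1) * 1 \<le> (\<bar>x\<bar> - 1) * len a" "(\<bar>y\<bar> - 1) * 1 \<le> (\<bar>y\<bar> - 1) * len b"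
    using xy l by (intro mult_left_mono; simp)+
  moreover have "(\<bar>x\<bar> - 1) * len a = \<bar>x\<bar> * len a - len a" "(\<bar>y\<bar> - 1) * len b = \<bar>y\<bar> * len b - len b"
    by (simp_all add: algebra_simps)
  ultimately show ?thesis using len_comb'[OF assms(1), of x y] assms(3) len_add[OF assms(1)] by simp
qed

lemma parallelogram_noncrossing:
  assumes "det a b = 1" "same_quadrant a b" "E p (p + a + b) \<in> lattice_edges m n"
    and "x \<in> insert (E (p + a) (p + b)) (sides p a b)" "y \<in> insert (E (p + a) (p + b)) (sides p a b)"
  shows "\<not> crosses x y"
proof -
  note lat = parallelogram_lattice[OF assms(1-3)]
  note X = xcross_aff[OF assms(1), of p]
  have *: "xcross (aff p a b u) (aff p a b v) (aff p a b w) (aff p a b z) \<longleftrightarrow> xcross u v w z" for u v w z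
    by (rule X)
  define B where "B = {((0,0),(1,0)), ((1,0),(1,1)), ((0,1),(1,1)), ((0,0),(0,1)), ((1::int,0::int),(0::int,1::int))}"
  have eq: "insert (E (p + a) (p + b)) (sides p a b) = (\<lambda>(u,v). E (aff p a b u) (aff p a b v)) ` B"
    unfolding B_def sides_def by (simp add: aff_basis) blast
  obtain u v where uv: "(u,v) \<in> B" "x = E (aff p a b u) (aff p a b v)" using assms(4) unfolding eq by auto
  obtain w z where wz: "(w,z) \<in> B" "y = E (aff p a b w) (aff p a b z)" using assms(5) unfolding eq by auto
  have "x \<in> lattice_edges m n" "y \<in> lattice_edges m n" using assms(4,5) lat by auto
  then have "crosses x y \<longleftrightarrow> xcross u v w z" unfolding uv wz by (subst crosses_E) (auto simp: *)
  moreover have "\<not> xcross u v w z" using uv(1) wz(1) unfolding B_def by (auto simp: xcross_def orient_Pair)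
  ultimately show ?thesis by simp
qed

lemma edge_crossing_diagonal:
  assumes ab: "det a b = 1" "same_quadrant a b" and f: "f = E p (p + a + b)" "f \<in> lattice_edges m n"
    and h: "h \<in> lattice_edges m n" "crosses h f" "h \<noteq> E (p + a) (p + b)"
  shows "\<exists>x\<in>insert (E (p + a) (p + b)) (sides p a b). crosses h x"
proof -
  obtain s t where st: "h = E s t" "prim (t - s)" using h(1) by (rule lattice_edgeE)
  obtain s' where s: "s = aff p a b s'" using aff_surj[OF ab(1)] .
  obtain t' where t: "t = aff p a b t'" using aff_surj[OF ab(1)] .
  note X = xcross_aff[OF ab(1), of p]
  have x': "xcross s t p (p + a) = xcross s' t' (0,0) (1,0)"
    "xcross s t (p + a) (p + a + b) = xcross s' t' (1,0) (1,1)"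
    "xcross s t (p + b) (p + a + b) = xcross s' t' (0,1) (1,1)"
    "xcross s t p (p + b) = xcross s' t' (0,0) (0,1)"
    "xcross s t (p + a) (p + b) = xcross s' t' (1,0) (0,1)"
    "xcross s t p (p + a + b) = xcross s' t' (0,0) (1,1)"
    using X[of s' t' "(0,0)" "(1,0)"] X[of s' t' "(1,0)" "(1,1)"] X[of s' t' "(0,1)" "(1,1)"]
      X[of s' t' "(0,0)" "(0,1)"] X[of s' t' "(1,0)" "(0,1)"] X[of s' t' "(0,0)" "(1,1)"]
    unfolding aff_basis s t by simp_all
  have "t - s = comb a b (fst (t' - s')) (snd (t' - s'))"
    unfolding s t comb_def by (simp add: aff_def prod_eq_iff algebra_simps)
  then have c: "fst (t - s) = fst (t' - s') * fst a + snd (t' - s') * fst b"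
     "snd (t - s) = fst (t' - s') * snd a + snd (t' - s') * snd b" by (simp_all add: comb_def)
  have "prim (t' - s')"
  proof (rule coprimeI)
    fix d assume "d dvd fst (t' - s')" "d dvd snd (t' - s')"
    then have "d dvd fst (t - s)" "d dvd snd (t - s)" unfolding c by (blast intro: dvd_add dvd_mult2)+
    then show "is_unit d" using st(2) coprime_common_divisor by blast
  qed
  moreover have "xcross s' t' (0,0) (1,1)" using h f st crosses_E x'(6) by metis
  moreover have "{s',t'} \<noteq> {(1,0),(0,1)}"
    using h(3) st(1) aff_basis(2,3)[of p a b] s t by (auto simp: doubleton_eq_iff E_eq_iff)
  ultimately have Y: "xcross s t p (p + a) \<or> xcross s t (p + a) (p + a + b) \<or> xcross s t (p + b) (p + a + b) \<or>
            xcross s t p (p + b) \<or> xcross s t (p + a) (p + b)"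
    using crosses_diagonal unfolding x' by blast
  note lat = parallelogram_lattice[OF ab, of p m n]
  show ?thesis using Y lat f h(1) crosses_E[of s t m n] unfolding st sides_def by auto
qed

text \<open>
  An edge that is not small has a unimodular decomposition into sides of the same quadrant; the
  short diagonal is strictly shorter, since otherwise both sides would be unit vectors.
\<close>

lemma flip_exists:
  assumes "f \<in> lattice_edges m n" "\<not> small f"
  obtains p a b where "f = E p (p + a + b)" "det a b = 1" "same_quadrant a b" "elen (E (p + a) (p + b)) < elen f"
    "\<forall>x\<in>sides p a b. elen x < elen f"
proof -
  obtain p q where f: "f = E p q" "inbox m n p" "inbox m n q" "prim (q - p)" using assms(1) by (rule lattice_edgeE)
  have big: "\<not> (\<bar>fst (q - p)\<bar> \<le> 1 \<and> \<bar>snd (q - p)\<bar> \<le> 1)" using assms(2) f small_E by blast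
  have "fst (q - p) \<noteq> 0" "snd (q - p) \<noteq> 0" using big f(4) by (auto simp: zdvd1_eq)
  then obtain a b where ab: "q - p = a + b" "det a b = 1" "same_quadrant a b"
    using unimodular_decomposition[OF f(4)] by metis
  have q: "q = p + a + b" using ab(1) by (simp add: algebra_simps)
  have "len (q - p) \<ge> 3" using \<open>fst (q - p) \<noteq> 0\<close> \<open>snd (q - p) \<noteq> 0\<close> big unfolding len_def by linarith
  then have l: "len (a - b) < len (a + b)" using len_diff_less[OF ab(3,2)] ab(1) by simp
  have la: "len a \<ge> 1" "len b \<ge> 1" "len (a + b) = len a + len b" using det_nonzero[OF ab(2)] len_add[OF ab(3)] by auto
  have fl: "elen f = nat (len (a + b))" unfolding f(1) elen_E ab(1) ..
  show ?thesis
  proof (rule that[of p a b])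
    show "f = E p (p + a + b)" using f q by simp
    show "elen (E (p + a) (p + b)) < elen f" unfolding fl elen_E using l la len_minus[of a b] by simp
    show "\<forall>x\<in>sides p a b. elen x < elen f"
      using la unfolding fl sides_def by (auto simp: elen_E)
  qed (use ab in auto)
qed

text \<open>
  Take a longest edge \<open>f\<close> among those crossing some unit edge \<open>g\<close>. The
  sides and the short diagonal of its parallelogram cross no other edge of \<open>T\<close>:
  such an edge would be longer than \<open>f\<close> and, as \<open>g\<close> is too short to
  cross \<open>f\<close> inside the cone, it would cross \<open>g\<close> as well. So
  \<open>f\<close> can be exchanged for these five shorter edges, the new set can be completed
  by induction, and at the end \<open>f\<close> is put back in place of the short diagonal. The
  measure \<open>6 ^ elen e\<close> decreases because five shorter edges weigh less than
  \<open>f\<close>. If all edges are small, the free midpoints are filled with default edges.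
\<close>

lemma noncrossing_extends_full:
  assumes "T \<subseteq> lattice_edges m n" "noncrossing T"
  shows "\<exists>T'. T \<subseteq> T' \<and> T' \<subseteq> lattice_edges m n \<and> noncrossing T' \<and> full m n T'"
  using assms
proof (induction "\<Sum>e\<in>T. (6::nat) ^ elen e" arbitrary: T rule: less_induct)
  case less
  note sub = less.prems(1) and nc = less.prems(2)
  have fin: "finite T" using sub finite_lattice_edges finite_subset by blast
  show ?case
  proof (cases "\<forall>e\<in>T. small e")
    case True
    define X where "X = {c. inbox (2*m) (2*n) c \<and> \<not> (even (fst c) \<and> even (snd c)) \<and> (\<forall>e\<in>T. edge_mid e \<noteq> mp c)}"
    define T' where "T' = T \<union> default_edge ` X"
    have lat: "T' \<subseteq> lattice_edges m n" using sub default_edge(1) by (auto simp: T'_def X_def)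
    have sm: "small e" if "e \<in> T'" for e using that True default_edge(2) by (auto simp: T'_def X_def)
    have dm: "edge_mid (default_edge c) = mp c" if "c \<in> X" for c using that default_edge(3)[of m n c] by (auto simp: X_def)
    have "noncrossing T'"
      unfolding noncrossing_def
    proof (intro ballI notI)
      fix e f assume ef: "e \<in> T'" "f \<in> T'" "crosses e f"
      then have mid: "edge_mid e = edge_mid f" using small_noncrossing sm lat by blast
      have ne: "e \<noteq> f" using ef by (auto simp: crosses_def)
      show False
      proof (cases "e \<in> T")
        case e: True
        show False
        proof (cases "f \<in> T")
          case True then show False using nc e ef by (auto simp: noncrossing_def)
        next
          case False
          then obtain c where "c \<in> X" "f = default_edge c" using ef by (auto simp: T'_def)
          then show False using mid dm e by (auto simp: X_def)
        qed
      next
        case False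
        then obtain c where c: "c \<in> X" "e = default_edge c" using ef by (auto simp: T'_def)
        then have "f \<notin> T" using mid dm by (auto simp: X_def)
        then obtain d where d: "d \<in> X" "f = default_edge d" using ef by (auto simp: T'_def)
        then have "mp c = mp d" using mid dm c by simp
        then show False using ne c d by simp
      qed
    qed
    moreover have "full m n T'"
      unfolding full_def
    proof
      fix x assume "x \<in> midpoints m n"
      then obtain c where c: "x = mp c" "inbox (2*m) (2*n) c" "\<not> (even (fst c) \<and> even (snd c))"
        by (auto simp: midpoints_iff)
      show "\<exists>e\<in>T'. edge_mid e = x"
      proof (cases "\<exists>e\<in>T. edge_mid e = x")
        case True then show ?thesis by (auto simp: T'_def)
      next
        case False
        then have "c \<in> X" using c by (auto simp: X_def)
        then show ?thesis using dm[of c] c by (auto simp: T'_def)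
      qed
    qed
    ultimately show ?thesis using lat by (auto simp: T'_def)
  next
    case False
    then obtain e0 where e0: "e0 \<in> T" "\<not> small e0" by blast
    obtain g where g: "g \<in> lattice_edges m n" "elen g = 1" "crosses e0 g"
      using crosses_unit_edge e0 sub by blast
    define F where "F = {e\<in>T. crosses e g}"
    have "finite F" "F \<noteq> {}" using fin e0 g by (auto simp: F_def)
    then have "Max (elen ` F) \<in> elen ` F" by (intro Max_in) auto
    then obtain f where f: "f \<in> F" "elen f = Max (elen ` F)" by auto
    have fmax: "elen h \<le> elen f" if "h \<in> F" for h using that f \<open>finite F\<close> by simp
    have fT: "f \<in> T" "crosses f g" using f by (auto simp: F_def)
    then have fl: "f \<in> lattice_edges m n" using sub by blast
    have fs: "\<not> small f"
    proof
      assume s: "small f"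
      obtain r s where rs: "g = E r s" using g(1) by (rule lattice_edgeE)
      obtain p q where pq: "f = E p q" "prim (q - p)" using fl by (rule lattice_edgeE)
      have "len (s - r) = 1" using g(2) rs elen_E by simp
      then have "len (q - p) \<ge> 3" using xcross_unit(3)[of p q r s] pq(2) fT fl g(1) crosses_E unfolding pq rs by metis
      then show False using s unfolding pq small_E len_def by linarith
    qed
    obtain p a b where ab: "f = E p (p + a + b)" "det a b = 1" "same_quadrant a b"
      "elen (E (p + a) (p + b)) < elen f" "\<forall>x\<in>sides p a b. elen x < elen f"
      using flip_exists[OF fl fs] .
    define N where "N = insert (E (p + a) (p + b)) (sides p a b)"
    define T1 where "T1 = (T - {f}) \<union> N"
    have Nl: "N \<subseteq> lattice_edges m n" using parallelogram_lattice[OF ab(2,3)] ab(1) fl by (auto simp: N_def)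
    have TN: "\<not> crosses h x" if "h \<in> T - {f}" "x \<in> N" for h x
    proof
      assume c: "crosses h x"
      have h: "h \<in> lattice_edges m n" "h \<noteq> f" "\<not> crosses h f" using that sub nc fT by (auto simp: noncrossing_def)
      note sh = shadow_edge[OF ab(2,3,1) fl h that(2)[unfolded N_def] c]
      have "crosses h g"
      proof (rule ccontr)
        assume "\<not> crosses h g"
        then obtain w v g1 g2 where gg: "g = E w v" "g1 * g2 > 0" "v - w = comb a b g1 g2"
          using sh(2)[OF g(1) fT(2)] by blast
        have "len (v - w) \<ge> len (a + b) + (\<bar>g1\<bar> - 1) + (\<bar>g2\<bar> - 1)" unfolding gg(3)
          by (rule len_comb_ge[OF ab(3,2) gg(2)])
        moreover have "len (a + b) \<ge> 2" using len_add[OF ab(3)] det_nonzero[OF ab(2)] by simp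
        moreover have "\<bar>g1\<bar> \<ge> 1" "\<bar>g2\<bar> \<ge> 1" using gg(2) by (auto simp: zero_less_mult_iff)
        ultimately show False using g(2) unfolding gg(1) elen_E by simp
      qed
      then have "h \<in> F" using that by (auto simp: F_def)
      then show False using fmax sh(1) by fastforce
    qed
    have nc1: "noncrossing T1"
      unfolding noncrossing_def
    proof (intro ballI)
      fix e h assume "e \<in> T1" "h \<in> T1"
      then consider "e \<in> T - {f}" "h \<in> T - {f}" | "e \<in> T - {f}" "h \<in> N" | "e \<in> N" "h \<in> T - {f}" | "e \<in> N" "h \<in> N"
        by (auto simp: T1_def)
      then show "\<not> crosses e h"
      proof cases
        case 1 then show ?thesis using nc by (auto simp: noncrossing_def)
      next
        case 2 then show ?thesis using TN by blast
      next
        case 3 then show ?thesis using TN crosses_commute by blast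
      next
        case 4 then show ?thesis using parallelogram_noncrossing[OF ab(2,3)] ab(1) fl unfolding N_def by blast
      qed
    qed
    have lat1: "T1 \<subseteq> lattice_edges m n" using sub Nl by (auto simp: T1_def)
    have finN: "finite N" "card N \<le> 5"
    proof -
      show "finite N" by (simp add: N_def sides_def)
      have "N = set [E (p + a) (p + b), E p (p + a), E (p + a) (p + a + b), E (p + b) (p + a + b), E p (p + b)]"
        by (simp add: N_def sides_def)
      then have "card N \<le> length [E (p + a) (p + b), E p (p + a), E (p + a) (p + a + b), E (p + b) (p + a + b), E p (p + b)]"
        using card_length by metis
      then show "card N \<le> 5" by simp
    qed
    obtain L where L: "elen f = Suc L" using ab(4) by (cases "elen f") auto
    have "(\<Sum>e\<in>N. (6::nat) ^ elen e) \<le> (\<Sum>e\<in>N. 6 ^ L)"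
      using ab(4,5) L by (intro sum_mono power_increasing) (auto simp: N_def less_Suc_eq_le)
    also have "\<dots> \<le> 5 * 6 ^ L" using finN by simp
    also have "\<dots> < 6 ^ elen f" using L by simp
    finally have sN: "(\<Sum>e\<in>N. (6::nat) ^ elen e) < 6 ^ elen f" .
    have "(\<Sum>e\<in>T1. (6::nat) ^ elen e) \<le> (\<Sum>e\<in>T - {f}. 6 ^ elen e) + (\<Sum>e\<in>N. 6 ^ elen e)"
      unfolding T1_def using fin finN sum_Un_nat[of "T - {f}" N "\<lambda>e. 6 ^ elen e"] by simp
    also have "\<dots> < (\<Sum>e\<in>T - {f}. 6 ^ elen e) + 6 ^ elen f" using sN by simp
    also have "\<dots> = (\<Sum>e\<in>T. 6 ^ elen e)" using fin fT(1) by (simp add: sum.remove add.commute)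
    finally obtain U where U: "T1 \<subseteq> U" "U \<subseteq> lattice_edges m n" "noncrossing U" "full m n U"
      using less.hyps[OF _ lat1 nc1] by blast
    define V where "V = insert f (U - {E (p + a) (p + b)})"
    have fU: "\<not> crosses h f" if "h \<in> U - {E (p + a) (p + b)}" for h
      using edge_crossing_diagonal[OF ab(2,3,1) fl, of h] that U unfolding T1_def N_def noncrossing_def by blast
    have "noncrossing V"
      unfolding noncrossing_def V_def using fU U(3) crosses_commute
      by (auto simp: noncrossing_def) (auto simp: crosses_def)
    moreover have "full m n V"
      unfolding full_def
    proof
      fix x assume "x \<in> midpoints m n"
      then obtain e where e: "e \<in> U" "edge_mid e = x" using U(4) by (auto simp: full_def)
      have "edge_mid (E (p + a) (p + b)) = edge_mid f" unfolding ab(1) edge_mid_mp by (simp add: algebra_simps)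
      then show "\<exists>e\<in>V. edge_mid e = x" using e by (cases "e = E (p + a) (p + b)") (auto simp: V_def)
    qed
    moreover have "T \<subseteq> V"
    proof -
      have "E (p + a) (p + b) \<notin> T"
      proof
        assume a: "E (p + a) (p + b) \<in> T"
        have "edge_mid (E (p + a) (p + b)) = edge_mid f" unfolding ab(1) edge_mid_mp by (simp add: algebra_simps)
        then have "crosses (E (p + a) (p + b)) f" using same_mid_crosses a fl sub ab(4) by fastforce
        then show False using nc a fT by (auto simp: noncrossing_def)
      qed
      then show ?thesis using U(1) by (auto simp: V_def T1_def)
    qed
    ultimately show ?thesis using U(2) fl by (intro exI[of _ V]) (auto simp: V_def)
  qed
qed

lemma triangulation_full: "triangulation m n T \<Longrightarrow> full m n T"
  using noncrossing_extends_full[of T m n] unfolding triangulation_def by metis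

lemma full_triangulation:
  assumes "T \<subseteq> lattice_edges m n" "noncrossing T" "full m n T"
  shows "triangulation m n T"
  unfolding triangulation_def
proof (intro conjI allI impI)
  fix T' assume T': "T' \<subseteq> lattice_edges m n \<and> noncrossing T' \<and> T \<subseteq> T'"
  show "T' = T"
  proof (rule ccontr)
    assume "T' \<noteq> T"
    then obtain e where e: "e \<in> T'" "e \<notin> T" using T' by blast
    then obtain f where f: "f \<in> T" "edge_mid f = edge_mid e"
      using assms(3) edge_mid_in_midpoints[of e m n] T' unfolding full_def by blast
    then have "crosses e f" using same_mid_crosses[of e m n f] T' e by auto
    then show False using T' e f by (auto simp: noncrossing_def)
  qed
qed (use assms in auto)

section \<open>Triangulations as functions of the midpoint\<close>

lemma triangulation_lattice: "triangulation m n T \<Longrightarrow> e \<in> T \<Longrightarrow> e \<in> lattice_edges m n"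
  by (auto simp: triangulation_def)

lemma triangulation_noncrossing: "triangulation m n T \<Longrightarrow> e \<in> T \<Longrightarrow> f \<in> T \<Longrightarrow> \<not> crosses e f"
  by (auto simp: triangulation_def noncrossing_def)

lemma edge_at:
  assumes "triangulation m n T" "x \<in> midpoints m n"
  shows "edge_at T x \<in> T" "edge_mid (edge_at T x) = x"
proof -
  obtain e where "e \<in> T" "edge_mid e = x"
    using triangulation_full[OF assms(1)] assms(2) by (auto simp: full_def)
  then show "edge_at T x \<in> T" "edge_mid (edge_at T x) = x"
    using edge_at_eqI[OF assms(1)] by auto
qed

lemma edge_at_lattice:
  "triangulation m n T \<Longrightarrow> x \<in> midpoints m n \<Longrightarrow> edge_at T x \<in> lattice_edges m n"
  using edge_at triangulation_lattice by blast

lemma triangulation_image: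
  assumes "triangulation m n T" shows "T = edge_at T ` midpoints m n"
proof
  show "T \<subseteq> edge_at T ` midpoints m n"
  proof
    fix e assume "e \<in> T"
    then show "e \<in> edge_at T ` midpoints m n"
      using edge_at_eqI[OF assms] edge_mid_in_midpoints triangulation_lattice[OF assms] by (metis imageI)
  qed
qed (use edge_at[OF assms] in auto)

lemma triangulation_eqI:
  assumes "triangulation m n T" "triangulation m n T'" "\<And>x. x \<in> midpoints m n \<Longrightarrow> edge_at T x = edge_at T' x"
  shows "T = T'"
  using triangulation_image[OF assms(1)] triangulation_image[OF assms(2)] assms(3) by (metis image_cong)

lemma edge_at_inj: "triangulation m n T \<Longrightarrow> inj_on (edge_at T) (midpoints m n)"
  by (metis edge_at(2) inj_onI)

lemma total_length_sum:
  assumes "triangulation m n T"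
  shows "total_length T = (\<Sum>x\<in>midpoints m n. real (elen (edge_at T x)))"
proof -
  have "total_length T = (\<Sum>e\<in>edge_at T ` midpoints m n. edge_length e)"
    unfolding total_length_def using triangulation_image[OF assms] by simp
  also have "\<dots> = (\<Sum>x\<in>midpoints m n. edge_length (edge_at T x))"
    by (simp add: sum.reindex edge_at_inj[OF assms])
  also have "\<dots> = (\<Sum>x\<in>midpoints m n. real (elen (edge_at T x)))"
    by (rule sum.cong) (auto simp: edge_length_elen[OF edge_at_lattice[OF assms]])
  finally show ?thesis .
qed

lemma triangulation_of_family:
  assumes "\<And>x. x \<in> midpoints m n \<Longrightarrow> \<phi> x \<in> lattice_edges m n"
    and "\<And>x. x \<in> midpoints m n \<Longrightarrow> edge_mid (\<phi> x) = x"
    and "\<And>x y. x \<in> midpoints m n \<Longrightarrow> y \<in> midpoints m n \<Longrightarrow> \<not> crosses (\<phi> x) (\<phi> y)"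
  shows "triangulation m n (\<phi> ` midpoints m n)"
    and "x \<in> midpoints m n \<Longrightarrow> edge_at (\<phi> ` midpoints m n) x = \<phi> x"
proof -
  show T: "triangulation m n (\<phi> ` midpoints m n)"
    using assms by (intro full_triangulation) (auto simp: noncrossing_def full_def)
  assume "x \<in> midpoints m n"
  then show "edge_at (\<phi> ` midpoints m n) x = \<phi> x"
    using edge_at_eqI[OF T, of "\<phi> x"] assms(2) by auto
qed

lemma edge_at_iff:
  assumes "triangulation m n T" "e \<in> lattice_edges m n"
  shows "edge_at T (edge_mid e) = e \<longleftrightarrow> e \<in> T"
  using edge_at_eqI[OF assms(1)] edge_at(1)[OF assms(1) edge_mid_in_midpoints[OF assms(2)]] by metis


section \<open>Minimal triangulations containing given edges\<close>

text \<open>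
  The edge cannot be shortened by a flip without crossing a prescribed edge.
\<close>

definition tight :: "edge set \<Rightarrow> edge \<Rightarrow> bool" where
  "tight \<Delta> f \<longleftrightarrow> (\<exists>p a b. f = E p (p + a + b) \<and> det a b = 1 \<and> same_quadrant a b \<and>
     (\<exists>d\<in>\<Delta>. crosses (E (p + a) (p + b)) d))"

definition compatible :: "edge set \<Rightarrow> edge \<Rightarrow> bool" where
  "compatible \<Delta> f \<longleftrightarrow> (\<forall>d\<in>\<Delta>. \<not> crosses f d)"

locale minimal_triangulation =
  fixes m n :: nat and \<Delta> S :: "edge set"
  assumes tri: "triangulation m n S" and sub: "\<Delta> \<subseteq> S"
    and min: "\<And>T. triangulation m n T \<Longrightarrow> \<Delta> \<subseteq> T \<Longrightarrow> total_length S \<le> total_length T"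
begin

lemma lat: "e \<in> S \<Longrightarrow> e \<in> lattice_edges m n"
  using tri triangulation_lattice by blast

lemma finite_S: "finite S"
  using lat finite_lattice_edges by (meson finite_subset subsetI)

text \<open>
  Consider a longest exception \<open>f\<close>. Its flip does not cross a prescribed edge. It
  could only be obstructed by a longer edge, which is not an exception, hence tight; but then
  the prescribed edge that makes it tight would force the flip of \<open>f\<close> to be at
  least as long as the obstructing edge. So the flip is admissible and shortens the
  triangulation.
\<close>

lemma minimal_cases:
  assumes "f \<in> S"
  shows "small f \<or> f \<in> \<Delta> \<or> tight \<Delta> f"
proof (rule ccontr)
  assume nf: "\<not> ?thesis"
  define F where "F = {f\<in>S. \<not> (small f \<or> f \<in> \<Delta> \<or> tight \<Delta> f)}"
  have "finite F" "F \<noteq> {}" using finite_S nf assms by (auto simp: F_def)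
  then have "Max (elen ` F) \<in> elen ` F" by (intro Max_in) auto
  then obtain f where f: "f \<in> F" "elen f = Max (elen ` F)" by auto
  have fmax: "elen h \<le> elen f" if "h \<in> F" for h using that f \<open>finite F\<close> by simp
  have fS: "f \<in> S" "\<not> small f" "f \<notin> \<Delta>" "\<not> tight \<Delta> f" using f by (auto simp: F_def)
  note fl = lat[OF fS(1)]
  obtain p a b where ab: "f = E p (p + a + b)" "det a b = 1" "same_quadrant a b"
      "elen (E (p + a) (p + b)) < elen f" "\<forall>x\<in>sides p a b. elen x < elen f"
    using flip_exists[OF fl fS(2)] .
  define f' where "f' = E (p + a) (p + b)"
  have l': "f' \<in> lattice_edges m n" using parallelogram_lattice(2)[OF ab(2,3)] fl ab(1) by (simp add: f'_def)
  have f'\<Delta>: "\<not> crosses f' d" if "d \<in> \<Delta>" for d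
  proof
    assume "crosses f' d"
    then have "\<exists>d\<in>\<Delta>. crosses (E (p + a) (p + b)) d" using that f'_def by blast
    then have "tight \<Delta> f" unfolding tight_def
      by (intro exI[of _ p] exI[of _ a] exI[of _ b] conjI ab(1-3))
    with fS(4) show False ..
  qed
  have mid: "edge_mid f' = edge_mid f" unfolding ab(1) f'_def edge_mid_mp by (simp add: algebra_simps)
  have nc: "\<not> crosses h f'" if h: "h \<in> S - {f}" for h
  proof
    assume c: "crosses h f'"
    have h': "h \<in> lattice_edges m n" "h \<noteq> f" "\<not> crosses h f"
      using h lat triangulation_noncrossing[OF tri] fS(1) by auto
    have long: "elen h > elen f"
      using shadow_edge(1)[OF ab(2,3,1) fl h', of f'] c by (simp add: f'_def)
    then have "h \<notin> F" using fmax by fastforce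
    moreover have "h \<notin> \<Delta>" using f'\<Delta> c crosses_commute by blast
    moreover have "\<not> small h"
    proof
      assume "small h"
      obtain s t where st: "h = E s t" using h'(1) by (rule lattice_edgeE)
      have "elen h \<le> 2" using \<open>small h\<close> unfolding st small_E elen_E len_def by linarith
      moreover have "elen f \<ge> 2" using len_add[OF ab(3)] det_nonzero[OF ab(2)]
        unfolding ab(1) elen_E by (simp add: add.assoc le_nat_iff)
      ultimately show False using long by simp
    qed
    ultimately have "tight \<Delta> h" using h by (auto simp: F_def)
    then obtain p' \<alpha> \<beta> d where t: "h = E p' (p' + \<alpha> + \<beta>)" "det \<alpha> \<beta> = 1" "same_quadrant \<alpha> \<beta>" "d \<in> \<Delta>"
      "crosses (E (p' + \<alpha>) (p' + \<beta>)) d" by (auto simp: tight_def)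
    have d: "d \<in> lattice_edges m n" "d \<noteq> h" "\<not> crosses d h"
      using t(4) sub lat \<open>h \<notin> \<Delta>\<close> triangulation_noncrossing[OF tri] h by auto
    have "crosses d (E (p' + \<alpha>) (p' + \<beta>))" using t(5) crosses_commute by blast
    moreover have "\<not> crosses d f'" using f'\<Delta> t(4) crosses_commute by blast
    ultimately obtain w v g1 g2 where g: "f' = E w v" "g1 * g2 > 0" "v - w = comb \<alpha> \<beta> g1 g2"
      using shadow_edge(2)[OF t(2,3,1) h'(1) d _ _ l' c] by blast
    have "len (v - w) \<ge> len (\<alpha> + \<beta>) + (\<bar>g1\<bar> - 1) + (\<bar>g2\<bar> - 1)"
      unfolding g(3) by (rule len_comb_ge[OF t(3,2) g(2)])
    moreover have "\<bar>g1\<bar> \<ge> 1" "\<bar>g2\<bar> \<ge> 1" using g(2) by (auto simp: zero_less_mult_iff)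
    ultimately have "elen f' \<ge> elen h" unfolding g(1) t(1) elen_E by (simp add: add.assoc)
    then show False using long ab(4) by (simp add: f'_def)
  qed
  define S' where "S' = insert f' (S - {f})"
  have "noncrossing S'"
    unfolding noncrossing_def S'_def
    using nc crosses_commute triangulation_noncrossing[OF tri] by (auto) (auto simp: crosses_def)
  moreover have "full m n S'"
    unfolding full_def
  proof
    fix x assume "x \<in> midpoints m n"
    then obtain e where "e \<in> S" "edge_mid e = x" using triangulation_full[OF tri] by (auto simp: full_def)
    then show "\<exists>e\<in>S'. edge_mid e = x" using mid by (cases "e = f") (auto simp: S'_def)
  qed
  ultimately have S': "triangulation m n S'" using lat l' by (intro full_triangulation) (auto simp: S'_def)
  have "f' \<notin> S"
  proof
    assume "f' \<in> S"
    then have "f' = f" using edge_at_eqI[OF tri] mid fS(1) by metis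
    then show False using ab(4) by (simp add: f'_def)
  qed
  have "total_length S' = edge_length f' + (total_length S - edge_length f)"
    unfolding S'_def total_length_def using finite_S fS(1) \<open>f' \<notin> S\<close> by (simp add: sum_diff1)
  moreover have "edge_length f' < edge_length f" using ab(4) edge_length_elen fl l' by (simp add: f'_def)
  ultimately have "total_length S' < total_length S" by simp
  moreover have "\<Delta> \<subseteq> S'" using sub fS(3) by (auto simp: S'_def)
  ultimately show False using min[OF S'] by simp
qed

text \<open>
  For a tight edge the prescribed edge blocks all competitors whose direction lies outside the
  cone of its parallelogram, by \<open>shadow_edge\<close>; those inside the cone have length
  controlled by \<open>len_comb_ge\<close>. In particular a minimal triangulation is shortest at
  every midpoint separately. The coordinates serve to count competitors of a given length, with
  a bound independent of the edge.
\<close>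

lemma compatible_coordinates:
  assumes f: "f \<in> S"
  shows "\<exists>a b. \<forall>v\<in>lattice_edges m n. edge_mid v = edge_mid f \<longrightarrow> compatible \<Delta> v \<longrightarrow>
    elen f \<le> elen v \<and>
    (\<exists>s t g1 g2. v = E s t \<and> t - s = comb a b g1 g2 \<and> \<bar>g1\<bar> + \<bar>g2\<bar> \<le> int (elen v - elen f) + 2)"
  (is "\<exists>a b. \<forall>v\<in>_. _ \<longrightarrow> _ \<longrightarrow> ?P a b v")
proof -
  note fl = lat[OF f]
  have small_case: ?thesis if sm: "small f"
  proof (intro exI ballI impI)
    fix v assume v: "v \<in> lattice_edges m n" "edge_mid v = edge_mid f"
    obtain s t where st: "v = E s t" "prim (t - s)" using v(1) by (rule lattice_edgeE)
    obtain p q where pq: "f = E p q" "prim (q - p)" using fl by (rule lattice_edgeE)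
    have mid: "s + t = p + q" using v(2) unfolding st pq edge_mid_mp by simp
    obtain u w where uw: "q - p = (u,w)" by (cases "q - p")
    obtain c d where cd: "t - s = (c,d)" by (cases "t - s")
    have par: "even (u - c)" "even (w - d)"
    proof -
      have "u - c = 2 * (fst s - fst p)" "w - d = 2 * (snd s - snd p)"
        using mid uw cd by (auto simp: prod_eq_iff)
      then show "even (u - c)" "even (w - d)" by auto
    qed
    have b: "\<bar>u\<bar> \<le> 1" "\<bar>w\<bar> \<le> 1" using sm uw pq small_E by auto
    have "\<bar>u\<bar> \<le> \<bar>c\<bar>" "\<bar>w\<bar> \<le> \<bar>d\<bar>" using par b by presburger+
    then have "len (q - p) \<le> len (t - s)" "len (q - p) \<le> 2" using b by (auto simp: uw cd len_def)
    have l: "elen v = nat (len (t - s))" "elen f = nat (len (q - p))" unfolding st pq elen_E by simp_all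
    have "t - s = comb (1,0) (0,1) c d" by (simp add: comb_def cd)
    moreover have "\<bar>c\<bar> + \<bar>d\<bar> \<le> int (elen v - elen f) + 2"
    proof -
      have "len (t - s) = \<bar>c\<bar> + \<bar>d\<bar>" by (simp add: len_def cd)
      then show ?thesis using \<open>len (q - p) \<le> 2\<close> unfolding l by linarith
    qed
    moreover have "elen f \<le> elen v" using \<open>len (q - p) \<le> len (t - s)\<close> unfolding l by (rule nat_mono)
    ultimately show "?P (1,0) (0,1) v" using st(1) by blast
  qed
  have diag_case: ?thesis if "\<not> small f" "f \<in> \<Delta>"
  proof -
    obtain p a b where ab: "f = E p (p + a + b)" using flip_exists[OF fl \<open>\<not> small f\<close>] by metis
    have "?P a b v" if v: "v \<in> lattice_edges m n" "edge_mid v = edge_mid f" "compatible \<Delta> v" for v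
    proof -
      have "v = f" using same_mid_crosses[OF v(1) fl v(2)] v(3) \<open>f \<in> \<Delta>\<close> by (auto simp: compatible_def)
      then have "elen f \<le> elen v \<and> v = E p (p + a + b) \<and> p + a + b - p = comb a b 1 1 \<and>
        \<bar>1::int\<bar> + \<bar>1\<bar> \<le> int (elen v - elen f) + 2" using ab by (simp add: comb_def prod_eq_iff)
      then show ?thesis by blast
    qed
    then show ?thesis by blast
  qed
  have tight_case: ?thesis if "f \<notin> \<Delta>" and tf: "tight \<Delta> f"
  proof -
    obtain p a b d where ab: "f = E p (p + a + b)" "det a b = 1" "same_quadrant a b" "d \<in> \<Delta>"
      "crosses (E (p + a) (p + b)) d" using tf unfolding tight_def by blast
    have d: "d \<in> lattice_edges m n" "d \<noteq> f" "\<not> crosses d f"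
      using ab(4) sub lat that triangulation_noncrossing[OF tri] f by auto
    have x: "crosses d (E (p + a) (p + b))" using ab(5) crosses_commute by blast
    have "?P a b v" if v: "v \<in> lattice_edges m n" "edge_mid v = edge_mid f" "compatible \<Delta> v" for v
    proof (cases "v = f")
      case True
      then have "elen f \<le> elen v \<and> v = E p (p + a + b) \<and> p + a + b - p = comb a b 1 1 \<and>
        \<bar>1::int\<bar> + \<bar>1\<bar> \<le> int (elen v - elen f) + 2" using ab by (simp add: comb_def prod_eq_iff)
      then show ?thesis by blast
    next
      case False
      then have "crosses f v" using same_mid_crosses[OF fl v(1)] v(2) by auto
      moreover have "\<not> crosses d v" using v(3) ab(4) crosses_commute by (auto simp: compatible_def)
      ultimately obtain s t g1 g2 where g: "v = E s t" "g1 * g2 > 0" "t - s = comb a b g1 g2"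
        using shadow_edge(2)[OF ab(2,3,1) fl d _ x v(1)] by blast
      have "len (t - s) \<ge> len (a + b) + (\<bar>g1\<bar> - 1) + (\<bar>g2\<bar> - 1)"
        unfolding g(3) by (rule len_comb_ge[OF ab(3,2) g(2)])
      moreover have "\<bar>g1\<bar> \<ge> 1" "\<bar>g2\<bar> \<ge> 1" using g(2) by (auto simp: zero_less_mult_iff)
      moreover have "elen v = nat (len (t - s))" "elen f = nat (len (a + b))"
        unfolding g(1) ab(1) elen_E by (simp_all add: add.assoc)
      ultimately have "elen f \<le> elen v" "\<bar>g1\<bar> + \<bar>g2\<bar> \<le> int (elen v - elen f) + 2"
        using len_nonneg[of "a + b"] by (auto simp: of_nat_diff)
      then show ?thesis using g by blast
    qed
    then show ?thesis by blast
  qed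
  show ?thesis using minimal_cases[OF f] small_case diag_case tight_case by blast
qed

lemma compatible_longer:
  "f \<in> S \<Longrightarrow> v \<in> lattice_edges m n \<Longrightarrow> edge_mid v = edge_mid f \<Longrightarrow> compatible \<Delta> v \<Longrightarrow> elen f \<le> elen v"
  using compatible_coordinates by blast

lemma card_compatible:
  assumes f: "f \<in> S"
  shows "card {v\<in>lattice_edges m n. edge_mid v = edge_mid f \<and> compatible \<Delta> v \<and> elen v \<le> elen f + k} \<le> (2 * k + 5)\<^sup>2"
proof -
  obtain a b where ab: "\<And>v. v \<in> lattice_edges m n \<Longrightarrow> edge_mid v = edge_mid f \<Longrightarrow> compatible \<Delta> v \<Longrightarrow>
    elen f \<le> elen v \<and>
    (\<exists>s t g1 g2. v = E s t \<and> t - s = comb a b g1 g2 \<and> \<bar>g1\<bar> + \<bar>g2\<bar> \<le> int (elen v - elen f) + 2)"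
    using compatible_coordinates[OF f] by blast
  define J where "J = {- int (k + 2)..int (k + 2)}"
  define F where "F = (\<lambda>(g1,g2). {edge_mid f - (1/2) *\<^sub>R rp (comb a b g1 g2), edge_mid f + (1/2) *\<^sub>R rp (comb a b g1 g2)})"
  have "{v\<in>lattice_edges m n. edge_mid v = edge_mid f \<and> compatible \<Delta> v \<and> elen v \<le> elen f + k} \<subseteq> F ` (J \<times> J)"
  proof
    fix v assume "v \<in> {v\<in>lattice_edges m n. edge_mid v = edge_mid f \<and> compatible \<Delta> v \<and> elen v \<le> elen f + k}"
    then have v: "v \<in> lattice_edges m n" "edge_mid v = edge_mid f" "compatible \<Delta> v" "elen v \<le> elen f + k" by auto
    obtain s t g1 g2 where g: "v = E s t" "t - s = comb a b g1 g2" "\<bar>g1\<bar> + \<bar>g2\<bar> \<le> int (elen v - elen f) + 2"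
      using ab[OF v(1-3)] by blast
    have "\<bar>g1\<bar> + \<bar>g2\<bar> \<le> int (k + 2)" using g(3) v(4) by linarith
    then have J: "g1 \<in> J" "g2 \<in> J" unfolding J_def by auto
    have "edge_mid f = (1/2) *\<^sub>R (rp s + rp t)" unfolding v(2)[symmetric] g(1) edge_mid_E by (simp add: rp_def)
    moreover have "rp (comb a b g1 g2) = rp t - rp s" unfolding g(2)[symmetric] by (simp add: rp_def)
    moreover have "rp s = (1/2) *\<^sub>R rp s + (1/2) *\<^sub>R rp s" "rp t = (1/2) *\<^sub>R rp t + (1/2) *\<^sub>R rp t"
      by (simp_all flip: scaleR_add_left)
    ultimately have "edge_mid f - (1/2) *\<^sub>R rp (comb a b g1 g2) = rp s" "edge_mid f + (1/2) *\<^sub>R rp (comb a b g1 g2) = rp t"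
      by (simp_all add: scaleR_right_diff_distrib scaleR_right_distrib)
    then have "v = F (g1,g2)" unfolding g(1) E_def F_def by simp
    then show "v \<in> F ` (J \<times> J)" using J by blast
  qed
  moreover have cJ: "card J = 2 * k + 5" by (simp add: J_def nat_eq_iff)
  moreover have "finite (J \<times> J)" by (simp add: J_def)
  ultimately have "card {v\<in>lattice_edges m n. edge_mid v = edge_mid f \<and> compatible \<Delta> v \<and> elen v \<le> elen f + k} \<le> card (J \<times> J)"
    by (meson card_image_le card_mono finite_imageI le_trans)
  also have "card (J \<times> J) = (2 * k + 5)\<^sup>2" using cJ by (simp add: card_cartesian_product power2_eq_square)
  finally show ?thesis .
qed

end

section \<open>The triangles of a triangulation\<close>

definition rect :: "nat \<Rightarrow> nat \<Rightarrow> point set" where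
  "rect m n = {0..real m} \<times> {0..real n}"

lemma convex_rect: "convex (rect m n)"
  unfolding rect_def by (intro convex_Times) auto

lemma rp_rect: "rp p \<in> rect m n \<longleftrightarrow> inbox m n p"
  by (cases p) (auto simp: rp_def rect_def inbox_def)

lemma mp_rect: "mp c \<in> rect m n \<longleftrightarrow> inbox (2*m) (2*n) c"
proof -
  have "(real_of_int x / 2 \<le> real k) = (x \<le> 2 * int k)" for x k by linarith
  then show ?thesis by (cases c) (simp add: mp_def rect_def inbox_def)
qed

lemma hull_E: "convex hull (E p q) = closed_segment (rp p) (rp q)"
  by (simp add: E_def segment_convex_hull)

lemma hull_rect:
  assumes "e \<in> lattice_edges m n" shows "convex hull e \<subseteq> rect m n"
proof -
  obtain p q where "e = E p q" "inbox m n p" "inbox m n q" using assms by (rule lattice_edgeE)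
  then have "e \<subseteq> rect m n" by (simp add: E_def rp_rect)
  then show ?thesis using convex_rect by (rule hull_minimal)
qed

lemma noncrossing_common_point:
  assumes "\<not> crosses e f" "e \<noteq> f" "x \<in> convex hull e" "x \<in> convex hull f"
  shows "x \<in> e \<and> x \<in> f"
  using assms unfolding crosses_def by blast

lemma exists_basis:
  assumes "prim a" obtains b where "det a b = 1"
proof -
  obtain x y where "x * fst a + y * snd a = 1" using assms bezout_int[of "fst a" "snd a"] by auto
  then have "det a (- y, x) = 1" by (simp add: det_def algebra_simps)
  then show ?thesis using that by blast
qed

text \<open>
  Lattice coordinates adapted to an edge: \<open>P\<close> runs along it and \<open>H\<close> is
  the lattice height above it.
\<close>

locale edge_frame =
  fixes m n :: nat and S :: "edge set" and p q a b :: "int \<times> int"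
  assumes tri: "triangulation m n S" and pq: "E p q \<in> S" and a: "a = q - p" and ab: "det a b = 1"
begin

definition H :: "point \<Rightarrow> real" where
  "H x = real_of_int (fst a) * (snd x - real_of_int (snd p)) - real_of_int (snd a) * (fst x - real_of_int (fst p))"
definition P :: "point \<Rightarrow> real" where
  "P x = (fst x - real_of_int (fst p)) * real_of_int (snd b) - (snd x - real_of_int (snd p)) * real_of_int (fst b)"
definition pt :: "real \<Rightarrow> real \<Rightarrow> point" where
  "pt y h = rp p + y *\<^sub>R rp a + h *\<^sub>R rp b"

lemma abR: "real_of_int (fst a) * real_of_int (snd b) - real_of_int (snd a) * real_of_int (fst b) = 1"
proof -
  have "real_of_int (fst a * snd b - snd a * fst b) = 1" using ab by (simp only: det_def of_int_1)
  then show ?thesis by simp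
qed

lemma pt_PH: "pt (P x) (H x) = x"
proof -
  define D where "D = real_of_int (fst a) * real_of_int (snd b) - real_of_int (snd a) * real_of_int (fst b)"
  have "fst (pt (P x) (H x)) = real_of_int (fst p) + (fst x - real_of_int (fst p)) * D"
    unfolding pt_def P_def H_def D_def rp_def by (simp add: algebra_simps)
  moreover have "snd (pt (P x) (H x)) = real_of_int (snd p) + (snd x - real_of_int (snd p)) * D"
    unfolding pt_def P_def H_def D_def rp_def by (simp add: algebra_simps)
  moreover have "D = 1" unfolding D_def by (rule abR)
  ultimately show ?thesis by (simp add: prod_eq_iff)
qed

lemma PH_pt: "P (pt y h) = y" "H (pt y h) = h"
proof -
  define D where "D = real_of_int (fst a) * real_of_int (snd b) - real_of_int (snd a) * real_of_int (fst b)"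
  have "P (pt y h) = y * D" "H (pt y h) = h * D"
    unfolding pt_def P_def H_def D_def rp_def by (simp_all add: algebra_simps)
  moreover have "D = 1" unfolding D_def by (rule abR)
  ultimately show "P (pt y h) = y" "H (pt y h) = h" by simp_all
qed

lemma PH_comb:
  "P ((1 - u) *\<^sub>R x + u *\<^sub>R y) = (1 - u) * P x + u * P y"
  "H ((1 - u) *\<^sub>R x + u *\<^sub>R y) = (1 - u) * H x + u * H y"
  by (simp_all add: P_def H_def algebra_simps)

lemma pt_comb: "(1 - u) *\<^sub>R pt y h + u *\<^sub>R pt y' h' = pt ((1 - u) * y + u * y') ((1 - u) * h + u * h')"
  by (simp add: pt_def algebra_simps)

lemma PH_rp: "P (rp c) \<in> \<int>" "H (rp c) \<in> \<int>"
  by (simp_all add: P_def H_def rp_def)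

lemma pt_rp: "pt (real_of_int x) (real_of_int y) = rp (aff p a b (x,y))"
  by (simp add: pt_def rp_def aff_def)

lemma pt_p: "rp p = pt 0 0" and pt_q: "rp q = pt 1 0"
proof -
  have "rp a = rp q - rp p" by (simp add: a rp_def)
  then show "rp p = pt 0 0" "rp q = pt 1 0" unfolding pt_def by simp_all
qed

definition c :: "int \<Rightarrow> int \<times> int" where "c k = p + p + (k * fst a, k * snd a) + b"

lemma mp_c: "mp (c k) = pt (real_of_int k / 2) (1 / 2)"
  by (simp add: mp_def c_def pt_def rp_def field_simps)

lemma mid_c: "mp (c k) \<in> midpoints m n \<longleftrightarrow> mp (c k) \<in> rect m n"
proof -
  have "\<not> (even (fst (c k)) \<and> even (snd (c k)))"
  proof
    assume e: "even (fst (c k)) \<and> even (snd (c k))"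
    have "det a (k * fst a + fst b, k * snd a + snd b) = 1" using ab by (simp add: det_def algebra_simps)
    moreover have "even (k * fst a + fst b)" "even (k * snd a + snd b)" using e by (auto simp: c_def add.assoc)
    then have "even (det a (k * fst a + fst b, k * snd a + snd b))" by (simp add: det_def)
    ultimately show False by simp
  qed
  then show ?thesis unfolding midpoints_iff mp_rect by auto
qed

text \<open>
  The positions at height one half whose midpoints lie in the rectangle.
\<close>

definition J :: "int set" where "J = {k. mp (c k) \<in> rect m n}"

lemma finite_J: "finite J"
proof -
  have "inj_on (\<lambda>k. mp (c k)) J"
  proof (rule inj_onI)
    fix k l assume "mp (c k) = mp (c l)"
    then have "pt (real_of_int k / 2) (1 / 2) = pt (real_of_int l / 2) (1 / 2)" by (simp only: mp_c)
    then have "real_of_int k / 2 = real_of_int l / 2" by (metis PH_pt(1))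
    then show "k = l" by simp
  qed
  moreover have "(\<lambda>k. mp (c k)) ` J \<subseteq> midpoints m n" using mid_c by (auto simp: J_def)
  ultimately show ?thesis using finite_midpoints by (meson inj_on_finite)
qed

text \<open>
  The edge at the \<open>k\<close>-th midpoint at height one half, with slope
  \<open>\<alpha>\<close>. It cannot cut the edge \<open>E p q\<close>, so going down it passes
  \<open>E p q\<close> on the left (\<open>\<alpha> \<ge> k\<close>) or on the right
  (\<open>\<alpha> \<le> k - 2\<close>).
\<close>

definition strand :: "int \<Rightarrow> int \<times> int \<Rightarrow> int \<times> int \<Rightarrow> real \<Rightarrow> bool" where
  "strand k s t \<alpha> \<longleftrightarrow> E s t \<in> S \<and> s + t = c k \<and> H (rp s) \<le> 0 \<and> 1 \<le> H (rp t) \<and>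
     (\<forall>h. H (rp s) \<le> h \<longrightarrow> h \<le> H (rp t) \<longrightarrow> pt (k / 2 + (h - 1/2) * \<alpha>) h \<in> convex hull (E s t)) \<and>
     (\<alpha> \<ge> k \<or> \<alpha> \<le> k - 2)"

lemma strand_exists:
  assumes "k \<in> J" shows "\<exists>s t \<alpha>. strand k s t \<alpha>"
proof -
  have x: "mp (c k) \<in> midpoints m n" using assms mid_c by (simp add: J_def)
  obtain e where e: "e \<in> S" "edge_mid e = mp (c k)" using edge_at[OF tri x] by blast
  obtain s0 t0 where "e = E s0 t0" using triangulation_lattice[OF tri e(1)] by (rule lattice_edgeE)
  have "H (rp s) + H (rp t) = 1" "P (rp s) + P (rp t) = k" if "s + t = c k" for s t
  proof -
    have "mp (c k) = (1 - 1/2) *\<^sub>R rp s + (1/2) *\<^sub>R rp t" unfolding that[symmetric] by (simp add: mp_def rp_def field_simps)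
    then have "P (pt (k / 2) (1 / 2)) = (1 - 1/2) * P (rp s) + 1/2 * P (rp t)"
      "H (pt (k / 2) (1 / 2)) = (1 - 1/2) * H (rp s) + 1/2 * H (rp t)" by (simp_all only: PH_comb mp_c)
    then show "H (rp s) + H (rp t) = 1" "P (rp s) + P (rp t) = k" by (simp_all add: PH_pt)
  qed note sums = this
  have "s0 + t0 = c k" using e \<open>e = E s0 t0\<close> by (simp add: edge_mid_mp)
  then have "H (rp s0) \<le> 0 \<or> H (rp t0) \<le> 0"
  proof -
    obtain i j :: int where "H (rp s0) = i" "H (rp t0) = j" using PH_rp(2) by (meson Ints_cases)
    moreover from this have "real_of_int (i + j) = 1" using sums(1)[OF \<open>s0 + t0 = c k\<close>] by simp
    then have "i + j = 1" by linarith
    then have "i \<le> 0 \<or> j \<le> 0" by linarith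
    ultimately show ?thesis by auto
  qed
  then obtain s t where st: "e = E s t" "s + t = c k" "H (rp s) \<le> 0"
    using \<open>e = E s0 t0\<close> \<open>s0 + t0 = c k\<close> E_commute add.commute by metis
  have Ht: "H (rp t) = 1 - H (rp s)" "P (rp t) = k - P (rp s)" using sums[OF st(2)] by auto
  have pos: "H (rp t) - H (rp s) > 0" using st(3) Ht by simp
  define \<alpha> where "\<alpha> = (P (rp t) - P (rp s)) / (H (rp t) - H (rp s))"
  have \<alpha>: "\<alpha> * (H (rp t) - H (rp s)) = P (rp t) - P (rp s)" using pos by (simp add: \<alpha>_def)
  have on: "pt (k / 2 + (h - 1/2) * \<alpha>) h \<in> convex hull (E s t)" if h: "H (rp s) \<le> h" "h \<le> H (rp t)" for h
  proof -
    define u where "u = (h - H (rp s)) / (H (rp t) - H (rp s))"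
    have u: "0 \<le> u" "u \<le> 1" "u * (H (rp t) - H (rp s)) = h - H (rp s)" using h pos by (auto simp: u_def)
    define y where "y = (1 - u) *\<^sub>R rp s + u *\<^sub>R rp t"
    have "H y = h" unfolding y_def PH_comb using u(3) by (simp add: algebra_simps)
    moreover have "P y = k / 2 + (h - 1/2) * \<alpha>"
    proof -
      have "P y = P (rp s) + u * (P (rp t) - P (rp s))" unfolding y_def PH_comb by (simp add: algebra_simps)
      also have "\<dots> = P (rp s) + \<alpha> * (u * (H (rp t) - H (rp s)))" by (simp add: \<alpha>[symmetric] algebra_simps)
      also have "\<dots> = P (rp s) + \<alpha> * (h - H (rp s))" by (simp only: u)
      finally have 1: "P y = P (rp s) + \<alpha> * (h - H (rp s))" .
      have "\<alpha> * (1 - 2 * H (rp s)) = k - 2 * P (rp s)" using \<alpha> unfolding Ht by (simp add: algebra_simps)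
      then show ?thesis unfolding 1 by (simp add: algebra_simps)
    qed
    ultimately have "pt (k / 2 + (h - 1/2) * \<alpha>) h = y" using pt_PH[of y] by simp
    then show ?thesis unfolding hull_E in_segment y_def using u by blast
  qed
  have "\<alpha> \<ge> k \<or> \<alpha> \<le> k - 2"
  proof (rule ccontr)
    assume neg: "\<not> ?thesis"
    define y where "y = k / 2 - \<alpha> / 2"
    have y: "0 < y" "y < 1" using neg by (auto simp: y_def)
    have "pt y 0 \<in> convex hull (E s t)" using on[of 0] st(3) Ht by (simp add: y_def algebra_simps)
    moreover have pty: "pt y 0 = (1 - y) *\<^sub>R rp p + y *\<^sub>R rp q" unfolding pt_p pt_q pt_comb by simp
    have "pt y 0 \<in> convex hull (E p q)" unfolding hull_E in_segment pty using y
      by (intro exI[of _ y]) auto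
    moreover have "\<not> crosses (E s t) (E p q)" using triangulation_noncrossing[OF tri] pq e st(1) by blast
    moreover have "E s t \<noteq> E p q"
    proof
      assume "E s t = E p q"
      then have "t = p \<or> t = q" by (auto simp: E_eq_iff)
      then have "H (rp t) = 0" using PH_pt(2) pt_p pt_q by metis
      then show False using Ht st(3) by simp
    qed
    ultimately have "pt y 0 \<in> E p q" using noncrossing_common_point by blast
    then have "P (pt y 0) = 0 \<or> P (pt y 0) = 1" unfolding E_def pt_p pt_q by (metis PH_pt(1) insertE singletonD)
    then show False using y by (simp add: PH_pt)
  qed
  then have "strand k s t \<alpha>" unfolding strand_def using e(1) st Ht on by auto
  then show ?thesis by blast
qed

lemma strand_top_rect:
  assumes "strand k s t \<alpha>" shows "pt (k / 2 + \<alpha> / 2) 1 \<in> rect m n"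
proof -
  have "pt (k / 2 + (1 - 1/2) * \<alpha>) 1 \<in> convex hull (E s t)" "E s t \<in> S"
  proof -
    have 1: "H (rp s) \<le> 0" "1 \<le> H (rp t)" "E s t \<in> S" using assms unfolding strand_def by blast+
    then have 2: "H (rp s) \<le> 1" by simp
    show "pt (k / 2 + (1 - 1/2) * \<alpha>) 1 \<in> convex hull (E s t)" using assms 1(2) 2 unfolding strand_def by blast
    show "E s t \<in> S" by (rule 1)
  qed
  then show ?thesis using hull_rect triangulation_lattice[OF tri] by fastforce
qed

lemma rect_comb: "x \<in> rect m n \<Longrightarrow> y \<in> rect m n \<Longrightarrow> 0 \<le> u \<Longrightarrow> u \<le> 1 \<Longrightarrow> (1 - u) *\<^sub>R x + u *\<^sub>R y \<in> rect m n"
  using convex_rect[of m n] by (simp add: convex_alt)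

lemma pq_rect: "pt 0 0 \<in> rect m n" "pt 1 0 \<in> rect m n"
  using triangulation_lattice[OF tri pq] unfolding pt_p[symmetric] pt_q[symmetric] rp_rect E_lattice_iff by auto

lemma rect_between:
  assumes "pt x h \<in> rect m n" "pt z h \<in> rect m n" "x \<le> y" "y \<le> z"
  shows "pt y h \<in> rect m n"
proof (cases "x = z")
  case True then show ?thesis using assms by simp
next
  case False
  define u where "u = (y - x) / (z - x)"
  have u: "0 \<le> u" "u \<le> 1" "u * (z - x) = y - x" using assms False by (auto simp: u_def)
  have "(1 - u) * x + u * z = y" using u(3) by (simp add: algebra_simps)
  moreover have "(1 - u) * h + u * h = h" by (simp add: algebra_simps)
  ultimately show ?thesis using rect_comb[OF assms(1,2) u(1,2)] unfolding pt_comb by simp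
qed

lemma J_step_left:
  assumes "k \<in> J" "strand k s t \<alpha>" "\<alpha> \<le> k - 2" shows "k - 1 \<in> J"
proof -
  have "(1 - 1/2) *\<^sub>R pt 0 0 + (1/2) *\<^sub>R pt (k / 2 + \<alpha> / 2) 1 \<in> rect m n"
    by (rule rect_comb[OF pq_rect(1) strand_top_rect[OF assms(2)]]) auto
  then have "pt ((k / 2 + \<alpha> / 2) / 2) (1/2) \<in> rect m n" unfolding pt_comb by simp
  moreover have "pt (k / 2) (1/2) \<in> rect m n" using assms(1) by (simp add: J_def mp_c)
  ultimately have "pt ((k - 1) / 2) (1/2) \<in> rect m n"
    by (rule rect_between) (use assms(3) in \<open>auto simp: field_simps\<close>)
  then show ?thesis by (simp add: J_def mp_c)
qed

lemma J_step_right: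
  assumes "k \<in> J" "strand k s t \<alpha>" "\<alpha> \<ge> k" shows "k + 1 \<in> J"
proof -
  have "(1 - 1/2) *\<^sub>R pt 1 0 + (1/2) *\<^sub>R pt (k / 2 + \<alpha> / 2) 1 \<in> rect m n"
    by (rule rect_comb[OF pq_rect(2) strand_top_rect[OF assms(2)]]) auto
  then have "pt (1/2 + (k / 2 + \<alpha> / 2) / 2) (1/2) \<in> rect m n" unfolding pt_comb by simp
  moreover have "pt (k / 2) (1/2) \<in> rect m n" using assms(1) by (simp add: J_def mp_c)
  ultimately have "pt ((k + 1) / 2) (1/2) \<in> rect m n"
    using rect_between[of "k / 2" "1/2" "1/2 + (k / 2 + \<alpha> / 2) / 2" "(k + 1) / 2"] assms(3) by (simp add: field_simps)
  then show ?thesis by (simp add: J_def mp_c)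
qed

text \<open>
  The two consecutive strands converge upwards and must not cross, so they meet in a lattice
  point; its height is between one half and one, hence one, and this point is the apex.
\<close>

lemma strands_meet:
  assumes 1: "strand k s t \<alpha>" "\<alpha> \<ge> k" and 2: "strand (k + 1) s' t' \<alpha>'" "\<alpha>' \<le> k - 1"
  shows "\<exists>r. E p r \<in> S \<and> E q r \<in> S \<and> orient p q r = 1"
proof -
  define D where "D = \<alpha> - \<alpha>'"
  have D: "D \<ge> 1" using 1(2) 2(2) by (simp add: D_def)
  define h where "h = 1/2 + 1 / (2 * D)"
  have h: "1/2 < h" "h \<le> 1" "(h - 1/2) * D = 1/2" using D by (auto simp: h_def field_simps)
  have eq: "k / 2 + (h - 1/2) * \<alpha> = (k + 1) / 2 + (h - 1/2) * \<alpha>'"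
  proof -
    have "(h - 1/2) * \<alpha> - (h - 1/2) * \<alpha>' = 1/2" using h(3) unfolding D_def right_diff_distrib .
    moreover have "real_of_int (k + 1) / 2 = real_of_int k / 2 + 1/2" by simp
    ultimately show ?thesis by linarith
  qed
  define X where "X = pt (k / 2 + (h - 1/2) * \<alpha>) h"
  have s1: "E s t \<in> S" "s + t = c k" "H (rp s) \<le> 0" "1 \<le> H (rp t)"
    and s2: "E s' t' \<in> S" "s' + t' = c (k + 1)" "H (rp s') \<le> 0" "1 \<le> H (rp t')"
    using 1 2 by (auto simp: strand_def)
  have X1: "X \<in> convex hull (E s t)" using 1(1) h s1 unfolding strand_def X_def by auto
  have X2: "X \<in> convex hull (E s' t')" using 2(1) h s2 unfolding strand_def X_def eq by auto
  have ne: "E s t \<noteq> E s' t'"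
  proof
    assume "E s t = E s' t'"
    then have "s + t = s' + t'" by (auto simp: E_eq_iff add.commute)
    then have "b + p + p + (k * fst a, k * snd a) = b + p + p + ((k + 1) * fst a, (k + 1) * snd a)"
      using s1(2) s2(2) by (simp add: c_def add.commute add.left_commute add.assoc)
    then have "fst a = 0 \<and> snd a = 0" by (auto simp: algebra_simps prod_eq_iff)
    then show False using ab by (simp add: det_def)
  qed
  have X: "X \<in> E s t" "X \<in> E s' t'"
    using noncrossing_common_point[OF triangulation_noncrossing[OF tri s1(1) s2(1)] ne X1 X2] by auto
  have HX: "H X = h" "P X = k / 2 + (h - 1/2) * \<alpha>" by (simp_all add: X_def PH_pt)
  have "X \<noteq> rp s" "X \<noteq> rp s'" using HX(1) h s1(3) s2(3) by auto
  then have Xt: "X = rp t" "X = rp t'" using X by (auto simp: E_def)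
  then have t': "t' = t" by simp
  have "h \<in> \<int>" using PH_rp(2)[of t] Xt HX(1) by simp
  then have h1: "h = 1" using h by (auto elim!: Ints_cases)
  then have "D = 1" using h(3) by simp
  then have \<alpha>: "\<alpha> = k" using 1(2) 2(2) by (simp add: D_def)
  have "X = pt (real_of_int k) (real_of_int 1)" by (simp add: X_def h1 \<alpha>)
  then have t: "t = aff p a b (k,1)" unfolding Xt pt_rp by simp
  have "c k = p + aff p a b (k,1)" "c (k + 1) = q + aff p a b (k,1)"
    unfolding c_def by (simp_all add: aff_def a prod_eq_iff algebra_simps)
  then have "s = p" "s' = q" using s1(2) s2(2) t t' by simp_all
  moreover have "orient p q t = 1"
    using orient_aff[of p a b "(0,0)" "(1,0)" "(k,1)"] ab by (simp add: aff_basis t a orient_Pair)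
  ultimately show ?thesis using s1(1) s2(1) t' by blast
qed

text \<open>
  The first strand passes \<open>E p q\<close> on the left, for otherwise there would be a
  midpoint of the rectangle further to the left, and likewise the last one passes on the right.
  Somewhere in between two consecutive strands pass on different sides.
\<close>

lemma apex:
  assumes w: "inbox m n w" "orient p q w > 0"
  shows "\<exists>r. E p r \<in> S \<and> E q r \<in> S \<and> orient p q r = 1"
proof -
  have "J \<noteq> {}"
  proof -
    obtain w1 h where wh: "w = aff p a b (w1,h)" using aff_surj[OF ab, of w p] by (metis prod.exhaust_sel)
    have "orient p q w = h"
      using orient_aff[of p a b "(0,0)" "(1,0)" "(w1,h)"] ab by (simp add: aff_basis wh a orient_Pair)
    then have h: "h \<ge> 1" using w by simp
    define k where "k = \<lceil>w1 / h\<rceil>"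
    have hw: "real_of_int h \<ge> 1" using h by simp
    have k1: "real_of_int k \<ge> w1 / h" by (simp add: k_def)
    have k2: "real_of_int k \<le> (w1 + h - 1) / h"
    proof -
      have "k = - ((- w1) div h)" unfolding k_def by (simp add: ceiling_divide_eq_div)
      then have "h * k = - (h * ((- w1) div h))" by simp
      moreover have "h * ((- w1) div h) + (- w1) mod h = - w1" by (rule mult_div_mod_eq)
      moreover have "(- w1) mod h \<le> h - 1" using h by simp
      ultimately have "h * k \<le> w1 + h - 1" by linarith
      then have "real_of_int (h * k) \<le> real_of_int (w1 + h - 1)" by (simp only: of_int_le_iff)
      then show ?thesis using hw by (simp add: field_simps)
    qed
    have wr: "pt w1 h \<in> rect m n" using w(1) unfolding pt_rp wh[symmetric] rp_rect .
    define \<gamma> where "\<gamma> = 1 / (2 * real_of_int h)"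
    have \<gamma>: "0 \<le> \<gamma>" "\<gamma> \<le> 1" "\<gamma> * h = 1/2" using hw by (auto simp: \<gamma>_def)
    have "(1 - \<gamma>) *\<^sub>R pt 0 0 + \<gamma> *\<^sub>R pt w1 h \<in> rect m n" by (rule rect_comb[OF pq_rect(1) wr \<gamma>(1,2)])
    then have A: "pt (\<gamma> * w1) (1/2) \<in> rect m n" unfolding pt_comb using \<gamma> by simp
    have "(1 - \<gamma>) *\<^sub>R pt 1 0 + \<gamma> *\<^sub>R pt w1 h \<in> rect m n" by (rule rect_comb[OF pq_rect(2) wr \<gamma>(1,2)])
    then have B: "pt (1 - \<gamma> + \<gamma> * w1) (1/2) \<in> rect m n" unfolding pt_comb using \<gamma> by simp
    have "\<gamma> * w1 \<le> k / 2" using k1 hw by (simp add: \<gamma>_def field_simps)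
    moreover have "k / 2 \<le> 1 - \<gamma> + \<gamma> * w1"
    proof -
      have "k / 2 \<le> (w1 + h - 1) / h / 2" by (rule divide_right_mono[OF k2]) simp
      also have "\<dots> = \<gamma> * w1 + \<gamma> * h - \<gamma>" using hw by (simp add: \<gamma>_def add_divide_distrib diff_divide_distrib)
      also have "\<dots> = \<gamma> * w1 + 1/2 - \<gamma>" using \<gamma>(3) by simp
      finally show ?thesis by simp
    qed
    ultimately have "pt (k / 2) (1/2) \<in> rect m n" by (rule rect_between[OF A B])
    then have "k \<in> J" by (simp add: J_def mp_c)
    then show ?thesis by blast
  qed
  define K where "K = {k\<in>J. \<exists>s t \<alpha>. strand k s t \<alpha> \<and> \<alpha> \<ge> k}"
  have "Min J \<in> J" using finite_J \<open>J \<noteq> {}\<close> by simp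
  moreover obtain s t \<alpha> where st: "strand (Min J) s t \<alpha>" using strand_exists calculation by blast
  moreover have "\<not> \<alpha> \<le> Min J - 2"
  proof
    assume "\<alpha> \<le> Min J - 2"
    then have "Min J - 1 \<in> J" using J_step_left st calculation(1) by blast
    then show False using finite_J Min_le[of J "Min J - 1"] by simp
  qed
  ultimately have "Min J \<in> K" unfolding K_def strand_def by auto
  then have K: "finite K" "K \<noteq> {}" using finite_J by (auto simp: K_def)
  define k where "k = Max K"
  have "k \<in> K" using K by (simp add: k_def)
  then obtain s t \<alpha> where st: "k \<in> J" "strand k s t \<alpha>" "\<alpha> \<ge> k" by (auto simp: K_def)
  have k1: "k + 1 \<in> J" using J_step_right st by blast
  obtain s' t' \<alpha>' where st': "strand (k + 1) s' t' \<alpha>'" using strand_exists[OF k1] by blast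
  have "k + 1 \<notin> K" using K(1) Max_ge[of K "k + 1"] by (auto simp: k_def)
  then have "\<not> \<alpha>' \<ge> k + 1" using k1 st' unfolding K_def by auto
  then have "\<alpha>' \<le> k - 1" using st' unfolding strand_def by auto
  then show ?thesis using strands_meet st st' by blast
qed

end

lemma apex_exists:
  assumes "triangulation m n S" "E p q \<in> S" "inbox m n w" "orient p q w > 0"
  obtains r where "E p r \<in> S" "E q r \<in> S" "orient p q r = 1"
proof -
  have "prim (q - p)" using triangulation_lattice[OF assms(1,2)] by (simp add: E_lattice_iff)
  then obtain b where b: "det (q - p) b = 1" by (rule exists_basis)
  interpret edge_frame m n S p q "q - p" b using assms b by unfold_locales auto
  show ?thesis using apex assms that by blast
qed

lemma apex_unique:
  assumes S: "triangulation m n S" and r: "E p r \<in> S" "E q r \<in> S" "orient p q r = 1"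
    and r': "E p r' \<in> S" "E q r' \<in> S" "orient p q r' = 1" and pq: "prim (q - p)"
  shows "r = r'"
proof -
  have *: False if r: "E p r \<in> S" "E q r \<in> S" "orient p q r = 1" and r': "E p r' \<in> S" "E q r' \<in> S"
    and k: "r' - r = (k * fst (q - p), k * snd (q - p))" "k \<ge> 1" for r r' k
  proof -
    have d: "det (q - p) (r - p) = 1" using r by (simp add: orient_def)
    have b: "p = aff p (q - p) (r - p) (0,0)" "q = aff p (q - p) (r - p) (1,0)" "r = aff p (q - p) (r - p) (0,1)"
      "r' = aff p (q - p) (r - p) (k,1)"
      using k(1) by (auto simp: aff_def prod_eq_iff algebra_simps)
    have "xcross (0,0) (k,1) (1,0) (0,1)" using k(2) by (simp add: xcross_def orient_Pair mult_less_0_iff)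
    then have "xcross p r' q r" using xcross_aff[OF d, of p "(0,0)" "(k,1)" "(1,0)" "(0,1)"] b by simp
    then show False using triangulation_noncrossing[OF S r'(1) r(2)] crosses_E triangulation_lattice[OF S] r r' by blast
  qed
  have "det (q - p) (r' - r) = 0" using r(3) r'(3) by (simp add: orient_def det_def algebra_simps)
  then obtain k where k: "r' - r = (k * fst (q - p), k * snd (q - p))" using prim_parallel[OF pq] by blast
  consider "k = 0" | "k \<ge> 1" | "- k \<ge> 1" by linarith
  then show ?thesis
  proof cases
    case 1 then show ?thesis using k by (simp add: prod_eq_iff)
  next
    case 2 then show ?thesis using *[OF r r'(1,2) k] by blast
  next
    case 3
    have "r - r' = ((- k) * fst (q - p), (- k) * snd (q - p))" using k by (simp add: prod_eq_iff)
    then show ?thesis using *[OF r' r(1,2) _ 3] by blast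
  qed
qed

lemma orientR_affine3:
  assumes "x + y + z = 1"
  shows "orientR u v (x *\<^sub>R a + y *\<^sub>R b + z *\<^sub>R c) = x * orientR u v a + y * orientR u v b + z * orientR u v c"
proof -
  have x: "x = 1 - y - z" using assms by simp
  show ?thesis unfolding x by (simp add: orientR_def algebra_simps)
qed

lemma orientR_self: "orientR a b a = 0" "orientR a b b = 0"
  by (simp_all add: orientR_def)

lemma orientR_rot: "orientR b c a = orientR a b c"
  by (simp add: orientR_def algebra_simps)

lemma orient_rot: "orient q r p = orient p q r"
  by (cases p; cases q; cases r) (simp add: orient_Pair algebra_simps)

lemma orientR_sum: "orientR a b x + orientR b c x + orientR c a x = orientR a b c"
  by (simp add: orientR_def algebra_simps)

lemma barycentric:
  assumes "orientR a b c = 1"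
  shows "x = orientR b c x *\<^sub>R a + orientR c a x *\<^sub>R b + orientR a b x *\<^sub>R c"
proof -
  obtain a1 a2 b1 b2 c1 c2 x1 x2 where s: "a = (a1,a2)" "b = (b1,b2)" "c = (c1,c2)" "x = (x1,x2)"
    by (cases a; cases b; cases c; cases x) auto
  define D where "D = orientR a b c"
  have "orientR b c x * a1 + orientR c a x * b1 + orientR a b x * c1 = x1 * D"
    "orientR b c x * a2 + orientR c a x * b2 + orientR a b x * c2 = x2 * D"
    unfolding D_def s orientR_def by (simp_all add: algebra_simps)
  moreover have "D = 1" using assms by (simp add: D_def)
  ultimately show ?thesis by (simp add: s)
qed

lemma noncollinear:
  assumes "orientR a b c \<noteq> 0" shows "\<not> collinear {a, b, c}"
proof
  assume "collinear {a, b, c}"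
  then consider "a = c" | u where "b = u *\<^sub>R a + (1 - u) *\<^sub>R c" unfolding collinear_3_expand by blast
  then have "orientR a b c = 0"
  proof cases
    case 2 show ?thesis unfolding 2 by (simp add: orientR_def algebra_simps)
  qed (auto simp: orientR_def)
  with assms show False ..
qed

lemma dim_point: "DIM(point) = 2" by simp

lemma interior_triangle:
  assumes "orientR a b c = 1"
  shows "interior (convex hull {a, b, c}) = {x. orientR a b x > 0 \<and> orientR b c x > 0 \<and> orientR c a x > 0}"
proof -
  have nc: "\<not> collinear {a, b, c}" using assms by (intro noncollinear) simp
  show ?thesis unfolding interior_convex_hull_3_minimal[OF nc dim_point]
  proof (intro equalityI subsetI CollectI)
    fix v assume "v \<in> {v. \<exists>x y z. 0 < x \<and> 0 < y \<and> 0 < z \<and> x + y + z = 1 \<and> x *\<^sub>R a + y *\<^sub>R b + z *\<^sub>R c = v}"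
    then obtain x y z where xyz: "0 < x" "0 < y" "0 < z" "x + y + z = 1" "v = x *\<^sub>R a + y *\<^sub>R b + z *\<^sub>R c" by blast
    have "orientR b c a = 1" "orientR c a b = 1" using assms orientR_rot by metis+
    then have "orientR a b v = z" "orientR b c v = x" "orientR c a v = y"
      unfolding xyz(5) orientR_affine3[OF xyz(4)] orientR_self using assms by simp_all
    then show "orientR a b v > 0 \<and> orientR b c v > 0 \<and> orientR c a v > 0" using xyz by simp
  next
    fix v assume "v \<in> {x. orientR a b x > 0 \<and> orientR b c x > 0 \<and> orientR c a x > 0}"
    then show "\<exists>x y z. 0 < x \<and> 0 < y \<and> 0 < z \<and> x + y + z = 1 \<and> x *\<^sub>R a + y *\<^sub>R b + z *\<^sub>R c = v"
      using barycentric[OF assms, of v] orientR_sum[of a b v c] assms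
      by (intro exI[of _ "orientR b c v"] exI[of _ "orientR c a v"] exI[of _ "orientR a b v"]) auto
  qed
qed

text \<open>
  A point in the relative interior of a side can be moved into the triangle towards any point on
  the inner side of its line.
\<close>

lemma near_interior:
  assumes abc: "orientR a b c = 1" and P: "P = (1 - \<eta>) *\<^sub>R a + \<eta> *\<^sub>R b" "0 < \<eta>" "\<eta> < 1"
    and P': "orientR a b P' > 0"
  shows "\<exists>t. 0 < t \<and> t < 1 \<and> (1 - t) *\<^sub>R P + t *\<^sub>R P' \<in> interior (convex hull {a, b, c})"
proof -
  define B B' where "B = orientR b c P'" and "B' = orientR c a P'"
  define A where "A = min (1 - \<eta>) \<eta>"
  define M where "M = 1 + \<bar>B\<bar> + \<bar>B'\<bar>"
  define t where "t = A / (A + M)"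
  have A: "A > 0" "A \<le> 1 - \<eta>" "A \<le> \<eta>" using P by (auto simp: A_def)
  have M: "M > \<bar>B\<bar>" "M > \<bar>B'\<bar>" "M > 0" by (auto simp: M_def)
  have t: "0 < t" "t < 1" using A M by (auto simp: t_def)
  have "(1 - t) * A = t * M"
    using A M by (simp add: t_def field_simps)
  have pos: "(1 - t) * A' + t * C > 0" if "A' \<ge> A" "\<bar>C\<bar> < M" for A' C
  proof -
    have "(1 - t) * A' \<ge> (1 - t) * A" using that t by (intro mult_left_mono) auto
    moreover have "t * C > t * (- M)" using that t by (intro mult_strict_left_mono) auto
    ultimately show ?thesis using \<open>(1 - t) * A = t * M\<close> by simp
  qed
  have "orientR b c P = 1 - \<eta>" "orientR c a P = \<eta>" "orientR a b P = 0"
    unfolding P(1) orientR_comb orientR_self using abc orientR_rot by simp_all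
  then have "orientR b c ((1 - t) *\<^sub>R P + t *\<^sub>R P') > 0" "orientR c a ((1 - t) *\<^sub>R P + t *\<^sub>R P') > 0"
     "orientR a b ((1 - t) *\<^sub>R P + t *\<^sub>R P') > 0"
    unfolding orientR_comb using pos[of "1 - \<eta>" B] pos[of \<eta> B'] A M P' t by (auto simp: B_def B'_def)
  then show ?thesis unfolding interior_triangle[OF abc] using t by blast
qed

lemma segment_meets_frontier:
  fixes X :: "'a::real_normed_vector"
  assumes "X \<in> interior K" "Y \<notin> interior K"
  shows "closed_segment X Y \<inter> frontier K \<noteq> {}"
proof (cases "Y \<in> K")
  case True
  then have "Y \<in> frontier K" using assms(2) closure_subset by (auto simp: frontier_def)
  then show ?thesis by auto
next
  case False
  have "X \<in> K" using assms(1) interior_subset by blast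
  then show ?thesis using False by (intro connected_Int_frontier) auto
qed

text \<open>
  Three edges of the triangulation bounding a triangle of area one half; such a triangle
  contains no further lattice points.
\<close>

definition utri :: "edge set \<Rightarrow> point set \<Rightarrow> bool" where
  "utri S t \<longleftrightarrow> (\<exists>p q r. t = {rp p, rp q, rp r} \<and> orient p q r = 1 \<and> E p q \<in> S \<and> E q r \<in> S \<and> E p r \<in> S)"

lemma utriE:
  assumes "utri S t" "E x y \<in> S" "E x y \<subseteq> t" "x \<noteq> y"
  obtains z where "t = {rp x, rp y, rp z}" "E x z \<in> S" "E y z \<in> S" "orient x y z = 1 \<or> orient y x z = 1"
proof -
  obtain p q r where t: "t = {rp p, rp q, rp r}" "orient p q r = 1" "E p q \<in> S" "E q r \<in> S" "E p r \<in> S"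
    using assms(1) by (auto simp: utri_def)
  have o: "orient q r p = 1" "orient r p q = 1" using t(2) orient_rot by metis+
  have S: "E q p \<in> S" "E r q \<in> S" "E r p \<in> S" using t E_commute by metis+
  have "x \<in> {p,q,r}" "y \<in> {p,q,r}" using assms(3) t(1) by (auto simp: E_def)
  then consider "x = p \<and> y = q" | "x = q \<and> y = p" | "x = p \<and> y = r" | "x = r \<and> y = p"
    | "x = q \<and> y = r" | "x = r \<and> y = q" using assms(4) by blast
  then show ?thesis
  proof cases
    case 1 then show ?thesis using that[of r] t by auto
  next
    case 2 then show ?thesis using that[of r] t by auto
  next
    case 3 then show ?thesis using that[of q] t S o by (auto simp: insert_commute)
  next
    case 4 then show ?thesis using that[of q] t S o by (auto simp: insert_commute)
  next
    case 5 then show ?thesis using that[of p] t S o by (auto simp: insert_commute)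
  next
    case 6 then show ?thesis using that[of p] t S o by (auto simp: insert_commute)
  qed
qed

lemma interior_no_lattice:
  assumes "orient p q r = 1" shows "rp x \<notin> interior (convex hull {rp p, rp q, rp r})"
proof
  assume "rp x \<in> interior (convex hull {rp p, rp q, rp r})"
  moreover have o: "orientR (rp p) (rp q) (rp r) = 1" using assms by (simp add: orientR_rp)
  ultimately have "orient p q x > 0" "orient q r x > 0" "orient r p x > 0"
    unfolding interior_triangle[OF o] by (auto simp: orientR_rp)
  moreover have "real_of_int (orient p q x + orient q r x + orient r p x) = real_of_int (orient p q r)"
    using orientR_sum[of "rp p" "rp q" "rp x" "rp r"] by (simp add: orientR_rp)
  then have "orient p q x + orient q r x + orient r p x = 1" using assms by linarith
  ultimately show False by simp
qed

text \<open>
  An edge meeting the interior without crossing a side would have an end point in the interior,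
  or both end points among the corners.
\<close>

lemma utri_interior_avoids:
  assumes S: "triangulation m n S" and t: "utri S t" and g: "g \<in> S"
  shows "convex hull g \<inter> interior (convex hull t) = {}"
proof (rule ccontr)
  assume "\<not> ?thesis"
  then obtain X where X: "X \<in> convex hull g" "X \<in> interior (convex hull t)" by blast
  obtain p q r where pqr: "t = {rp p, rp q, rp r}" "orient p q r = 1" "E p q \<in> S" "E q r \<in> S" "E p r \<in> S"
    using t by (auto simp: utri_def)
  have fr: "frontier (convex hull t) = convex hull (E p q) \<union> convex hull (E q r) \<union> convex hull (E p r)"
    unfolding pqr(1) frontier_of_triangle[OF dim_point] hull_E by (simp add: closed_segment_commute)
  have dis: "interior (convex hull t) \<inter> frontier (convex hull t) = {}" by (auto simp: frontier_def)
  obtain s s' where ss: "g = E s s'" "prim (s' - s)" using triangulation_lattice[OF S g] by (rule lattice_edgeE)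
  have nl: "rp x \<notin> interior (convex hull t)" for x using interior_no_lattice[OF pqr(2)] pqr(1) by simp
  have gside: False if "g = x" "x \<in> {E p q, E q r, E p r}" for x
    using that X fr dis by auto
  have ends: "rp e \<in> t" if e: "e = s \<or> e = s'" for e
  proof -
    have sub: "closed_segment X (rp e) \<subseteq> convex hull g"
      using X(1) e unfolding ss hull_E by (intro closed_segment_subset) auto
    have "closed_segment X (rp e) \<inter> frontier (convex hull t) \<noteq> {}"
      by (rule segment_meets_frontier[OF X(2) nl])
    then obtain Y where Y: "Y \<in> closed_segment X (rp e)" "Y \<in> frontier (convex hull t)" by blast
    then obtain x where x: "x \<in> {E p q, E q r, E p r}" "Y \<in> convex hull x" unfolding fr by auto
    have "g \<noteq> x" using gside x by blast
    moreover have "\<not> crosses g x" using triangulation_noncrossing[OF S g] x pqr by auto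
    ultimately have Yg: "Y \<in> g" "Y \<in> x" using noncrossing_common_point Y(1) sub x(2) by blast+
    have "Y \<in> t" using Yg(2) x(1) unfolding pqr(1) E_def by auto
    moreover have "Y = rp e"
    proof (rule ccontr)
      assume ne: "Y \<noteq> rp e"
      obtain e' where e': "{s,s'} = {e,e'}" "Y = rp e'" using Yg(1) e ne unfolding ss E_def by blast
      have "X \<in> closed_segment (rp e') (rp e)" using X(1) e' unfolding ss hull_E
        by (auto simp: doubleton_eq_iff closed_segment_commute)
      then have "X = Y" using Y(1) e'(2) between_antisym[of "rp e" X Y]
        by (simp add: between_mem_segment closed_segment_commute) (metis between_antisym between_commute between_mem_segment)
      then show False using X(2) nl e'(2) by auto
    qed
    ultimately show ?thesis by simp
  qed
  have "g \<subseteq> t" using ends unfolding ss E_def by auto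
  then have "{s,s'} \<subseteq> {p,q,r}" "s \<noteq> s'" using ss by (auto simp: E_def pqr(1))
  then have "g \<in> {E p q, E q r, E p r}" unfolding ss E_def by auto
  then show False using gside by blast
qed

lemma utri_triangles:
  assumes S: "triangulation m n S" and t: "utri S t"
  shows "t \<in> triangles S"
proof -
  obtain p q r where pqr: "t = {rp p, rp q, rp r}" "orient p q r = 1" "E p q \<in> S" "E q r \<in> S" "E p r \<in> S"
    using t by (auto simp: utri_def)
  show ?thesis unfolding triangles_def
    using pqr utri_interior_avoids[OF S t] unfolding E_def by blast
qed

section \<open>Consecutive edges crossed by a segment\<close>

text \<open>
  The segment is parametrized by \<open>L\<close>; \<open>par g u\<close> says that
  \<open>g\<close> meets it at the interior parameter \<open>u\<close>.
\<close>

locale crossing_segment =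
  fixes m n :: nat and S :: "edge set" and p0 q0 :: "int \<times> int"
  assumes tri: "triangulation m n S" and f: "E p0 q0 \<in> lattice_edges m n"
begin

definition L :: "real \<Rightarrow> point" where "L u = (1 - u) *\<^sub>R rp p0 + u *\<^sub>R rp q0"
definition par :: "edge \<Rightarrow> real \<Rightarrow> bool" where "par g u \<longleftrightarrow> 0 < u \<and> u < 1 \<and> L u \<in> convex hull g"

lemma L_comb: "(1 - t) *\<^sub>R L u + t *\<^sub>R L v = L (u + t * (v - u))"
  by (simp add: L_def algebra_simps)

lemma L_f: "0 \<le> u \<Longrightarrow> u \<le> 1 \<Longrightarrow> L u \<in> convex hull (E p0 q0)"
  unfolding hull_E in_segment L_def by blast

lemma primf: "prim (q0 - p0)" using f by (simp add: E_lattice_iff)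

lemma L_inj: "L u = L v \<Longrightarrow> u = v"
proof -
  assume "L u = L v"
  then have "(u - v) *\<^sub>R (rp q0 - rp p0) = 0" by (simp add: L_def algebra_simps)
  moreover have "rp q0 - rp p0 \<noteq> 0" using primf by auto
  ultimately show ?thesis by simp
qed

lemma L_not_lattice: assumes "0 < u" "u < 1" shows "L u \<noteq> rp c"
proof
  assume c: "L u = rp c"
  then have "c = p0 \<or> c = q0" using L_f[of u] assms rp_in_prim_segment[OF primf] by (auto simp: hull_E)
  moreover have "rp p0 = L 0" "rp q0 = L 1" by (simp_all add: L_def)
  ultimately show False using c L_inj assms by (metis less_irrefl)
qed

lemma par_crosses:
  assumes "par g u" "g \<noteq> E p0 q0" shows "crosses (E p0 q0) g"
proof -
  have "L u \<notin> E p0 q0" using assms L_not_lattice by (auto simp: par_def E_def)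
  then show ?thesis using assms L_f[of u] unfolding crosses_def par_def by force
qed

lemma crosses_par:
  assumes "crosses (E p0 q0) g" "g \<in> lattice_edges m n"
  shows "\<exists>u. par g u"
proof -
  obtain r s where g: "g = E r s" using assms(2) by (rule lattice_edgeE)
  have "xcross p0 q0 r s" using assms f crosses_E unfolding g by blast
  then obtain u v where "0 < u" "u < 1" "0 < v" "v < 1"
    "(1 - u) *\<^sub>R rp p0 + u *\<^sub>R rp q0 = (1 - v) *\<^sub>R rp r + v *\<^sub>R rp s" by (rule xcross_point)
  then show ?thesis unfolding par_def L_def g hull_E in_segment
    by (intro exI[of _ u] conjI exI[of _ v]) auto
qed

lemma orient_zero:
  assumes "x \<in> convex hull (E r s)" shows "orientR (rp r) (rp s) x = 0"
  using assms orientR_on[of "rp r" "rp s"] unfolding hull_E in_segment by auto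

lemma orientR_L: "orientR a b (L u) = (1 - u) * orientR a b (rp p0) + u * orientR a b (rp q0)"
  unfolding L_def orientR_comb ..

lemma par_unique:
  assumes "crosses (E p0 q0) g" "g \<in> lattice_edges m n" "par g u" "par g v"
  shows "u = v"
proof -
  obtain r s where g: "g = E r s" using assms(2) by (rule lattice_edgeE)
  have "xcross p0 q0 r s" using assms f crosses_E unfolding g by blast
  then have "orient r s p0 * orient r s q0 < 0" by (simp add: xcross_def)
  then have d: "real_of_int (orient r s q0) - real_of_int (orient r s p0) \<noteq> 0" by (auto simp: mult_less_0_iff)
  have "orientR (rp r) (rp s) (L u) = 0" "orientR (rp r) (rp s) (L v) = 0"
    using orient_zero assms(3,4) unfolding par_def g by blast+
  then have "(u - v) * (real_of_int (orient r s q0) - real_of_int (orient r s p0)) = 0"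
    unfolding orientR_L orientR_rp by (simp add: algebra_simps)
  then show ?thesis using d by simp
qed

lemma par_inj:
  assumes "g \<in> S" "g' \<in> S" "par g u" "par g' u" shows "g = g'"
proof (rule ccontr)
  assume "g \<noteq> g'"
  then have "L u \<in> g" using noncrossing_common_point[OF triangulation_noncrossing[OF tri assms(1,2)]] assms(3,4)
    by (auto simp: par_def)
  moreover obtain r s where "g = E r s" using triangulation_lattice[OF tri assms(1)] by (rule lattice_edgeE)
  ultimately show False using L_not_lattice assms(3) by (auto simp: par_def E_def)
qed

text \<open>
  The segment continues behind \<open>g\<close> into the triangle on that side, and it leaves
  this triangle through another side, which is the next edge that it meets.
\<close>

lemma consecutive:
  assumes g: "g \<in> S" "crosses (E p0 q0) g" "par g u" and g': "g' \<in> S" "crosses (E p0 q0) g'" "par g' u'"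
    and uu: "u < u'" and none: "\<And>h v. h \<in> S \<Longrightarrow> u < v \<Longrightarrow> v < u' \<Longrightarrow> \<not> par h v"
  shows "\<exists>t. utri S t \<and> g \<subseteq> t \<and> g' \<subseteq> t"
proof -
  have fS: "E p0 q0 \<notin> S" using g triangulation_noncrossing[OF tri] by blast
  have gl: "g \<in> lattice_edges m n" using g triangulation_lattice[OF tri] by blast
  obtain r0 s0 where g0: "g = E r0 s0" using gl by (rule lattice_edgeE)
  have x0: "xcross p0 q0 r0 s0" using g gl f crosses_E unfolding g0 by blast
  then have "orient r0 s0 p0 * orient r0 s0 q0 < 0" by (simp add: xcross_def)
  then consider "orient r0 s0 q0 > 0" "orient r0 s0 p0 < 0" | "orient s0 r0 q0 > 0" "orient s0 r0 p0 < 0"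
    using orient_swap[of r0 s0] by (auto simp: mult_less_0_iff)
  then obtain r s where rs: "g = E r s" "orient r s q0 > 0" "orient r s p0 < 0"
    using g0 E_commute by metis
  have q0: "inbox m n q0" using f by (simp add: E_lattice_iff)
  obtain c where c: "E r c \<in> S" "E s c \<in> S" "orient r s c = 1"
    using apex_exists[OF tri _ q0 rs(2)] g rs(1) by blast
  define t where "t = {rp r, rp s, rp c}"
  have t: "utri S t" unfolding utri_def t_def using c g rs by blast
  have oc: "orientR (rp r) (rp s) (rp c) = 1" using c by (simp add: orientR_rp)
  have u: "0 < u" "u < 1" "0 < u'" "u' < 1" using g g' by (auto simp: par_def)
  define k where "k = orientR (rp r) (rp s) (rp q0) - orientR (rp r) (rp s) (rp p0)"
  have k: "k > 0" using rs by (simp add: k_def orientR_rp)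
  have ou: "orientR (rp r) (rp s) (L u) = 0" using g(3) orient_zero unfolding par_def rs by blast
  have "orientR (rp r) (rp s) (L v) - orientR (rp r) (rp s) (L u) = (v - u) * k" for v
    unfolding orientR_L k_def by (simp add: algebra_simps)
  then have ov: "orientR (rp r) (rp s) (L v) > 0" if "u < v" for v
    using that k ou by (metis diff_gt_0_iff_gt diff_zero mult_pos_pos)
  obtain \<eta> where \<eta>: "0 \<le> \<eta>" "\<eta> \<le> 1" "L u = (1 - \<eta>) *\<^sub>R rp r + \<eta> *\<^sub>R rp s"
    using g(3) unfolding par_def rs hull_E in_segment by blast
  have "\<eta> \<noteq> 0" "\<eta> \<noteq> 1" using \<eta>(3) L_not_lattice[OF u(1,2), of r] L_not_lattice[OF u(1,2), of s] by auto
  then have \<eta>': "0 < \<eta>" "\<eta> < 1" using \<eta> by auto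
  obtain \<epsilon> where \<epsilon>: "0 < \<epsilon>" "\<epsilon> < 1" "(1 - \<epsilon>) *\<^sub>R L u + \<epsilon> *\<^sub>R L u' \<in> interior (convex hull t)"
    using near_interior[OF oc \<eta>(3) \<eta>' ov[OF uu]] unfolding t_def by blast
  define w where "w = u + \<epsilon> * (u' - u)"
  have "\<epsilon> * (u' - u) < 1 * (u' - u)" using \<epsilon> uu by (intro mult_strict_right_mono) auto
  then have "w < u'" unfolding w_def mult_1_left less_diff_eq by (simp only: add.commute)
  then have w: "u < w" "w < u'" "L w \<in> interior (convex hull t)"
    using \<epsilon> uu unfolding L_comb w_def by simp_all
  have "L u' \<notin> interior (convex hull t)"
    using utri_interior_avoids[OF tri t g'(1)] g'(3) by (auto simp: par_def)
  then have "closed_segment (L w) (L u') \<inter> frontier (convex hull t) \<noteq> {}"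
    by (rule segment_meets_frontier[OF w(3)])
  then obtain Y where Y: "Y \<in> closed_segment (L w) (L u')" "Y \<in> frontier (convex hull t)" by blast
  then obtain \<theta> where \<theta>: "0 \<le> \<theta>" "\<theta> \<le> 1" "Y = (1 - \<theta>) *\<^sub>R L w + \<theta> *\<^sub>R L u'" by (auto simp: in_segment)
  define v where "v = w + \<theta> * (u' - w)"
  have "\<theta> * (u' - w) \<le> 1 * (u' - w)" "\<theta> * (u' - w) \<ge> 0" using \<theta> w by (auto intro!: mult_right_mono)
  then have "v \<le> u'" "w \<le> v" unfolding v_def mult_1_left by linarith+
  then have v: "u < v" "v \<le> u'" "Y = L v" using w \<theta>(3) unfolding L_comb v_def[symmetric] by simp_all
  have "Y \<notin> convex hull (E r s)" using ov[OF v(1)] orient_zero v(3) by fastforce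
  then obtain x where x: "x \<in> {E r c, E s c}" "Y \<in> convex hull x"
  proof -
    have "Y \<in> convex hull (E r s) \<union> convex hull (E s c) \<union> convex hull (E r c)"
      using Y(2) unfolding t_def frontier_of_triangle[OF dim_point] hull_E closed_segment_commute[of "rp c" "rp r"] .
    then show ?thesis using that \<open>Y \<notin> convex hull (E r s)\<close> by blast
  qed
  have xS: "x \<in> S" using x c by auto
  have "par x v" using v u x unfolding par_def by auto
  then have "v = u'" using none[OF xS] v by force
  then have "x = g'" using par_inj[OF xS g'(1)] \<open>par x v\<close> g'(3) by simp
  then have "g' \<subseteq> t" using x(1) unfolding t_def E_def by auto
  moreover have "g \<subseteq> t" unfolding rs t_def E_def by auto
  ultimately show ?thesis using t by blast
qed

end

section \<open>The adjacency graph of a triangulation\<close>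

definition unit_diagonal :: "edge \<Rightarrow> bool" where "unit_diagonal d \<longleftrightarrow> small d \<and> elen d = 2"

text \<open>
  Unit diagonals may differ between triangulations of the same weight, so an edge lying between
  two others must be skipped when it is a unit diagonal; adjacency therefore allows for one of
  them between the two triangles.
\<close>

definition hadj :: "edge set \<Rightarrow> edge \<Rightarrow> edge \<Rightarrow> bool" where
  "hadj S g h \<longleftrightarrow> (\<exists>t t'. utri S t \<and> utri S t' \<and> g \<subseteq> t \<and> h \<subseteq> t' \<and>
     (t = t' \<or> (\<exists>d\<in>S. unit_diagonal d \<and> d \<subseteq> t \<and> d \<subseteq> t')))"

lemma hadj_sym: "hadj S g h \<Longrightarrow> hadj S h g"
  unfolding hadj_def by metis

lemma two_diagonals:
  assumes "triangulation m n S" "utri S t" "d \<in> S" "d' \<in> S" "d \<subseteq> t" "d' \<subseteq> t" "unit_diagonal d" "unit_diagonal d'"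
  shows "d = d'"
proof (rule ccontr)
  assume ne: "d \<noteq> d'"
  obtain x y where d: "d = E x y" "prim (y - x)" using triangulation_lattice[OF assms(1,3)] by (rule lattice_edgeE)
  have "x \<noteq> y" using d by auto
  then obtain z where z: "t = {rp x, rp y, rp z}" "orient x y z = 1 \<or> orient y x z = 1"
    using utriE[OF assms(2), of x y] assms(3,5) d by metis
  obtain x' y' where d': "d' = E x' y'" "prim (y' - x')" using triangulation_lattice[OF assms(1,4)] by (rule lattice_edgeE)
  have "x' \<noteq> y'" using d' by auto
  have odd: "odd (fst (y - x))" "odd (snd (y - x))" if "unit_diagonal (E x y)" for x y
  proof -
    have "nat (\<bar>fst (y - x)\<bar> + \<bar>snd (y - x)\<bar>) = 2" "\<bar>fst (y - x)\<bar> \<le> 1" "\<bar>snd (y - x)\<bar> \<le> 1"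
      using that unfolding unit_diagonal_def small_E elen_E len_def by auto
    then have "\<bar>fst (y - x)\<bar> = 1" "\<bar>snd (y - x)\<bar> = 1" by linarith+
    then show "odd (fst (y - x))" "odd (snd (y - x))" by presburger+
  qed
  have "E x' y' \<in> {E x z, E y z}"
    using assms(6) ne d d' z(1) \<open>x' \<noteq> y'\<close> by (auto simp: E_def)
  then have "unit_diagonal (E x z) \<or> unit_diagonal (E y z)" using assms(8) d' by auto
  then have "even (orient x y z) \<and> even (orient y x z)"
    using odd[of x y] odd[of x z] odd[of y z] assms(7) d
    by (auto simp: orient_def det_def)
  then show False using z(2) by auto
qed

context crossing_segment
begin

text \<open>
  Along the segment the edges with \<open>good\<close> occur with gaps of at most one, since two
  unit diagonals are never sides of a common triangle. Somewhere between \<open>g\<close> and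
  \<open>g'\<close> the property \<open>W\<close> changes.
\<close>

lemma crossing_chain:
  assumes bad: "\<And>g. g \<in> S \<Longrightarrow> crosses (E p0 q0) g \<Longrightarrow> \<not> good g \<Longrightarrow> unit_diagonal g"
    and g: "g \<in> S" "crosses (E p0 q0) g" "good g" "W g"
    and g': "g' \<in> S" "crosses (E p0 q0) g'" "good g'" "\<not> W g'"
  shows "\<exists>h h'. h \<in> S \<and> crosses (E p0 q0) h \<and> good h \<and> W h \<and> h' \<in> S \<and> crosses (E p0 q0) h' \<and> good h' \<and> \<not> W h' \<and> hadj S h h'"
proof -
  define C where "C = {g\<in>S. crosses (E p0 q0) g}"
  have Cl: "g \<in> lattice_edges m n" if "g \<in> C" for g using that triangulation_lattice[OF tri] by (auto simp: C_def)
  have finC: "finite C" using Cl finite_lattice_edges by (meson finite_subset subsetI)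
  define \<pi> where "\<pi> g = (SOME u. par g u)" for g
  have \<pi>: "par g (\<pi> g)" if "g \<in> C" for g
    unfolding \<pi>_def using crosses_par Cl that by (auto simp: C_def intro: someI_ex)
  have fS: "E p0 q0 \<notin> S" using g triangulation_noncrossing[OF tri] by blast
  have parC: "h \<in> C \<and> v = \<pi> h" if "h \<in> S" "par h v" for h v
  proof -
    have "h \<in> C" using that par_crosses fS unfolding C_def by auto
    then show ?thesis using par_unique[of h v "\<pi> h"] \<pi> Cl that by (auto simp: C_def)
  qed
  have \<pi>inj: "g = h" if "g \<in> C" "h \<in> C" "\<pi> g = \<pi> h" for g h
  proof (rule par_inj[of g h "\<pi> g"])
    show "g \<in> S" "h \<in> S" using that by (auto simp: C_def)
    show "par g (\<pi> g)" "par h (\<pi> g)" using \<pi>[OF that(1)] \<pi>[OF that(2)] that(3) by simp_all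
  qed
  define PP where "PP = {(h,h'). h \<in> C \<and> h' \<in> C \<and> good h \<and> good h' \<and> W h \<and> \<not> W h'}"
  have "finite PP" by (rule finite_subset[of _ "C \<times> C"]) (auto simp: PP_def finC)
  have "(g,g') \<in> PP" using g g' by (auto simp: PP_def C_def)
  then have "PP \<noteq> {}" by blast
  define hh where "hh = arg_min_on (\<lambda>y. \<bar>\<pi> (fst y) - \<pi> (snd y)\<bar>) PP"
  have hh: "hh \<in> PP" unfolding hh_def using \<open>finite PP\<close> \<open>PP \<noteq> {}\<close> by (rule arg_min_if_finite(1))
  have hmin: "\<bar>\<pi> (fst hh) - \<pi> (snd hh)\<bar> \<le> \<bar>\<pi> (fst y) - \<pi> (snd y)\<bar>" if "y \<in> PP" for y
    unfolding hh_def using arg_min_least[OF \<open>finite PP\<close> \<open>PP \<noteq> {}\<close> that] .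
  obtain h h' where hpair: "hh = (h,h')" by (cases hh)
  have h: "h \<in> C" "good h" "W h" "h' \<in> C" "good h'" "\<not> W h'" using hh by (auto simp: hpair PP_def)
  have between_bad: "\<not> good x" if "x \<in> C" "min (\<pi> h) (\<pi> h') < \<pi> x" "\<pi> x < max (\<pi> h) (\<pi> h')" for x
  proof
    assume "good x"
    show False
    proof (cases "W x")
      case True
      then have "(x,h') \<in> PP" using that \<open>good x\<close> h by (auto simp: PP_def)
      then show False using hmin[of "(x,h')"] that by (auto simp: hpair)
    next
      case False
      then have "(h,x) \<in> PP" using that \<open>good x\<close> h by (auto simp: PP_def)
      then show False using hmin[of "(h,x)"] that by (auto simp: hpair)
    qed
  qed
  have ordered: "hadj S lo hi" if lh: "lo \<in> C" "hi \<in> C" "\<pi> lo < \<pi> hi"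
    and bb: "\<And>x. x \<in> C \<Longrightarrow> \<pi> lo < \<pi> x \<Longrightarrow> \<pi> x < \<pi> hi \<Longrightarrow> \<not> good x" for lo hi
  proof -
    have cons: "\<exists>t. utri S t \<and> x \<subseteq> t \<and> y \<subseteq> t" if "x \<in> C" "y \<in> C" "\<pi> x < \<pi> y"
      "\<And>z. z \<in> C \<Longrightarrow> \<pi> x < \<pi> z \<Longrightarrow> \<pi> z < \<pi> y \<Longrightarrow> False" for x y
    proof (rule consecutive[of x "\<pi> x" y "\<pi> y"])
      show "x \<in> S" "y \<in> S" "crosses (E p0 q0) x" "crosses (E p0 q0) y" using that by (auto simp: C_def)
      show "par x (\<pi> x)" "par y (\<pi> y)" using \<pi> that by auto
      show "\<not> par z v" if "z \<in> S" "\<pi> x < v" "v < \<pi> y" for z v using parC[of z v] that \<open>\<And>z. z \<in> C \<Longrightarrow> \<pi> x < \<pi> z \<Longrightarrow> \<pi> z < \<pi> y \<Longrightarrow> False\<close> by blast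
    qed fact
    have diag: "unit_diagonal x" if "x \<in> C" "\<pi> lo < \<pi> x" "\<pi> x < \<pi> hi" for x
      using bb[OF that] bad that(1) by (auto simp: C_def)
    define B where "B = {x\<in>C. \<pi> lo < \<pi> x \<and> \<pi> x < \<pi> hi}"
    have next_exists: "\<exists>y. y \<in> C \<and> \<pi> x < \<pi> y \<and> \<pi> y \<le> \<pi> hi \<and> (\<exists>t. utri S t \<and> x \<subseteq> t \<and> y \<subseteq> t)"
      if "x \<in> C" "\<pi> x < \<pi> hi" for x
    proof -
      define N where "N = {y\<in>C. \<pi> x < \<pi> y \<and> \<pi> y \<le> \<pi> hi}"
      have "finite N" "N \<noteq> {}" using finC that lh by (auto simp: N_def)
      then obtain y where y: "y \<in> N" "\<And>z. z \<in> N \<Longrightarrow> \<pi> y \<le> \<pi> z"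
        using arg_min_if_finite(1)[of N \<pi>] arg_min_least[of N _ \<pi>] by blast
      have "\<exists>t. utri S t \<and> x \<subseteq> t \<and> y \<subseteq> t"
      proof (rule cons)
        fix z assume "z \<in> C" "\<pi> x < \<pi> z" "\<pi> z < \<pi> y"
        then show False using y unfolding N_def by force
      qed (use y that in \<open>auto simp: N_def\<close>)
      then show ?thesis using y by (auto simp: N_def)
    qed
    obtain y t where y: "y \<in> C" "\<pi> lo < \<pi> y" "\<pi> y \<le> \<pi> hi" "utri S t" "lo \<subseteq> t" "y \<subseteq> t"
      using next_exists[OF lh(1,3)] by blast
    show ?thesis
    proof (cases "y = hi")
      case True
      then show ?thesis using y unfolding hadj_def by blast
    next
      case False
      then have yh: "\<pi> y < \<pi> hi" using \<pi>inj y lh by force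
      have dy: "unit_diagonal y" using diag y yh by blast
      obtain z t' where z: "z \<in> C" "\<pi> y < \<pi> z" "\<pi> z \<le> \<pi> hi" "utri S t'" "y \<subseteq> t'" "z \<subseteq> t'"
        using next_exists[OF y(1) yh] by blast
      have "z = hi"
      proof (rule ccontr)
        assume "z \<noteq> hi"
        then have "\<pi> z < \<pi> hi" using \<pi>inj z lh by force
        then have "unit_diagonal z" using diag z y by simp
        then have "y = z" using two_diagonals[OF tri z(4) _ _ z(5,6) dy] y z by (auto simp: C_def)
        then show False using z by simp
      qed
      then show ?thesis using y z dy unfolding hadj_def C_def by blast
    qed
  qed
  have "\<pi> h \<noteq> \<pi> h'" using \<pi>inj h by blast
  then have "hadj S h h'"
  proof (cases "\<pi> h < \<pi> h'")
    case True
    then show ?thesis using ordered[of h h'] between_bad h by auto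
  next
    case False
    then have "hadj S h' h" using ordered[of h' h] between_bad h \<open>\<pi> h \<noteq> \<pi> h'\<close> by auto
    then show ?thesis by (rule hadj_sym)
  qed
  then show ?thesis using h by (auto simp: C_def)
qed

end

lemma card_utri_edge:
  assumes S: "triangulation m n S" and g: "g \<in> S"
  shows "finite {t. utri S t \<and> g \<subseteq> t}" "card {t. utri S t \<and> g \<subseteq> t} \<le> 2"
proof -
  obtain x y where xy: "g = E x y" "prim (y - x)" using triangulation_lattice[OF S g] by (rule lattice_edgeE)
  have pr: "prim (x - y)" using xy(2) prim_commute by blast
  have ne: "x \<noteq> y" using xy by auto
  define A where "A x y = {t. \<exists>z. t = {rp x, rp y, rp z} \<and> E x z \<in> S \<and> E y z \<in> S \<and> orient x y z = 1}" for x y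
  have one: "\<exists>t. A x y \<subseteq> {t}" if "prim (y - x)" for x y
  proof (cases "A x y = {}")
    case False
    then obtain z where z: "E x z \<in> S" "E y z \<in> S" "orient x y z = 1" by (auto simp: A_def)
    have "t = {rp x, rp y, rp z}" if t: "t \<in> A x y" for t
    proof -
      obtain z' where z': "t = {rp x, rp y, rp z'}" "E x z' \<in> S" "E y z' \<in> S" "orient x y z' = 1"
        using t by (auto simp: A_def)
      have "z' = z" using apex_unique[OF S z'(2-4) z] \<open>prim (y - x)\<close> by blast
      then show ?thesis using z'(1) by simp
    qed
    then show ?thesis by blast
  qed auto
  obtain t1 t2 where t: "A x y \<subseteq> {t1}" "A y x \<subseteq> {t2}" using one xy(2) pr by meson
  have "{t. utri S t \<and> g \<subseteq> t} \<subseteq> A x y \<union> A y x"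
  proof
    fix t assume "t \<in> {t. utri S t \<and> g \<subseteq> t}"
    then obtain z where "t = {rp x, rp y, rp z}" "E x z \<in> S" "E y z \<in> S" "orient x y z = 1 \<or> orient y x z = 1"
      using utriE[of S t x y] g ne unfolding xy by blast
    then show "t \<in> A x y \<union> A y x" unfolding A_def by (auto simp: insert_commute)
  qed
  then have sub: "{t. utri S t \<and> g \<subseteq> t} \<subseteq> {t1, t2}" using t by blast
  then show "finite {t. utri S t \<and> g \<subseteq> t}" by (rule finite_subset) simp
  have "card {t. utri S t \<and> g \<subseteq> t} \<le> card {t1, t2}" using sub by (intro card_mono) auto
  also have "\<dots> \<le> 2" by (simp add: card_insert_if)
  finally show "card {t. utri S t \<and> g \<subseteq> t} \<le> 2" .
qed

lemma card_utri_sides: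
  assumes S: "triangulation m n S" and t: "utri S t"
  shows "finite {d\<in>S. d \<subseteq> t}" "card {d\<in>S. d \<subseteq> t} \<le> 3"
proof -
  obtain p q r where pqr: "t = {rp p, rp q, rp r}" using t by (auto simp: utri_def)
  have sub: "{d\<in>S. d \<subseteq> t} \<subseteq> {E p q, E q r, E p r}"
  proof
    fix d assume d: "d \<in> {d\<in>S. d \<subseteq> t}"
    then obtain x y where xy: "d = E x y" "prim (y - x)" using triangulation_lattice[OF S] lattice_edgeE
      by (metis (no_types, lifting) mem_Collect_eq)
    then have "x \<noteq> y" "x \<in> {p,q,r}" "y \<in> {p,q,r}" using d unfolding pqr by (auto simp: E_def)
    then show "d \<in> {E p q, E q r, E p r}" unfolding xy E_def by auto
  qed
  then show "finite {d\<in>S. d \<subseteq> t}" by (rule finite_subset) simp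
  have "card {d\<in>S. d \<subseteq> t} \<le> card {E p q, E q r, E p r}" using sub by (intro card_mono) auto
  also have "\<dots> \<le> 3" by (simp add: card_insert_if)
  finally show "card {d\<in>S. d \<subseteq> t} \<le> 3" .
qed

lemma card_UN_le_mult:
  assumes "finite I" "card I \<le> a" "\<And>i. i \<in> I \<Longrightarrow> card (A i) \<le> b"
  shows "card (\<Union>i\<in>I. A i) \<le> a * b"
proof -
  have "card (\<Union>i\<in>I. A i) \<le> (\<Sum>i\<in>I. card (A i))" using assms(1) by (rule card_UN_le)
  also have "\<dots> \<le> card I * b" using sum_bounded_above[of I "\<lambda>i. card (A i)" b] assms(3) by simp
  also have "\<dots> \<le> a * b" using assms(2) by simp
  finally show ?thesis .
qed

text \<open>
  There are two triangles at an edge, three sides of each, two triangles at each of these, and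
  again three sides: \<open>2 * 3 * 2 * 3 = 36\<close>.
\<close>

lemma card_hadj:
  assumes S: "triangulation m n S" and g: "g \<in> S"
  shows "finite {h\<in>S. hadj S g h}" "card {h\<in>S. hadj S g h} \<le> 36"
proof -
  define T where "T d = {t. utri S t \<and> d \<subseteq> t}" for d
  define D where "D t = {d\<in>S. d \<subseteq> t}" for t :: "point set"
  have T: "finite (T d)" "card (T d) \<le> 2" if "d \<in> S" for d
    using card_utri_edge[OF S that] by (auto simp: T_def)
  have D: "finite (D t)" "card (D t) \<le> 3" if "utri S t" for t
    using card_utri_sides[OF S that] by (auto simp: D_def)
  define U where "U = (\<Union>t\<in>T g. \<Union>d\<in>D t. \<Union>t'\<in>T d. D t')"
  have sub: "{h\<in>S. hadj S g h} \<subseteq> U"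
    unfolding hadj_def U_def T_def D_def using g by blast
  have 1: "card (\<Union>t'\<in>T d. D t') \<le> 2 * 3" if "d \<in> S" for d
    by (rule card_UN_le_mult[OF T[OF that]], rule D(2)) (simp add: T_def)
  have 2: "card (\<Union>d\<in>D t. \<Union>t'\<in>T d. D t') \<le> 3 * (2 * 3)" if "utri S t" for t
    by (rule card_UN_le_mult[OF D[OF that]], rule 1) (simp add: D_def)
  have "card U \<le> 2 * (3 * (2 * 3))"
    unfolding U_def by (rule card_UN_le_mult[OF T[OF g]], rule 2) (simp add: T_def)
  moreover have "finite U" unfolding U_def using T D g by (intro finite_UN_I) (auto simp: T_def D_def)
  ultimately show "finite {h\<in>S. hadj S g h}" "card {h\<in>S. hadj S g h} \<le> 36"
    using sub card_mono[of U "{h\<in>S. hadj S g h}"] finite_subset by auto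
qed

section \<open>Sets of vertices connected to given roots\<close>

text \<open>
  Every element of \<open>X\<close> is connected within \<open>X\<close> to one of the roots
  \<open>Y \<subseteq> X\<close>.
\<close>

definition rooted :: "('a \<Rightarrow> 'a \<Rightarrow> bool) \<Rightarrow> 'a set \<Rightarrow> 'a set \<Rightarrow> bool" where
  "rooted adj Y X \<longleftrightarrow> Y \<subseteq> X \<and> (\<forall>x\<in>X. \<exists>y\<in>Y. (y, x) \<in> {(g, h). g \<in> X \<and> h \<in> X \<and> adj g h}\<^sup>*)"

lemma rooted_remove:
  assumes X: "rooted adj Y X" and y: "y \<in> Y"
  shows "rooted adj ((Y - {y}) \<union> {h \<in> X - Y. adj y h}) (X - {y})"
proof -
  define Y' where "Y' = (Y - {y}) \<union> {h \<in> X - Y. adj y h}"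
  define R where "R = {(g, h). g \<in> X - {y} \<and> h \<in> X - {y} \<and> adj g h}"
  have YX: "Y \<subseteq> X" using X by (simp add: rooted_def)
  have *: "x \<noteq> y \<longrightarrow> (\<exists>r\<in>Y'. (r, x) \<in> R\<^sup>*)"
    if "(r0, x) \<in> {(g, h). g \<in> X \<and> h \<in> X \<and> adj g h}\<^sup>*" "r0 \<in> Y" for r0 x
    using that
  proof (induction rule: rtrancl_induct)
    case base then show ?case by (auto simp: Y'_def)
  next
    case (step x x')
    show ?case
    proof (intro impI)
      assume ne: "x' \<noteq> y"
      show "\<exists>r\<in>Y'. (r, x') \<in> R\<^sup>*"
      proof (cases "x = y")
        case True
        then have "x' \<in> Y'" using step ne by (auto simp: Y'_def)
        then show ?thesis by blast
      next
        case False
        then obtain r where "r \<in> Y'" "(r, x) \<in> R\<^sup>*" using step by blast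
        moreover have "(x, x') \<in> R" using step False ne by (auto simp: R_def)
        ultimately show ?thesis by (meson rtrancl.rtrancl_into_rtrancl)
      qed
    qed
  qed
  have "Y' \<subseteq> X - {y}" using YX y by (auto simp: Y'_def)
  moreover have "\<forall>x\<in>X - {y}. \<exists>r\<in>Y'. (r, x) \<in> R\<^sup>*" using X * unfolding rooted_def by blast
  ultimately show ?thesis unfolding rooted_def Y'_def R_def by blast
qed

text \<open>
  Remove a root \<open>y\<close> and declare its neighbours in \<open>X\<close> to be roots.
  These form one of at most \<open>2 ^ D\<close> sets of neighbours, and one factor
  \<open>\<delta>\<close> is gained, so that the sum acquires a factor \<open>\<delta> * 2 ^ D
  \<le> \<kappa>\<close> for each of the original roots.
\<close>

lemma rooted_sum:
  fixes \<delta> \<kappa> :: real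
  assumes "finite U" and deg: "\<And>g. g \<in> U0 \<Longrightarrow> card {h \<in> U0. adj g h} \<le> D" and fin0: "finite U0" and "U \<subseteq> U0"
    and \<delta>: "0 \<le> \<delta>" "\<delta> * 2 ^ D \<le> \<kappa>" "0 \<le> \<kappa>" "\<kappa> \<le> 1" and "Y \<subseteq> U"
  shows "(\<Sum>X | X \<subseteq> U \<and> rooted adj Y X. \<delta> ^ card X) \<le> \<kappa> ^ card Y"
  using assms(1,4,9)
proof (induction "card U" arbitrary: U Y)
  case 0
  then have "U = {}" "Y = {}" by auto
  then have "{X. X \<subseteq> U \<and> rooted adj Y X} = {{}}" by (auto simp: rooted_def)
  then show ?case using \<open>Y = {}\<close> by simp
next
  case (Suc N)
  show ?case
  proof (cases "Y = {}")
    case True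
    then have "{X. X \<subseteq> U \<and> rooted adj Y X} = {{}}" by (auto simp: rooted_def)
    then show ?thesis using True by simp
  next
    case False
    then obtain y where y: "y \<in> Y" by blast
    define A where "A = {X. X \<subseteq> U \<and> rooted adj Y X}"
    define NB where "NB = {h \<in> U - Y. adj y h}"
    define B where "B n' = {X. X \<subseteq> U - {y} \<and> rooted adj ((Y - {y}) \<union> n') X}" for n'
    define F where "F X = ({h \<in> X - Y. adj y h}, X - {y})" for X
    have yX: "y \<in> X" if "X \<in> A" for X using that y by (auto simp: A_def rooted_def)
    have finA: "finite A" using Suc.prems(1) by (simp add: A_def)
    have finNB: "finite NB" using Suc.prems(1) by (simp add: NB_def)
    have finB: "finite (B n')" for n' using Suc.prems(1) by (simp add: B_def)
    have inj: "inj_on F A"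
    proof (rule inj_onI)
      fix X X' assume "X \<in> A" "X' \<in> A" "F X = F X'"
      then show "X = X'" using yX unfolding F_def by (metis insert_Diff prod.inject)
    qed
    have im: "F ` A \<subseteq> (SIGMA n':Pow NB. B n')"
    proof
      fix z assume "z \<in> F ` A"
      then obtain X where X: "X \<in> A" "z = F X" by blast
      have "rooted adj ((Y - {y}) \<union> {h \<in> X - Y. adj y h}) (X - {y})"
        using rooted_remove[of adj Y X y] X(1) y by (simp add: A_def)
      then show "z \<in> (SIGMA n':Pow NB. B n')" using X by (auto simp: F_def A_def B_def NB_def)
    qed
    have IH: "(\<Sum>X\<in>B n'. \<delta> ^ card X) \<le> \<kappa> ^ (card Y - 1)" if n': "n' \<subseteq> NB" for n'
    proof -
      have fY: "finite Y" using Suc.prems finite_subset by blast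
      have "(\<Sum>X\<in>B n'. \<delta> ^ card X) \<le> \<kappa> ^ card ((Y - {y}) \<union> n')"
        unfolding B_def
      proof (rule Suc.hyps(1))
        show "N = card (U - {y})" using Suc.hyps(2) Suc.prems y by auto
        show "Y - {y} \<union> n' \<subseteq> U - {y}" using n' Suc.prems y by (auto simp: NB_def)
      qed (use Suc.prems in auto)
      also have "card ((Y - {y}) \<union> n') \<ge> card Y - 1"
      proof -
        have "finite ((Y - {y}) \<union> n')" using fY n' finNB finite_subset by auto
        then have "card (Y - {y}) \<le> card ((Y - {y}) \<union> n')" by (intro card_mono) auto
        then show ?thesis using y fY by simp
      qed
      then have "\<kappa> ^ card ((Y - {y}) \<union> n') \<le> \<kappa> ^ (card Y - 1)" using \<delta> by (intro power_decreasing) auto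
      finally show ?thesis .
    qed
    have cX: "\<delta> ^ card X = \<delta> * \<delta> ^ card (snd (F X))" if "X \<in> A" for X
    proof -
      have "finite X" using that Suc.prems(1) finite_subset by (auto simp: A_def)
      then have "card X = Suc (card (X - {y}))" using yX[OF that] by (metis card.remove)
      then show ?thesis by (simp add: F_def)
    qed
    have "(\<Sum>X\<in>A. \<delta> ^ card X) = (\<Sum>X\<in>A. \<delta> * \<delta> ^ card (snd (F X)))" using cX by (intro sum.cong) auto
    also have "\<dots> = (\<Sum>z\<in>F ` A. \<delta> * \<delta> ^ card (snd z))" by (simp add: sum.reindex[OF inj])
    also have "\<dots> \<le> (\<Sum>z\<in>(SIGMA n':Pow NB. B n'). \<delta> * \<delta> ^ card (snd z))"
      using im finNB finB \<delta> by (intro sum_mono2) auto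
    also have "\<dots> = (\<Sum>n'\<in>Pow NB. \<Sum>X\<in>B n'. \<delta> * \<delta> ^ card X)"
      using finNB finB by (subst sum.Sigma) (auto simp: case_prod_beta)
    also have "\<dots> = (\<Sum>n'\<in>Pow NB. \<delta> * (\<Sum>X\<in>B n'. \<delta> ^ card X))" by (simp add: sum_distrib_left)
    also have "\<dots> \<le> (\<Sum>n'\<in>Pow NB. \<delta> * \<kappa> ^ (card Y - 1))"
      using IH \<delta> by (intro sum_mono mult_left_mono) auto
    also have "\<dots> = 2 ^ card NB * (\<delta> * \<kappa> ^ (card Y - 1))" using finNB by (simp add: card_Pow)
    also have "\<dots> \<le> 2 ^ D * (\<delta> * \<kappa> ^ (card Y - 1))"
    proof -
      have "card NB \<le> card {h \<in> U0. adj y h}" using fin0 Suc.prems by (intro card_mono) (auto simp: NB_def)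
      also have "\<dots> \<le> D" using deg y Suc.prems by blast
      finally show ?thesis using \<delta> by (intro mult_right_mono power_increasing) auto
    qed
    also have "\<dots> = (\<delta> * 2 ^ D) * \<kappa> ^ (card Y - 1)" by simp
    also have "\<dots> \<le> \<kappa> * \<kappa> ^ (card Y - 1)" using \<delta> by (intro mult_right_mono) auto
    also have "\<dots> = \<kappa> ^ card Y"
    proof -
      have "card Y > 0" using y Suc.prems finite_subset card_gt_0_iff by blast
      then show ?thesis by (simp flip: power_Suc)
    qed
    finally show ?thesis unfolding A_def .
  qed
qed

section \<open>Long edges are exponentially unlikely\<close>

context minimal_triangulation
begin

text \<open>
  For an edge that is not small the coordinates of a competitor of the same length are both of
  absolute value one, hence it is the edge itself.
\<close>

lemma compatible_equal_length:
  assumes g: "g \<in> S" and v: "v \<in> lattice_edges m n" "edge_mid v = edge_mid g" "compatible \<Delta> v"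
    and len: "elen v = elen g" and ne: "v \<noteq> g"
  shows "unit_diagonal g" "unit_diagonal v"
proof -
  note gl = lat[OF g]
  have cr: "crosses g v" using same_mid_crosses[OF gl v(1)] v(2) ne by auto
  have g\<Delta>: "g \<notin> \<Delta>" using v(3) cr crosses_commute by (auto simp: compatible_def)
  obtain s t where st: "v = E s t" "prim (t - s)" using v(1) by (rule lattice_edgeE)
  have "small g"
  proof (rule ccontr)
    assume "\<not> small g"
    then have "tight \<Delta> g" using minimal_cases[OF g] g\<Delta> by blast
    then obtain p a b d where ab: "g = E p (p + a + b)" "det a b = 1" "same_quadrant a b" "d \<in> \<Delta>"
      "crosses (E (p + a) (p + b)) d" by (auto simp: tight_def)
    have d: "d \<in> lattice_edges m n" "d \<noteq> g" "\<not> crosses d g"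
      using ab(4) sub lat g\<Delta> triangulation_noncrossing[OF tri] g by auto
    have x: "crosses d (E (p + a) (p + b))" using ab(5) crosses_commute by blast
    have "\<not> crosses d v" using v(3) ab(4) crosses_commute by (auto simp: compatible_def)
    then obtain s t g1 g2 where st: "v = E s t" "g1 * g2 > 0" "t - s = comb a b g1 g2"
      using shadow_edge(2)[OF ab(2,3,1) gl d _ x v(1) cr] by blast
    have "len (t - s) \<ge> len (a + b) + (\<bar>g1\<bar> - 1) + (\<bar>g2\<bar> - 1)"
      unfolding st(3) by (rule len_comb_ge[OF ab(3,2) st(2)])
    moreover have "\<bar>g1\<bar> \<ge> 1" "\<bar>g2\<bar> \<ge> 1" using st(2) by (auto simp: zero_less_mult_iff)
    moreover have "elen v = nat (len (t - s))" "elen g = nat (len (a + b))"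
      unfolding st(1) ab(1) elen_E by (simp_all add: add.assoc)
    ultimately have "\<bar>g1\<bar> = 1" "\<bar>g2\<bar> = 1" using len len_nonneg[of "a + b"] by linarith+
    then have "(g1 = 1 \<and> g2 = 1) \<or> (g1 = -1 \<and> g2 = -1)" using st(2) by (auto simp: abs_if split: if_splits)
    then have "t - s = a + b \<or> t - s = - (a + b)" unfolding st(3) comb_def by (auto simp: prod_eq_iff)
    moreover have "s + t = p + (p + a + b)" using v(2) unfolding st(1) ab(1) edge_mid_mp by simp
    ultimately have "v = g" unfolding st(1) ab(1) E_eq_iff by (auto simp: prod_eq_iff algebra_simps)
    with ne show False ..
  qed
  obtain p q where pq: "g = E p q" "prim (q - p)" using gl by (rule lattice_edgeE)
  have mid: "s + t = p + q" using v(2) unfolding st pq edge_mid_mp by simp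
  obtain u w where uw: "q - p = (u,w)" by (cases "q - p")
  obtain c d where cd: "t - s = (c,d)" by (cases "t - s")
  have "u - c = 2 * (fst s - fst p)" "w - d = 2 * (snd s - snd p)"
    using mid uw cd by (auto simp: prod_eq_iff)
  then have par: "even (u - c)" "even (w - d)" by auto
  have b: "\<bar>u\<bar> \<le> 1" "\<bar>w\<bar> \<le> 1" using \<open>small g\<close> uw pq small_E by auto
  have l: "\<bar>u\<bar> + \<bar>w\<bar> = \<bar>c\<bar> + \<bar>d\<bar>"
  proof -
    have "nat (\<bar>c\<bar> + \<bar>d\<bar>) = nat (\<bar>u\<bar> + \<bar>w\<bar>)" using len unfolding st pq elen_E len_def uw cd by simp
    then show ?thesis by linarith
  qed
  have "\<bar>u\<bar> \<le> \<bar>c\<bar>" "\<bar>w\<bar> \<le> \<bar>d\<bar>" using par b by presburger+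
  then have eq: "\<bar>c\<bar> = \<bar>u\<bar>" "\<bar>d\<bar> = \<bar>w\<bar>" using l by linarith+
  have "u \<noteq> 0 \<and> w \<noteq> 0"
  proof (rule ccontr)
    assume z: "\<not> ?thesis"
    then have "(c = u \<and> d = w) \<or> (c = - u \<and> d = - w)" using eq by auto
    then have "t - s = q - p \<or> t - s = - (q - p)" using uw cd by auto
    then have "v = g" using mid unfolding st(1) pq(1) E_eq_iff by (auto simp: prod_eq_iff algebra_simps)
    with ne show False ..
  qed
  then have "\<bar>u\<bar> = 1" "\<bar>w\<bar> = 1" using b by auto
  then show "unit_diagonal g" "unit_diagonal v"
    using eq unfolding unit_diagonal_def st(1) pq(1) small_E elen_E len_def uw cd by auto
qed

text \<open>
  Two small edges can only cross at their common midpoint. Any other edge of \<open>S\<close> is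
  prescribed or tight, and a small edge crossing a tight one without crossing the prescribed
  edge behind it would have to be longer.
\<close>

lemma small_crosses_minimal:
  assumes g: "g \<in> S" and v: "v \<in> lattice_edges m n" "small v" "compatible \<Delta> v" and cr: "crosses v g"
  shows "edge_mid v = edge_mid g"
proof (cases "small g")
  case True
  then show ?thesis using small_noncrossing[OF v(1) lat[OF g] v(2)] cr by blast
next
  case False
  note gl = lat[OF g]
  have g\<Delta>: "g \<notin> \<Delta>" using v(3) cr by (auto simp: compatible_def)
  then have "tight \<Delta> g" using minimal_cases[OF g] False by blast
  then obtain p a b d where ab: "g = E p (p + a + b)" "det a b = 1" "same_quadrant a b" "d \<in> \<Delta>"
    "crosses (E (p + a) (p + b)) d" by (auto simp: tight_def)
  have d: "d \<in> lattice_edges m n" "d \<noteq> g" "\<not> crosses d g"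
    using ab(4) sub lat g\<Delta> triangulation_noncrossing[OF tri] g by auto
  have x: "crosses d (E (p + a) (p + b))" using ab(5) crosses_commute by blast
  have "\<not> crosses d v" "crosses g v" using v(3) ab(4) crosses_commute cr by (auto simp: compatible_def)
  then obtain s t g1 g2 where st: "v = E s t" "g1 * g2 > 0" "t - s = comb a b g1 g2"
    using shadow_edge(2)[OF ab(2,3,1) gl d _ x v(1)] by blast
  have "len (t - s) \<ge> len (a + b) + (\<bar>g1\<bar> - 1) + (\<bar>g2\<bar> - 1)"
    unfolding st(3) by (rule len_comb_ge[OF ab(3,2) st(2)])
  moreover have "\<bar>g1\<bar> \<ge> 1" "\<bar>g2\<bar> \<ge> 1" using st(2) by (auto simp: zero_less_mult_iff)
  moreover have "len (t - s) \<le> 2" using v(2) unfolding st(1) small_E len_def by linarith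
  ultimately have l: "len (a + b) \<le> 2" by simp
  have "prim (a + b)" using gl unfolding ab(1) E_lattice_iff by (simp add: add.assoc)
  have "\<not> (\<bar>fst (a + b)\<bar> \<le> 1 \<and> \<bar>snd (a + b)\<bar> \<le> 1)" using False unfolding ab(1) small_E by (simp add: add.assoc)
  then have "(\<bar>fst (a + b)\<bar> = 2 \<and> snd (a + b) = 0) \<or> (\<bar>snd (a + b)\<bar> = 2 \<and> fst (a + b) = 0)"
    using l unfolding len_def by linarith
  then have "\<not> prim (a + b)" by (metis coprime_abs_left_iff coprime_abs_right_iff coprime_0_left_iff coprime_0_right_iff
      abs_numeral odd_one even_numeral zdvd1_eq numeral_eq_one_iff semiring_norm(85))
  with \<open>prim (a + b)\<close> show ?thesis by blast
qed

text \<open>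
  Triangulations are compared midpoint by midpoint with \<open>S\<close>: \<open>slot \<tau>
  g\<close> is the edge of \<open>\<tau>\<close> that takes the place of \<open>g\<close>, and
  an edge of \<open>S\<close> is excited if its replacement is longer.
\<close>

definition slot :: "edge set \<Rightarrow> edge \<Rightarrow> edge" where "slot \<tau> g = edge_at \<tau> (edge_mid g)"

definition \<Omega> :: "edge set set" where "\<Omega> = {\<tau>. triangulation m n \<tau> \<and> \<Delta> \<subseteq> \<tau>}"

definition excited :: "edge set \<Rightarrow> edge set" where "excited \<tau> = {g\<in>S. elen (slot \<tau> g) > elen g}"

lemma finite_\<Omega>: "finite \<Omega>"
  using finite_triangulations[of m n] by (rule finite_subset[rotated]) (auto simp: \<Omega>_def)

lemma slot:
  assumes "\<tau> \<in> \<Omega>" "g \<in> S"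
  shows "slot \<tau> g \<in> \<tau>" "edge_mid (slot \<tau> g) = edge_mid g" "slot \<tau> g \<in> lattice_edges m n" "compatible \<Delta> (slot \<tau> g)"
proof -
  have t: "triangulation m n \<tau>" "\<Delta> \<subseteq> \<tau>" using assms by (auto simp: \<Omega>_def)
  have x: "edge_mid g \<in> midpoints m n" using edge_mid_in_midpoints lat assms by blast
  show 1: "slot \<tau> g \<in> \<tau>" "edge_mid (slot \<tau> g) = edge_mid g" unfolding slot_def using edge_at[OF t(1) x] by auto
  show "slot \<tau> g \<in> lattice_edges m n" using 1 triangulation_lattice[OF t(1)] by blast
  show "compatible \<Delta> (slot \<tau> g)" unfolding compatible_def
    using 1 t(2) triangulation_noncrossing[OF t(1)] by blast
qed

lemma slot_ge: "\<tau> \<in> \<Omega> \<Longrightarrow> g \<in> S \<Longrightarrow> elen g \<le> elen (slot \<tau> g)"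
  using compatible_longer slot by blast

lemma not_excited:
  assumes "\<tau> \<in> \<Omega>" "g \<in> S" "g \<notin> excited \<tau>"
  shows "slot \<tau> g = g \<or> (unit_diagonal g \<and> unit_diagonal (slot \<tau> g))"
proof -
  have "elen (slot \<tau> g) = elen g" using assms slot_ge[of \<tau> g] by (auto simp: excited_def)
  then show ?thesis using compatible_equal_length[OF assms(2) slot(3,2,4)[OF assms(1,2)]] by blast
qed

text \<open>
  The triangulation in which the edges of \<open>X\<close> are put back in their places.
\<close>

definition repl :: "edge set \<Rightarrow> edge set \<Rightarrow> edge set" where
  "repl \<tau> X = (\<lambda>x. let g = edge_at S x in if g \<in> X then g else edge_at \<tau> x) ` midpoints m n"

lemma mid_S: "g \<in> S \<Longrightarrow> edge_mid g \<in> midpoints m n \<and> edge_at S (edge_mid g) = g"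
  using edge_mid_in_midpoints lat edge_at_eqI[OF tri] by blast

text \<open>
  If an edge of \<open>\<tau>\<close> in another place crosses \<open>g\<close>, then this place
  is itself excited and the edge cuts through a sequence of edges of \<open>S\<close> from
  \<open>g\<close> to its own place. All edges on the way are excited or unit diagonals, so
  \<open>X\<close>, being closed under adjacency among excited edges, would reach that place.
\<close>

lemma repl_noncrossing:
  assumes \<tau>: "\<tau> \<in> \<Omega>" and X: "X \<subseteq> excited \<tau>"
    and closed: "\<And>g h. g \<in> X \<Longrightarrow> h \<in> excited \<tau> \<Longrightarrow> hadj S g h \<Longrightarrow> h \<in> X"
    and g: "g \<in> X" and h: "h \<in> S" "h \<notin> X"
  shows "\<not> crosses (slot \<tau> h) g"
proof
  assume cr: "crosses (slot \<tau> h) g"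
  have XS: "X \<subseteq> S" using X by (auto simp: excited_def)
  then have gS: "g \<in> S" using g by blast
  have t: "triangulation m n \<tau>" using \<tau> by (simp add: \<Omega>_def)
  note sl = slot[OF \<tau> h(1)]
  have ne: "slot \<tau> h \<noteq> h" using cr triangulation_noncrossing[OF tri h(1) gS] by auto
  show False
  proof (cases "h \<in> excited \<tau>")
    case False
    then have "small (slot \<tau> h)" using not_excited[OF \<tau> h(1)] ne by (simp add: unit_diagonal_def)
    then have "edge_mid (slot \<tau> h) = edge_mid g" using small_crosses_minimal[OF gS sl(3) _ sl(4) cr] by blast
    then have "g = h" using mid_S gS h(1) sl(2) by metis
    then show False using g h by simp
  next
    case True
    obtain p0 q0 where pq: "slot \<tau> h = E p0 q0" using sl(3) by (rule lattice_edgeE)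
    interpret crossing_segment m n S p0 q0 using tri sl(3) pq by unfold_locales auto
    have hc: "crosses (E p0 q0) h" using same_mid_crosses[OF sl(3) lat[OF h(1)] sl(2) ne] pq by simp
    have gc: "crosses (E p0 q0) g" using cr pq by simp
    have bad: "unit_diagonal e" if "e \<in> S" "crosses (E p0 q0) e" "e \<notin> excited \<tau>" for e
    proof -
      have "slot \<tau> e \<noteq> e"
      proof
        assume "slot \<tau> e = e"
        then have "e \<in> \<tau>" using slot(1)[OF \<tau> that(1)] by simp
        then show False using triangulation_noncrossing[OF t sl(1)] that(2) pq by simp
      qed
      then show ?thesis using not_excited[OF \<tau> that(1,3)] by blast
    qed
    obtain k k' where "k \<in> X" "k' \<in> excited \<tau>" "k' \<notin> X" "hadj S k k'"
      using crossing_chain[of "\<lambda>e. e \<in> excited \<tau>" g "\<lambda>e. e \<in> X" h] bad gS gc g X h hc True by blast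
    then show False using closed by blast
  qed
qed

lemma repl:
  assumes \<tau>: "\<tau> \<in> \<Omega>" and X: "X \<subseteq> excited \<tau>"
    and closed: "\<And>g h. g \<in> X \<Longrightarrow> h \<in> excited \<tau> \<Longrightarrow> hadj S g h \<Longrightarrow> h \<in> X"
  shows "repl \<tau> X \<in> \<Omega>" "\<And>g. g \<in> S \<Longrightarrow> slot (repl \<tau> X) g = (if g \<in> X then g else slot \<tau> g)"
proof -
  have t: "triangulation m n \<tau>" "\<Delta> \<subseteq> \<tau>" using \<tau> by (auto simp: \<Omega>_def)
  define \<phi> where "\<phi> x = (let g = edge_at S x in if g \<in> X then g else edge_at \<tau> x)" for x
  have \<phi>: "\<phi> x \<in> lattice_edges m n" "edge_mid (\<phi> x) = x" if "x \<in> midpoints m n" for x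
    using edge_at[OF tri that] edge_at[OF t(1) that] lat triangulation_lattice[OF t(1)] by (auto simp: \<phi>_def Let_def)
  have key: "\<not> crosses (edge_at \<tau> y) (edge_at S x)" if "x \<in> midpoints m n" "y \<in> midpoints m n" "edge_at S x \<in> X" "edge_at S y \<notin> X" for x y
    using repl_noncrossing[OF \<tau> X closed that(3), where h = "edge_at S y"] edge_at[OF tri that(2)] that(4)
    by (simp add: slot_def)
  have nc: "\<not> crosses (\<phi> x) (\<phi> y)" if xy: "x \<in> midpoints m n" "y \<in> midpoints m n" for x y
  proof -
    have 1: "\<not> crosses (edge_at S x) (edge_at S y)" "\<not> crosses (edge_at \<tau> x) (edge_at \<tau> y)"
      using triangulation_noncrossing tri t edge_at xy by blast+
    show ?thesis using 1 key[OF xy] key[OF xy(2,1)] crosses_commute unfolding \<phi>_def Let_def by auto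
  qed
  have eq: "repl \<tau> X = \<phi> ` midpoints m n" by (simp add: repl_def \<phi>_def)
  have T: "triangulation m n (repl \<tau> X)" unfolding eq by (rule triangulation_of_family(1)[OF \<phi> nc])
  show sl: "slot (repl \<tau> X) g = (if g \<in> X then g else slot \<tau> g)" if g: "g \<in> S" for g
  proof -
    have "slot (repl \<tau> X) g = \<phi> (edge_mid g)" unfolding slot_def eq
      by (rule triangulation_of_family(2)[OF \<phi> nc]) (use mid_S[OF g] in auto)
    then show ?thesis using mid_S[OF g] by (simp add: \<phi>_def slot_def)
  qed
  have "\<Delta> \<subseteq> repl \<tau> X"
  proof
    fix d assume d: "d \<in> \<Delta>"
    then have dS: "d \<in> S" and "d \<in> \<tau>" using sub t by auto
    then have "slot \<tau> d = d" unfolding slot_def using edge_at_eqI[OF t(1)] by blast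
    then have "slot (repl \<tau> X) d = d" using sl[OF dS] by simp
    then show "d \<in> repl \<tau> X" unfolding slot_def using edge_at(1)[OF T] mid_S[OF dS] by metis
  qed
  then show "repl \<tau> X \<in> \<Omega>" using T by (simp add: \<Omega>_def)
qed

lemma slot_eqI:
  assumes "\<tau> \<in> \<Omega>" "\<tau>' \<in> \<Omega>" "\<And>g. g \<in> S \<Longrightarrow> slot \<tau> g = slot \<tau>' g"
  shows "\<tau> = \<tau>'"
proof (rule triangulation_eqI)
  show "triangulation m n \<tau>" "triangulation m n \<tau>'" using assms by (auto simp: \<Omega>_def)
  fix x assume "x \<in> midpoints m n"
  then show "edge_at \<tau> x = edge_at \<tau>' x" using assms(3)[of "edge_at S x"] edge_at[OF tri] by (simp add: slot_def)
qed

definition wt :: "real \<Rightarrow> edge set \<Rightarrow> real" where "wt lam \<tau> = (\<Prod>g\<in>S. lam ^ elen (slot \<tau> g))"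

lemma wt_powr:
  assumes "\<tau> \<in> \<Omega>" "lam > 0" shows "lam powr total_length \<tau> = wt lam \<tau>"
proof -
  have t: "triangulation m n \<tau>" using assms by (simp add: \<Omega>_def)
  have bij: "bij_betw edge_mid S (midpoints m n)"
    unfolding bij_betw_def
  proof
    show "inj_on edge_mid S" using mid_S by (metis inj_onI)
    show "edge_mid ` S = midpoints m n" using mid_S edge_at[OF tri] by (metis (no_types, lifting) image_iff set_eq_iff)
  qed
  have "total_length \<tau> = (\<Sum>g\<in>S. real (elen (slot \<tau> g)))"
    unfolding total_length_sum[OF t] slot_def using sum.reindex_bij_betw[OF bij, of "\<lambda>x. real (elen (edge_at \<tau> x))"] by simp
  also have "\<dots> = real (\<Sum>g\<in>S. elen (slot \<tau> g))" by simp
  finally have e: "total_length \<tau> = real (\<Sum>g\<in>S. elen (slot \<tau> g))" .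
  show ?thesis unfolding e powr_realpow[OF assms(2)] wt_def by (rule power_sum)
qed

definition longer :: "edge \<Rightarrow> edge set" where
  "longer g = {v\<in>lattice_edges m n. edge_mid v = edge_mid g \<and> compatible \<Delta> v \<and> elen v > elen g}"

lemma finite_longer: "finite (longer g)"
  using finite_lattice_edges[of m n] by (simp add: longer_def)

text \<open>
  There are at most \<open>(2 * k + 5)\<^sup>2 \<le> 64 ^ k\<close> competitors with excess
  length \<open>k\<close>, and the geometric series with ratio \<open>64 * lam \<le> 1 /
  2\<close> is at most twice its first term.
\<close>

lemma longer_sum:
  fixes lam :: real
  assumes g: "g \<in> S" and lam: "0 < lam" "lam \<le> 1 / 128"
  shows "(\<Sum>v\<in>longer g. lam ^ (elen v - elen g)) \<le> 128 * lam"
proof -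
  define K where "K = Max (insert 1 ((\<lambda>v. elen v - elen g) ` longer g))"
  have K: "(\<lambda>v. elen v - elen g) ` longer g \<subseteq> {1..K}"
    unfolding K_def using finite_longer by (auto simp: longer_def intro: Max_ge)
  have "(\<Sum>v\<in>longer g. lam ^ (elen v - elen g)) =
     (\<Sum>k\<in>{1..K}. \<Sum>v\<in>{v\<in>longer g. elen v - elen g = k}. lam ^ (elen v - elen g))"
    by (rule sum.group[symmetric]) (use K finite_longer in auto)
  also have "\<dots> = (\<Sum>k\<in>{1..K}. real (card {v\<in>longer g. elen v - elen g = k}) * lam ^ k)"
    by (intro sum.cong) auto
  also have "\<dots> \<le> (\<Sum>k\<in>{1..K}. (64 * lam) ^ k)"
  proof (rule sum_mono)
    fix k assume k: "k \<in> {1..K}"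
    have "card {v\<in>longer g. elen v - elen g = k} \<le>
      card {v\<in>lattice_edges m n. edge_mid v = edge_mid g \<and> compatible \<Delta> v \<and> elen v \<le> elen g + k}"
      using finite_lattice_edges[of m n] by (intro card_mono) (auto simp: longer_def)
    also have "\<dots> \<le> (2 * k + 5)\<^sup>2" by (rule card_compatible[OF g])
    also have "\<dots> \<le> (8 ^ k)\<^sup>2"
    proof (rule power_mono)
      have "k \<ge> 1" using k by simp
      then show "2 * k + 5 \<le> 8 ^ k" by (induction k rule: dec_induct) auto
    qed simp
    also have "((8::nat) ^ k)\<^sup>2 = (8\<^sup>2) ^ k" unfolding power_mult[symmetric] mult.commute[of k 2] ..
    also have "(8\<^sup>2 :: nat) = 64" by simp
    finally have "real (card {v\<in>longer g. elen v - elen g = k}) \<le> real (64 ^ k)"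
      by (simp only: of_nat_le_iff)
    then have "real (card {v\<in>longer g. elen v - elen g = k}) \<le> 64 ^ k" by simp
    then show "real (card {v\<in>longer g. elen v - elen g = k}) * lam ^ k \<le> (64 * lam) ^ k"
      using lam by (simp add: power_mult_distrib mult_right_mono)
  qed
  also have "\<dots> \<le> 2 * (64 * lam)"
  proof -
    define r where "r = 64 * lam"
    have r: "0 < r" "r \<le> 1/2" using lam by (auto simp: r_def)
    have "(\<Sum>k\<in>{1..K}. r ^ k) \<le> 2 * r - 2 * r * r ^ K"
    proof (induction K)
      case (Suc K)
      have "r * r ^ K \<le> (1/2) * r ^ K" using r by (intro mult_right_mono) auto
      then have "r * (r * r ^ K) \<le> r * ((1/2) * r ^ K)" using r by (intro mult_left_mono) auto
      then show ?case using Suc by simp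
    qed simp
    also have "\<dots> \<le> 2 * r" using r by simp
    finally show ?thesis by (simp add: r_def)
  qed
  finally show ?thesis by simp
qed

definition cluster :: "edge set \<Rightarrow> edge set \<Rightarrow> edge set" where
  "cluster Y B = {h\<in>B. \<exists>y\<in>Y. (y, h) \<in> {(g, h). g \<in> B \<and> h \<in> B \<and> hadj S g h}\<^sup>*}"

lemma cluster:
  assumes "Y \<subseteq> B"
  shows "cluster Y B \<subseteq> B" "rooted (hadj S) Y (cluster Y B)"
    "\<And>g h. g \<in> cluster Y B \<Longrightarrow> h \<in> B \<Longrightarrow> hadj S g h \<Longrightarrow> h \<in> cluster Y B"
proof -
  define R where "R = {(g, h). g \<in> B \<and> h \<in> B \<and> hadj S g h}"
  define C where "C = cluster Y B"
  have C: "C = {h\<in>B. \<exists>y\<in>Y. (y, h) \<in> R\<^sup>*}" by (simp add: C_def cluster_def R_def)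
  show "cluster Y B \<subseteq> B" by (auto simp: cluster_def)
  show "h \<in> cluster Y B" if gC: "g \<in> cluster Y B" and hB: "h \<in> B" and gh: "hadj S g h" for g h
  proof -
    obtain y where y: "y \<in> Y" "(y, g) \<in> R\<^sup>*" "g \<in> B" using gC unfolding C_def[symmetric] C by blast
    have "(g, h) \<in> R" using gh hB y by (simp add: R_def)
    then have "(y, h) \<in> R\<^sup>*" using y by (meson rtrancl.rtrancl_into_rtrancl)
    then show ?thesis using y(1) hB unfolding C_def[symmetric] C by blast
  qed
  have "(y, h) \<in> {(g, h). g \<in> C \<and> h \<in> C \<and> hadj S g h}\<^sup>*" if "(y, h) \<in> R\<^sup>*" "y \<in> Y" for y h
    using that
  proof (induction rule: rtrancl_induct)
    case (step h h')
    have "h \<in> C" "h' \<in> C" using step unfolding C by (auto simp: R_def intro: rtrancl.rtrancl_into_rtrancl)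
    then have "(h, h') \<in> {(g, h). g \<in> C \<and> h \<in> C \<and> hadj S g h}" using step by (auto simp: R_def)
    then show ?case using step by (meson rtrancl.rtrancl_into_rtrancl)
  qed simp
  moreover have "Y \<subseteq> C" using assms by (auto simp: C)
  ultimately show "rooted (hadj S) Y (cluster Y B)" unfolding rooted_def C_def[symmetric] by (auto simp: C)
qed

text \<open>
  Putting the cluster back is injective once the removed edges are recorded, and the weight
  factors accordingly; the sum over the removed edges is a product of sums over longer
  competitors.
\<close>

lemma peierls_fixed_cluster:
  assumes lam: "0 < lam" "lam \<le> 1 / 128" and XS: "X \<subseteq> S" and Y: "Y \<subseteq> X"
  shows "(\<Sum>\<tau> | \<tau> \<in> \<Omega> \<and> Y \<subseteq> excited \<tau> \<and> cluster Y (excited \<tau>) = X. wt lam \<tau>)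
    \<le> (128 * lam) ^ card X * (\<Sum>\<tau>\<in>\<Omega>. wt lam \<tau>)"
proof -
  define A where "A = {\<tau>. \<tau> \<in> \<Omega> \<and> Y \<subseteq> excited \<tau> \<and> cluster Y (excited \<tau>) = X}"
  have finX: "finite X" using XS finite_S finite_subset by blast
  have finA: "finite A" using finite_\<Omega> by (simp add: A_def)
  have A: "\<tau> \<in> \<Omega>" "X \<subseteq> excited \<tau>" "\<And>g h. g \<in> X \<Longrightarrow> h \<in> excited \<tau> \<Longrightarrow> hadj S g h \<Longrightarrow> h \<in> X" if "\<tau> \<in> A" for \<tau>
    using that cluster[of Y "excited \<tau>"] by (auto simp: A_def)
  define F where "F \<tau> = (restrict (slot \<tau>) X, repl \<tau> X)" for \<tau>
  define P where "P = (\<Pi>\<^sub>E g\<in>X. longer g)"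
  define G where "G z = (\<Prod>g\<in>X. lam ^ (elen (fst z g) - elen g)) * wt lam (snd z)" for z :: "(edge \<Rightarrow> edge) \<times> edge set"
  have rp: "repl \<tau> X \<in> \<Omega>" "slot (repl \<tau> X) g = (if g \<in> X then g else slot \<tau> g)" if "\<tau> \<in> A" "g \<in> S" for \<tau> g
    using repl[OF A[OF that(1)]] that(2) by auto
  have rp1: "repl \<tau> X \<in> \<Omega>" if "\<tau> \<in> A" for \<tau> using repl(1)[OF A[OF that]] by auto
  have im: "F ` A \<subseteq> P \<times> \<Omega>"
  proof
    fix z assume "z \<in> F ` A"
    then obtain \<tau> where t: "\<tau> \<in> A" "z = F \<tau>" by blast
    have "slot \<tau> g \<in> longer g" if "g \<in> X" for g
      using slot(2-4)[OF A(1)[OF t(1)], of g] that A(2)[OF t(1)] XS by (auto simp: longer_def excited_def)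
    then show "z \<in> P \<times> \<Omega>" using rp1[OF t(1)] by (auto simp: t F_def P_def)
  qed
  have inj: "inj_on F A"
  proof (rule inj_onI)
    fix \<tau> \<tau>' assume t: "\<tau> \<in> A" "\<tau>' \<in> A" "F \<tau> = F \<tau>'"
    show "\<tau> = \<tau>'"
    proof (rule slot_eqI[OF A(1)[OF t(1)] A(1)[OF t(2)]])
      fix g assume g: "g \<in> S"
      have e: "restrict (slot \<tau>) X = restrict (slot \<tau>') X" "repl \<tau> X = repl \<tau>' X" using t(3) by (auto simp: F_def)
      show "slot \<tau> g = slot \<tau>' g"
      proof (cases "g \<in> X")
        case True then show ?thesis using fun_cong[OF e(1), of g] by simp
      next
        case False then show ?thesis using rp(2)[OF t(1) g] rp(2)[OF t(2) g] e(2) by simp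
      qed
    qed
  qed
  have w: "wt lam \<tau> = G (F \<tau>)" if t: "\<tau> \<in> A" for \<tau>
  proof -
    have "wt lam \<tau> = (\<Prod>g\<in>X. lam ^ elen (slot \<tau> g)) * (\<Prod>g\<in>S - X. lam ^ elen (slot \<tau> g))"
      unfolding wt_def prod.subset_diff[OF XS finite_S] by (simp add: mult.commute)
    also have "(\<Prod>g\<in>X. lam ^ elen (slot \<tau> g)) = (\<Prod>g\<in>X. lam ^ (elen (slot \<tau> g) - elen g) * lam ^ elen g)"
    proof (rule prod.cong)
      fix g assume "g \<in> X"
      then have "elen g \<le> elen (slot \<tau> g)" using slot_ge[OF A(1)[OF t]] XS by blast
      then show "lam ^ elen (slot \<tau> g) = lam ^ (elen (slot \<tau> g) - elen g) * lam ^ elen g"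
        by (simp flip: power_add)
    qed simp
    also have "\<dots> = (\<Prod>g\<in>X. lam ^ (elen (slot \<tau> g) - elen g)) * (\<Prod>g\<in>X. lam ^ elen g)" by (rule prod.distrib)
    also have "(\<Prod>g\<in>X. lam ^ elen g) = (\<Prod>g\<in>X. lam ^ elen (slot (repl \<tau> X) g))"
      using rp(2)[OF t] XS by (intro prod.cong) auto
    also have "(\<Prod>g\<in>S - X. lam ^ elen (slot \<tau> g)) = (\<Prod>g\<in>S - X. lam ^ elen (slot (repl \<tau> X) g))"
      using rp(2)[OF t] by (intro prod.cong) auto
    finally have "wt lam \<tau> = (\<Prod>g\<in>X. lam ^ (elen (slot \<tau> g) - elen g)) *
      ((\<Prod>g\<in>X. lam ^ elen (slot (repl \<tau> X) g)) * (\<Prod>g\<in>S - X. lam ^ elen (slot (repl \<tau> X) g)))"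
      by (simp add: mult.assoc)
    also have "(\<Prod>g\<in>X. lam ^ elen (slot (repl \<tau> X) g)) * (\<Prod>g\<in>S - X. lam ^ elen (slot (repl \<tau> X) g)) = wt lam (repl \<tau> X)"
      unfolding wt_def prod.subset_diff[OF XS finite_S] by (simp add: mult.commute)
    finally show ?thesis unfolding G_def F_def by simp
  qed
  have wpos: "wt lam \<tau> \<ge> 0" for \<tau> using lam by (simp add: wt_def prod_nonneg)
  have finP: "finite P" unfolding P_def using finX finite_longer by (intro finite_PiE) auto
  have Gpos: "G z \<ge> 0" for z using wpos lam unfolding G_def by (intro mult_nonneg_nonneg prod_nonneg) auto
  have "(\<Sum>\<tau>\<in>A. wt lam \<tau>) = (\<Sum>z\<in>F ` A. G z)" using w by (simp add: sum.reindex[OF inj])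
  also have "\<dots> \<le> (\<Sum>z\<in>P \<times> \<Omega>. G z)" using im finP finite_\<Omega> Gpos by (intro sum_mono2) auto
  also have "\<dots> = (\<Sum>\<phi>\<in>P. \<Sum>\<tau>\<in>\<Omega>. (\<Prod>g\<in>X. lam ^ (elen (\<phi> g) - elen g)) * wt lam \<tau>)"
    unfolding G_def by (simp add: sum.cartesian_product case_prod_beta)
  also have "\<dots> = (\<Sum>\<phi>\<in>P. \<Prod>g\<in>X. lam ^ (elen (\<phi> g) - elen g)) * (\<Sum>\<tau>\<in>\<Omega>. wt lam \<tau>)"
    by (simp add: sum_product)
  also have "(\<Sum>\<phi>\<in>P. \<Prod>g\<in>X. lam ^ (elen (\<phi> g) - elen g)) = (\<Prod>g\<in>X. \<Sum>v\<in>longer g. lam ^ (elen v - elen g))"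
    unfolding P_def using finX finite_longer by (subst prod_sum_PiE) auto
  also have "\<dots> \<le> (\<Prod>g\<in>X. 128 * lam)"
    using longer_sum[OF _ lam] XS lam by (intro prod_mono) (auto intro!: sum_nonneg)
  also have "(\<Prod>g\<in>X. 128 * lam) = (128 * lam) ^ card X" by simp
  finally show ?thesis unfolding A_def using wpos by (simp add: mult_right_mono sum_nonneg)
qed

text \<open>
  Sum over the cluster of excited edges connected to \<open>Y\<close>. The degree bound
  \<open>36\<close> and \<open>rooted_sum\<close> require \<open>128 * lam * 2 ^ 36 \<le> 1 /
  64\<close>, which is where \<open>2 ^ 49\<close> comes from.
\<close>

lemma peierls:
  assumes lam: "0 < lam" "lam \<le> 1 / 2 ^ 49" and Y: "Y \<subseteq> S"
  shows "(\<Sum>\<tau> | \<tau> \<in> \<Omega> \<and> Y \<subseteq> excited \<tau>. lam powr total_length \<tau>)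
    \<le> (1 / 64) ^ card Y * (\<Sum>\<tau>\<in>\<Omega>. lam powr total_length \<tau>)"
proof -
  have lam': "lam \<le> 1 / 128" using lam(2) by (rule order_trans) simp
  define A where "A = {\<tau>. \<tau> \<in> \<Omega> \<and> Y \<subseteq> excited \<tau>}"
  define XX where "XX = {X. X \<subseteq> S \<and> rooted (hadj S) Y X}"
  have finA: "finite A" using finite_\<Omega> by (simp add: A_def)
  have finXX: "finite XX" using finite_S by (simp add: XX_def)
  have Z: "(\<Sum>\<tau>\<in>\<Omega>. wt lam \<tau>) \<ge> 0" using lam by (simp add: wt_def prod_nonneg sum_nonneg)
  have im: "(\<lambda>\<tau>. cluster Y (excited \<tau>)) ` A \<subseteq> XX"
  proof
    fix X assume "X \<in> (\<lambda>\<tau>. cluster Y (excited \<tau>)) ` A"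
    then obtain \<tau> where "\<tau> \<in> A" "X = cluster Y (excited \<tau>)" by blast
    then show "X \<in> XX" using cluster(1,2)[of Y "excited \<tau>"] unfolding A_def XX_def excited_def by blast
  qed
  have "(\<Sum>\<tau>\<in>A. lam powr total_length \<tau>) = (\<Sum>\<tau>\<in>A. wt lam \<tau>)"
    using wt_powr lam by (intro sum.cong) (auto simp: A_def)
  also have "\<dots> = (\<Sum>X\<in>XX. \<Sum>\<tau>\<in>{\<tau>\<in>A. cluster Y (excited \<tau>) = X}. wt lam \<tau>)"
    by (rule sum.group[symmetric, OF finA finXX im])
  also have "\<dots> \<le> (\<Sum>X\<in>XX. (128 * lam) ^ card X * (\<Sum>\<tau>\<in>\<Omega>. wt lam \<tau>))"
  proof (rule sum_mono)
    fix X assume "X \<in> XX"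
    then have X: "X \<subseteq> S" "Y \<subseteq> X" by (auto simp: XX_def rooted_def)
    have "{\<tau>\<in>A. cluster Y (excited \<tau>) = X} = {\<tau>. \<tau> \<in> \<Omega> \<and> Y \<subseteq> excited \<tau> \<and> cluster Y (excited \<tau>) = X}"
      by (auto simp: A_def)
    then show "(\<Sum>\<tau>\<in>{\<tau>\<in>A. cluster Y (excited \<tau>) = X}. wt lam \<tau>) \<le> (128 * lam) ^ card X * (\<Sum>\<tau>\<in>\<Omega>. wt lam \<tau>)"
      using peierls_fixed_cluster[OF lam(1) lam' X] by simp
  qed
  also have "\<dots> = (\<Sum>X\<in>XX. (128 * lam) ^ card X) * (\<Sum>\<tau>\<in>\<Omega>. wt lam \<tau>)" by (simp add: sum_distrib_right)
  also have "\<dots> \<le> (1 / 64) ^ card Y * (\<Sum>\<tau>\<in>\<Omega>. wt lam \<tau>)"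
  proof (rule mult_right_mono[OF _ Z])
    have "128 * lam * 2 ^ 36 \<le> 128 * (1 / 2 ^ 49) * 2 ^ 36" using lam by simp
    also have "\<dots> \<le> (1 / 64 :: real)" by simp
    finally have d: "128 * lam * 2 ^ 36 \<le> 1 / 64" .
    show "(\<Sum>X\<in>XX. (128 * lam) ^ card X) \<le> (1 / 64) ^ card Y"
      unfolding XX_def
      by (rule rooted_sum[OF finite_S card_hadj(2)[OF tri] finite_S order_refl _ d _ _ Y]) (use lam in auto)
  qed
  also have "(\<Sum>\<tau>\<in>\<Omega>. wt lam \<tau>) = (\<Sum>\<tau>\<in>\<Omega>. lam powr total_length \<tau>)"
    using wt_powr lam by (intro sum.cong) auto
  finally show ?thesis unfolding A_def .
qed

end

section \<open>Unit squares met by an edge\<close>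

text \<open>
  Unit squares are named by their lower left corner; \<open>osq\<close> is the open and
  \<open>csq\<close> the closed square.
\<close>

definition osq :: "int \<times> int \<Rightarrow> point set" where
  "osq q = {x. real_of_int (fst q) < fst x \<and> fst x < real_of_int (fst q) + 1 \<and>
               real_of_int (snd q) < snd x \<and> snd x < real_of_int (snd q) + 1}"

definition csq :: "int \<times> int \<Rightarrow> point set" where
  "csq q = {x. real_of_int (fst q) \<le> fst x \<and> fst x \<le> real_of_int (fst q) + 1 \<and>
               real_of_int (snd q) \<le> snd x \<and> snd x \<le> real_of_int (snd q) + 1}"

definition meets :: "edge \<Rightarrow> int \<times> int \<Rightarrow> bool" where
  "meets e q \<longleftrightarrow> convex hull e \<inter> osq q \<noteq> {}"

lemma meets_E:
  "meets (E p r) q \<longleftrightarrow> (\<exists>t. 0 \<le> t \<and> t \<le> 1 \<and> (1 - t) *\<^sub>R rp p + t *\<^sub>R rp r \<in> osq q)"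
  unfolding meets_def hull_E closed_segment_def by auto

text \<open>
  The side from \<open>a\<close> to \<open>b\<close> separates the square \<open>q\<close> from
  its right or upper neighbour.
\<close>

definition side :: "int \<times> int \<Rightarrow> int \<times> int \<Rightarrow> int \<times> int \<Rightarrow> int \<times> int \<Rightarrow> bool" where
  "side a b q q' \<longleftrightarrow> (q' = q + (1,0) \<and> a = q + (1,0) \<and> b = q + (1,1)) \<or>
                     (q' = q + (0,1) \<and> a = q + (0,1) \<and> b = q + (1,1))"

definition sep :: "edge \<Rightarrow> int \<times> int \<Rightarrow> int \<times> int \<Rightarrow> bool" where
  "sep u q q' \<longleftrightarrow> (\<exists>a b. u = E a b \<and> (side a b q q' \<or> side a b q' q))"

lemma sep_commute: "sep u q q' \<longleftrightarrow> sep u q' q"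
  unfolding sep_def by blast

text \<open>
  Neighbouring squares whose common side is crossed by the segment.
\<close>

definition stair :: "int \<times> int \<Rightarrow> int \<times> int \<Rightarrow> ((int \<times> int) \<times> (int \<times> int)) set" where
  "stair p r = {(q, q'). \<exists>a b. (side a b q q' \<or> side a b q' q) \<and> xcross p r a b}"

text \<open>
  The segment from \<open>p\<close> to \<open>r\<close>, which is rising, passes below the upper
  left and above the lower right corner of the square.
\<close>

definition under :: "int \<times> int \<Rightarrow> int \<times> int \<Rightarrow> int \<times> int \<Rightarrow> bool" where
  "under p r q \<longleftrightarrow> orient p r (q + (0,1)) > 0 \<and> orient p r (q + (1,0)) < 0 \<and>
     fst p \<le> fst q \<and> fst q < fst r \<and> snd p \<le> snd q \<and> snd q < snd r"

text \<open>
  A rising primitive segment that is not at its end leaves a square through its right or its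
  upper side, as it avoids the upper right corner unless this is its end point.
\<close>

lemma stair_to_last:
  assumes pr: "prim (r - p)" and M: "under p r q"
  shows "(q, r - (1,1)) \<in> (stair p r)\<^sup>*"
  using M
proof (induction "nat (fst r + snd r - fst q - snd q)" arbitrary: q rule: less_induct)
  case less
  obtain p1 p2 r1 r2 i j where c: "p = (p1,p2)" "r = (r1,r2)" "q = (i,j)"
    by (cases p; cases r; cases q) auto
  define u v where "u = r1 - p1" and "v = r2 - p2"
  have M: "u * (j + 1 - p2) - v * (i - p1) > 0" "u * (j - p2) - v * (i + 1 - p1) < 0"
    "p1 \<le> i" "i < r1" "p2 \<le> j" "j < r2"
    using less.prems by (auto simp: under_def c orient_Pair u_def v_def)
  have uv: "u > 0" "v > 0" using M by (auto simp: u_def v_def)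
  have o: "orient p r (x,y) = u * (y - p2) - v * (x - p1)" for x y by (simp add: c orient_Pair u_def v_def)
  define k where "k = orient p r (i + 1, j + 1)"
  have k: "k = u * (j + 1 - p2) - v * (i + 1 - p1)" unfolding k_def o by simp
  show ?case
  proof (cases "k = 0")
    case True
    have "det (r - p) ((i + 1, j + 1) - p) = 0" using True by (simp add: k_def orient_def)
    then obtain l where l: "(i + 1, j + 1) - p = (l * fst (r - p), l * snd (r - p))"
      using prim_parallel[OF pr] by blast
    have l1: "i + 1 - p1 = l * u" "j + 1 - p2 = l * v" using l by (auto simp: c u_def v_def)
    have "l > 0" using l1(1) M(3) uv by (smt (verit) mult_nonpos_nonneg)
    moreover have "l < 2"
    proof (rule ccontr)
      assume "\<not> l < 2"
      then have "l * u \<ge> 2 * u" using uv by (intro mult_right_mono) auto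
      then show False using l1(1) M(4) uv by (simp add: u_def)
    qed
    ultimately have "l = 1" by simp
    then have "q = r - (1,1)" using l1 by (simp add: c u_def v_def)
    then show ?thesis by simp
  next
    case False
    have edge: "\<exists>q'. (q, q') \<in> stair p r \<and> under p r q' \<and> fst q + snd q < fst q' + snd q'"
    proof (cases "k > 0")
      case True
      have i: "i + 1 < r1"
      proof (rule ccontr)
        assume "\<not> i + 1 < r1"
        then have "i + 1 - p1 = u" using M by (simp add: u_def)
        then have "k = u * (j + 1 - p2 - v)" by (simp add: k algebra_simps)
        moreover have "j + 1 - p2 - v \<le> 0" using M by (simp add: v_def)
        ultimately show False using True uv by (simp add: zero_less_mult_iff)
      qed
      have x: "xcross p r (i + 1, j) (i + 1, j + 1)"
        unfolding xcross_def o using True k M(2) i M(3) by (auto simp: mult_less_0_iff c orient_Pair)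
      have "(q, (i + 1, j)) \<in> stair p r" unfolding stair_def
        using x by (auto simp: side_def c intro!: exI[of _ "(i + 1, j)"] exI[of _ "(i + 1, j + 1)"])
      moreover have "under p r (i + 1, j)"
      proof -
        have "u * (j - p2) - v * (i + 1 + 1 - p1) = u * (j - p2) - v * (i + 1 - p1) - v" by (simp add: algebra_simps)
        then show ?thesis unfolding under_def using True k M i uv by (simp add: o) (simp add: c)
      qed
      ultimately show ?thesis by (intro exI[of _ "(i + 1, j)"]) (auto simp: c)
    next
      case neg: False
      then have kn: "k < 0" using False by simp
      have j: "j + 1 < r2"
      proof (rule ccontr)
        assume "\<not> j + 1 < r2"
        then have "j + 1 - p2 = v" using M by (simp add: v_def)
        then have "k = v * (u - (i + 1 - p1))" by (simp add: k algebra_simps)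
        moreover have "u - (i + 1 - p1) \<ge> 0" using M by (simp add: u_def)
        ultimately show False using kn uv by (simp add: mult_less_0_iff)
      qed
      have x: "xcross p r (i, j + 1) (i + 1, j + 1)"
        unfolding xcross_def o using kn k M(1) j M(5) by (auto simp: mult_less_0_iff c orient_Pair)
      have "(q, (i, j + 1)) \<in> stair p r" unfolding stair_def
        using x by (auto simp: side_def c intro!: exI[of _ "(i, j + 1)"] exI[of _ "(i + 1, j + 1)"])
      moreover have "under p r (i, j + 1)"
      proof -
        have "u * (j + 1 + 1 - p2) - v * (i - p1) = u * (j + 1 - p2) - v * (i - p1) + u" by (simp add: algebra_simps)
        then show ?thesis unfolding under_def using kn k M j uv by (simp add: o) (simp add: c)
      qed
      ultimately show ?thesis by (intro exI[of _ "(i, j + 1)"]) (auto simp: c)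
    qed
    then obtain q' where q': "(q, q') \<in> stair p r" "under p r q'" "fst q + snd q < fst q' + snd q'" by blast
    have "nat (fst r + snd r - fst q' - snd q') < nat (fst r + snd r - fst q - snd q)"
      using q'(3) M by (simp add: c)
    then have "(q', r - (1,1)) \<in> (stair p r)\<^sup>*" using less.hyps q'(2) by blast
    then show ?thesis using q'(1) by (meson converse_rtrancl_into_rtrancl)
  qed
qed

lemma stair_sym: "sym (stair p r)"
  by (auto simp: stair_def sym_def)

lemma stair_connected:
  assumes "prim (r - p)" "under p r q" "under p r q'"
  shows "(q, q') \<in> (stair p r)\<^sup>*"
proof -
  have "(r - (1,1), q') \<in> (stair p r)\<^sup>*"
    using sym_rtrancl[OF stair_sym] stair_to_last[OF assms(1,3)] by (rule symD)
  then show ?thesis using stair_to_last[OF assms(1,2)] by simp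
qed

lemma meets_under:
  assumes m: "meets (E p r) q" and pos: "fst p < fst r" "snd p < snd r"
  shows "under p r q"
proof -
  obtain p1 p2 r1 r2 i j where c: "p = (p1,p2)" "r = (r1,r2)" "q = (i,j)"
    by (cases p; cases r; cases q) auto
  obtain x t where x: "0 \<le> t" "t \<le> 1" "x = (1 - t) *\<^sub>R rp p + t *\<^sub>R rp r" "x \<in> osq q"
    using m unfolding meets_E by blast
  define x1 x2 where "x1 = (1 - t) * real_of_int p1 + t * real_of_int r1" and "x2 = (1 - t) * real_of_int p2 + t * real_of_int r2"
  have xx: "x = (x1, x2)" unfolding x(3) by (simp add: rp_def c x1_def x2_def)
  have sq: "real_of_int i < x1" "x1 < real_of_int i + 1" "real_of_int j < x2" "x2 < real_of_int j + 1"
    using x(4) by (auto simp: osq_def xx c)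
  define U V where "U = real_of_int r1 - real_of_int p1" and "V = real_of_int r2 - real_of_int p2"
  have UV: "U > 0" "V > 0" using pos by (auto simp: c U_def V_def)
  have x12: "x1 = p1 + t * U" "x2 = p2 + t * V" by (simp_all add: x1_def x2_def U_def V_def algebra_simps)
  have b: "0 \<le> t * U" "t * U \<le> U" "0 \<le> t * V" "t * V \<le> V"
    using x UV mult_right_mono[of t 1 U] mult_right_mono[of t 1 V] by auto
  have "real_of_int p1 < real_of_int i + 1" "real_of_int i < real_of_int r1" "real_of_int p2 < real_of_int j + 1" "real_of_int j < real_of_int r2"
    using sq b unfolding x12 U_def V_def by linarith+
  then have box: "p1 \<le> i" "i < r1" "p2 \<le> j" "j < r2" by linarith+
  have z: "U * (x2 - p2) - V * (x1 - p1) = 0" by (simp add: x12)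
  have "real_of_int (orient p r (i, j + 1)) = U * (j + 1 - p2) - V * (i - p1)"
    by (simp add: c orient_Pair U_def V_def)
  also have "\<dots> = U * (j + 1 - x2) + V * (x1 - i)" using z by (simp add: algebra_simps)
  also have "\<dots> > 0" using UV sq by (intro add_pos_pos mult_pos_pos) auto
  finally have 1: "orient p r (i, j + 1) > 0" by simp
  have "real_of_int (orient p r (i + 1, j)) = U * (j - p2) - V * (i + 1 - p1)"
    by (simp add: c orient_Pair U_def V_def)
  also have "\<dots> = - (U * (x2 - j) + V * (i + 1 - x1))" using z by (simp add: algebra_simps)
  also have "\<dots> < 0" using mult_pos_pos[OF UV(1), of "x2 - j"] mult_pos_pos[OF UV(2), of "i + 1 - x1"] sq by linarith
  finally have 2: "orient p r (i + 1, j) < 0" by simp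
  show ?thesis using 1 2 box by (simp add: under_def c)
qed

text \<open>Reflection in the horizontal axis reduces falling edges to rising ones.\<close>

definition mir :: "int \<times> int \<Rightarrow> int \<times> int" where "mir a = (fst a, - snd a)"
definition mirq :: "int \<times> int \<Rightarrow> int \<times> int" where "mirq q = (fst q, - snd q - 1)"

lemma mir_mir[simp]: "mir (mir a) = a" "mirq (mirq q) = q" by (simp_all add: mir_def mirq_def)

lemma xcross_mir: "xcross (mir p) (mir q) (mir r) (mir s) = xcross p q r s"
proof -
  have "orient (mir p) (mir q) (mir r) = - orient p q r" for p q r
    by (cases p; cases q; cases r) (simp add: orient_Pair mir_def algebra_simps)
  then show ?thesis unfolding xcross_def by simp
qed

lemma side_mir: "side a b q q' \<Longrightarrow> side (mir a) (mir b) (mirq q') (mirq q) \<or> side (mir b) (mir a) (mirq q) (mirq q')"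
  by (cases a; cases b; cases q; cases q') (auto simp: side_def mir_def mirq_def)

lemma stair_mir:
  assumes "(q, q') \<in> (stair (mir p) (mir r))\<^sup>*" shows "(mirq q, mirq q') \<in> (stair p r)\<^sup>*"
  using assms
proof (induction rule: rtrancl_induct)
  case (step y z)
  obtain a b where ab: "side a b y z \<or> side a b z y" "xcross (mir p) (mir r) a b" using step by (auto simp: stair_def)
  have x: "xcross p r (mir a) (mir b)" "xcross p r (mir b) (mir a)"
    using ab(2) xcross_mir[of p r "mir a" "mir b"] by (auto simp: xcross_rev)
  have "side (mir a) (mir b) (mirq z) (mirq y) \<or> side (mir b) (mir a) (mirq y) (mirq z) \<or>
      side (mir a) (mir b) (mirq y) (mirq z) \<or> side (mir b) (mir a) (mirq z) (mirq y)"
    using ab(1) side_mir[of a b y z] side_mir[of a b z y] by blast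
  then have "(mirq y, mirq z) \<in> stair p r" unfolding stair_def using x by blast
  then show ?case using step by (meson rtrancl.rtrancl_into_rtrancl)
qed simp

lemma meets_mir: "meets (E p r) q \<Longrightarrow> meets (E (mir p) (mir r)) (mirq q)"
proof -
  assume "meets (E p r) q"
  then obtain x t where x: "0 \<le> t" "t \<le> 1" "x = (1 - t) *\<^sub>R rp p + t *\<^sub>R rp r" "x \<in> osq q"
    unfolding meets_E by blast
  have "(fst x, - snd x) = (1 - t) *\<^sub>R rp (mir p) + t *\<^sub>R rp (mir r)" unfolding x(3) by (simp add: rp_def mir_def)
  moreover have "(fst x, - snd x) \<in> osq (mirq q)" using x(4) by (auto simp: osq_def mirq_def)
  ultimately show ?thesis unfolding meets_E using x(1,2) by auto
qed

lemma meets_diff: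
  assumes "meets (E p r) q" shows "fst p \<noteq> fst r" "snd p \<noteq> snd r"
proof -
  obtain x t where x: "x = (1 - t) *\<^sub>R rp p + t *\<^sub>R rp r" "x \<in> osq q"
    using assms unfolding meets_E by blast
  show "fst p \<noteq> fst r"
  proof
    assume "fst p = fst r"
    then have "fst x = real_of_int (fst p)" unfolding x(1) by (simp add: rp_def algebra_simps)
    then show False using x(2) by (simp add: osq_def) linarith
  qed
  show "snd p \<noteq> snd r"
  proof
    assume "snd p = snd r"
    then have "snd x = real_of_int (snd p)" unfolding x(1) by (simp add: rp_def algebra_simps)
    then show False using x(2) by (simp add: osq_def) linarith
  qed
qed

lemma meets_stair:
  assumes pr: "prim (r - p)" and m: "meets (E p r) q" "meets (E p r) q'"
  shows "(q, q') \<in> (stair p r)\<^sup>*"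
proof -
  have rising: "(q, q') \<in> (stair p r)\<^sup>*" if "prim (r - p)" "meets (E p r) q" "meets (E p r) q'"
    "fst p < fst r" "snd p < snd r" for p r q q'
    using stair_connected[OF that(1)] meets_under that by blast
  have right: "(q, q') \<in> (stair p r)\<^sup>*" if "prim (r - p)" "meets (E p r) q" "meets (E p r) q'"
    "fst p < fst r" for p r q q'
  proof (cases "snd p < snd r")
    case True then show ?thesis using rising that by blast
  next
    case False
    then have s: "snd r < snd p" using meets_diff(2)[OF that(2)] by simp
    have pm: "prim (mir r - mir p)"
    proof -
      have "fst (mir r - mir p) = fst (r - p)" "snd (mir r - mir p) = - snd (r - p)" by (simp_all add: mir_def)
      then show ?thesis using that(1) by (simp only: coprime_minus_right_iff)
    qed
    have "(mirq q, mirq q') \<in> (stair (mir p) (mir r))\<^sup>*"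
      by (rule rising[OF pm meets_mir[OF that(2)] meets_mir[OF that(3)]]) (use that s in \<open>auto simp: mir_def\<close>)
    then show ?thesis using stair_mir by fastforce
  qed
  show ?thesis
  proof (cases "fst p < fst r")
    case True then show ?thesis using right pr m by blast
  next
    case False
    then have "fst r < fst p" using meets_diff(1)[OF m(1)] by simp
    then have "(q, q') \<in> (stair r p)\<^sup>*"
      using right[of p r q q'] pr m prim_commute E_commute by metis
    moreover have "stair r p = stair p r" unfolding stair_def by (simp add: xcross_rev)
    ultimately show ?thesis by simp
  qed
qed

definition crossed_steps :: "nat \<Rightarrow> nat \<Rightarrow> edge \<Rightarrow> ((int \<times> int) \<times> (int \<times> int)) set" where
  "crossed_steps m n e = {(q, q'). \<exists>u\<in>lattice_edges m n. sep u q q' \<and> crosses e u}"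

lemma side_len: "side a b q q' \<Longrightarrow> len (b - a) = 1"
  by (cases q) (auto simp: side_def len_def)

lemma len1_prim: "len w = 1 \<Longrightarrow> prim w"
proof -
  assume "len w = 1"
  then have "\<bar>fst w\<bar> = 1 \<or> \<bar>snd w\<bar> = 1" unfolding len_def by linarith
  then show ?thesis by (metis coprime_abs_left_iff coprime_abs_right_iff coprime_1_left coprime_1_right)
qed

lemma xcross_unit_inbox:
  assumes x: "xcross p r a b" and ab: "len (b - a) = 1" and box: "inbox m n p" "inbox m n r"
  shows "inbox m n a \<and> inbox m n b"
proof -
  obtain u v where uv: "0 < u" "u < 1" "0 < v" "v < 1"
    "(1 - u) *\<^sub>R rp p + u *\<^sub>R rp r = (1 - v) *\<^sub>R rp a + v *\<^sub>R rp b" using x by (rule xcross_point)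
  define X where "X = (1 - u) *\<^sub>R rp p + u *\<^sub>R rp r"
  have "X \<in> rect m n" unfolding X_def
    using convexD[OF convex_rect[of m n], of "rp p" "rp r" "1 - u" u] box uv(1,2) by (simp add: rp_rect)
  then have X: "0 \<le> fst X" "fst X \<le> real m" "0 \<le> snd X" "snd X \<le> real n" by (auto simp: rect_def)
  have X2: "fst X = fst a + v * (fst b - fst a)" "snd X = snd a + v * (snd b - snd a)"
    unfolding X_def uv(5) by (simp_all add: rp_def algebra_simps)
  have *: "0 \<le> y \<and> y \<le> int N \<and> 0 \<le> y' \<and> y' \<le> int N"
    if "0 \<le> real_of_int y + v * (real_of_int y' - real_of_int y)" "real_of_int y + v * (real_of_int y' - real_of_int y) \<le> real N"
      "y' - y = 0 \<or> y' - y = 1 \<or> y' - y = -1" for y y' N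
  proof -
    have e: "real_of_int y' = real_of_int y + real_of_int (y' - y)" by simp
    from that(3) show ?thesis
    proof (elim disjE)
      assume "y' - y = 0" then show ?thesis using that(1,2) by simp
    next
      assume a: "y' - y = 1"
      then have "0 \<le> real_of_int y + v" "real_of_int y + v \<le> real N" using that(1,2) e by simp_all
      then have "-1 < real_of_int y" "real_of_int y < real N" using uv by linarith+
      then show ?thesis using a by linarith
    next
      assume a: "y' - y = -1"
      then have "0 \<le> real_of_int y - v" "real_of_int y - v \<le> real N" using that(1,2) e by simp_all
      then have "0 < real_of_int y" "real_of_int y < real N + 1" using uv by linarith+
      then show ?thesis using a by linarith
    qed
  qed
  have "\<bar>fst (b - a)\<bar> + \<bar>snd (b - a)\<bar> = 1" using ab by (simp add: len_def)
  then have "fst b - fst a = 0 \<or> fst b - fst a = 1 \<or> fst b - fst a = -1"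
    "snd b - snd a = 0 \<or> snd b - snd a = 1 \<or> snd b - snd a = -1" by auto
  then show ?thesis using *[of "fst a" "fst b" m] *[of "snd a" "snd b" n] X X2 unfolding inbox_def by simp
qed

text \<open>
  The segment passes from one of its squares to the next by crossing unit edges, which lie in
  the box together with the segment.
\<close>

lemma meets_connected:
  assumes e: "e \<in> lattice_edges m n" and m: "meets e q" "meets e q'"
  shows "(q, q') \<in> (crossed_steps m n e)\<^sup>*"
proof -
  obtain p r where pr: "e = E p r" "inbox m n p" "inbox m n r" "prim (r - p)" using e by (rule lattice_edgeE)
  have "stair p r \<subseteq> crossed_steps m n e"
  proof
    fix z assume "z \<in> stair p r"
    moreover obtain q q' where "z = (q, q')" by (cases z)
    ultimately obtain q q' a b where z: "z = (q, q')" "side a b q q' \<or> side a b q' q" "xcross p r a b"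
      unfolding stair_def by blast
    have l: "len (b - a) = 1" using z(2) side_len by blast
    have "E a b \<in> lattice_edges m n"
      using xcross_unit_inbox[OF z(3) l pr(2,3)] len1_prim[OF l] by (simp add: E_lattice_iff)
    moreover have "crosses e (E a b)" using crosses_iff_xcross[OF pr(4) len1_prim[OF l]] z(3) pr(1) by simp
    ultimately show "z \<in> crossed_steps m n e" unfolding crossed_steps_def z(1) sep_def using z(2) by blast
  qed
  then show ?thesis using meets_stair[OF pr(4)] m unfolding pr(1) by (meson rtrancl_mono subsetD)
qed

lemma crosses_meets_triangle:
  assumes f: "f \<in> lattice_edges m n" and ab: "E a b \<in> lattice_edges m n" and cr: "crosses f (E a b)"
    and c: "orient a b c = 1"
  shows "convex hull f \<inter> interior (convex hull {rp a, rp b, rp c}) \<noteq> {}"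
proof -
  obtain p r where pr: "f = E p r" using f by (rule lattice_edgeE)
  have x: "xcross p r a b" using cr f ab crosses_E unfolding pr by blast
  obtain u v where uv: "0 < u" "u < 1" "0 < v" "v < 1"
    "(1 - u) *\<^sub>R rp p + u *\<^sub>R rp r = (1 - v) *\<^sub>R rp a + v *\<^sub>R rp b" using x by (rule xcross_point)
  define P where "P = (1 - u) *\<^sub>R rp p + u *\<^sub>R rp r"
  have P: "P = (1 - v) *\<^sub>R rp a + v *\<^sub>R rp b" by (simp add: P_def uv(5))
  have Pf: "P \<in> convex hull f" unfolding pr hull_E in_segment P_def using uv by (intro exI[of _ u]) auto
  have oc: "orientR (rp a) (rp b) (rp c) = 1" using c by (simp add: orientR_rp)
  have "orient a b p > 0 \<or> orient a b r > 0" using x by (auto simp: xcross_def mult_less_0_iff)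
  then obtain z where z: "orient a b z > 0" "rp z \<in> convex hull f"
    unfolding pr E_def by (metis hull_inc insertCI)
  have "orientR (rp a) (rp b) (rp z) > 0" using z by (simp add: orientR_rp)
  then obtain t where t: "0 < t" "t < 1" "(1 - t) *\<^sub>R P + t *\<^sub>R rp z \<in> interior (convex hull {rp a, rp b, rp c})"
    using near_interior[OF oc P uv(3,4)] by blast
  have "(1 - t) *\<^sub>R P + t *\<^sub>R rp z \<in> convex hull f"
    by (rule convexD[OF convex_convex_hull Pf z(2)]) (use t in auto)
  then show ?thesis using t by blast
qed

lemma half_square_subset:
  assumes o: "orient a b c = 1" and in1: "\<And>x. x \<in> {a,b,c} \<Longrightarrow> fst q \<le> fst x \<and> fst x \<le> fst q + 1 \<and> snd q \<le> snd x \<and> snd x \<le> snd q + 1"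
  shows "interior (convex hull {rp a, rp b, rp c}) \<subseteq> osq q"
proof -
  have "convex hull {rp a, rp b, rp c} \<subseteq> csq q"
  proof (rule hull_minimal)
    show "{rp a, rp b, rp c} \<subseteq> csq q"
    proof
      fix y assume "y \<in> {rp a, rp b, rp c}"
      then obtain x where x: "x \<in> {a,b,c}" "y = rp x" by blast
      then show "y \<in> csq q" using in1[OF x(1)] by (simp add: csq_def rp_def)
    qed
    have "csq q = {real_of_int (fst q)..real_of_int (fst q) + 1} \<times> {real_of_int (snd q)..real_of_int (snd q) + 1}"
      by (auto simp: csq_def)
    then show "convex (csq q)" by (simp add: convex_Times)
  qed
  then have "interior (convex hull {rp a, rp b, rp c}) \<subseteq> interior (csq q)" by (rule interior_mono)
  also have "interior (csq q) = osq q"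
  proof -
    have 1: "csq q = {real_of_int (fst q)..real_of_int (fst q) + 1} \<times> {real_of_int (snd q)..real_of_int (snd q) + 1}"
      by (auto simp: csq_def)
    have 2: "osq q = {real_of_int (fst q)<..<real_of_int (fst q) + 1} \<times> {real_of_int (snd q)<..<real_of_int (snd q) + 1}"
      by (auto simp: osq_def)
    show ?thesis unfolding 1 2 interior_Times interior_atLeastAtMost_real ..
  qed
  finally show ?thesis .
qed

lemma crosses_side_meets:
  assumes f: "f \<in> lattice_edges m n" and u: "u \<in> lattice_edges m n" "sep u q q'" and cr: "crosses f u"
  shows "meets f q" "meets f q'"
proof -
  have key: "meets f q \<and> meets f q'" if "u = E a b" "side a b q q'" for a b q q'
  proof -
    have ab: "E a b \<in> lattice_edges m n" "crosses f (E a b)" and ba: "E b a \<in> lattice_edges m n" "crosses f (E b a)"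
      using u cr that(1) E_commute by metis+
    have mt: "meets f q" if "orient a b c = 1" "E a b \<in> lattice_edges m n" "crosses f (E a b)"
      "\<And>x. x \<in> {a,b,c} \<Longrightarrow> fst q \<le> fst x \<and> fst x \<le> fst q + 1 \<and> snd q \<le> snd x \<and> snd x \<le> snd q + 1" for a b c q
      using crosses_meets_triangle[OF f that(2,3,1)] half_square_subset[OF that(1), of q] that(4)
      unfolding meets_def by blast
    obtain i j where q: "q = (i,j)" by (cases q)
    from that(2) consider "q' = (i+1,j)" "a = (i+1,j)" "b = (i+1,j+1)" | "q' = (i,j+1)" "a = (i,j+1)" "b = (i+1,j+1)"
      by (auto simp: side_def q)
    then show ?thesis
    proof cases
      case 1
      have "meets f q" using ab by (intro mt[of a b "(i,j)"]) (auto simp: q 1 orient_Pair)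
      moreover have "meets f q'" using ba by (intro mt[of b a "(i+2,j)"]) (auto simp: q 1 orient_Pair)
      ultimately show ?thesis ..
    next
      case 2
      have "meets f q" using ba by (intro mt[of b a "(i,j)"]) (auto simp: q 2 orient_Pair)
      moreover have "meets f q'" using ab by (intro mt[of a b "(i,j+2)"]) (auto simp: q 2 orient_Pair)
      ultimately show ?thesis ..
    qed
  qed
  show "meets f q" "meets f q'" using u(2) key unfolding sep_def by blast+
qed

lemma point_on_grid:
  assumes x: "x \<in> rect m n" and nl: "\<And>c. x \<noteq> rp c"
  shows "(\<exists>q. x \<in> osq q) \<or> (\<exists>u\<in>lattice_edges m n. \<exists>q q'. sep u q q' \<and> x \<in> convex hull u \<and> x \<in> csq q \<and> x \<in> csq q')"
proof -
  obtain x1 x2 where xx: "x = (x1,x2)" by (cases x)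
  define i j where "i = \<lfloor>x1\<rfloor>" and "j = \<lfloor>x2\<rfloor>"
  have b: "real_of_int i \<le> x1" "x1 < real_of_int i + 1" "real_of_int j \<le> x2" "x2 < real_of_int j + 1"
    by (auto simp: i_def j_def)
  have r: "0 \<le> x1" "x1 \<le> real m" "0 \<le> x2" "x2 \<le> real n" using x by (auto simp: rect_def xx)
  consider "x1 \<noteq> i" "x2 \<noteq> j" | "x1 = i" "x2 \<noteq> j" | "x1 \<noteq> i" "x2 = j"
    using nl[of "(i,j)"] by (auto simp: xx rp_def)
  then show ?thesis
  proof cases
    case 1
    then have "x \<in> osq (i,j)" using b by (auto simp: osq_def xx)
    then show ?thesis by blast
  next
    case 2
    have "0 \<le> i" "i \<le> int m" "0 \<le> j" "j + 1 \<le> int n" using r b 2 by linarith+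
    then have l: "E (i,j) (i,j+1) \<in> lattice_edges m n" by (simp add: E_lattice_iff inbox_def)
    have s: "sep (E (i,j) (i,j+1)) (i-1,j) (i,j)" unfolding sep_def side_def
      by (intro exI[of _ "(i,j)"] exI[of _ "(i,j+1)"]) auto
    have "x = (1 - (x2 - j)) *\<^sub>R rp (i,j) + (x2 - j) *\<^sub>R rp (i,j+1)" by (simp add: rp_def xx 2 algebra_simps)
    then have "x \<in> convex hull (E (i,j) (i,j+1))" unfolding hull_E in_segment using b by (intro exI[of _ "x2 - j"]) auto
    moreover have "x \<in> csq (i-1,j)" "x \<in> csq (i,j)" using b 2 by (auto simp: csq_def xx)
    ultimately show ?thesis using l s by blast
  next
    case 3
    have "0 \<le> j" "j \<le> int n" "0 \<le> i" "i + 1 \<le> int m" using r b 3 by linarith+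
    then have l: "E (i,j) (i+1,j) \<in> lattice_edges m n" by (simp add: E_lattice_iff inbox_def)
    have s: "sep (E (i,j) (i+1,j)) (i,j-1) (i,j)" unfolding sep_def side_def
      by (intro exI[of _ "(i,j)"] exI[of _ "(i+1,j)"]) auto
    have "x = (1 - (x1 - i)) *\<^sub>R rp (i,j) + (x1 - i) *\<^sub>R rp (i+1,j)" by (simp add: rp_def xx 3 algebra_simps)
    then have "x \<in> convex hull (E (i,j) (i+1,j))" unfolding hull_E in_segment using b by (intro exI[of _ "x1 - i"]) auto
    moreover have "x \<in> csq (i,j-1)" "x \<in> csq (i,j)" using b 3 by (auto simp: csq_def xx)
    ultimately show ?thesis using l s by blast
  qed
qed

lemma sep_elen: "sep u q q' \<Longrightarrow> elen u = 1"
proof -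
  assume "sep u q q'"
  then obtain a b where ab: "u = E a b" "side a b q q' \<or> side a b q' q" unfolding sep_def by blast
  then have "len (b - a) = 1" using side_len by blast
  then show "elen u = 1" using ab(1) elen_E by simp
qed

text \<open>
  The crossing point is not a lattice point. If it lies on a unit edge, then both segments cross
  this edge and therefore meet the squares on either side of it.
\<close>

lemma crossing_share_square:
  assumes e: "e \<in> lattice_edges m n" and f: "f \<in> lattice_edges m n" and cr: "crosses e f"
    and nu: "elen e \<noteq> 1" "elen f \<noteq> 1"
  shows "\<exists>q. meets e q \<and> meets f q"
proof -
  obtain p r where pr: "e = E p r" "prim (r - p)" using e by (rule lattice_edgeE)
  obtain a b where ab: "f = E a b" "prim (b - a)" using f by (rule lattice_edgeE)
  have "xcross p r a b" using cr e f crosses_E unfolding pr ab by blast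
  then obtain u v where uv: "0 < u" "u < 1" "0 < v" "v < 1"
    "(1 - u) *\<^sub>R rp p + u *\<^sub>R rp r = (1 - v) *\<^sub>R rp a + v *\<^sub>R rp b" by (rule xcross_point)
  define P where "P = (1 - u) *\<^sub>R rp p + u *\<^sub>R rp r"
  have Pe: "P \<in> convex hull e" unfolding pr hull_E in_segment P_def using uv by (intro exI[of _ u]) auto
  have Pf: "P \<in> convex hull f" unfolding ab hull_E in_segment P_def uv(5) using uv(3,4) by (intro exI[of _ v]) auto
  have Pr: "P \<in> rect m n" using Pe hull_rect[OF e] by blast
  have nl: "P \<noteq> rp c" for c
  proof
    assume c: "P = rp c"
    then have "c = p \<or> c = r" using Pe rp_in_prim_segment[OF pr(2)] unfolding pr hull_E by simp
    moreover have "P = rp p + u *\<^sub>R (rp r - rp p)" "P = rp r - (1 - u) *\<^sub>R (rp r - rp p)"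
      by (simp_all add: P_def algebra_simps)
    moreover have "rp r - rp p \<noteq> 0" using pr(2) by auto
    ultimately show False using c uv by auto
  qed
  from point_on_grid[OF Pr nl] show ?thesis
  proof
    assume "\<exists>q. P \<in> osq q" then show ?thesis using Pe Pf unfolding meets_def by blast
  next
    assume "\<exists>u\<in>lattice_edges m n. \<exists>q q'. sep u q q' \<and> P \<in> convex hull u \<and> P \<in> csq q \<and> P \<in> csq q'"
    then obtain w q q' where w: "w \<in> lattice_edges m n" "sep w q q'" "P \<in> convex hull w" by blast
    have "P \<notin> w" using w(1) nl by (auto elim!: lattice_edgeE simp: E_def)
    then have "crosses e w" "crosses f w" using Pe Pf w nu sep_elen[OF w(2)] unfolding crosses_def by auto
    then show ?thesis using crosses_side_meets(1) e f w by blast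
  qed
qed

section \<open>Exchanging two triangulations off a common zone\<close>

definition missing :: "nat \<Rightarrow> nat \<Rightarrow> edge set \<Rightarrow> edge set \<Rightarrow> edge \<Rightarrow> bool" where
  "missing m n \<sigma> \<tau> u \<longleftrightarrow> u \<in> lattice_edges m n \<and> elen u = 1 \<and> (u \<notin> \<sigma> \<or> u \<notin> \<tau>)"

definition steps :: "nat \<Rightarrow> nat \<Rightarrow> edge set \<Rightarrow> edge set \<Rightarrow> ((int \<times> int) \<times> (int \<times> int)) set" where
  "steps m n \<sigma> \<tau> = {(q, q'). \<exists>u. missing m n \<sigma> \<tau> u \<and> sep u q q'}"

definition reach :: "nat \<Rightarrow> nat \<Rightarrow> edge \<Rightarrow> edge set \<Rightarrow> edge set \<Rightarrow> (int \<times> int) set" where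
  "reach m n e \<sigma> \<tau> = {q. \<exists>q0. meets e q0 \<and> (q0, q) \<in> (steps m n \<sigma> \<tau>)\<^sup>*}"

text \<open>
  Midpoints at which both triangulations have a unit edge are left out: there the two agree, and
  the edge may separate a square inside from a square outside.
\<close>

definition zone :: "nat \<Rightarrow> nat \<Rightarrow> edge \<Rightarrow> edge set \<Rightarrow> edge set \<Rightarrow> point set" where
  "zone m n e \<sigma> \<tau> = {x\<in>midpoints m n. \<not> (elen (edge_at \<sigma> x) = 1 \<and> elen (edge_at \<tau> x) = 1) \<and>
     (\<exists>q\<in>reach m n e \<sigma> \<tau>. x \<in> csq q)}"

lemma steps_sym: "(q, q') \<in> (steps m n \<sigma> \<tau>)\<^sup>* \<longleftrightarrow> (q', q) \<in> (steps m n \<sigma> \<tau>)\<^sup>*"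
proof -
  have "sym (steps m n \<sigma> \<tau>)" unfolding steps_def sym_def using sep_commute by blast
  then show ?thesis by (meson sym_rtrancl symD)
qed

lemma edge_mid_hull: "e \<in> lattice_edges m n \<Longrightarrow> edge_mid e \<in> convex hull e"
proof -
  assume "e \<in> lattice_edges m n"
  then obtain p q where e: "e = E p q" by (rule lattice_edgeE)
  have "edge_mid e = (1 - 1/2) *\<^sub>R rp p + (1/2) *\<^sub>R rp q" unfolding e by (simp add: edge_mid_E rp_def field_simps)
  then show ?thesis unfolding e hull_E in_segment by (intro exI[of _ "1/2"]) auto
qed

lemma odd_sum_gap:
  fixes p r i :: int assumes "p + r = 2 * i + 1" shows "\<bar>r - p\<bar> \<ge> 1"
proof -
  have "r \<noteq> p" using assms by presburger
  then show ?thesis by linarith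
qed

lemma odd_sum_neighbours:
  fixes p r i :: int assumes "p + r = 2 * i + 1" "\<bar>r - p\<bar> \<le> 1"
  shows "p = i \<and> r = i + 1 \<or> p = i + 1 \<and> r = i"
proof (cases "p \<le> i")
  case True
  then have "p = i" "r = i + 1" using assms by linarith+
  then show ?thesis by blast
next
  case False
  then have "p = i + 1" "r = i" using assms by linarith+
  then show ?thesis by blast
qed

lemma mp_csq: "mp c \<in> csq q \<longleftrightarrow> 2 * fst q \<le> fst c \<and> fst c \<le> 2 * fst q + 2 \<and> 2 * snd q \<le> snd c \<and> snd c \<le> 2 * snd q + 2"
proof -
  have "(real_of_int i \<le> real_of_int x / 2) = (2 * i \<le> x)" "(real_of_int x / 2 \<le> real_of_int i + 1) = (x \<le> 2 * i + 2)" for i x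
    by linarith+
  then show ?thesis by (simp add: mp_def csq_def)
qed

lemma mp_osq: "mp c \<in> osq q \<longleftrightarrow> c = (2 * fst q + 1, 2 * snd q + 1)"
proof -
  have *: "(real_of_int i < real_of_int x / 2 \<and> real_of_int x / 2 < real_of_int i + 1) = (x = 2 * i + 1)" for i x
    by linarith
  show ?thesis using *[of "fst q" "fst c"] *[of "snd q" "snd c"]
    unfolding mp_def osq_def prod_eq_iff mem_Collect_eq fst_conv snd_conv by blast
qed

text \<open>
  A midpoint is the centre of a unit square or of a unit edge.
\<close>

lemma midpoint_on_side:
  assumes "x \<in> midpoints m n" "x \<in> csq q" "x \<notin> osq q"
  shows "\<exists>u\<in>lattice_edges m n. \<exists>q'. sep u q q' \<and> edge_mid u = x"
proof -
  obtain c where c: "x = mp c" "inbox (2*m) (2*n) c" "\<not> (even (fst c) \<and> even (snd c))"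
    using assms(1) midpoints_iff by blast
  obtain c1 c2 where cc: "c = (c1,c2)" by (cases c)
  obtain i j where q: "q = (i,j)" by (cases q)
  have b: "2 * i \<le> c1" "c1 \<le> 2 * i + 2" "2 * j \<le> c2" "c2 \<le> 2 * j + 2" "\<not> (c1 = 2 * i + 1 \<and> c2 = 2 * j + 1)"
    using assms(2,3) unfolding c(1) mp_csq mp_osq by (auto simp: cc q)
  have nb: "\<not> (even c1 \<and> even c2)" using c(3) cc by simp
  have box: "0 \<le> c1" "c1 \<le> 2 * int m" "0 \<le> c2" "c2 \<le> 2 * int n" using c(2) by (auto simp: inbox_def cc)
  consider "c1 = 2 * i \<and> c2 = 2 * j + 1" | "c1 = 2 * i + 2 \<and> c2 = 2 * j + 1"
    | "c1 = 2 * i + 1 \<and> c2 = 2 * j" | "c1 = 2 * i + 1 \<and> c2 = 2 * j + 2"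
  proof -
    have "c1 = 2 * i \<or> c1 = 2 * i + 1 \<or> c1 = 2 * i + 2" "c2 = 2 * j \<or> c2 = 2 * j + 1 \<or> c2 = 2 * j + 2"
      using b(1-4) by linarith+
    then show ?thesis using b(5) nb that by (elim disjE) auto
  qed
  then show ?thesis
  proof cases
    case 1
    have "E (i,j) (i,j+1) \<in> lattice_edges m n" using box 1 by (auto simp: E_lattice_iff inbox_def)
    moreover have "sep (E (i,j) (i,j+1)) q (i-1,j)" unfolding sep_def side_def q
      by (intro exI[of _ "(i,j)"] exI[of _ "(i,j+1)"]) auto
    moreover have "edge_mid (E (i,j) (i,j+1)) = x" using 1 by (simp add: edge_mid_mp c(1) cc)
    ultimately show ?thesis by blast
  next
    case 2
    have "E (i+1,j) (i+1,j+1) \<in> lattice_edges m n" using box 2 by (auto simp: E_lattice_iff inbox_def)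
    moreover have "sep (E (i+1,j) (i+1,j+1)) q (i+1,j)" unfolding sep_def side_def q
      by (intro exI[of _ "(i+1,j)"] exI[of _ "(i+1,j+1)"]) auto
    moreover have "edge_mid (E (i+1,j) (i+1,j+1)) = x" using 2 by (simp add: edge_mid_mp c(1) cc)
    ultimately show ?thesis by blast
  next
    case 3
    have "E (i,j) (i+1,j) \<in> lattice_edges m n" using box 3 by (auto simp: E_lattice_iff inbox_def)
    moreover have "sep (E (i,j) (i+1,j)) q (i,j-1)" unfolding sep_def side_def q
      by (intro exI[of _ "(i,j)"] exI[of _ "(i+1,j)"]) auto
    moreover have "edge_mid (E (i,j) (i+1,j)) = x" using 3 by (simp add: edge_mid_mp c(1) cc)
    ultimately show ?thesis by blast
  next
    case 4
    have "E (i,j+1) (i+1,j+1) \<in> lattice_edges m n" using box 4 by (auto simp: E_lattice_iff inbox_def)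
    moreover have "sep (E (i,j+1) (i+1,j+1)) q (i,j+1)" unfolding sep_def side_def q
      by (intro exI[of _ "(i,j+1)"] exI[of _ "(i+1,j+1)"]) auto
    moreover have "edge_mid (E (i,j+1) (i+1,j+1)) = x" using 4 by (simp add: edge_mid_mp c(1) cc)
    ultimately show ?thesis by blast
  qed
qed

text \<open>
  An edge that is not a unit edge crosses the unit edge that has the same midpoint, or passes
  through the centre of a square.
\<close>

lemma meets_home:
  assumes f: "f \<in> lattice_edges m n" "elen f \<noteq> 1" and q: "edge_mid f \<in> csq q"
  shows "meets f q"
proof (cases "edge_mid f \<in> osq q")
  case True
  then show ?thesis using edge_mid_hull[OF f(1)] unfolding meets_def by blast
next
  case False
  then obtain u q' where u: "u \<in> lattice_edges m n" "sep u q q'" "edge_mid u = edge_mid f"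
    using midpoint_on_side[OF edge_mid_in_midpoints[OF f(1)] q] by blast
  have "f \<noteq> u" using f(2) sep_elen[OF u(2)] by auto
  then have "crosses f u" using same_mid_crosses[OF f(1) u(1)] u(3) by simp
  then show ?thesis using crosses_side_meets(1)[OF f(1) u(1,2)] by blast
qed

lemma home_exists: "\<exists>q. x \<in> csq q"
proof -
  have "x \<in> csq (\<lfloor>fst x\<rfloor>, \<lfloor>snd x\<rfloor>)" by (auto simp: csq_def intro: less_imp_le)
  then show ?thesis by blast
qed

lemma unit_edge_unique:
  assumes "e \<in> lattice_edges m n" "f \<in> lattice_edges m n" "elen e = 1" "elen f = 1" "edge_mid e = edge_mid f"
  shows "e = f"
proof (rule ccontr)
  assume ne: "e \<noteq> f"
  obtain p q where e: "e = E p q" "prim (q - p)" using assms(1) by (rule lattice_edgeE)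
  obtain r s where f: "f = E r s" "prim (s - r)" using assms(2) by (rule lattice_edgeE)
  have "crosses e f" using same_mid_crosses[OF assms(1,2,5) ne] .
  then have X: "xcross p q r s" using crosses_iff_xcross[OF e(2) f(2)] unfolding e(1) f(1) by simp
  have l: "len (s - r) = 1" "len (q - p) = 1" using assms(3,4) unfolding e(1) f(1) elen_E by auto
  show False using xcross_unit(3)[OF X e(2) l(1)] l(2) by simp
qed

lemma unit_crossed:
  assumes "e \<in> lattice_edges m n" "f \<in> lattice_edges m n" "crosses e f" "elen e = 1"
  shows "elen f \<noteq> 1"
proof
  assume f1: "elen f = 1"
  obtain p q where e: "e = E p q" "prim (q - p)" using assms(1) by (rule lattice_edgeE)
  obtain r s where f: "f = E r s" "prim (s - r)" using assms(2) by (rule lattice_edgeE)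
  have X: "xcross p q r s" using crosses_iff_xcross[OF e(2) f(2)] assms(3) unfolding e(1) f(1) by simp
  have l: "len (s - r) = 1" "len (q - p) = 1" using assms(4) f1 unfolding e(1) f(1) elen_E by auto
  show False using xcross_unit(3)[OF X e(2) l(1)] l(2) by simp
qed

locale two_triangulations =
  fixes m n :: nat and e :: edge and \<sigma> \<tau> :: "edge set"
  assumes \<sigma>: "triangulation m n \<sigma>" and \<tau>: "triangulation m n \<tau>"
begin

text \<open>
  The unit edges crossed by an edge of one of the two triangulations are missing from that
  triangulation.
\<close>

lemma met_squares:
  assumes "f \<in> \<sigma> \<or> f \<in> \<tau>" "meets f q" "meets f q'"
  shows "(q, q') \<in> (steps m n \<sigma> \<tau>)\<^sup>*"
proof -
  have fl: "f \<in> lattice_edges m n" using assms(1) triangulation_lattice \<sigma> \<tau> by blast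
  have "crossed_steps m n f \<subseteq> steps m n \<sigma> \<tau>"
  proof
    fix z assume z: "z \<in> crossed_steps m n f"
    obtain y y' where yy: "z = (y, y')" by (cases z)
    then obtain u where u: "u \<in> lattice_edges m n" "sep u y y'" "crosses f u"
      using z unfolding crossed_steps_def by blast
    have "u \<notin> \<sigma> \<or> u \<notin> \<tau>"
      using assms(1) u(3) triangulation_noncrossing[OF \<sigma>] triangulation_noncrossing[OF \<tau>] by blast
    then have "missing m n \<sigma> \<tau> u" unfolding missing_def using u(1) sep_elen[OF u(2)] by blast
    then show "z \<in> steps m n \<sigma> \<tau>" unfolding steps_def yy using u(2) by blast
  qed
  then have "(crossed_steps m n f)\<^sup>* \<subseteq> (steps m n \<sigma> \<tau>)\<^sup>*" by (rule rtrancl_mono)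
  then show ?thesis using meets_connected[OF fl assms(2,3)] by (rule subsetD)
qed

lemma reach_closed: "q \<in> reach m n e \<sigma> \<tau> \<Longrightarrow> (q, q') \<in> (steps m n \<sigma> \<tau>)\<^sup>* \<Longrightarrow> q' \<in> reach m n e \<sigma> \<tau>"
  unfolding reach_def mem_Collect_eq by (elim exE conjE, intro exI conjI, assumption, rule rtrancl_trans)

text \<open>
  All squares met by \<open>f\<close> are joined to each other, and they include those
  containing its midpoint, so any of them decides.
\<close>

lemma zone_iff:
  assumes x: "x \<in> midpoints m n" and f: "f = edge_at \<sigma> x \<or> f = edge_at \<tau> x" "elen f \<noteq> 1" "meets f q"
  shows "x \<in> zone m n e \<sigma> \<tau> \<longleftrightarrow> q \<in> reach m n e \<sigma> \<tau>"
proof -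
  have fin: "f \<in> \<sigma> \<or> f \<in> \<tau>" and mid: "edge_mid f = x" using f(1) edge_at[OF \<sigma> x] edge_at[OF \<tau> x] by auto
  have fl: "f \<in> lattice_edges m n" using fin triangulation_lattice \<sigma> \<tau> by blast
  have home: "meets f q'" if "x \<in> csq q'" for q' using meets_home[OF fl f(2)] mid that by simp
  have conn: "q1 \<in> reach m n e \<sigma> \<tau> \<Longrightarrow> q2 \<in> reach m n e \<sigma> \<tau>" if "meets f q1" "meets f q2" for q1 q2
    using reach_closed met_squares[OF fin that] by blast
  have nu: "\<not> (elen (edge_at \<sigma> x) = 1 \<and> elen (edge_at \<tau> x) = 1)" using f by auto
  obtain q1 where q1: "x \<in> csq q1" using home_exists by blast
  show ?thesis
  proof
    assume "x \<in> zone m n e \<sigma> \<tau>"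
    then obtain q2 where "q2 \<in> reach m n e \<sigma> \<tau>" "x \<in> csq q2" by (auto simp: zone_def)
    then show "q \<in> reach m n e \<sigma> \<tau>" using conn[of q2 q] home f(3) by blast
  next
    assume "q \<in> reach m n e \<sigma> \<tau>"
    then have "q1 \<in> reach m n e \<sigma> \<tau>" using conn[of q q1] home q1 f(3) by blast
    then show "x \<in> zone m n e \<sigma> \<tau>" using x nu q1 by (auto simp: zone_def)
  qed
qed

lemma unit_zone_iff:
  assumes x: "x \<in> midpoints m n" and f: "f \<in> \<sigma> \<or> f \<in> \<tau>" and q: "meets f q"
    and u: "u = edge_at \<sigma> x \<or> u = edge_at \<tau> x" "elen u = 1" and cr: "crosses f u"
  shows "x \<in> zone m n e \<sigma> \<tau> \<longleftrightarrow> q \<in> reach m n e \<sigma> \<tau>"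
proof -
  have fl: "f \<in> lattice_edges m n" using f triangulation_lattice \<sigma> \<tau> by blast
  have ul: "u \<in> lattice_edges m n" "edge_mid u = x"
    using u(1) edge_at_lattice[OF \<sigma> x] edge_at_lattice[OF \<tau> x] edge_at[OF \<sigma> x] edge_at[OF \<tau> x] by auto
  have nu: "\<not> (elen (edge_at \<sigma> x) = 1 \<and> elen (edge_at \<tau> x) = 1)"
  proof
    assume a: "elen (edge_at \<sigma> x) = 1 \<and> elen (edge_at \<tau> x) = 1"
    have "edge_at \<sigma> x = edge_at \<tau> x"
      using unit_edge_unique[OF edge_at_lattice[OF \<sigma> x] edge_at_lattice[OF \<tau> x]] a edge_at(2)[OF \<sigma> x] edge_at(2)[OF \<tau> x] by simp
    then have "u \<in> \<sigma>" "u \<in> \<tau>" using u(1) edge_at(1)[OF \<sigma> x] edge_at(1)[OF \<tau> x] by auto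
    then show False using f cr triangulation_noncrossing[OF \<sigma>] triangulation_noncrossing[OF \<tau>] by blast
  qed
  have home: "meets f q'" if xq: "x \<in> csq q'" for q'
  proof -
    have "x \<notin> osq q'"
    proof
      assume "x \<in> osq q'"
      obtain a b where ab: "u = E a b" using ul(1) by (rule lattice_edgeE)
      have "a + b = (2 * fst q' + 1, 2 * snd q' + 1)" using \<open>x \<in> osq q'\<close> ul(2) unfolding ab edge_mid_mp by (metis mp_osq)
      then have s: "fst a + fst b = 2 * fst q' + 1" "snd a + snd b = 2 * snd q' + 1" by (auto simp: prod_eq_iff)
      have "len (b - a) = 1" using u(2) unfolding ab elen_E by simp
      then have "\<bar>fst b - fst a\<bar> + \<bar>snd b - snd a\<bar> = 1" by (simp add: len_def)
      then show False using odd_sum_gap[OF s(1)] odd_sum_gap[OF s(2)] by linarith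
    qed
    then obtain w q2 where w: "w \<in> lattice_edges m n" "sep w q' q2" "edge_mid w = x"
      using midpoint_on_side[OF x xq] by blast
    have "w = u" using unit_edge_unique[OF w(1) ul(1) sep_elen[OF w(2)] u(2)] w(3) ul(2) by simp
    then show ?thesis using crosses_side_meets(1)[OF fl w(1,2)] cr by simp
  qed
  have conn: "q1 \<in> reach m n e \<sigma> \<tau> \<Longrightarrow> q2 \<in> reach m n e \<sigma> \<tau>" if "meets f q1" "meets f q2" for q1 q2
    using reach_closed met_squares[OF f that] by blast
  obtain q1 where q1: "x \<in> csq q1" using home_exists by blast
  show ?thesis
  proof
    assume "x \<in> zone m n e \<sigma> \<tau>"
    then obtain q2 where "q2 \<in> reach m n e \<sigma> \<tau>" "x \<in> csq q2" by (auto simp: zone_def)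
    then show "q \<in> reach m n e \<sigma> \<tau>" using conn[of q2 q] home q by blast
  next
    assume "q \<in> reach m n e \<sigma> \<tau>"
    then have "q1 \<in> reach m n e \<sigma> \<tau>" using conn[of q q1] home q1 q by blast
    then show "x \<in> zone m n e \<sigma> \<tau>" using x nu q1 by (auto simp: zone_def)
  qed
qed

text \<open>
  Two crossing edges meet a common square, unless one of them is a unit edge, in which case the
  other meets the two squares next to it.
\<close>

lemma zone_closed:
  assumes x: "x \<in> midpoints m n" and y: "y \<in> midpoints m n" and cr: "crosses (edge_at \<sigma> x) (edge_at \<tau> y)"
  shows "x \<in> zone m n e \<sigma> \<tau> \<longleftrightarrow> y \<in> zone m n e \<sigma> \<tau>"
proof -
  note l = edge_at_lattice[OF \<sigma> x] edge_at_lattice[OF \<tau> y]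
  note s = edge_at(1)[OF \<sigma> x] edge_at(1)[OF \<tau> y]
  have cr': "crosses (edge_at \<tau> y) (edge_at \<sigma> x)" using cr crosses_commute by blast
  consider "elen (edge_at \<sigma> x) = 1" "elen (edge_at \<tau> y) \<noteq> 1" | "elen (edge_at \<tau> y) = 1" "elen (edge_at \<sigma> x) \<noteq> 1"
    | "elen (edge_at \<sigma> x) \<noteq> 1" "elen (edge_at \<tau> y) \<noteq> 1"
    using unit_crossed[OF l cr] by blast
  then show ?thesis
  proof cases
    case 1
    obtain q where "y \<in> csq q" using home_exists by blast
    then have q: "meets (edge_at \<tau> y) q" using meets_home[OF l(2) 1(2)] edge_at(2)[OF \<tau> y] by simp
    show ?thesis using unit_zone_iff[OF x _ q _ 1(1) cr'] zone_iff[OF y _ 1(2) q] s by blast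
  next
    case 2
    obtain q where "x \<in> csq q" using home_exists by blast
    then have q: "meets (edge_at \<sigma> x) q" using meets_home[OF l(1) 2(2)] edge_at(2)[OF \<sigma> x] by simp
    show ?thesis using unit_zone_iff[OF y _ q _ 2(1) cr] zone_iff[OF x _ 2(2) q] s by blast
  next
    case 3
    obtain q where q: "meets (edge_at \<sigma> x) q" "meets (edge_at \<tau> y) q"
      using crossing_share_square[OF l cr 3] by blast
    show ?thesis using zone_iff[OF x _ 3(1) q(1)] zone_iff[OF y _ 3(2) q(2)] by blast
  qed
qed

end

definition mix :: "nat \<Rightarrow> nat \<Rightarrow> point set \<Rightarrow> edge set \<Rightarrow> edge set \<Rightarrow> edge set" where
  "mix m n C \<sigma> \<tau> = (\<lambda>x. if x \<in> C then edge_at \<sigma> x else edge_at \<tau> x) ` midpoints m n"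

lemma mix:
  assumes \<sigma>: "triangulation m n \<sigma>" and \<tau>: "triangulation m n \<tau>"
    and C: "\<And>x y. x \<in> midpoints m n \<Longrightarrow> y \<in> midpoints m n \<Longrightarrow> crosses (edge_at \<sigma> x) (edge_at \<tau> y) \<Longrightarrow> x \<in> C \<longleftrightarrow> y \<in> C"
  shows "triangulation m n (mix m n C \<sigma> \<tau>)"
    "x \<in> midpoints m n \<Longrightarrow> edge_at (mix m n C \<sigma> \<tau>) x = (if x \<in> C then edge_at \<sigma> x else edge_at \<tau> x)"
proof -
  define \<phi> where "\<phi> x = (if x \<in> C then edge_at \<sigma> x else edge_at \<tau> x)" for x
  have \<phi>: "\<phi> x \<in> lattice_edges m n" "edge_mid (\<phi> x) = x" if "x \<in> midpoints m n" for x
    using edge_at_lattice[OF \<sigma> that] edge_at_lattice[OF \<tau> that] edge_at(2)[OF \<sigma> that] edge_at(2)[OF \<tau> that] by (auto simp: \<phi>_def)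
  have nc: "\<not> crosses (\<phi> x) (\<phi> y)" if xy: "x \<in> midpoints m n" "y \<in> midpoints m n" for x y
  proof -
    have 1: "\<not> crosses (edge_at \<sigma> x) (edge_at \<sigma> y)" "\<not> crosses (edge_at \<tau> x) (edge_at \<tau> y)"
      using triangulation_noncrossing \<sigma> \<tau> edge_at(1) xy by blast+
    show ?thesis using 1 C[OF xy] C[OF xy(2,1)] crosses_commute unfolding \<phi>_def by auto
  qed
  have eq: "mix m n C \<sigma> \<tau> = \<phi> ` midpoints m n" by (simp add: mix_def \<phi>_def)
  show "triangulation m n (mix m n C \<sigma> \<tau>)" unfolding eq by (rule triangulation_of_family(1)[OF \<phi> nc])
  assume x: "x \<in> midpoints m n"
  have "edge_at (mix m n C \<sigma> \<tau>) x = \<phi> x" unfolding eq by (rule triangulation_of_family(2)[OF \<phi> nc]) (use x in auto)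
  then show "edge_at (mix m n C \<sigma> \<tau>) x = (if x \<in> C then edge_at \<sigma> x else edge_at \<tau> x)" by (simp add: \<phi>_def)
qed

definition exchange :: "nat \<Rightarrow> nat \<Rightarrow> edge \<Rightarrow> edge set \<times> edge set \<Rightarrow> edge set \<times> edge set" where
  "exchange m n e z = (let C = zone m n e (fst z) (snd z) in (mix m n C (fst z) (snd z), mix m n C (snd z) (fst z)))"

text \<open>
  The same unit edges are missing after the exchange, since missing only depends on the
  unordered pair of edges at each midpoint; hence the zone does not change and the exchange is
  an involution.
\<close>

lemma exchange:
  fixes e :: edge
  assumes \<sigma>: "triangulation m n \<sigma>" and \<tau>: "triangulation m n \<tau>"
  defines "C \<equiv> zone m n e \<sigma> \<tau>"
  shows "triangulation m n (fst (exchange m n e (\<sigma>, \<tau>)))" "triangulation m n (snd (exchange m n e (\<sigma>, \<tau>)))"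
    "\<And>x. x \<in> midpoints m n \<Longrightarrow> edge_at (fst (exchange m n e (\<sigma>, \<tau>))) x = (if x \<in> C then edge_at \<sigma> x else edge_at \<tau> x)"
    "\<And>x. x \<in> midpoints m n \<Longrightarrow> edge_at (snd (exchange m n e (\<sigma>, \<tau>))) x = (if x \<in> C then edge_at \<tau> x else edge_at \<sigma> x)"
    "zone m n e (fst (exchange m n e (\<sigma>, \<tau>))) (snd (exchange m n e (\<sigma>, \<tau>))) = C"
proof -
  interpret two_triangulations m n e \<sigma> \<tau> using \<sigma> \<tau> by unfold_locales
  define \<sigma>' \<tau>' where "\<sigma>' = fst (exchange m n e (\<sigma>, \<tau>))" and "\<tau>' = snd (exchange m n e (\<sigma>, \<tau>))"
  have C1: "x \<in> C \<longleftrightarrow> y \<in> C" if "x \<in> midpoints m n" "y \<in> midpoints m n" "crosses (edge_at \<sigma> x) (edge_at \<tau> y)" for x y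
    unfolding C_def using zone_closed that by blast
  have C2: "x \<in> C \<longleftrightarrow> y \<in> C" if "x \<in> midpoints m n" "y \<in> midpoints m n" "crosses (edge_at \<tau> x) (edge_at \<sigma> y)" for x y
    using C1[of y x] that crosses_commute by blast
  have eq: "\<sigma>' = mix m n C \<sigma> \<tau>" "\<tau>' = mix m n C \<tau> \<sigma>" by (simp_all add: \<sigma>'_def \<tau>'_def exchange_def C_def Let_def)
  have t: "triangulation m n \<sigma>'" "triangulation m n \<tau>'" unfolding eq using mix(1)[OF \<sigma> \<tau> C1] mix(1)[OF \<tau> \<sigma> C2] by blast+
  have s: "edge_at \<sigma>' x = (if x \<in> C then edge_at \<sigma> x else edge_at \<tau> x)"
    "edge_at \<tau>' x = (if x \<in> C then edge_at \<tau> x else edge_at \<sigma> x)" if "x \<in> midpoints m n" for x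
    unfolding eq using mix(2)[OF \<sigma> \<tau> C1 that] mix(2)[OF \<tau> \<sigma> C2 that] by blast+
  have mis: "missing m n \<sigma>' \<tau>' u = missing m n \<sigma> \<tau> u" for u
  proof (cases "u \<in> lattice_edges m n")
    case True
    have "u \<in> T \<longleftrightarrow> edge_at T (edge_mid u) = u" if "triangulation m n T" for T
      using edge_at_iff[OF that True] by simp
    then show ?thesis using s[OF edge_mid_in_midpoints[OF True]] t \<sigma> \<tau> unfolding missing_def by auto
  next
    case False then show ?thesis by (simp add: missing_def)
  qed
  have "reach m n e \<sigma>' \<tau>' = reach m n e \<sigma> \<tau>" unfolding reach_def steps_def mis ..
  then have "zone m n e \<sigma>' \<tau>' = {x\<in>midpoints m n. \<not> (elen (edge_at \<sigma>' x) = 1 \<and> elen (edge_at \<tau>' x) = 1) \<and>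
     (\<exists>q\<in>reach m n e \<sigma> \<tau>. x \<in> csq q)}" unfolding zone_def by simp
  also have "\<dots> = C"
  proof -
    have "(elen (edge_at \<sigma>' x) = 1 \<and> elen (edge_at \<tau>' x) = 1) = (elen (edge_at \<sigma> x) = 1 \<and> elen (edge_at \<tau> x) = 1)"
      if "x \<in> midpoints m n" for x by (cases "x \<in> C") (auto simp: s[OF that])
    then show ?thesis unfolding C_def zone_def by blast
  qed
  finally have "zone m n e \<sigma>' \<tau>' = C" .
  then show "triangulation m n (fst (exchange m n e (\<sigma>, \<tau>)))" "triangulation m n (snd (exchange m n e (\<sigma>, \<tau>)))"
    "\<And>x. x \<in> midpoints m n \<Longrightarrow> edge_at (fst (exchange m n e (\<sigma>, \<tau>))) x = (if x \<in> C then edge_at \<sigma> x else edge_at \<tau> x)"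
    "\<And>x. x \<in> midpoints m n \<Longrightarrow> edge_at (snd (exchange m n e (\<sigma>, \<tau>))) x = (if x \<in> C then edge_at \<tau> x else edge_at \<sigma> x)"
    "zone m n e (fst (exchange m n e (\<sigma>, \<tau>))) (snd (exchange m n e (\<sigma>, \<tau>))) = C"
    using t s unfolding \<sigma>'_def \<tau>'_def by blast+
qed

lemma exchange_involution:
  assumes \<sigma>: "triangulation m n \<sigma>" and \<tau>: "triangulation m n \<tau>"
  shows "exchange m n e (exchange m n e (\<sigma>, \<tau>)) = (\<sigma>, \<tau>)"
proof -
  obtain \<sigma>' \<tau>' where z: "exchange m n e (\<sigma>, \<tau>) = (\<sigma>', \<tau>')" by (cases "exchange m n e (\<sigma>, \<tau>)")
  note x = exchange[OF \<sigma> \<tau>, where e = e, unfolded z fst_conv snd_conv]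
  note y = exchange[OF x(1,2), where e = e]
  have "fst (exchange m n e (\<sigma>', \<tau>')) = \<sigma>"
    by (rule triangulation_eqI[OF y(1) \<sigma>]) (simp add: y(3) x)
  moreover have "snd (exchange m n e (\<sigma>', \<tau>')) = \<tau>"
    by (rule triangulation_eqI[OF y(2) \<tau>]) (simp add: y(4) x)
  ultimately show ?thesis unfolding z by (simp add: prod_eq_iff)
qed

text \<open>
  The edge \<open>e\<close> is not a unit edge, so its own midpoint belongs to the zone.
\<close>

lemma exchange_contains:
  assumes \<sigma>: "triangulation m n \<sigma>" and \<tau>: "triangulation m n \<tau>" and e: "e \<in> \<tau>" "elen e \<noteq> 1"
  shows "e \<in> snd (exchange m n e (\<sigma>, \<tau>))"
proof -
  interpret two_triangulations m n e \<sigma> \<tau> using \<sigma> \<tau> by unfold_locales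
  have el: "e \<in> lattice_edges m n" using triangulation_lattice[OF \<tau> e(1)] .
  note x = edge_mid_in_midpoints[OF el]
  have at: "edge_at \<tau> (edge_mid e) = e" using edge_at_eqI[OF \<tau> e(1)] .
  obtain q where "edge_mid e \<in> csq q" using home_exists by blast
  then have q: "meets e q" using meets_home[OF el e(2)] by blast
  then have "q \<in> reach m n e \<sigma> \<tau>" unfolding reach_def by blast
  then have "edge_mid e \<in> zone m n e \<sigma> \<tau>" using zone_iff[OF x, of e q] at e q by simp
  then have "edge_at (snd (exchange m n e (\<sigma>, \<tau>))) (edge_mid e) = e" using exchange(4)[OF \<sigma> \<tau> x] at by simp
  then show ?thesis using edge_at(1)[OF exchange(2)[OF \<sigma> \<tau>] x] by metis
qed

section \<open>The variation distance and the exchange zone\<close>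

lemma prob_finite_support:
  assumes "finite W" "set_pmf p \<subseteq> W"
  shows "measure_pmf.prob p B = (\<Sum>x\<in>W. if x \<in> B then pmf p x else 0)"
proof -
  have "measure_pmf.prob p B = measure_pmf.prob p (B \<inter> W)"
  proof -
    have "measure_pmf.prob p B = measure_pmf.prob p (B \<inter> set_pmf p)" by (simp add: measure_Int_set_pmf)
    moreover have "measure_pmf.prob p (B \<inter> W) = measure_pmf.prob p (B \<inter> W \<inter> set_pmf p)" by (simp add: measure_Int_set_pmf)
    moreover have "B \<inter> W \<inter> set_pmf p = B \<inter> set_pmf p" using assms by blast
    ultimately show ?thesis by simp
  qed
  also have "\<dots> = (\<Sum>x\<in>B \<inter> W. pmf p x)" using assms by (intro measure_measure_pmf_finite) auto
  also have "\<dots> = (\<Sum>x\<in>W. if x \<in> B then pmf p x else 0)"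
    using assms by (simp add: sum.inter_filter[symmetric] Int_def conj_commute)
  finally show ?thesis .
qed

text \<open>
  The exchange preserves the product weight on pairs, and it turns the second marginal off the
  zone into the first one.
\<close>

lemma tv_zone:
  fixes lam :: real
  assumes lam: "lam > 0" and e: "e \<in> lattice_edges m n" "elen e \<noteq> 1" and A: "A \<subseteq> midpoints m n"
  defines "W \<equiv> {\<tau>. triangulation m n \<tau>}" and "We \<equiv> {\<tau>. triangulation m n \<tau> \<and> e \<in> \<tau>}"
    and "w \<equiv> (\<lambda>\<tau>. lam powr total_length \<tau>)"
  shows "tv_dist (marginal A (gibbs m n lam)) (marginal A (gibbs_cond m n lam (edge_mid e) e)) \<le>
    (\<Sum>z\<in>W \<times> We. if A \<inter> zone m n e (fst z) (snd z) \<noteq> {} then w (fst z) * w (snd z) else 0) / ((\<Sum>\<sigma>\<in>W. w \<sigma>) * (\<Sum>\<tau>\<in>We. w \<tau>))"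
    (is "_ \<le> ?R")
proof -
  define Z Ze where "Z = (\<Sum>\<sigma>\<in>W. w \<sigma>)" and "Ze = (\<Sum>\<tau>\<in>We. w \<tau>)"
  have finW: "finite W" unfolding W_def using finite_triangulations .
  have WeW: "We \<subseteq> W" by (auto simp: W_def We_def)
  then have finWe: "finite We" using finW finite_subset by blast
  have wpos: "w \<tau> > 0" for \<tau> using lam by (simp add: w_def)
  have "W \<noteq> {}" using triangulation_exists by (auto simp: W_def)
  then have Z: "Z > 0" unfolding Z_def using finW wpos by (intro sum_pos) auto
  have "We \<noteq> {}" using triangulation_containing_exists[OF e(1)] by (auto simp: We_def)
  then have Ze: "Ze > 0" unfolding Ze_def using finWe wpos by (intro sum_pos) auto
  define g where "g \<tau> = restrict (edge_at \<tau>) A" for \<tau>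
  have pg: "pmf (gibbs m n lam) \<tau> = (if \<tau> \<in> W then w \<tau> / Z else 0)" for \<tau>
    unfolding pmf_gibbs[OF lam] by (simp add: W_def w_def Z_def)
  have sg: "set_pmf (gibbs m n lam) \<subseteq> W" by (auto simp: set_pmf_iff pg split: if_splits)
  have P1: "measure_pmf.prob (marginal A (gibbs m n lam)) F = (\<Sum>\<sigma>\<in>W. if g \<sigma> \<in> F then w \<sigma> / Z else 0)" for F
  proof -
    have "measure_pmf.prob (marginal A (gibbs m n lam)) F = measure_pmf.prob (gibbs m n lam) (g -` F)"
      unfolding marginal_def g_def by (simp add: measure_map_pmf)
    also have "\<dots> = (\<Sum>\<sigma>\<in>W. if \<sigma> \<in> g -` F then pmf (gibbs m n lam) \<sigma> else 0)"
      by (rule prob_finite_support[OF finW sg])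
    also have "\<dots> = (\<Sum>\<sigma>\<in>W. if g \<sigma> \<in> F then w \<sigma> / Z else 0)" by (intro sum.cong) (auto simp: pg)
    finally show ?thesis .
  qed
  define ev where "ev = {T. edge_at T (edge_mid e) = e}"
  have ne: "set_pmf (gibbs m n lam) \<inter> ev \<noteq> {}" unfolding ev_def by (rule gibbs_cond_event[OF lam e(1)])
  have evW: "\<tau> \<in> ev \<longleftrightarrow> \<tau> \<in> We" if "\<tau> \<in> W" for \<tau>
    using edge_at_iff[of m n \<tau> e] that e(1) by (simp add: ev_def W_def We_def)
  have pev: "measure_pmf.prob (gibbs m n lam) ev = Ze / Z"
  proof -
    have "measure_pmf.prob (gibbs m n lam) ev = (\<Sum>\<sigma>\<in>W. if \<sigma> \<in> ev then pmf (gibbs m n lam) \<sigma> else 0)"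
      by (rule prob_finite_support[OF finW sg])
    also have "\<dots> = (\<Sum>\<sigma>\<in>W. if \<sigma> \<in> We then w \<sigma> / Z else 0)" by (intro sum.cong) (auto simp: pg evW)
    also have "\<dots> = (\<Sum>\<sigma>\<in>We. w \<sigma> / Z)" using finW WeW by (simp add: sum.inter_restrict[symmetric] inf.absorb2)
    finally show ?thesis by (simp add: Ze_def sum_divide_distrib)
  qed
  have pc: "pmf (gibbs_cond m n lam (edge_mid e) e) \<tau> = (if \<tau> \<in> We then w \<tau> / Ze else 0)" for \<tau>
  proof -
    have "pmf (gibbs_cond m n lam (edge_mid e) e) \<tau> = (if \<tau> \<in> ev then pmf (gibbs m n lam) \<tau> / (Ze / Z) else 0)"
      unfolding gibbs_cond_def ev_def[symmetric] pmf_cond[OF ne] pev ..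
    also have "\<dots> = (if \<tau> \<in> We then w \<tau> / Ze else 0)" using Z WeW by (auto simp: pg evW)
    finally show ?thesis .
  qed
  have sc: "set_pmf (gibbs_cond m n lam (edge_mid e) e) \<subseteq> We" by (auto simp: set_pmf_iff pc split: if_splits)
  have P2: "measure_pmf.prob (marginal A (gibbs_cond m n lam (edge_mid e) e)) F = (\<Sum>\<tau>\<in>We. if g \<tau> \<in> F then w \<tau> / Ze else 0)" for F
  proof -
    have "measure_pmf.prob (marginal A (gibbs_cond m n lam (edge_mid e) e)) F = measure_pmf.prob (gibbs_cond m n lam (edge_mid e) e) (g -` F)"
      unfolding marginal_def g_def by (simp add: measure_map_pmf)
    also have "\<dots> = (\<Sum>\<sigma>\<in>We. if \<sigma> \<in> g -` F then pmf (gibbs_cond m n lam (edge_mid e) e) \<sigma> else 0)"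
      by (rule prob_finite_support[OF finWe sc])
    also have "\<dots> = (\<Sum>\<sigma>\<in>We. if g \<sigma> \<in> F then w \<sigma> / Ze else 0)" by (intro sum.cong) (auto simp: pc)
    finally show ?thesis .
  qed
  define X where "X = exchange m n e"
  have Xm: "X z \<in> W \<times> We" "X (X z) = z" "w (fst (X z)) * w (snd (X z)) = w (fst z) * w (snd z)"
    "A \<inter> zone m n e (fst z) (snd z) = {} \<Longrightarrow> g (snd (X z)) = g (fst z)" if zW: "z \<in> W \<times> We" for z
  proof -
    obtain \<sigma> \<tau> where z: "z = (\<sigma>, \<tau>)" "triangulation m n \<sigma>" "triangulation m n \<tau>" "e \<in> \<tau>"
      using zW by (auto simp: W_def We_def)
    note ex = exchange[OF z(2,3), where e = e]
    show "X z \<in> W \<times> We" using ex(1,2) exchange_contains[OF z(2-4) e(2)] unfolding X_def z(1) W_def We_def mem_Times_iff by simp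
    show "X (X z) = z" unfolding X_def z(1) by (rule exchange_involution[OF z(2,3)])
    have "total_length (fst (X z)) + total_length (snd (X z)) = total_length \<sigma> + total_length \<tau>"
      unfolding X_def z(1) total_length_sum[OF ex(1)] total_length_sum[OF ex(2)] total_length_sum[OF z(2)] total_length_sum[OF z(3)]
        sum.distrib[symmetric] by (intro sum.cong) (auto simp: ex(3,4))
    then show "w (fst (X z)) * w (snd (X z)) = w (fst z) * w (snd z)"
      unfolding w_def z(1) by (simp flip: powr_add)
    show "g (snd (X z)) = g (fst z)" if Az: "A \<inter> zone m n e (fst z) (snd z) = {}"
    proof
      fix y
      show "g (snd (X z)) y = g (fst z) y"
      proof (cases "y \<in> A")
        case True
        then have "y \<in> midpoints m n" "y \<notin> zone m n e \<sigma> \<tau>" using A Az by (auto simp: z(1))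
        then have "edge_at (snd (exchange m n e (\<sigma>, \<tau>))) y = edge_at \<sigma> y" using ex(4)[of y] by simp
        then show ?thesis using True unfolding g_def X_def z(1) by simp
      qed (simp add: g_def)
    qed
  qed
  have bij: "bij_betw X (W \<times> We) (W \<times> We)"
  proof (rule bij_betw_byWitness[of _ X])
    show "\<forall>z\<in>W \<times> We. X (X z) = z" "\<forall>z\<in>W \<times> We. X (X z) = z" by (rule ballI, erule Xm(2))+
    show "X ` (W \<times> We) \<subseteq> W \<times> We" "X ` (W \<times> We) \<subseteq> W \<times> We" by (rule image_subsetI, erule Xm(1))+
  qed
  define ww where "ww z = w (fst z) * w (snd z)" for z :: "edge set \<times> edge set"
  have main: "\<bar>measure_pmf.prob (marginal A (gibbs m n lam)) F - measure_pmf.prob (marginal A (gibbs_cond m n lam (edge_mid e) e)) F\<bar> \<le> ?R" for F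
  proof -
    have s1: "(\<Sum>\<sigma>\<in>W. if g \<sigma> \<in> F then w \<sigma> / Z else 0) = (\<Sum>z\<in>W \<times> We. if g (fst z) \<in> F then ww z else 0) / (Z * Ze)"
    proof -
      have "(\<Sum>z\<in>W \<times> We. if g (fst z) \<in> F then ww z else 0) = (\<Sum>\<sigma>\<in>W. \<Sum>\<tau>\<in>We. (if g \<sigma> \<in> F then w \<sigma> else 0) * w \<tau>)"
        unfolding sum.cartesian_product by (intro sum.cong) (auto simp: ww_def)
      also have "\<dots> = (\<Sum>\<sigma>\<in>W. if g \<sigma> \<in> F then w \<sigma> else 0) * Ze" by (simp add: sum_product Ze_def)
      finally have "(\<Sum>z\<in>W \<times> We. if g (fst z) \<in> F then ww z else 0) / (Z * Ze) = (\<Sum>\<sigma>\<in>W. if g \<sigma> \<in> F then w \<sigma> else 0) / Z"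
        using Ze by simp
      also have "\<dots> = (\<Sum>\<sigma>\<in>W. if g \<sigma> \<in> F then w \<sigma> / Z else 0)"
        unfolding sum_divide_distrib by (intro sum.cong) auto
      finally show ?thesis ..
    qed
    have s2: "(\<Sum>\<tau>\<in>We. if g \<tau> \<in> F then w \<tau> / Ze else 0) = (\<Sum>z\<in>W \<times> We. if g (snd z) \<in> F then ww z else 0) / (Z * Ze)"
    proof -
      have "(\<Sum>z\<in>W \<times> We. if g (snd z) \<in> F then ww z else 0) = (\<Sum>\<sigma>\<in>W. \<Sum>\<tau>\<in>We. w \<sigma> * (if g \<tau> \<in> F then w \<tau> else 0))"
        unfolding sum.cartesian_product by (intro sum.cong) (auto simp: ww_def)
      also have "\<dots> = Z * (\<Sum>\<tau>\<in>We. if g \<tau> \<in> F then w \<tau> else 0)" by (simp add: sum_product Z_def)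
      finally have "(\<Sum>z\<in>W \<times> We. if g (snd z) \<in> F then ww z else 0) / (Z * Ze) = (\<Sum>\<tau>\<in>We. if g \<tau> \<in> F then w \<tau> else 0) / Ze"
        using Z by simp
      also have "\<dots> = (\<Sum>\<tau>\<in>We. if g \<tau> \<in> F then w \<tau> / Ze else 0)"
        unfolding sum_divide_distrib by (intro sum.cong) auto
      finally show ?thesis ..
    qed
    have "(\<Sum>z\<in>W \<times> We. if g (snd z) \<in> F then ww z else 0) = (\<Sum>z\<in>W \<times> We. if g (snd (X z)) \<in> F then ww (X z) else 0)"
      by (rule sum.reindex_bij_betw[OF bij, symmetric])
    also have "\<dots> = (\<Sum>z\<in>W \<times> We. if g (snd (X z)) \<in> F then ww z else 0)"
      using Xm(3) by (intro sum.cong) (auto simp: ww_def)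
    finally have s3: "(\<Sum>z\<in>W \<times> We. if g (snd z) \<in> F then ww z else 0) = (\<Sum>z\<in>W \<times> We. if g (snd (X z)) \<in> F then ww z else 0)" .
    have wwpos: "ww z \<ge> 0" for z using wpos by (simp add: ww_def less_imp_le)
    have "\<bar>(\<Sum>z\<in>W \<times> We. if g (fst z) \<in> F then ww z else 0) - (\<Sum>z\<in>W \<times> We. if g (snd (X z)) \<in> F then ww z else 0)\<bar>
      = \<bar>\<Sum>z\<in>W \<times> We. (if g (fst z) \<in> F then ww z else 0) - (if g (snd (X z)) \<in> F then ww z else 0)\<bar>"
      by (simp add: sum_subtractf)
    also have "\<dots> \<le> (\<Sum>z\<in>W \<times> We. \<bar>(if g (fst z) \<in> F then ww z else 0) - (if g (snd (X z)) \<in> F then ww z else 0)\<bar>)"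
      by (rule sum_abs)
    also have "\<dots> \<le> (\<Sum>z\<in>W \<times> We. if A \<inter> zone m n e (fst z) (snd z) \<noteq> {} then ww z else 0)"
      using Xm(4) wwpos by (intro sum_mono) auto
    finally have b: "\<bar>(\<Sum>z\<in>W \<times> We. if g (fst z) \<in> F then ww z else 0) - (\<Sum>z\<in>W \<times> We. if g (snd (X z)) \<in> F then ww z else 0)\<bar>
      \<le> (\<Sum>z\<in>W \<times> We. if A \<inter> zone m n e (fst z) (snd z) \<noteq> {} then ww z else 0)" .
    have "\<bar>measure_pmf.prob (marginal A (gibbs m n lam)) F - measure_pmf.prob (marginal A (gibbs_cond m n lam (edge_mid e) e)) F\<bar>
      = \<bar>(\<Sum>z\<in>W \<times> We. if g (fst z) \<in> F then ww z else 0) - (\<Sum>z\<in>W \<times> We. if g (snd (X z)) \<in> F then ww z else 0)\<bar> / (Z * Ze)"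
      unfolding P1 P2 s1 s2 s3 using Z Ze by (simp flip: diff_divide_distrib)
    also have "\<dots> \<le> (\<Sum>z\<in>W \<times> We. if A \<inter> zone m n e (fst z) (snd z) \<noteq> {} then ww z else 0) / (Z * Ze)"
      using b Z Ze by (intro divide_right_mono) auto
    finally show ?thesis unfolding ww_def Z_def Ze_def .
  qed
  show ?thesis unfolding tv_dist_def by (rule cSUP_least) (use main in auto)
qed

section \<open>Corners, sides and diagonals of a unit square\<close>

definition insq :: "nat \<Rightarrow> nat \<Rightarrow> int \<times> int \<Rightarrow> bool" where
  "insq m n q \<longleftrightarrow> 0 \<le> fst q \<and> fst q < int m \<and> 0 \<le> snd q \<and> snd q < int n"

text \<open>
  The corners of a square in counterclockwise order, starting from any of them; arguments about
  one side or one diagonal of a square then need no distinction of cases.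
\<close>

definition frames :: "int \<times> int \<Rightarrow> ((int \<times> int) \<times> (int \<times> int) \<times> (int \<times> int) \<times> (int \<times> int)) set" where
  "frames q = (let c0 = q; c1 = q + (1,0); c2 = q + (1,1); c3 = q + (0,1) in
     {(c0,c1,c2,c3), (c1,c2,c3,c0), (c2,c3,c0,c1), (c3,c0,c1,c2)})"

lemma framesE:
  assumes "(k0,k1,k2,k3) \<in> frames q"
  obtains i j where "q = (i,j)" "(k0,k1,k2,k3) = ((i,j),(i+1,j),(i+1,j+1),(i,j+1))"
  | i j where "q = (i,j)" "(k0,k1,k2,k3) = ((i+1,j),(i+1,j+1),(i,j+1),(i,j))"
  | i j where "q = (i,j)" "(k0,k1,k2,k3) = ((i+1,j+1),(i,j+1),(i,j),(i+1,j))"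
  | i j where "q = (i,j)" "(k0,k1,k2,k3) = ((i,j+1),(i,j),(i+1,j),(i+1,j+1))"
  using assms by (cases q) (auto simp: frames_def Let_def)

lemma frames_rot: "(k0,k1,k2,k3) \<in> frames q \<Longrightarrow> (k1,k2,k3,k0) \<in> frames q"
  by (auto simp: frames_def Let_def)

lemma frames_exists: "\<exists>k0 k1 k2 k3. (k0,k1,k2,k3) \<in> frames q"
  unfolding frames_def Let_def by blast

lemma frames_orient:
  assumes "(k0,k1,k2,k3) \<in> frames q"
  shows "orient k0 k1 k2 = 1" "orient k0 k2 k3 = 1" "orient k0 k1 k3 = 1" "orient k1 k2 k3 = 1"
  using assms by (auto elim!: framesE simp: orient_Pair)

lemma rp_csq: "rp x \<in> csq q \<longleftrightarrow> fst q \<le> fst x \<and> fst x \<le> fst q + 1 \<and> snd q \<le> snd x \<and> snd x \<le> snd q + 1"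
proof -
  have "(real_of_int b \<le> real_of_int a + 1) = (b \<le> a + 1)" for a b :: int by linarith
  then show ?thesis by (simp add: csq_def rp_def)
qed

lemma frames_csq:
  assumes "(k0,k1,k2,k3) \<in> frames q"
  shows "rp x \<in> csq q \<longleftrightarrow> x \<in> {k0,k1,k2,k3}"
proof -
  obtain i j where q: "q = (i,j)" by (cases q)
  obtain x1 x2 where x: "x = (x1,x2)" by (cases x)
  have "rp x \<in> csq q \<longleftrightarrow> (x1 = i \<or> x1 = i + 1) \<and> (x2 = j \<or> x2 = j + 1)"
    unfolding rp_csq q x fst_conv snd_conv by linarith
  also have "\<dots> \<longleftrightarrow> x \<in> {(i,j),(i+1,j),(i+1,j+1),(i,j+1)}" unfolding x by auto
  also have "{(i,j),(i+1,j),(i+1,j+1),(i,j+1)} = {k0,k1,k2,k3}"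
    using assms unfolding q by (auto elim!: framesE)
  finally show ?thesis .
qed

lemma frames_apex:
  assumes f: "(k0,k1,k2,k3) \<in> frames q" and o: "orient k0 k1 c = 1" and s: "rp k0 \<in> csq q'" "rp k1 \<in> csq q'" "rp c \<in> csq q'"
  shows "c = k2 \<or> c = k3"
proof -
  obtain a b where q': "q' = (a,b)" by (cases q')
  obtain c1 c2 where c: "c = (c1,c2)" by (cases c)
  show ?thesis using f o s unfolding rp_csq q' c
    by (elim framesE) (simp_all add: orient_Pair, presburger+)
qed

lemma frames_diag_square:
  assumes f: "(k0,k1,k2,k3) \<in> frames q" and s: "rp k0 \<in> csq q'" "rp k2 \<in> csq q'"
  shows "q' = q"
proof -
  obtain a b where q': "q' = (a,b)" by (cases q')
  show ?thesis using f s unfolding rp_csq q' by (elim framesE) simp_all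
qed

lemma frames_lattice:
  assumes f: "(k0,k1,k2,k3) \<in> frames q" and q: "insq m n q"
  shows "E k0 k1 \<in> lattice_edges m n" "elen (E k0 k1) = 1" "E k0 k2 \<in> lattice_edges m n" "elen (E k0 k2) = 2"
    "inbox m n k0" "edge_mid (E k0 k2) = edge_mid (E k1 k3)"
  using assms by (auto elim!: framesE simp: E_lattice_iff inbox_def insq_def elen_E len_def edge_mid_mp)

lemma frames_sep:
  assumes f: "(k0,k1,k2,k3) \<in> frames q" shows "\<exists>q'. sep (E k0 k1) q q'"
  using f
proof (cases rule: framesE)
  case (1 i j)
  have "side k0 k1 (i,j-1) q" using 1 by (auto simp: side_def)
  then show ?thesis unfolding sep_def by blast
next
  case (2 i j)
  have "side k0 k1 q (i+1,j)" using 2 by (auto simp: side_def)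
  then show ?thesis unfolding sep_def by blast
next
  case (3 i j)
  have "side k1 k0 q (i,j+1)" using 3 by (auto simp: side_def)
  then show ?thesis unfolding sep_def using E_commute by blast
next
  case (4 i j)
  have "side k1 k0 (i-1,j) q" using 4 by (auto simp: side_def)
  then show ?thesis unfolding sep_def using E_commute by blast
qed

lemma sep_frames:
  assumes "sep u q q'" shows "\<exists>k0 k1 k2 k3. (k0,k1,k2,k3) \<in> frames q \<and> u = E k0 k1"
proof -
  obtain i j where q: "q = (i,j)" by (cases q)
  obtain a b where ab: "u = E a b" "side a b q q' \<or> side a b q' q" using assms unfolding sep_def by blast
  then consider "a = (i+1,j)" "b = (i+1,j+1)" | "a = (i,j+1)" "b = (i+1,j+1)" | "a = (i,j)" "b = (i,j+1)" | "a = (i,j)" "b = (i+1,j)"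
    unfolding side_def q by (cases q') auto
  then show ?thesis
  proof cases
    case 1
    have "((i+1,j),(i+1,j+1),(i,j+1),(i,j)) \<in> frames q" by (simp add: frames_def Let_def q)
    then show ?thesis using 1 ab(1) by blast
  next
    case 2
    have "((i+1,j+1),(i,j+1),(i,j),(i+1,j)) \<in> frames q" by (simp add: frames_def Let_def q)
    then show ?thesis using 2 ab(1) E_commute by blast
  next
    case 3
    have "((i,j+1),(i,j),(i+1,j),(i+1,j+1)) \<in> frames q" by (simp add: frames_def Let_def q)
    then show ?thesis using 3 ab(1) E_commute by blast
  next
    case 4
    have "((i,j),(i+1,j),(i+1,j+1),(i,j+1)) \<in> frames q" by (simp add: frames_def Let_def q)
    then show ?thesis using 4 ab(1) by blast
  qed
qed

lemma closed_triangle: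
  assumes abc: "orientR a b c = 1" and x: "orientR a b x \<ge> 0" "orientR b c x \<ge> 0" "orientR c a x \<ge> 0"
  shows "x \<in> convex hull {a, b, c}"
proof -
  have "orientR b c x + orientR c a x + orientR a b x = 1" using orientR_sum[of a b x c] abc by simp
  then show ?thesis unfolding convex_hull_3
    using x by (intro CollectI exI[of _ "orientR b c x"] exI[of _ "orientR c a x"] exI[of _ "orientR a b x"])
      (simp add: barycentric[OF abc, of x, symmetric])
qed

lemma square_halves:
  assumes f: "(k0,k1,k2,k3) \<in> frames q"
  shows "x \<in> csq q \<Longrightarrow> x \<in> convex hull {rp k0, rp k1, rp k2} \<or> x \<in> convex hull {rp k0, rp k2, rp k3}"
    "x \<in> osq q \<Longrightarrow> x \<in> interior (convex hull {rp k0, rp k1, rp k2}) \<or> x \<in> interior (convex hull {rp k0, rp k2, rp k3})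
       \<or> x \<in> convex hull (E k0 k2)"
proof -
  have o: "orientR (rp k0) (rp k1) (rp k2) = 1" "orientR (rp k0) (rp k2) (rp k3) = 1"
    using frames_orient[OF f] by (simp_all add: orientR_rp)
  have diag: "orientR (rp k0) (rp k2) x = - orientR (rp k2) (rp k0) x" for x by (simp add: orientR_def algebra_simps)
  obtain x1 x2 where xx: "x = (x1,x2)" by (cases x)
  have pos: "(x \<in> csq q \<longrightarrow> orientR (rp k0) (rp k1) x \<ge> 0 \<and> orientR (rp k1) (rp k2) x \<ge> 0 \<and> orientR (rp k2) (rp k3) x \<ge> 0 \<and> orientR (rp k3) (rp k0) x \<ge> 0)
     \<and> (x \<in> osq q \<longrightarrow> orientR (rp k0) (rp k1) x > 0 \<and> orientR (rp k1) (rp k2) x > 0 \<and> orientR (rp k2) (rp k3) x > 0 \<and> orientR (rp k3) (rp k0) x > 0)"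
    using f by (elim framesE) (auto simp: xx csq_def osq_def orientR_def rp_def)
  show "x \<in> convex hull {rp k0, rp k1, rp k2} \<or> x \<in> convex hull {rp k0, rp k2, rp k3}" if "x \<in> csq q"
  proof (cases "orientR (rp k2) (rp k0) x \<ge> 0")
    case True
    then show ?thesis using closed_triangle[OF o(1)] pos that by blast
  next
    case False
    then have "orientR (rp k0) (rp k2) x \<ge> 0" using diag[of x] by simp
    then show ?thesis using closed_triangle[OF o(2)] pos that by blast
  qed
  show "x \<in> interior (convex hull {rp k0, rp k1, rp k2}) \<or> x \<in> interior (convex hull {rp k0, rp k2, rp k3})
       \<or> x \<in> convex hull (E k0 k2)" if "x \<in> osq q"
  proof -
    consider "orientR (rp k2) (rp k0) x > 0" | "orientR (rp k0) (rp k2) x > 0" | "orientR (rp k2) (rp k0) x = 0"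
      using diag[of x] by linarith
    then show ?thesis
    proof cases
      case 1
      then show ?thesis unfolding interior_triangle[OF o(1)] using pos that by blast
    next
      case 2
      then show ?thesis unfolding interior_triangle[OF o(2)] using pos that by blast
    next
      case 3
      have "x = orientR (rp k1) (rp k2) x *\<^sub>R rp k0 + orientR (rp k0) (rp k1) x *\<^sub>R rp k2"
        using barycentric[OF o(1), of x] 3 by simp
      moreover have "orientR (rp k1) (rp k2) x + orientR (rp k0) (rp k1) x = 1"
        using orientR_sum[of "rp k0" "rp k1" x "rp k2"] 3 o by simp
      then have "orientR (rp k1) (rp k2) x = 1 - orientR (rp k0) (rp k1) x" by simp
      ultimately have "x = (1 - orientR (rp k0) (rp k1) x) *\<^sub>R rp k0 + orientR (rp k0) (rp k1) x *\<^sub>R rp k2" by simp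
      moreover have "orientR (rp k0) (rp k1) x > 0" "orientR (rp k0) (rp k1) x < 1"
        using pos that \<open>orientR (rp k1) (rp k2) x = 1 - _\<close> by auto
      ultimately show ?thesis unfolding hull_E in_segment by (metis less_imp_le)
    qed
  qed
qed

lemma unit_diagonal_frames:
  assumes f: "(k0,k1,k2,k3) \<in> frames q" and g: "g \<in> lattice_edges m n" "elen g \<le> 2" "edge_mid g = edge_mid (E k0 k2)"
  shows "g = E k0 k2 \<or> g = E k1 k3"
proof -
  obtain p r where pr: "g = E p r" using g(1) by (rule lattice_edgeE)
  obtain p1 p2 r1 r2 where c: "p = (p1,p2)" "r = (r1,r2)" by (cases p; cases r) auto
  have "len (r - p) \<le> 2" using g(2) unfolding pr elen_E by simp
  then have l: "\<bar>r1 - p1\<bar> + \<bar>r2 - p2\<bar> \<le> 2" by (simp add: len_def c)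
  have s: "p + r = k0 + k2" using g(3) unfolding pr edge_mid_mp by simp
  obtain i j where ij: "q = (i,j)" by (cases q)
  have k: "k0 + k2 = (2 * i + 1, 2 * j + 1)" using f ij by (auto elim!: framesE)
  then have s': "p1 + r1 = 2 * i + 1" "p2 + r2 = 2 * j + 1" using s by (auto simp: c)
  have "\<bar>r1 - p1\<bar> \<le> 1" "\<bar>r2 - p2\<bar> \<le> 1" using l odd_sum_gap[OF s'(1)] odd_sum_gap[OF s'(2)] by linarith+
  then have "(p1 = i \<and> r1 = i + 1 \<or> p1 = i + 1 \<and> r1 = i) \<and> (p2 = j \<and> r2 = j + 1 \<or> p2 = j + 1 \<and> r2 = j)"
    using odd_sum_neighbours s' by blast
  then show ?thesis using f ij unfolding pr c by (elim framesE) (auto simp: E_eq_iff)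
qed

text \<open>
  A segment through the open square has two opposite corners on different sides, and they are
  joined by a diagonal.
\<close>

lemma meets_crosses_diagonal:
  assumes e: "e \<in> lattice_edges m n" and mt: "meets e q" and f: "(k0,k1,k2,k3) \<in> frames q" and q: "insq m n q"
  shows "crosses e (E k0 k2) \<or> crosses e (E k1 k3)"
proof -
  obtain i j where ij: "q = (i,j)" by (cases q)
  have rising: "xcross p r (q + (1,0)) (q + (0,1))" if "meets (E p r) q" "fst p < fst r" "snd p < snd r" for p r q
  proof -
    obtain p1 p2 r1 r2 i j where c: "p = (p1,p2)" "r = (r1,r2)" "q = (i,j)" by (cases p; cases r; cases q) auto
    have u: "under p r q" using meets_under that by blast
    then have b: "p1 \<le> i" "i < r1" "p2 \<le> j" "j < r2" by (auto simp: under_def c)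
    have "orient (i+1,j) (i,j+1) p > 0" "orient (i+1,j) (i,j+1) r < 0" using b by (auto simp: orient_Pair c algebra_simps)
    then show ?thesis using u unfolding xcross_def under_def by (simp add: c mult_less_0_iff)
  qed
  have right: "xcross p r (i+1,j) (i,j+1) \<or> xcross p r (i,j) (i+1,j+1)" if "meets (E p r) q" "fst p < fst r" for p r
  proof (cases "snd p < snd r")
    case True then show ?thesis using rising[OF that True] by (simp add: ij)
  next
    case False
    then have "snd r < snd p" using meets_diff(2)[OF that(1)] by simp
    then have "xcross (mir p) (mir r) (mirq q + (1,0)) (mirq q + (0,1))"
      using rising[OF meets_mir[OF that(1)]] that(2) by (simp add: mir_def)
    moreover have "mirq q + (1,0) = mir (i+1,j+1)" "mirq q + (0,1) = mir (i,j)" by (simp_all add: ij mir_def mirq_def)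
    ultimately show ?thesis using xcross_mir xcross_rev by metis
  qed
  obtain p r where pr: "e = E p r" using e by (rule lattice_edgeE)
  have "xcross p r (i+1,j) (i,j+1) \<or> xcross p r (i,j) (i+1,j+1)"
  proof (cases "fst p < fst r")
    case True then show ?thesis using right mt pr by blast
  next
    case False
    moreover have "fst p \<noteq> fst r" using meets_diff(1)[of p r q] mt pr by simp
    ultimately have "fst r < fst p" by linarith
    then have "xcross r p (i+1,j) (i,j+1) \<or> xcross r p (i,j) (i+1,j+1)" using right[of r p] mt pr E_commute by metis
    then show ?thesis by (simp add: xcross_rev)
  qed
  moreover have "(k0,k2) \<in> {((i,j),(i+1,j+1)), ((i+1,j+1),(i,j))} \<and> (k1,k3) \<in> {((i+1,j),(i,j+1)), ((i,j+1),(i+1,j))}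
     \<or> (k1,k3) \<in> {((i,j),(i+1,j+1)), ((i+1,j+1),(i,j))} \<and> (k0,k2) \<in> {((i+1,j),(i,j+1)), ((i,j+1),(i+1,j))}"
    using f ij by (auto elim!: framesE)
  ultimately have "xcross p r k0 k2 \<or> xcross p r k1 k3" by (auto simp: xcross_rev)
  moreover have "E k0 k2 \<in> lattice_edges m n" "E k1 k3 \<in> lattice_edges m n"
    using frames_lattice(3)[OF f q] frames_lattice(3)[OF frames_rot[OF f] q] by auto
  ultimately show ?thesis using e crosses_E unfolding pr by blast
qed

lemma osq_insq:
  assumes "x \<in> osq q" "x \<in> rect m n" shows "insq m n q"
proof -
  have "real_of_int (fst q) < fst x" "fst x < real_of_int (fst q) + 1" "real_of_int (snd q) < snd x" "snd x < real_of_int (snd q) + 1"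
    "0 \<le> fst x" "fst x \<le> real m" "0 \<le> snd x" "snd x \<le> real n" using assms by (auto simp: osq_def rect_def)
  then show ?thesis unfolding insq_def by linarith
qed

lemma meets_insq: "e \<in> lattice_edges m n \<Longrightarrow> meets e q \<Longrightarrow> insq m n q"
  using osq_insq hull_rect unfolding meets_def by blast

context minimal_triangulation
begin

text \<open>
  A minimal triangulation is shortest at every midpoint, and a unit edge is the only shortest
  one at its midpoint.
\<close>

lemma unit_in:
  assumes "u \<in> lattice_edges m n" "elen u = 1" "compatible \<Delta> u"
  shows "u \<in> S"
proof -
  note x = edge_mid_in_midpoints[OF assms(1)]
  note f = edge_at[OF tri x]
  have "elen (edge_at S (edge_mid u)) \<le> 1" using compatible_longer[OF f(1) assms(1) _ assms(3)] f(2) assms(2) by simp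
  moreover have "elen (edge_at S (edge_mid u)) \<noteq> 0"
  proof -
    obtain p q where pq: "edge_at S (edge_mid u) = E p q" "prim (q - p)" using lat[OF f(1)] by (rule lattice_edgeE)
    then have "q - p \<noteq> 0" by auto
    then show ?thesis unfolding pq elen_E using len_pos[of "q - p"] by simp
  qed
  ultimately have "elen (edge_at S (edge_mid u)) = 1" by simp
  then have "edge_at S (edge_mid u) = u" using unit_edge_unique[OF lat[OF f(1)] assms(1)] assms(2) f(2) by simp
  then show ?thesis using f(1) by simp
qed

lemma diagonal_in:
  assumes f: "(k0,k1,k2,k3) \<in> frames q" and q: "insq m n q" and c: "compatible \<Delta> (E k0 k2)"
  shows "E k0 k2 \<in> S \<or> E k1 k3 \<in> S"
proof -
  note l = frames_lattice[OF f q]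
  note x = edge_mid_in_midpoints[OF l(3)]
  note g = edge_at[OF tri x]
  have "elen (edge_at S (edge_mid (E k0 k2))) \<le> 2" using compatible_longer[OF g(1) l(3) _ c] g(2) l(4) by simp
  then show ?thesis using unit_diagonal_frames[OF f lat[OF g(1)] _ g(2)] g(1) by metis
qed

end

section \<open>The influence region\<close>

lemma utri_closure:
  assumes "utri S t"
  shows "closure (interior (convex hull t)) = convex hull t" "compact (convex hull t)" "interior (convex hull t) \<noteq> {}"
proof -
  obtain p q r where t: "t = {rp p, rp q, rp r}" "orient p q r = 1" using assms by (auto simp: utri_def)
  have o: "orientR (rp p) (rp q) (rp r) = 1" using t by (simp add: orientR_rp)
  show c: "compact (convex hull t)" unfolding t by (intro compact_convex_hull) auto
  have "(1/3) *\<^sub>R rp p + (1/3) *\<^sub>R rp q + (1/3) *\<^sub>R rp r \<in> interior (convex hull t)"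
    unfolding t interior_convex_hull_3_minimal[OF noncollinear[of "rp p" "rp q" "rp r", unfolded o, OF one_neq_zero] dim_point]
    by (intro CollectI exI[of _ "1/3"] conjI refl) simp_all
  then have "interior (convex hull t) \<noteq> {}" by blast
  then show "interior (convex hull t) \<noteq> {}" "closure (interior (convex hull t)) = convex hull t"
    using convex_closure_interior[OF convex_convex_hull] closure_closed[OF compact_imp_closed[OF c]] by auto
qed

text \<open>
  Finitely many segments have no interior points, so almost every point of a triangle lies off
  the ground state edges.
\<close>

lemma interior_Union_segments:
  assumes "finite F" "\<And>g. g \<in> F \<Longrightarrow> g \<in> lattice_edges m n"
  shows "interior (\<Union>g\<in>F. convex hull g) = {} \<and> closed (\<Union>g\<in>F. convex hull g)"
  using assms
proof (induction F)
  case (insert g F)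
  obtain p q where g: "g = E p q" using insert.prems[of g] by (auto elim: lattice_edgeE)
  have "interior (convex hull g) = {}" unfolding g hull_E by (rule interior_closed_segment_ge2) simp
  moreover have "closed (convex hull g)" unfolding g hull_E by simp
  ultimately show ?case using insert interior_closed_Un_empty_interior[of "convex hull g" "\<Union>g\<in>F. convex hull g"] by auto
qed simp

locale influence =
  G: minimal_triangulation m n "{}" G + S: minimal_triangulation m n "{e}" S for m n G S e +
  assumes el: "e \<in> lattice_edges m n" and eG: "e \<notin> G" and mn: "m \<ge> 1" "n \<ge> 1"
begin

text \<open>
  The union of the ground state triangles whose interior is met by \<open>e\<close>; it is shown
  to be the influence region.
\<close>

definition U :: "point set" where
  "U = (\<Union>t\<in>{t. utri G t \<and> convex hull e \<inter> interior (convex hull t) \<noteq> {}}. convex hull t)"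

lemma eS: "e \<in> S" using S.sub by simp

lemma finite_utri: "finite {t. utri G t}"
proof -
  have "{t. utri G t} \<subseteq> Pow (\<Union>G)" by (auto simp: utri_def E_def)
  moreover have "finite g" if "g \<in> G" for g
    using G.lat[OF that] by (rule lattice_edgeE) (simp add: E_def)
  then have "finite (\<Union>G)" using G.finite_S by blast
  ultimately show ?thesis using finite_subset by auto
qed

lemma compact_U: "compact U"
  unfolding U_def using finite_utri utri_closure(2) by (intro compact_UN) auto

text \<open>
  A point of \<open>e\<close> on a ground state edge is a crossing point, where \<open>e\<close>
  enters an adjacent triangle. All other points lie in open unit squares, which the ground state
  divides into two triangles.
\<close>

lemma e_cases:
  assumes P: "P \<in> convex hull e" "\<And>c. P \<noteq> rp c"
  shows "P \<in> U"
proof -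
  have Pr: "P \<in> rect m n" using P hull_rect[OF el] by blast
  have crossing: "P \<in> U" if g: "g \<in> G" "P \<in> convex hull g" for g
  proof -
    have gl: "g \<in> lattice_edges m n" using G.lat g by blast
    obtain a b where ab: "g = E a b" using gl by (rule lattice_edgeE)
    have "P \<notin> g" using P(2) by (auto simp: ab E_def)
    then have cr: "crosses e g" using g P(1) eG unfolding crosses_def by auto
    obtain p r where pr: "e = E p r" "inbox m n p" "inbox m n r" using el by (rule lattice_edgeE)
    have "xcross p r a b" using cr el gl crosses_E unfolding ab pr(1) by blast
    then have "orient a b p > 0 \<or> orient a b r > 0" by (auto simp: xcross_def mult_less_0_iff)
    then obtain w where "inbox m n w" "orient a b w > 0" using pr(2,3) by blast
    then obtain c where c: "E a c \<in> G" "E b c \<in> G" "orient a b c = 1" using apex_exists[OF G.tri] g(1) ab by metis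
    define t where "t = {rp a, rp b, rp c}"
    have t: "utri G t" unfolding utri_def t_def using c g ab by blast
    have "convex hull e \<inter> interior (convex hull t) \<noteq> {}" unfolding t_def
      using crosses_meets_triangle[OF el _ _ c(3)] gl cr ab by simp
    moreover have "convex hull g \<subseteq> convex hull t" unfolding ab E_def t_def by (intro hull_mono) auto
    ultimately show ?thesis using t g(2) unfolding U_def by blast
  qed
  show ?thesis
  proof (cases "\<exists>g\<in>G. P \<in> convex hull g")
    case True then show ?thesis using crossing by blast
  next
    case False
    have ugrid: "u \<in> G" if "u \<in> lattice_edges m n" "elen u = 1" for u using G.unit_in that by (simp add: compatible_def)
    from point_on_grid[OF Pr P(2)] obtain q where q: "P \<in> osq q"
      using False ugrid sep_elen by blast
    have iq: "insq m n q" using osq_insq[OF q Pr] .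
    obtain l0 l1 l2 l3 where "(l0,l1,l2,l3) \<in> frames q" using frames_exists by blast
    then obtain k0 k1 k2 k3 where f: "(k0,k1,k2,k3) \<in> frames q" "E k0 k2 \<in> G"
      using G.diagonal_in[OF _ iq] frames_rot unfolding compatible_def by blast
    note f2 = frames_rot[OF f(1)] note f3 = frames_rot[OF f2] note f4 = frames_rot[OF f3]
    have sides: "E k0 k1 \<in> G" "E k1 k2 \<in> G" "E k2 k3 \<in> G" "E k3 k0 \<in> G"
      using frames_lattice(1,2)[OF f(1) iq] frames_lattice(1,2)[OF f2 iq] frames_lattice(1,2)[OF f3 iq] frames_lattice(1,2)[OF f4 iq] ugrid by auto
    have "utri G {rp k0, rp k1, rp k2}" "utri G {rp k0, rp k2, rp k3}"
      unfolding utri_def using frames_orient(1,2)[OF f(1)] sides f(2) E_commute by metis+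
    moreover have "P \<in> interior (convex hull {rp k0, rp k1, rp k2}) \<or> P \<in> interior (convex hull {rp k0, rp k2, rp k3})"
      using square_halves(2)[OF f(1) q] False f(2) by blast
    ultimately obtain t where "utri G t" "P \<in> interior (convex hull t)" by blast
    then show ?thesis using P(1) interior_subset unfolding U_def by blast
  qed
qed

lemma e_subset_U: "convex hull e \<subseteq> U"
proof -
  obtain p r where pr: "e = E p r" "prim (r - p)" using el by (rule lattice_edgeE)
  have ne: "rp p \<noteq> rp r" using pr by auto
  have "open_segment (rp p) (rp r) \<subseteq> U"
  proof
    fix P assume P: "P \<in> open_segment (rp p) (rp r)"
    then have "P \<in> convex hull e" "P \<noteq> rp p" "P \<noteq> rp r" unfolding pr hull_E by (auto simp: open_segment_def)
    moreover have "P \<noteq> rp c" for c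
      using calculation rp_in_prim_segment[OF pr(2), of c] unfolding pr(1) hull_E by blast
    ultimately show "P \<in> U" using e_cases by blast
  qed
  then have "closure (open_segment (rp p) (rp r)) \<subseteq> U" using compact_imp_closed[OF compact_U] by (rule closure_minimal)
  then show ?thesis unfolding pr hull_E using ne by (simp add: closure_open_segment)
qed

lemma utri_frontier:
  assumes "utri G t" shows "frontier (convex hull t) \<subseteq> (\<Union>g\<in>G. convex hull g)"
proof -
  obtain p q r where t: "t = {rp p, rp q, rp r}" "E p q \<in> G" "E q r \<in> G" "E p r \<in> G" using assms by (auto simp: utri_def)
  have "frontier (convex hull t) = convex hull (E p q) \<union> convex hull (E q r) \<union> convex hull (E p r)"
    unfolding t(1) frontier_of_triangle[OF dim_point] hull_E by (simp add: closed_segment_commute)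
  then show ?thesis using t by blast
qed

lemma region_U: "ground_state_region G U"
proof -
  have cl: "closed U" using compact_imp_closed[OF compact_U] .
  have 1: "closure (interior U) = U"
  proof
    show "closure (interior U) \<subseteq> U" using cl interior_subset closure_minimal by metis
    show "U \<subseteq> closure (interior U)"
    proof
      fix x assume "x \<in> U"
      then obtain t where t: "utri G t" "convex hull t \<subseteq> U" "x \<in> convex hull t" unfolding U_def by blast
      have "x \<in> closure (interior (convex hull t))" using utri_closure(1)[OF t(1)] t(3) by simp
      then show "x \<in> closure (interior U)" using closure_mono[OF interior_mono[OF t(2)]] by blast
    qed
  qed
  have 2: "frontier U \<subseteq> (\<Union>g\<in>G. convex hull g)"
  proof
    fix x assume x: "x \<in> frontier U"
    then have "x \<in> U" using cl frontier_subset_closed by blast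
    then obtain t where t: "utri G t" "convex hull t \<subseteq> U" "x \<in> convex hull t" unfolding U_def by blast
    have "x \<notin> interior (convex hull t)" using x interior_mono[OF t(2)] by (auto simp: frontier_def)
    then have "x \<in> frontier (convex hull t)" using t(3) closure_subset by (auto simp: frontier_def)
    then show "x \<in> (\<Union>g\<in>G. convex hull g)" using utri_frontier[OF t(1)] by blast
  qed
  show ?thesis unfolding ground_state_region_def using 1 2 compact_imp_bounded[OF compact_U] by blast
qed

text \<open>
  The interior of a triangle of the ground state is connected and avoids the boundary of every
  ground state region, hence lies in the region as soon as it meets the region.
\<close>

lemma U_least:
  assumes R: "ground_state_region G R" "convex hull e \<subseteq> R" shows "U \<subseteq> R"
proof -
  have cR: "closed R" using R(1) unfolding ground_state_region_def by (metis closed_closure)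
  have "convex hull t \<subseteq> R" if t: "utri G t" "convex hull e \<inter> interior (convex hull t) \<noteq> {}" for t
  proof -
    have "interior (convex hull t) \<inter> frontier R = {}"
      using utri_interior_avoids[OF G.tri t(1)] R(1) unfolding ground_state_region_def by blast
    moreover have "connected (interior (convex hull t))"
      by (intro convex_connected convex_interior convex_convex_hull)
    moreover have "interior (convex hull t) \<inter> R \<noteq> {}" using t(2) R(2) by blast
    ultimately have "interior (convex hull t) \<subseteq> R" using connected_Int_frontier by blast
    then have "closure (interior (convex hull t)) \<subseteq> R" using cR by (rule closure_minimal)
    then show ?thesis using utri_closure(1)[OF t(1)] by simp
  qed
  then show ?thesis unfolding U_def by blast
qed

lemma influence_region_U: "influence_region G e = U"
proof -
  have "edge_at G (edge_mid e) \<noteq> e" using edge_at_iff[OF G.tri el] eG by simp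
  moreover have "(LEAST R. ground_state_region G R \<and> convex hull e \<subseteq> R) = U"
    by (rule Least_equality) (use region_U e_subset_U U_least in auto)
  ultimately show ?thesis by (simp add: influence_region_def)
qed

text \<open>
  The interior of \<open>t\<close> is connected and avoids the edges of \<open>S\<close>, in
  particular the boundary of the given triangle.
\<close>

lemma utri_trapped:
  assumes t: "utri S t" and x: "x \<in> interior (convex hull t)" "x \<in> interior (convex hull {rp a, rp b, rp c})"
    and s: "E a b \<in> S" "E b c \<in> S" "E c a \<in> S"
  shows "convex hull t \<subseteq> convex hull {rp a, rp b, rp c}"
proof -
  have "frontier (convex hull {rp a, rp b, rp c}) = convex hull (E a b) \<union> convex hull (E b c) \<union> convex hull (E c a)"
    unfolding frontier_of_triangle[OF dim_point] hull_E ..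
  then have "interior (convex hull t) \<inter> frontier (convex hull {rp a, rp b, rp c}) = {}"
    using utri_interior_avoids[OF S.tri t] s by blast
  moreover have "connected (interior (convex hull t))"
    by (intro convex_connected convex_interior convex_convex_hull)
  moreover have "interior (convex hull t) \<inter> convex hull {rp a, rp b, rp c} \<noteq> {}" using x interior_subset by blast
  ultimately have "interior (convex hull t) \<subseteq> convex hull {rp a, rp b, rp c}" using connected_Int_frontier by blast
  moreover have "closed (convex hull {rp a, rp b, rp c})" by (intro compact_imp_closed compact_convex_hull) auto
  ultimately have "closure (interior (convex hull t)) \<subseteq> convex hull {rp a, rp b, rp c}" by (rule closure_minimal)
  then show ?thesis using utri_closure(1)[OF t] by simp
qed

lemma half_in_csq:
  assumes "(k0,k1,k2,k3) \<in> frames q" "{a,b,c} \<subseteq> {k0,k1,k2,k3}"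
  shows "convex hull {rp a, rp b, rp c} \<subseteq> csq q"
proof (rule hull_minimal)
  show "{rp a, rp b, rp c} \<subseteq> csq q" using frames_csq[OF assms(1)] assms(2) by auto
  have "csq q = {real_of_int (fst q)..real_of_int (fst q) + 1} \<times> {real_of_int (snd q)..real_of_int (snd q) + 1}"
    by (auto simp: csq_def)
  then show "convex (csq q)" by (simp add: convex_Times)
qed

lemma unit_in_S: "u \<in> lattice_edges m n \<Longrightarrow> elen u = 1 \<Longrightarrow> \<not> crosses e u \<Longrightarrow> u \<in> S"
  using S.unit_in crosses_commute by (auto simp: compatible_def)

text \<open>
  Suppose that a point of the interior lies off the ground state edges and outside
  \<open>U\<close>. It lies in a half square of the ground state that is not met by
  \<open>e\<close>. The sides of this half then belong to \<open>S\<close>, or the square is cut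
  by its other diagonal in \<open>S\<close>; in both cases \<open>t\<close> is trapped in half
  of the square. So almost all of the interior lies in \<open>U\<close>.
\<close>

lemma utri_small_or_influenced:
  assumes t: "utri S t" and ns: "\<And>q. \<not> t \<subseteq> csq q"
  shows "convex hull t \<subseteq> U"
proof -
  define K where "K = (\<Union>g\<in>G. convex hull g)"
  define O' where "O' = interior (convex hull t)"
  have K: "interior K = {}" "closed K" unfolding K_def using interior_Union_segments[OF G.finite_S G.lat] by auto
  have "t \<subseteq> rect m n"
  proof -
    obtain p q r where pqr: "t = {rp p, rp q, rp r}" "E p q \<in> S" "E q r \<in> S" using t by (auto simp: utri_def)
    then show ?thesis using S.lat[of "E p q"] S.lat[of "E q r"] by (auto simp: E_lattice_iff rp_rect)
  qed
  then have tr: "convex hull t \<subseteq> rect m n" using convex_rect by (rule hull_minimal)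
  have trap: "\<not> convex hull t \<subseteq> csq q" for q using ns hull_subset[of t convex] by blast
  have main: "x \<in> U" if x: "x \<in> O' - K" for x
  proof (rule ccontr)
    assume xU: "x \<notin> U"
    have xi: "x \<in> interior (convex hull t)" "x \<in> rect m n" using x tr interior_subset unfolding O'_def by blast+
    have ugrid: "u \<in> G" if "u \<in> lattice_edges m n" "elen u = 1" for u using G.unit_in that by (simp add: compatible_def)
    have nl: "x \<noteq> rp c" for c
    proof -
      obtain p q r where pqr: "t = {rp p, rp q, rp r}" "orient p q r = 1" using t by (auto simp: utri_def)
      show ?thesis using interior_no_lattice[OF pqr(2), of c] xi(1) pqr(1) by blast
    qed
    from point_on_grid[OF xi(2) nl] obtain q where q: "x \<in> osq q"
      using x ugrid sep_elen unfolding K_def by blast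
    have iq: "insq m n q" using osq_insq[OF q xi(2)] .
    obtain l0 l1 l2 l3 where "(l0,l1,l2,l3) \<in> frames q" using frames_exists by blast
    then obtain k0 k1 k2 k3 where f: "(k0,k1,k2,k3) \<in> frames q" "E k0 k2 \<in> G"
      using G.diagonal_in[OF _ iq] frames_rot unfolding compatible_def by blast
    \<comment> \<open>rotate the square so that the point lies in the first half of the ground state\<close>
    have half: False if f: "(k0,k1,k2,k3) \<in> frames q" and dG: "E k0 k2 \<in> G"
      and xh: "x \<in> interior (convex hull {rp k0, rp k1, rp k2})" for k0 k1 k2 k3
    proof -
      note f2 = frames_rot[OF f] note f3 = frames_rot[OF f2] note f4 = frames_rot[OF f3]
      note o = frames_orient(1)[OF f]
      have l: "E k0 k1 \<in> lattice_edges m n" "elen (E k0 k1) = 1" "E k1 k2 \<in> lattice_edges m n" "elen (E k1 k2) = 1"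
        "E k2 k3 \<in> lattice_edges m n" "elen (E k2 k3) = 1" "E k3 k0 \<in> lattice_edges m n" "elen (E k3 k0) = 1"
        "E k0 k2 \<in> lattice_edges m n" "E k1 k3 \<in> lattice_edges m n"
        using frames_lattice(1,2,3)[OF f iq] frames_lattice(1,2,3)[OF f2 iq] frames_lattice(1,2)[OF f3 iq] frames_lattice(1,2)[OF f4 iq] by auto
      have tG: "utri G {rp k0, rp k1, rp k2}" unfolding utri_def using o dG ugrid l(1-4) by blast
      have nm: "convex hull e \<inter> interior (convex hull {rp k0, rp k1, rp k2}) = {}"
        using tG xh xU interior_subset unfolding U_def by blast
      have o2: "orient k1 k2 k0 = 1" "orient k2 k0 k1 = 1" using o orient_rot by metis+
      have c1: "\<not> crosses e (E k0 k1)" using crosses_meets_triangle[OF el l(1) _ o] nm by blast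
      have c2: "\<not> crosses e (E k1 k2)" using crosses_meets_triangle[OF el l(3) _ o2(1)] nm by (auto simp: insert_commute)
      have "E k2 k0 \<in> lattice_edges m n" using l(9) E_commute by metis
      then have c3: "\<not> crosses e (E k2 k0)" using crosses_meets_triangle[OF el _ _ o2(2)] nm by (auto simp: insert_commute)
      have s: "E k0 k1 \<in> S" "E k1 k2 \<in> S" using unit_in_S l c1 c2 by auto
      have "compatible {e} (E k0 k2)" using c3 crosses_commute E_commute unfolding compatible_def by (metis singletonD)
      then have d: "E k0 k2 \<in> S \<or> E k1 k3 \<in> S" using S.diagonal_in[OF f iq] by blast
      show False
      proof (cases "E k0 k2 \<in> S")
        case True
        then have "E k2 k0 \<in> S" using E_commute by metis
        then have "convex hull t \<subseteq> convex hull {rp k0, rp k1, rp k2}" using utri_trapped[OF t xi(1) xh s] by blast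
        then show False using half_in_csq[OF f, of k0 k1 k2] trap by blast
      next
        case False
        then have d': "E k1 k3 \<in> S" using d by blast
        have nmq: "\<not> meets e q"
        proof
          assume "meets e q"
          then have "crosses e (E k0 k2) \<or> crosses e (E k1 k3)" using meets_crosses_diagonal[OF el _ f iq] by blast
          moreover have "\<not> crosses e (E k1 k3)" using triangulation_noncrossing[OF S.tri eS d'] .
          moreover have "\<not> crosses e (E k0 k2)" using c3 E_commute by metis
          ultimately show False by blast
        qed
        have nc: "\<not> crosses e (E a b)" if "(a,b,c,d) \<in> frames q" "E a b \<in> lattice_edges m n" for a b c d
          using frames_sep[OF that(1)] crosses_side_meets(1)[OF el that(2)] nmq by blast
        have s2: "E k2 k3 \<in> S" "E k3 k0 \<in> S" using unit_in_S l nc f3 f4 by auto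
        have "x \<in> interior (convex hull {rp k1, rp k2, rp k3}) \<or> x \<in> interior (convex hull {rp k1, rp k3, rp k0}) \<or> x \<in> convex hull (E k1 k3)"
          by (rule square_halves(2)[OF f2 q])
        moreover have "x \<notin> convex hull (E k1 k3)" using utri_interior_avoids[OF S.tri t d'] xi(1) by blast
        moreover have "E k3 k1 \<in> S" using d' E_commute by metis
        ultimately have "convex hull t \<subseteq> convex hull {rp k1, rp k2, rp k3} \<or> convex hull t \<subseteq> convex hull {rp k1, rp k3, rp k0}"
          using utri_trapped[OF t xi(1) _ s(2) s2(1)] utri_trapped[OF t xi(1) _ d' s2(2) s(1)] by blast
        then show False using half_in_csq[OF f, of k1 k2 k3] half_in_csq[OF f, of k1 k3 k0] trap by blast
      qed
    qed
    have "x \<notin> convex hull (E k0 k2)" using x f(2) unfolding K_def by blast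
    then have "x \<in> interior (convex hull {rp k0, rp k1, rp k2}) \<or> x \<in> interior (convex hull {rp k0, rp k2, rp k3})"
      using square_halves(2)[OF f(1) q] by blast
    then show False
    proof
      assume "x \<in> interior (convex hull {rp k0, rp k1, rp k2})" then show False using half f by blast
    next
      assume "x \<in> interior (convex hull {rp k0, rp k2, rp k3})"
      then have "x \<in> interior (convex hull {rp k2, rp k3, rp k0})" by (simp add: insert_commute)
      moreover have "(k2,k3,k0,k1) \<in> frames q" using frames_rot frames_rot f(1) by blast
      moreover have "E k2 k0 \<in> G" using f(2) E_commute by metis
      ultimately show False using half by blast
    qed
  qed
  have "O' \<subseteq> closure (O' - K)"
  proof
    fix x assume x: "x \<in> O'"
    show "x \<in> closure (O' - K)"
    proof (rule ccontr)
      assume nx: "x \<notin> closure (O' - K)"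
      define V where "V = O' \<inter> - closure (O' - K)"
      have "open V" unfolding V_def O'_def by (intro open_Int) auto
      moreover have "V \<subseteq> K" using closure_subset[of "O' - K"] unfolding V_def by blast
      ultimately have "V \<subseteq> interior K" by (simp add: interior_maximal)
      then show False using x nx K(1) unfolding V_def by blast
    qed
  qed
  also have "\<dots> \<subseteq> U" using main compact_imp_closed[OF compact_U] by (intro closure_minimal) auto
  finally have "closure O' \<subseteq> U" using compact_imp_closed[OF compact_U] by (rule closure_minimal)
  then show ?thesis unfolding O'_def using utri_closure(1)[OF t] by simp
qed

end

section \<open>Chains of missing unit edges\<close>

text \<open>
  Unit edges whose midpoint shares a square with \<open>x\<close>.
\<close>

definition nbrs :: "nat \<Rightarrow> nat \<Rightarrow> point \<Rightarrow> edge set" where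
  "nbrs m n x = {u\<in>lattice_edges m n. elen u = 1 \<and> (\<exists>q. x \<in> csq q \<and> edge_mid u \<in> csq q)}"

primrec chains :: "nat \<Rightarrow> nat \<Rightarrow> nat \<Rightarrow> point \<Rightarrow> edge list set" where
  "chains m n 0 x = {[]}"
| "chains m n (Suc k) x = {u # us |u us. u \<in> nbrs m n x \<and> us \<in> chains m n k (edge_mid u)}"

lemma chains_take: "us \<in> chains m n k x \<Longrightarrow> j \<le> k \<Longrightarrow> take j us \<in> chains m n j x"
proof (induction k arbitrary: j us x)
  case (Suc k)
  then obtain u vs where us: "us = u # vs" "u \<in> nbrs m n x" "vs \<in> chains m n k (edge_mid u)" by auto
  show ?case
  proof (cases j)
    case (Suc i)
    then have "take i vs \<in> chains m n i (edge_mid u)" using Suc.IH[OF us(3)] Suc.prems(2) by simp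
    then show ?thesis using us Suc by simp
  qed simp
qed simp

lemma chains_length: "us \<in> chains m n k x \<Longrightarrow> length us = k"
proof (induction k arbitrary: us x)
  case (Suc k)
  then obtain u vs where "us = u # vs" "vs \<in> chains m n k (edge_mid u)" by auto
  then show ?case using Suc.IH[of vs "edge_mid u"] by simp
qed simp

lemma osq_csq_unique: "x \<in> osq q \<Longrightarrow> x \<in> csq q' \<Longrightarrow> q' = q"
proof -
  assume a: "x \<in> osq q" "x \<in> csq q'"
  then have "real_of_int (fst q) < real_of_int (fst q') + 1" "real_of_int (fst q') < real_of_int (fst q) + 1"
    "real_of_int (snd q) < real_of_int (snd q') + 1" "real_of_int (snd q') < real_of_int (snd q) + 1"
    unfolding osq_def csq_def mem_Collect_eq by linarith+
  then have "fst q' = fst q" "snd q' = snd q" by linarith+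
  then show ?thesis by (simp add: prod_eq_iff)
qed

lemma frames_mid:
  assumes "(k0,k1,k2,k3) \<in> frames q"
  shows "edge_mid (E k0 k1) \<in> csq q" "edge_mid (E k0 k2) \<in> osq q"
  using assms by (auto elim!: framesE simp: edge_mid_mp mp_csq mp_osq)

lemma sep_mid: "sep u q q' \<Longrightarrow> edge_mid u \<in> csq q"
  using sep_frames[of u q q'] frames_mid(1) by blast

lemma sep_unique:
  assumes "sep u q q'" "sep u a b" shows "q = a \<or> q = b"
proof -
  obtain c d where cd: "u = E c d" "side c d q q' \<or> side c d q' q" using assms(1) unfolding sep_def by blast
  obtain c' d' where cd': "u = E c' d'" "side c' d' a b \<or> side c' d' b a" using assms(2) unfolding sep_def by blast
  have "c = c' \<and> d = d' \<or> c = d' \<and> d = c'" using cd(1) cd'(1) by (metis E_eq_iff)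
  then show ?thesis using cd(2) cd'(2)
    by (cases q; cases q'; cases a; cases b) (auto simp: side_def)
qed

lemma frames_frames:
  assumes "(k0,k1,k2,k3) \<in> frames q" "(l0,l1,l2,l3) \<in> frames q"
  shows "E l0 l1 \<in> {E k0 k1, E k1 k2, E k2 k3, E k3 k0}"
  using assms by (auto simp: frames_def Let_def)

lemma edge_in_square:
  assumes g: "g \<in> lattice_edges m n" "g \<subseteq> csq q"
  shows "elen g = 1 \<or> elen g = 2 \<and> edge_mid g \<in> osq q"
proof -
  obtain p r where pr: "g = E p r" "prim (r - p)" using g(1) by (rule lattice_edgeE)
  obtain i j where q: "q = (i,j)" by (cases q)
  obtain p1 p2 r1 r2 where c: "p = (p1,p2)" "r = (r1,r2)" by (cases p; cases r) auto
  have "rp p \<in> csq q" "rp r \<in> csq q" using g(2) unfolding pr E_def by auto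
  then have b: "p1 = i \<or> p1 = i + 1" "p2 = j \<or> p2 = j + 1" "r1 = i \<or> r1 = i + 1" "r2 = j \<or> r2 = j + 1"
    unfolding rp_csq c q fst_conv snd_conv by linarith+
  have "r \<noteq> p" using pr(2) by auto
  then show ?thesis using b unfolding pr(1) elen_E edge_mid_mp mp_osq by (auto simp: c q len_def)
qed

lemma missing_insq:
  assumes \<sigma>: "triangulation m n \<sigma>" and \<tau>: "triangulation m n \<tau>" and u: "missing m n \<sigma> \<tau> u" "sep u q q'"
  shows "insq m n q"
proof -
  have ul: "u \<in> lattice_edges m n" using u(1) by (simp add: missing_def)
  have *: "insq m n q" if T: "triangulation m n T" "u \<notin> T" for T
  proof -
    note x = edge_mid_in_midpoints[OF ul]
    note g = edge_at[OF T(1) x]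
    note gl = triangulation_lattice[OF T(1) g(1)]
    have "edge_at T (edge_mid u) \<noteq> u" using g(1) T(2) by auto
    then have "crosses (edge_at T (edge_mid u)) u" using same_mid_crosses[OF gl ul] g(2) by simp
    then have "meets (edge_at T (edge_mid u)) q" using crosses_side_meets(1)[OF gl ul u(2)] by blast
    then show ?thesis using meets_insq[OF gl] by blast
  qed
  show ?thesis using u(1) *[OF \<sigma>] *[OF \<tau>] unfolding missing_def by blast
qed

lemma edge_in_utri:
  assumes S: "triangulation m n S" and mn: "m \<ge> 1" "n \<ge> 1" and g: "g \<in> S"
  shows "\<exists>t. utri S t \<and> g \<subseteq> t"
proof -
  have gl: "g \<in> lattice_edges m n" using triangulation_lattice[OF S g] .
  obtain p r where pr: "g = E p r" "prim (r - p)" using gl by (rule lattice_edgeE)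
  have tri: "\<exists>t. utri S t \<and> E a b \<subseteq> t" if ab: "E a b \<in> S" and w: "inbox m n w" "orient a b w > 0" for a b w
  proof -
    obtain c where c: "E a c \<in> S" "E b c \<in> S" "orient a b c = 1" using apex_exists[OF S ab w] by blast
    have "utri S {rp a, rp b, rp c}" unfolding utri_def using c ab by blast
    moreover have "E a b \<subseteq> {rp a, rp b, rp c}" by (simp add: E_def)
    ultimately show ?thesis by blast
  qed
  obtain p1 p2 r1 r2 where c: "p = (p1,p2)" "r = (r1,r2)" by (cases p; cases r) auto
  have ib: "inbox m n (0,0)" "inbox m n (int m,0)" "inbox m n (0,int n)" by (simp_all add: inbox_def)
  have "\<exists>w. inbox m n w \<and> orient p r w \<noteq> 0"
  proof (rule ccontr)
    assume "\<not> ?thesis"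
    then have z: "orient p r (0,0) = 0" "orient p r (int m,0) = 0" "orient p r (0,int n) = 0" using ib by blast+
    have "(r2 - p2) * int m = 0" "(r1 - p1) * int n = 0" using z by (auto simp: orient_Pair c algebra_simps)
    then have "r2 = p2" "r1 = p1" using mn by auto
    then show False using pr(2) by (simp add: c)
  qed
  then obtain w where w: "inbox m n w" "orient p r w \<noteq> 0" by blast
  show ?thesis
  proof (cases "orient p r w > 0")
    case True then show ?thesis using tri[of p r w] w g pr(1) by blast
  next
    case False
    then have "orient r p w > 0" using w(2) orient_swap[of r p w] by simp
    moreover have "E r p \<in> S" "E r p = g" using g pr(1) E_commute by metis+
    ultimately show ?thesis using tri[of r p w] w(1) by metis
  qed
qed

context influence
begin

text \<open>
  The triangle \<open>t\<close> is at distance at most \<open>k\<close> from the influence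
  region, and \<open>near k v\<close> says this of some triangle at the edge \<open>v\<close>.
\<close>

definition dist_le :: "nat \<Rightarrow> point set \<Rightarrow> bool" where
  "dist_le k t \<longleftrightarrow> (\<exists>j\<le>k. \<exists>t0. utri S t0 \<and> convex hull t0 \<subseteq> U \<and> (t0, t) \<in> triangle_adj S ^^ j)"

definition near :: "nat \<Rightarrow> edge \<Rightarrow> bool" where
  "near k v \<longleftrightarrow> (\<exists>t. utri S t \<and> v \<subseteq> t \<and> dist_le k t)"

lemma dist_le_0: "utri S t \<Longrightarrow> convex hull t \<subseteq> U \<Longrightarrow> dist_le k t"
  unfolding dist_le_def by (intro exI[of _ 0] exI[of _ t] conjI) auto

lemma dist_le_step:
  assumes "dist_le k t" "utri S t" "utri S t'" "d \<in> S" "d \<subseteq> t" "d \<subseteq> t'"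
  shows "dist_le (Suc k) t'"
proof -
  obtain j t0 where j: "j \<le> k" "utri S t0" "convex hull t0 \<subseteq> U" "(t0, t) \<in> triangle_adj S ^^ j"
    using assms(1) unfolding dist_le_def by blast
  show ?thesis
  proof (cases "t = t'")
    case True
    then show ?thesis using j unfolding dist_le_def by (intro exI[of _ j] exI[of _ t0]) auto
  next
    case False
    then have "(t, t') \<in> triangle_adj S" unfolding triangle_adj_def using assms utri_triangles[OF S.tri] by blast
    then have "(t0, t') \<in> triangle_adj S ^^ Suc j" using j(4) by auto
    then show ?thesis unfolding dist_le_def using j(1-3) by (intro exI[of _ "Suc j"] exI[of _ t0]) auto
  qed
qed

lemma near_dist:
  assumes "near k (edge_at S z)" "z \<in> A" shows "influence_dist G S A e \<le> k"
proof -
  obtain t j t0 where t: "utri S t" "edge_at S z \<subseteq> t" "j \<le> k" "utri S t0" "convex hull t0 \<subseteq> U" "(t0, t) \<in> triangle_adj S ^^ j"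
    using assms(1) unfolding near_def dist_le_def by blast
  define X where "X = {t \<in> triangles S. convex hull t \<subseteq> influence_region G e}"
  define Y where "Y = {t \<in> triangles S. \<exists>z\<in>A. edge_at S z \<subseteq> t}"
  have "t0 \<in> X" "t \<in> Y" unfolding X_def Y_def influence_region_U using t utri_triangles[OF S.tri] assms(2) by auto
  then have "(LEAST k. \<exists>t\<in>X. \<exists>t'\<in>Y. (t, t') \<in> triangle_adj S ^^ k) \<le> j" using t(6) by (intro Least_le) blast
  then show ?thesis unfolding influence_dist_def X_def[symmetric] Y_def[symmetric] triangle_set_dist_def using t(3) by simp
qed

lemma unit_in_G: "u \<in> lattice_edges m n \<Longrightarrow> elen u = 1 \<Longrightarrow> u \<in> G"
  using G.unit_in by (simp add: compatible_def)

lemma split_square: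
  assumes f: "(k0,k1,k2,k3) \<in> frames q"
    and s: "E k0 k1 \<in> T" "E k1 k2 \<in> T" "E k2 k3 \<in> T" "E k3 k0 \<in> T" "E k0 k2 \<in> T"
  shows "utri T {rp k0, rp k1, rp k2}" "utri T {rp k0, rp k2, rp k3}"
  unfolding utri_def using frames_orient(1,2)[OF f] s E_commute by metis+

text \<open>
  Since both halves belong to \<open>S\<close>, the edge \<open>e\<close> can meet the square
  only as its diagonal. As \<open>e\<close> is not in the ground state, the ground state
  contains the other diagonal, and \<open>e\<close> meets the two halves on either side of it.
\<close>

lemma square_influenced:
  assumes f: "(k0,k1,k2,k3) \<in> frames q" and mt: "meets e q"
    and t: "utri S {rp k0, rp k1, rp k2}" "utri S {rp k0, rp k2, rp k3}" and d: "E k0 k2 \<in> S"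
  shows "csq q \<subseteq> U"
proof -
  have iq: "insq m n q" using meets_insq[OF el mt] .
  note f2 = frames_rot[OF f] note f3 = frames_rot[OF f2] note f4 = frames_rot[OF f3]
  obtain x where x: "x \<in> convex hull e" "x \<in> osq q" using mt unfolding meets_def by blast
  have "x \<in> convex hull (E k0 k2)"
    using square_halves(2)[OF f x(2)] utri_interior_avoids[OF S.tri t(1) eS] utri_interior_avoids[OF S.tri t(2) eS] x(1) by blast
  moreover have "x \<notin> e"
  proof
    assume xe: "x \<in> e"
    obtain p r where "e = E p r" using el by (rule lattice_edgeE)
    then obtain c where c: "x = rp c" using xe unfolding E_def by blast
    have "fst q < fst c" "real_of_int (fst c) < real_of_int (fst q + 1)" using x(2) unfolding c osq_def rp_def by auto
    then show False by linarith
  qed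
  moreover have "\<not> crosses e (E k0 k2)" using triangulation_noncrossing[OF S.tri eS d] .
  ultimately have eq: "e = E k0 k2" using x(1) unfolding crosses_def by blast
  have "E k1 k3 \<in> G" using G.diagonal_in[OF f iq] eG eq by (auto simp: compatible_def)
  moreover have units: "E k0 k1 \<in> G" "E k1 k2 \<in> G" "E k2 k3 \<in> G" "E k3 k0 \<in> G"
    using frames_lattice(1,2)[OF f iq] frames_lattice(1,2)[OF f2 iq] frames_lattice(1,2)[OF f3 iq]
      frames_lattice(1,2)[OF f4 iq] unit_in_G by auto
  ultimately have tG: "utri G {rp k1, rp k2, rp k3}" "utri G {rp k1, rp k3, rp k0}"
    using split_square[OF f2] by auto
  have cr: "crosses e (E k1 k3)"
    using meets_crosses_diagonal[OF el mt f iq] \<open>\<not> crosses e (E k0 k2)\<close> by blast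
  have l: "E k1 k3 \<in> lattice_edges m n" using frames_lattice(3)[OF f2 iq] .
  have "orient k1 k3 k0 = 1" using frames_orient(2)[OF f2] .
  then have m1: "convex hull e \<inter> interior (convex hull {rp k1, rp k3, rp k0}) \<noteq> {}"
    using crosses_meets_triangle[OF el l cr] by blast
  have "orient k3 k1 k2 = 1" using frames_orient(2)[OF f4] .
  then have "convex hull e \<inter> interior (convex hull {rp k3, rp k1, rp k2}) \<noteq> {}"
    using crosses_meets_triangle[OF el, of k3 k1 k2] l cr E_commute by metis
  moreover have "{rp k3, rp k1, rp k2} = {rp k1, rp k2, rp k3}" by auto
  ultimately have m2: "convex hull e \<inter> interior (convex hull {rp k1, rp k2, rp k3}) \<noteq> {}" by simp
  have "convex hull {rp k1, rp k2, rp k3} \<subseteq> U" "convex hull {rp k1, rp k3, rp k0} \<subseteq> U"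
    unfolding U_def using tG m1 m2 by blast+
  then show ?thesis using square_halves(1)[OF f2] by blast
qed

text \<open>
  Otherwise the triangles on both sides of the diagonal are small and therefore the two halves
  of the square, which then lies in the influence region.
\<close>

lemma diagonal_influenced:
  assumes f: "(k0,k1,k2,k3) \<in> frames q" and mt: "meets e q" and d: "E k0 k2 \<in> S"
  shows "\<exists>t. utri S t \<and> E k0 k2 \<subseteq> t \<and> convex hull t \<subseteq> U"
proof (rule ccontr)
  assume no: "\<not> ?thesis"
  have iq: "insq m n q" using meets_insq[OF el mt] .
  have half: "utri S {rp a, rp c, rp d}" if g: "(a,b,c,d) \<in> frames q" and ac: "E a c \<in> S" "E a c = E k0 k2" for a b c d
  proof -
    note g2 = frames_rot[OF g] note g3 = frames_rot[OF g2] note g4 = frames_rot[OF g3]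
    have "orient a c d > 0" using frames_orient(2)[OF g] by simp
    then obtain r where r: "E a r \<in> S" "E c r \<in> S" "orient a c r = 1"
      using apex_exists[OF S.tri ac(1) frames_lattice(5)[OF g4 iq]] by blast
    define t where "t = {rp a, rp c, rp r}"
    have t: "utri S t" "E k0 k2 \<subseteq> t" unfolding utri_def t_def ac(2)[symmetric] using r ac(1) by (blast, simp add: E_def)
    then obtain q' where q': "t \<subseteq> csq q'" using utri_small_or_influenced no by blast
    then have "q' = q" using frames_diag_square[OF g] by (auto simp: t_def)
    then have "r \<in> {a,b,c,d}" using q' frames_csq[OF g] by (auto simp: t_def)
    moreover have "orient a c b = -1" using frames_orient(1)[OF g3] frames_orient(2)[OF g2] frames_orient(1)[OF g]
      by (metis orient_rot orient_swap)
    ultimately have "r = d" using r(3) by (auto simp: orient_def det_def)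
    then show ?thesis using t(1) t_def by simp
  qed
  have 1: "utri S {rp k0, rp k2, rp k3}" using half[OF f d] by simp
  have f3: "(k2,k3,k0,k1) \<in> frames q" using frames_rot[OF frames_rot[OF f]] .
  have "E k2 k0 \<in> S" "E k2 k0 = E k0 k2" using d E_commute by metis+
  then have "utri S {rp k2, rp k0, rp k1}" using half[OF f3] by simp
  moreover have "{rp k2, rp k0, rp k1} = {rp k0, rp k1, rp k2}" by auto
  ultimately have 2: "utri S {rp k0, rp k1, rp k2}" by simp
  have "convex hull {rp k0, rp k2, rp k3} \<subseteq> U"
    using square_influenced[OF f mt 2 1 d] half_in_csq[OF f, of k0 k2 k3] by blast
  then show False using no 1 by (auto simp: E_def)
qed

text \<open>
  The triangle at the side \<open>u\<close> towards the square lies in the influence region or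
  has a diagonal of the square as a side.
\<close>

lemma side_near:
  assumes u: "u \<in> S" and s: "sep u q q'" and mt: "meets e q"
  shows "near 1 u"
proof -
  have iq: "insq m n q" using meets_insq[OF el mt] .
  obtain k0 k1 k2 k3 where f: "(k0,k1,k2,k3) \<in> frames q" and uk: "u = E k0 k1" using sep_frames[OF s] by blast
  note f2 = frames_rot[OF f] note f3 = frames_rot[OF f2] note f4 = frames_rot[OF f3]
  have "orient k0 k1 k2 > 0" using frames_orient(1)[OF f] by simp
  then obtain c where c: "E k0 c \<in> S" "E k1 c \<in> S" "orient k0 k1 c = 1"
    using apex_exists[OF S.tri _ frames_lattice(5)[OF f3 iq]] u uk by blast
  define t where "t = {rp k0, rp k1, rp c}"
  have t: "utri S t" "u \<subseteq> t" unfolding utri_def t_def uk using c u uk by (blast, simp add: E_def)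
  show ?thesis
  proof (cases "\<exists>q'. t \<subseteq> csq q'")
    case False
    then have "convex hull t \<subseteq> U" using utri_small_or_influenced[OF t(1)] by blast
    then show ?thesis using t dist_le_0 unfolding near_def by blast
  next
    case True
    then have "c = k2 \<or> c = k3" using frames_apex[OF f c(3)] by (auto simp: t_def)
    then obtain d t' where d: "d \<in> S" "d \<subseteq> t" "utri S t'" "d \<subseteq> t'" "convex hull t' \<subseteq> U"
    proof
      assume ck: "c = k2"
      have "E k0 k2 \<subseteq> t" by (simp add: t_def ck E_def)
      then show ?thesis using that diagonal_influenced[OF f mt] c(1) ck by blast
    next
      assume ck: "c = k3"
      have "E k1 k3 \<subseteq> t" by (simp add: t_def ck E_def)
      then show ?thesis using that diagonal_influenced[OF f2 mt] c(2) ck by blast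
    qed
    then have "dist_le (Suc 0) t" using dist_le_step[OF dist_le_0[OF d(3,5)] d(3) t(1) d(1) d(4,2)] by blast
    then show ?thesis using t unfolding near_def by auto
  qed
qed

lemma same_mid: "u \<in> S \<Longrightarrow> v \<in> S \<Longrightarrow> edge_mid u = edge_mid v \<Longrightarrow> u = v"
  using edge_at_eqI[OF S.tri] by metis

text \<open>
  The sides and one of the diagonals of a square not met by \<open>e\<close> do not cross
  \<open>e\<close>, hence they belong to \<open>S\<close>.
\<close>

lemma unmet_square:
  assumes iq: "insq m n q" and nm: "\<not> meets e q"
  obtains h1 h2 d where "utri S h1" "utri S h2" "d \<in> S" "d \<subseteq> h1" "d \<subseteq> h2"
    "\<And>v. v \<in> S \<Longrightarrow> edge_mid v \<in> csq q \<Longrightarrow> v \<subseteq> h1 \<or> v \<subseteq> h2"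
proof -
  have sides: "E a b \<in> S" if g: "(a,b,c,d) \<in> frames q" for a b c d
  proof -
    note l = frames_lattice(1,2)[OF g iq]
    obtain q' where "sep (E a b) q q'" using frames_sep[OF g] by blast
    then have "\<not> crosses e (E a b)" using crosses_side_meets(1)[OF el l(1)] nm by blast
    then show ?thesis using unit_in_S l by blast
  qed
  obtain l0 l1 l2 l3 where l: "(l0,l1,l2,l3) \<in> frames q" using frames_exists by blast
  have "\<not> crosses e (E l0 l2)"
  proof
    assume cr: "crosses e (E l0 l2)"
    have "E l0 l2 \<in> lattice_edges m n" "orient l0 l2 l3 = 1" using frames_lattice(3)[OF l iq] frames_orient(2)[OF l] by auto
    then have "convex hull e \<inter> interior (convex hull {rp l0, rp l2, rp l3}) \<noteq> {}" using crosses_meets_triangle[OF el _ cr] by blast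
    moreover have "interior (convex hull {rp l0, rp l2, rp l3}) \<subseteq> osq q"
      using \<open>orient l0 l2 l3 = 1\<close> by (rule half_square_subset) (use frames_csq[OF l] rp_csq in blast)
    ultimately show False using nm unfolding meets_def by blast
  qed
  then have "compatible {e} (E l0 l2)" unfolding compatible_def using crosses_commute by blast
  then have "E l0 l2 \<in> S \<or> E l1 l3 \<in> S" using S.diagonal_in[OF l iq] by blast
  then obtain k0 k1 k2 k3 where f: "(k0,k1,k2,k3) \<in> frames q" "E k0 k2 \<in> S" using l frames_rot by blast
  note f2 = frames_rot[OF f(1)] note f3 = frames_rot[OF f2] note f4 = frames_rot[OF f3]
  note t = split_square[OF f(1) sides[OF f(1)] sides[OF f2] sides[OF f3] sides[OF f4] f(2)]
  have cover: "v \<subseteq> {rp k0, rp k1, rp k2} \<or> v \<subseteq> {rp k0, rp k2, rp k3}" if v: "v \<in> S" "edge_mid v \<in> csq q" for v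
  proof -
    have vm: "edge_mid v \<in> midpoints m n" using edge_mid_in_midpoints[OF S.lat[OF v(1)]] .
    have "v \<in> {E k0 k1, E k1 k2, E k2 k3, E k3 k0, E k0 k2}"
    proof (cases "edge_mid v \<in> osq q")
      case True
      obtain p r where pr: "v = E p r" using S.lat[OF v(1)] by (rule lattice_edgeE)
      have "edge_mid v = edge_mid (E k0 k2)" using True frames_mid(2)[OF f(1)]
        unfolding pr edge_mid_mp mp_osq by simp
      then show ?thesis using same_mid[OF v(1) f(2)] by blast
    next
      case False
      obtain w q' where w: "w \<in> lattice_edges m n" "sep w q q'" "edge_mid w = edge_mid v"
        using midpoint_on_side[OF vm v(2) False] by blast
      have "\<exists>l0 l1 l2 l3. (l0,l1,l2,l3) \<in> frames q \<and> w = E l0 l1" using sep_frames[OF w(2)] .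
      then have "w \<in> S" "w \<in> {E k0 k1, E k1 k2, E k2 k3, E k3 k0}" using sides frames_frames[OF f(1)] by blast+
      then show ?thesis using same_mid[OF v(1) _ w(3)[symmetric]] by blast
    qed
    then show ?thesis by (auto simp: E_def)
  qed
  have "E k0 k2 \<subseteq> {rp k0, rp k1, rp k2}" "E k0 k2 \<subseteq> {rp k0, rp k2, rp k3}" by (auto simp: E_def)
  then show thesis using that[OF t(1,2) f(2)] cover by blast
qed

lemma near_across:
  assumes iq: "insq m n q" and nm: "\<not> meets e q" and u: "near k u" "u \<in> S" "edge_mid u \<in> csq q"
    and v: "v \<in> S" "edge_mid v \<in> csq q"
  shows "near (Suc (Suc k)) v"
proof -
  obtain h1 h2 d where h: "utri S h1" "utri S h2" "d \<in> S" "d \<subseteq> h1" "d \<subseteq> h2"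
    and c: "\<And>v. v \<in> S \<Longrightarrow> edge_mid v \<in> csq q \<Longrightarrow> v \<subseteq> h1 \<or> v \<subseteq> h2"
    using unmet_square[OF iq nm] by blast
  obtain t where t: "utri S t" "u \<subseteq> t" "dist_le k t" using u(1) unfolding near_def by blast
  have up: "dist_le (Suc j) s" if "dist_le j s" for j s using that unfolding dist_le_def by (meson le_SucI)
  have "dist_le (Suc (Suc k)) h1 \<and> dist_le (Suc (Suc k)) h2"
    using c[OF u(2,3)]
  proof
    assume "u \<subseteq> h1"
    then have w: "dist_le (Suc k) h1" using dist_le_step[OF t(3,1) h(1) u(2) t(2)] by blast
    then show ?thesis using dist_le_step[OF w h(1,2,3,4,5)] up by blast
  next
    assume "u \<subseteq> h2"
    then have w: "dist_le (Suc k) h2" using dist_le_step[OF t(3,1) h(2) u(2) t(2)] by blast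
    then show ?thesis using dist_le_step[OF w h(2,1,3,5,4)] up by blast
  qed
  then show ?thesis using c[OF v] h(1,2) unfolding near_def by blast
qed

text \<open>
  The number of steps from the square \<open>q\<close> to the nearest square met by
  \<open>e\<close>.
\<close>

definition lvl :: "edge set \<Rightarrow> edge set \<Rightarrow> nat \<Rightarrow> int \<times> int \<Rightarrow> bool" where
  "lvl \<sigma> \<tau> k q \<longleftrightarrow> (\<exists>q'. meets e q' \<and> (q, q') \<in> steps m n \<sigma> \<tau> ^^ k) \<and>
     (\<forall>j<k. \<not> (\<exists>q'. meets e q' \<and> (q, q') \<in> steps m n \<sigma> \<tau> ^^ j))"

lemma lvl_unique: "lvl \<sigma> \<tau> i q \<Longrightarrow> lvl \<sigma> \<tau> j q \<Longrightarrow> i = j"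
  unfolding lvl_def by (metis linorder_neqE_nat)

lemma lvl_0: "lvl \<sigma> \<tau> 0 q \<longleftrightarrow> meets e q"
  unfolding lvl_def by auto

lemma lvl_Suc:
  assumes "lvl \<sigma> \<tau> (Suc k) q"
  shows "\<not> meets e q" "\<exists>q'. (q, q') \<in> steps m n \<sigma> \<tau> \<and> lvl \<sigma> \<tau> k q'"
proof -
  show "\<not> meets e q" using assms lvl_0 lvl_unique by blast
  obtain r where r: "meets e r" "(q, r) \<in> steps m n \<sigma> \<tau> ^^ Suc k" using assms unfolding lvl_def by blast
  obtain q' where q': "(q, q') \<in> steps m n \<sigma> \<tau>" "(q', r) \<in> steps m n \<sigma> \<tau> ^^ k" using relpow_Suc_D2[OF r(2)] by blast
  have "False" if j: "j < k" "meets e s" "(q', s) \<in> steps m n \<sigma> \<tau> ^^ j" for j s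
  proof -
    have "(q, s) \<in> steps m n \<sigma> \<tau> ^^ Suc j" using relpow_Suc_I2[OF q'(1) j(3)] .
    then show False using assms j(1,2) unfolding lvl_def by (meson Suc_mono)
  qed
  then have "lvl \<sigma> \<tau> k q'" unfolding lvl_def using q'(2) r(1) by blast
  then show "\<exists>q'. (q, q') \<in> steps m n \<sigma> \<tau> \<and> lvl \<sigma> \<tau> k q'" using q'(1) by blast
qed

lemma reach_lvl:
  assumes "q \<in> reach m n e \<sigma> \<tau>" shows "\<exists>k. lvl \<sigma> \<tau> k q"
proof -
  obtain q0 where q0: "meets e q0" "(q0, q) \<in> (steps m n \<sigma> \<tau>)\<^sup>*" using assms unfolding reach_def by blast
  then have "(q, q0) \<in> (steps m n \<sigma> \<tau>)\<^sup>*" using steps_sym by blast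
  then obtain k where "(q, q0) \<in> steps m n \<sigma> \<tau> ^^ k" using rtrancl_imp_relpow by blast
  then have ex: "\<exists>k. \<exists>q'. meets e q' \<and> (q, q') \<in> steps m n \<sigma> \<tau> ^^ k" using q0(1) by blast
  then show ?thesis unfolding lvl_def using exists_least_iff[of "\<lambda>k. \<exists>q'. meets e q' \<and> (q, q') \<in> steps m n \<sigma> \<tau> ^^ k"] by blast
qed

text \<open>
  Follow a shortest path. The level decreases by one in each step, so an edge separating two
  squares of the path cannot occur again later. Each square on the way is not met by
  \<open>e\<close>, and \<open>near_across\<close> adds two steps for it.
\<close>

lemma chain_exists:
  assumes \<sigma>: "triangulation m n \<sigma>" and \<tau>: "triangulation m n \<tau>" and q: "lvl \<sigma> \<tau> (Suc k) q"
  shows "\<exists>u us. (\<forall>z. z \<in> csq q \<longrightarrow> u # us \<in> chains m n (Suc k) z) \<and> distinct (u # us) \<and>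
    (\<forall>v\<in>set (u # us). missing m n \<sigma> \<tau> v \<and> \<not> crosses e v \<and> (\<exists>a b i j. sep v a b \<and> lvl \<sigma> \<tau> i a \<and> lvl \<sigma> \<tau> j b \<and> i \<le> Suc k \<and> j \<le> Suc k)) \<and>
    edge_mid u \<in> csq q \<and> near (2 * k + 1) u"
  using q
proof (induction k arbitrary: q)
  case (0 q)
  obtain q' u where u: "missing m n \<sigma> \<tau> u" "sep u q q'" "lvl \<sigma> \<tau> 0 q'"
    using lvl_Suc(2)[OF 0] unfolding steps_def by blast
  have ul: "u \<in> lattice_edges m n" "elen u = 1" using u(1) by (auto simp: missing_def)
  have nc: "\<not> crosses e u" using crosses_side_meets(1)[OF el ul(1) u(2)] lvl_Suc(1)[OF 0] by blast
  have uS: "u \<in> S" using unit_in_S[OF ul nc] .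
  have s': "sep u q' q" using u(2) sep_commute by blast
  have mt: "meets e q'" using u(3) lvl_0 by blast
  have "near 1 u" using side_near[OF uS s' mt] .
  moreover have "\<forall>z. z \<in> csq q \<longrightarrow> [u] \<in> chains m n (Suc 0) z"
    using ul sep_mid[OF u(2)] by (auto simp: nbrs_def)
  moreover have "\<exists>a b i j. sep u a b \<and> lvl \<sigma> \<tau> i a \<and> lvl \<sigma> \<tau> j b \<and> i \<le> Suc 0 \<and> j \<le> Suc 0"
    using u(2,3) 0 by blast
  ultimately show ?case using u(1) nc sep_mid[OF u(2)] by (intro exI[of _ u] exI[of _ "[]"]) auto
next
  case (Suc k q)
  obtain q' u where u: "missing m n \<sigma> \<tau> u" "sep u q q'" "lvl \<sigma> \<tau> (Suc k) q'"
    using lvl_Suc(2)[OF Suc.prems] unfolding steps_def by blast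
  have ul: "u \<in> lattice_edges m n" "elen u = 1" using u(1) by (auto simp: missing_def)
  have nc: "\<not> crosses e u" using crosses_side_meets(1)[OF el ul(1) u(2)] lvl_Suc(1)[OF Suc.prems] by blast
  have uS: "u \<in> S" using unit_in_S[OF ul nc] .
  have s': "sep u q' q" using u(2) sep_commute by blast
  obtain v vs where v: "\<And>z. z \<in> csq q' \<Longrightarrow> v # vs \<in> chains m n (Suc k) z" "distinct (v # vs)"
    "\<And>w. w \<in> set (v # vs) \<Longrightarrow> missing m n \<sigma> \<tau> w \<and> \<not> crosses e w \<and>
       (\<exists>a b i j. sep w a b \<and> lvl \<sigma> \<tau> i a \<and> lvl \<sigma> \<tau> j b \<and> i \<le> Suc k \<and> j \<le> Suc k)"
    "edge_mid v \<in> csq q'" "near (2 * k + 1) v"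
    using Suc.IH[OF u(3)] by blast
  have vS: "v \<in> S" using v(3)[of v] unit_in_S by (auto simp: missing_def)
  have iq': "insq m n q'" using missing_insq[OF \<sigma> \<tau> u(1) s'] .
  have "near (Suc (Suc (2 * k + 1))) u"
    using near_across[OF iq' lvl_Suc(1)[OF u(3)] v(5) vS v(4) uS sep_mid[OF s']] .
  moreover have "u \<notin> set (v # vs)"
  proof
    assume "u \<in> set (v # vs)"
    then obtain a b i j where ab: "sep u a b" "lvl \<sigma> \<tau> i a" "lvl \<sigma> \<tau> j b" "i \<le> Suc k" "j \<le> Suc k" using v(3) by blast
    have "q = a \<or> q = b" using sep_unique[OF u(2) ab(1)] .
    then show False using lvl_unique Suc.prems ab by (metis Suc_n_not_le_n)
  qed
  moreover have "\<forall>z. z \<in> csq q \<longrightarrow> u # v # vs \<in> chains m n (Suc (Suc k)) z"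
    using v(1)[OF sep_mid[OF s']] ul sep_mid[OF u(2)] by (auto simp: nbrs_def)
  moreover have "\<exists>a b i j. sep u a b \<and> lvl \<sigma> \<tau> i a \<and> lvl \<sigma> \<tau> j b \<and> i \<le> Suc (Suc k) \<and> j \<le> Suc (Suc k)"
    using u(2,3) Suc.prems by (meson le_refl le_SucI)
  moreover have "\<forall>w\<in>set (v # vs). missing m n \<sigma> \<tau> w \<and> \<not> crosses e w \<and>
       (\<exists>a b i j. sep w a b \<and> lvl \<sigma> \<tau> i a \<and> lvl \<sigma> \<tau> j b \<and> i \<le> Suc (Suc k) \<and> j \<le> Suc (Suc k))"
    using v(3) by (meson le_SucI)
  ultimately show ?case using u(1) nc sep_mid[OF u(2)] v(2)
    by (intro exI[of _ u] exI[of _ "v # vs"] conjI ballI) (auto simp: numeral_eq_Suc)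
qed

text \<open>
  The triangle at the edge is in the influence region unless the edge is a side of the square,
  by \<open>utri_small_or_influenced\<close> and \<open>diagonal_influenced\<close>.
\<close>

lemma near_met_square:
  assumes \<sigma>: "triangulation m n \<sigma>" and \<tau>: "triangulation m n \<tau>"
    and z: "z \<in> midpoints m n" "z \<in> csq q" "meets e q"
  shows "near 0 (edge_at S z) \<or> (elen (edge_at S z) = 1 \<and> near 1 (edge_at S z))"
proof -
  define g where "g = edge_at S z"
  have g: "g \<in> S" "edge_mid g = z" using edge_at[OF S.tri z(1)] by (auto simp: g_def)
  note gl = S.lat[OF g(1)]
  show ?thesis
  proof (cases "elen g = 1")
    case True
    have "z \<notin> osq q"
    proof
      assume "z \<in> osq q"
      obtain p r where pr: "g = E p r" using gl by (rule lattice_edgeE)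
      have "p + r = (2 * fst q + 1, 2 * snd q + 1)" using \<open>z \<in> osq q\<close> g(2) unfolding pr edge_mid_mp by (metis mp_osq)
      moreover have "len (r - p) = 1" using True unfolding pr elen_E by simp
      ultimately show False
        using odd_sum_gap[of "fst p" "fst r" "fst q"] odd_sum_gap[of "snd p" "snd r" "snd q"] by (auto simp: len_def prod_eq_iff)
    qed
    then obtain u q' where u: "u \<in> lattice_edges m n" "sep u q q'" "edge_mid u = z" using midpoint_on_side[OF z(1,2)] by blast
    then have "u = g" using unit_edge_unique[OF u(1) gl sep_elen[OF u(2)] True] g(2) by simp
    then have "near 1 g" using side_near[OF g(1) _ z(3)] u(2) by blast
    then show ?thesis using True g_def by blast
  next
    case False
    obtain t where t: "utri S t" "g \<subseteq> t" using edge_in_utri[OF S.tri mn g(1)] by blast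
    have "near 0 g"
    proof (cases "\<exists>q1. t \<subseteq> csq q1")
      case False
      then have "convex hull t \<subseteq> U" using utri_small_or_influenced[OF t(1)] by blast
      then show ?thesis using t dist_le_0 unfolding near_def by blast
    next
      case True
      then obtain q1 where "g \<subseteq> csq q1" using t(2) by blast
      then have s: "elen g = 2" "z \<in> osq q1" using edge_in_square[OF gl] False g(2) by auto
      then have "q1 = q" using osq_csq_unique z(2) by blast
      obtain l0 l1 l2 l3 where l: "(l0,l1,l2,l3) \<in> frames q" using frames_exists by blast
      obtain p r where pr: "g = E p r" using gl by (rule lattice_edgeE)
      have "edge_mid g = edge_mid (E l0 l2)" using s(2) frames_mid(2)[OF l] g(2) \<open>q1 = q\<close>
        unfolding pr edge_mid_mp by (metis mp_osq)
      then have "g = E l0 l2 \<or> g = E l1 l3" using unit_diagonal_frames[OF l gl] s(1) by simp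
      then obtain k0 k1 k2 k3 where f: "(k0,k1,k2,k3) \<in> frames q" "g = E k0 k2" using l frames_rot by blast
      obtain t' where "utri S t'" "E k0 k2 \<subseteq> t'" "convex hull t' \<subseteq> U" using diagonal_influenced[OF f(1) z(3)] g(1) f(2) by blast
      then show ?thesis using f(2) dist_le_0 unfolding near_def by blast
    qed
    then show ?thesis using g_def by blast
  qed
qed

text \<open>
  A shortest path with \<open>k + 1\<close> steps gives distance at most \<open>2 * k +
  3\<close>. If the square of \<open>z\<close> is itself met by \<open>e\<close>, then either
  the distance is \<open>0\<close> or \<open>z\<close> carries a unit edge of \<open>S\<close>;
  this edge is missing because \<open>z\<close> is in the zone, and it forms a chain of length
  one. The factor \<open>4\<close> covers both cases.
\<close>

lemma zone_chain:
  assumes \<sigma>: "triangulation m n \<sigma>" and \<tau>: "triangulation m n \<tau>"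
    and z: "z \<in> A" "z \<in> zone m n e \<sigma> \<tau>" and d: "influence_dist G S A e > 0"
  shows "\<exists>k us. us \<in> chains m n k z \<and> distinct us \<and> influence_dist G S A e \<le> 4 * k \<and>
     (\<forall>v\<in>set us. missing m n \<sigma> \<tau> v \<and> \<not> crosses e v)"
proof -
  obtain q where zm: "z \<in> midpoints m n" and zu: "\<not> (elen (edge_at \<sigma> z) = 1 \<and> elen (edge_at \<tau> z) = 1)"
    and q: "q \<in> reach m n e \<sigma> \<tau>" "z \<in> csq q" using z(2) unfolding zone_def by blast
  have g: "edge_at S z \<in> S" "edge_mid (edge_at S z) = z" using edge_at[OF S.tri zm] by auto
  obtain k where k: "lvl \<sigma> \<tau> k q" using reach_lvl[OF q(1)] by blast
  show ?thesis
  proof (cases k)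
    case 0
    then have mt: "meets e q" using k lvl_0 by blast
    have "\<not> near 0 (edge_at S z)" using near_dist[OF _ z(1)] d by fastforce
    then have g1: "elen (edge_at S z) = 1" "near 1 (edge_at S z)" using near_met_square[OF \<sigma> \<tau> zm q(2) mt] by auto
    have gl: "edge_at S z \<in> lattice_edges m n" using S.lat g(1) by blast
    have "edge_at T z = edge_at S z" if "triangulation m n T" "edge_at S z \<in> T" for T
      using edge_at_eqI[OF that] g(2) by simp
    then have "missing m n \<sigma> \<tau> (edge_at S z)" unfolding missing_def using gl g1(1) zu \<sigma> \<tau> by metis
    moreover have "\<not> crosses e (edge_at S z)" using triangulation_noncrossing[OF S.tri eS g(1)] .
    moreover have "[edge_at S z] \<in> chains m n 1 z" using gl g1(1) g(2) q(2) by (auto simp: nbrs_def)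
    moreover have "influence_dist G S A e \<le> 4 * 1" using near_dist[OF g1(2) z(1)] by simp
    ultimately show ?thesis by (intro exI[of _ 1] exI[of _ "[edge_at S z]"]) auto
  next
    case (Suc k')
    note kq = k[unfolded Suc]
    obtain u us where u: "u # us \<in> chains m n (Suc k') z" "distinct (u # us)"
      "\<And>v. v \<in> set (u # us) \<Longrightarrow> missing m n \<sigma> \<tau> v \<and> \<not> crosses e v"
      "edge_mid u \<in> csq q" "near (2 * k' + 1) u"
      using chain_exists[OF \<sigma> \<tau> kq] q(2) by blast
    have uS: "u \<in> S" using u(3)[of u] unit_in_S by (auto simp: missing_def)
    obtain q' w where w: "missing m n \<sigma> \<tau> w" "sep w q q'" using lvl_Suc(2)[OF kq] unfolding steps_def by blast
    have iq: "insq m n q" using missing_insq[OF \<sigma> \<tau> w] .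
    have "near (Suc (Suc (2 * k' + 1))) (edge_at S z)"
      using near_across[OF iq lvl_Suc(1)[OF kq] u(5) uS u(4) g(1)] g(2) q(2) by simp
    then have "influence_dist G S A e \<le> 4 * Suc k'" using near_dist[OF _ z(1)] by fastforce
    then show ?thesis using u(1,2,3) by blast
  qed
qed

end

lemma sum_UN_le:
  fixes f :: "'b \<Rightarrow> real"
  assumes "finite I" "\<And>i. i \<in> I \<Longrightarrow> finite (B i)" "\<And>x. f x \<ge> 0"
  shows "sum f (\<Union>i\<in>I. B i) \<le> (\<Sum>i\<in>I. sum f (B i))"
  using assms(1,2)
proof (induction I)
  case (insert i I)
  have "sum f (B i \<union> (\<Union>i\<in>I. B i)) + sum f (B i \<inter> (\<Union>i\<in>I. B i)) = sum f (B i) + sum f (\<Union>i\<in>I. B i)"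
    using insert by (intro sum.union_inter) auto
  moreover have "sum f (B i \<inter> (\<Union>i\<in>I. B i)) \<ge> 0" using assms(3) by (simp add: sum_nonneg)
  moreover have "sum f (\<Union>i\<in>I. B i) \<le> (\<Sum>i\<in>I. sum f (B i))" using insert by auto
  ultimately show ?case using insert.hyps by simp
qed simp

section \<open>Counting chains\<close>

text \<open>
  In doubled coordinates two points of a common unit square differ by at most two in each
  coordinate, and a unit edge is determined by its midpoint; this gives \<open>25 =
  5\<^sup>2\<close>.
\<close>

lemma nbrs_card:
  assumes "x = mp c" shows "finite (nbrs m n x)" "card (nbrs m n x) \<le> 25"
proof -
  show fin: "finite (nbrs m n x)"
    by (rule finite_subset[OF _ finite_lattice_edges[of m n]]) (auto simp: nbrs_def)
  define B where "B = {fst c - 2..fst c + 2} \<times> {snd c - 2..snd c + 2}"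
  have "inj_on edge_mid (nbrs m n x)" by (rule inj_onI, rule unit_edge_unique[of _ m n]) (auto simp: nbrs_def)
  moreover have "edge_mid ` nbrs m n x \<subseteq> mp ` B"
  proof
    fix y assume "y \<in> edge_mid ` nbrs m n x"
    then obtain u q where u: "u \<in> lattice_edges m n" "y = edge_mid u" "x \<in> csq q" "edge_mid u \<in> csq q"
      unfolding nbrs_def by blast
    obtain p r where pr: "u = E p r" using u(1) by (rule lattice_edgeE)
    have y: "y = mp (p + r)" using u(2) pr edge_mid_mp by simp
    have "p + r \<in> B" using u(3) u(4)[folded u(2)] unfolding assms y mp_csq B_def mem_Times_iff by auto
    then show "y \<in> mp ` B" using y by blast
  qed
  moreover have "finite B" "card B = 25" by (auto simp: B_def card_cartesian_product)
  ultimately show "card (nbrs m n x) \<le> 25"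
    using card_mono[of "mp ` B" "edge_mid ` nbrs m n x"] card_image_le[of B mp] card_image by fastforce
qed

lemma chains_card:
  "finite (chains m n k (mp c)) \<and> card (chains m n k (mp c)) \<le> 25 ^ k"
proof (induction k arbitrary: c)
  case (Suc k)
  define N where "N = nbrs m n (mp c)"
  have N: "finite N" "card N \<le> 25" unfolding N_def using nbrs_card[OF refl] by auto
  have eq: "chains m n (Suc k) (mp c) = (\<Union>u\<in>N. (#) u ` chains m n k (edge_mid u))" by (auto simp: N_def)
  have IH: "finite (chains m n k (edge_mid u)) \<and> card (chains m n k (edge_mid u)) \<le> 25 ^ k" if "u \<in> N" for u
  proof -
    have "u \<in> lattice_edges m n" using that by (simp add: N_def nbrs_def)
    then obtain p r where "u = E p r" by (rule lattice_edgeE)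
    then show ?thesis using Suc.IH[of "p + r"] by (simp add: edge_mid_mp)
  qed
  have "card (chains m n (Suc k) (mp c)) \<le> (\<Sum>u\<in>N. card ((#) u ` chains m n k (edge_mid u)))"
    unfolding eq by (rule card_UN_le[OF N(1)])
  also have "\<dots> \<le> (\<Sum>u\<in>N. 25 ^ k)"
  proof (rule sum_mono)
    fix u assume "u \<in> N"
    then show "card ((#) u ` chains m n k (edge_mid u)) \<le> 25 ^ k"
      using IH[of u] card_image_le[of "chains m n k (edge_mid u)" "(#) u"] by linarith
  qed
  also have "\<dots> = card N * 25 ^ k" by simp
  also have "\<dots> \<le> 25 * 25 ^ k" using N(2) by (rule mult_le_mono1)
  finally show ?case unfolding eq using N(1) IH by auto
qed simp

context minimal_triangulation
begin

lemma missing_excited: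
  assumes "u \<in> lattice_edges m n" "elen u = 1" "compatible \<Delta> u" "triangulation m n \<tau>" "u \<notin> \<tau>"
  shows "u \<in> excited \<tau>"
proof -
  have uS: "u \<in> S" using unit_in assms(1-3) by blast
  note x = edge_mid_in_midpoints[OF assms(1)]
  note f = edge_at[OF assms(4) x]
  have fl: "edge_at \<tau> (edge_mid u) \<in> lattice_edges m n" using triangulation_lattice[OF assms(4) f(1)] .
  have "elen (edge_at \<tau> (edge_mid u)) \<noteq> 0"
  proof -
    obtain p q where pq: "edge_at \<tau> (edge_mid u) = E p q" "prim (q - p)" using fl by (rule lattice_edgeE)
    then have "q - p \<noteq> 0" by auto
    then show ?thesis unfolding pq elen_E using len_pos[of "q - p"] by simp
  qed
  moreover have "elen (edge_at \<tau> (edge_mid u)) \<noteq> 1"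
  proof
    assume "elen (edge_at \<tau> (edge_mid u)) = 1"
    then have "edge_at \<tau> (edge_mid u) = u" using unit_edge_unique[OF fl assms(1)] assms(2) f(2) by simp
    then show False using f(1) assms(5) by simp
  qed
  ultimately show ?thesis using uS assms(2) by (simp add: excited_def slot_def)
qed

end

section \<open>The total variation bound\<close>

context influence
begin

text \<open>
  Each edge of \<open>Y\<close> is missing from \<open>\<sigma>\<close> or from
  \<open>\<tau>\<close>, and where it is missing it is excited with respect to the ground state
  or to \<open>S\<close>. The \<open>2 ^ card Y\<close> ways of distributing the edges turn
  \<open>1 / 64\<close> into \<open>1 / 32\<close>.
\<close>

lemma missing_prob:
  fixes lam :: real
  assumes lam: "0 < lam" "lam \<le> 1 / 2 ^ 49" and Y: "finite Y"
    and u: "\<And>v. v \<in> Y \<Longrightarrow> v \<in> lattice_edges m n \<and> elen v = 1 \<and> \<not> crosses e v"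
  defines "W \<equiv> {\<tau>. triangulation m n \<tau>}" and "We \<equiv> {\<tau>. triangulation m n \<tau> \<and> e \<in> \<tau>}"
    and "w \<equiv> (\<lambda>\<tau>. lam powr total_length \<tau>)"
  shows "(\<Sum>z\<in>W \<times> We. if \<forall>v\<in>Y. missing m n (fst z) (snd z) v then w (fst z) * w (snd z) else 0)
    \<le> (1 / 32) ^ card Y * ((\<Sum>\<sigma>\<in>W. w \<sigma>) * (\<Sum>\<tau>\<in>We. w \<tau>))"
proof -
  define Z Ze where "Z = (\<Sum>\<sigma>\<in>W. w \<sigma>)" and "Ze = (\<Sum>\<tau>\<in>We. w \<tau>)"
  have finW: "finite W" unfolding W_def using finite_triangulations .
  then have finWe: "finite We" by (rule rev_finite_subset) (auto simp: W_def We_def)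
  have wpos: "w \<tau> \<ge> 0" for \<tau> by (simp add: w_def)
  have Zpos: "Z \<ge> 0" "Ze \<ge> 0" unfolding Z_def Ze_def by (simp_all add: sum_nonneg wpos)
  define a where "a Q = (\<Sum>\<sigma> | \<sigma> \<in> W \<and> Q \<inter> \<sigma> = {}. w \<sigma>)" for Q
  define b where "b Q = (\<Sum>\<tau> | \<tau> \<in> We \<and> Q \<inter> \<tau> = {}. w \<tau>)" for Q
  have a: "a Q \<le> (1/64) ^ card Q * Z" if Q: "Q \<subseteq> Y" for Q
  proof -
    have "Q \<subseteq> G" using Q u unit_in_G by blast
    have "a Q \<le> (\<Sum>\<tau> | \<tau> \<in> G.\<Omega> \<and> Q \<subseteq> G.excited \<tau>. w \<tau>)" unfolding a_def
    proof (rule sum_mono2)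
      show "finite {\<tau> \<in> G.\<Omega>. Q \<subseteq> G.excited \<tau>}"
        by (rule finite_subset[OF _ finW]) (auto simp: G.\<Omega>_def W_def)
      show "{\<sigma> \<in> W. Q \<inter> \<sigma> = {}} \<subseteq> {\<tau> \<in> G.\<Omega>. Q \<subseteq> G.excited \<tau>}"
      proof
        fix \<sigma> assume "\<sigma> \<in> {\<sigma> \<in> W. Q \<inter> \<sigma> = {}}"
        then have s: "triangulation m n \<sigma>" "Q \<inter> \<sigma> = {}" by (auto simp: W_def)
        have "v \<in> G.excited \<sigma>" if "v \<in> Q" for v
          by (rule G.missing_excited) (use that Q u s in \<open>auto simp: compatible_def\<close>)
        then show "\<sigma> \<in> {\<tau> \<in> G.\<Omega>. Q \<subseteq> G.excited \<tau>}" using s by (auto simp: G.\<Omega>_def)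
      qed
    qed (use wpos in auto)
    also have "\<dots> \<le> (1/64) ^ card Q * (\<Sum>\<tau>\<in>G.\<Omega>. w \<tau>)" unfolding w_def by (rule G.peierls[OF lam \<open>Q \<subseteq> G\<close>])
    also have "G.\<Omega> = W" by (auto simp: G.\<Omega>_def W_def)
    finally show ?thesis by (simp add: Z_def)
  qed
  have b: "b Q \<le> (1/64) ^ card Q * Ze" if Q: "Q \<subseteq> Y" for Q
  proof -
    have "Q \<subseteq> S" using Q u unit_in_S by blast
    have "b Q \<le> (\<Sum>\<tau> | \<tau> \<in> S.\<Omega> \<and> Q \<subseteq> S.excited \<tau>. w \<tau>)" unfolding b_def
    proof (rule sum_mono2)
      show "finite {\<tau> \<in> S.\<Omega>. Q \<subseteq> S.excited \<tau>}"
        by (rule finite_subset[OF _ finW]) (auto simp: S.\<Omega>_def W_def)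
      show "{\<sigma> \<in> We. Q \<inter> \<sigma> = {}} \<subseteq> {\<tau> \<in> S.\<Omega>. Q \<subseteq> S.excited \<tau>}"
      proof
        fix \<sigma> assume "\<sigma> \<in> {\<sigma> \<in> We. Q \<inter> \<sigma> = {}}"
        then have s: "triangulation m n \<sigma>" "e \<in> \<sigma>" "Q \<inter> \<sigma> = {}" by (auto simp: We_def)
        have "v \<in> S.excited \<sigma>" if "v \<in> Q" for v
        proof (rule S.missing_excited)
          have "\<not> crosses e v" using that Q u by blast
          then show "compatible {e} v" unfolding compatible_def using crosses_commute by (metis singletonD)
        qed (use that Q u s in auto)
        then show "\<sigma> \<in> {\<tau> \<in> S.\<Omega>. Q \<subseteq> S.excited \<tau>}" using s by (auto simp: S.\<Omega>_def)
      qed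
    qed (use wpos in auto)
    also have "\<dots> \<le> (1/64) ^ card Q * (\<Sum>\<tau>\<in>S.\<Omega>. w \<tau>)" unfolding w_def by (rule S.peierls[OF lam \<open>Q \<subseteq> S\<close>])
    also have "S.\<Omega> = We" by (auto simp: S.\<Omega>_def We_def)
    finally show ?thesis by (simp add: Ze_def)
  qed
  have nn: "a Q \<ge> 0" "b Q \<ge> 0" for Q unfolding a_def b_def by (simp_all add: sum_nonneg wpos)
  define B where "B Q = {\<sigma>\<in>W. Q \<inter> \<sigma> = {}} \<times> {\<tau>\<in>We. (Y - Q) \<inter> \<tau> = {}}" for Q
  have finB: "finite (B Q)" for Q unfolding B_def using finW finWe by auto
  \<comment> \<open>split the missing edges into those missing on the left and the others\<close>
  have "(\<Sum>z\<in>W \<times> We. if \<forall>v\<in>Y. missing m n (fst z) (snd z) v then w (fst z) * w (snd z) else 0)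
    = (\<Sum>z | z \<in> W \<times> We \<and> (\<forall>v\<in>Y. missing m n (fst z) (snd z) v). w (fst z) * w (snd z))"
    using finW finWe by (subst sum.inter_filter) auto
  also have "\<dots> \<le> (\<Sum>z\<in>(\<Union>Q\<in>Pow Y. B Q). w (fst z) * w (snd z))"
  proof (rule sum_mono2)
    show "{z \<in> W \<times> We. \<forall>v\<in>Y. missing m n (fst z) (snd z) v} \<subseteq> (\<Union>Q\<in>Pow Y. B Q)"
    proof
      fix z assume "z \<in> {z \<in> W \<times> We. \<forall>v\<in>Y. missing m n (fst z) (snd z) v}"
      then have z: "fst z \<in> W" "snd z \<in> We" "\<And>v. v \<in> Y \<Longrightarrow> v \<notin> fst z \<or> v \<notin> snd z" by (auto simp: missing_def)
      then have zB: "z \<in> B (Y - fst z)" unfolding B_def mem_Times_iff by blast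
      have "Y - fst z \<in> Pow Y" by simp
      then show "z \<in> (\<Union>Q\<in>Pow Y. B Q)" using zB by (rule UN_I)
    qed
  qed (use finB Y wpos in auto)
  also have "\<dots> \<le> (\<Sum>Q\<in>Pow Y. \<Sum>z\<in>B Q. w (fst z) * w (snd z))"
    using Y finB wpos by (intro sum_UN_le) auto
  also have "\<dots> = (\<Sum>Q\<in>Pow Y. a Q * b (Y - Q))"
    unfolding a_def b_def B_def sum_product by (simp add: sum.cartesian_product case_prod_beta)
  also have "\<dots> \<le> (\<Sum>Q\<in>Pow Y. (1/64) ^ card Y * (Z * Ze))"
  proof (rule sum_mono)
    fix Q assume "Q \<in> Pow Y"
    then have Q: "Q \<subseteq> Y" by simp
    have "a Q * b (Y - Q) \<le> ((1/64) ^ card Q * Z) * ((1/64) ^ card (Y - Q) * Ze)"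
      using a[OF Q] b[of "Y - Q"] nn Zpos by (intro mult_mono) auto
    also have "\<dots> = (1/64) ^ (card Q + card (Y - Q)) * (Z * Ze)" by (simp add: power_add)
    also have "card Q + card (Y - Q) = card Y" using Q Y card_Diff_subset[of Q Y] card_mono[of Y Q] finite_subset[of Q Y] by simp
    finally show "a Q * b (Y - Q) \<le> (1/64) ^ card Y * (Z * Ze)" .
  qed
  also have "\<dots> = (2 ^ card Y * (1/64) ^ card Y) * (Z * Ze)" using Y by (simp add: card_Pow)
  also have "(2::real) ^ card Y * (1/64) ^ card Y = (1/32) ^ card Y" unfolding power_mult_distrib[symmetric] by simp
  finally show ?thesis by (simp add: Z_def Ze_def)
qed

text \<open>
  Only an initial piece of the chain, of length about a quarter of the distance, is used, so
  that all chains to be counted have the same length.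
\<close>

lemma influence_bound:
  fixes lam :: real
  assumes lam: "0 < lam" "lam \<le> 1 / 2 ^ 49" and A: "A \<subseteq> midpoints m n"
    and d: "influence_dist G S A e > 0" and k: "4 * k < influence_dist G S A e + 4"
  shows "tv_dist (marginal A (gibbs m n lam)) (marginal A (gibbs_cond m n lam (edge_mid e) e)) \<le> real (card A) * (25 / 32) ^ k"
proof -
  define W where "W = {\<tau>. triangulation m n \<tau>}"
  define We where "We = {\<tau>. triangulation m n \<tau> \<and> e \<in> \<tau>}"
  define w where "w = (\<lambda>\<tau>. lam powr total_length \<tau>)"
  define Z Ze where "Z = (\<Sum>\<sigma>\<in>W. w \<sigma>)" and "Ze = (\<Sum>\<tau>\<in>We. w \<tau>)"
  have finW: "finite W" unfolding W_def using finite_triangulations .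
  then have finWe: "finite We" by (rule rev_finite_subset) (auto simp: W_def We_def)
  have wpos: "w \<tau> > 0" for \<tau> using lam by (simp add: w_def)
  have "W \<noteq> {}" "We \<noteq> {}" using S.tri eS by (auto simp: W_def We_def)
  then have Zpos: "Z * Ze > 0" unfolding Z_def Ze_def using finW finWe wpos by (simp add: sum_pos)
  have e1: "elen e \<noteq> 1" using unit_in_G[OF el] eG by blast
  have finA: "finite A" using A finite_midpoints finite_subset by blast
  define C where "C z = {us \<in> chains m n k z. distinct us \<and> (\<forall>v\<in>set us. \<not> crosses e v)}" for z
  have C: "finite (C z)" "card (C z) \<le> 25 ^ k" if "z \<in> A" for z
  proof -
    have "z \<in> midpoints m n" using that A by blast
    then obtain c where "z = mp c" using midpoints_iff by blast
    then have ch: "finite (chains m n k z)" "card (chains m n k z) \<le> 25 ^ k" using chains_card[of m n k c] by auto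
    have sub: "C z \<subseteq> chains m n k z" by (auto simp: C_def)
    show "finite (C z)" using sub ch(1) by (rule finite_subset)
    show "card (C z) \<le> 25 ^ k" using card_mono[OF ch(1) sub] ch(2) by (rule order_trans)
  qed
  have bound: "(if A \<inter> zone m n e (fst p) (snd p) \<noteq> {} then w (fst p) * w (snd p) else 0)
     \<le> (\<Sum>z\<in>A. \<Sum>us\<in>C z. if \<forall>v\<in>set us. missing m n (fst p) (snd p) v then w (fst p) * w (snd p) else 0)"
    (is "_ \<le> (\<Sum>z\<in>A. \<Sum>us\<in>C z. ?f us)") if p: "p \<in> W \<times> We" for p
  proof (cases "A \<inter> zone m n e (fst p) (snd p) = {}")
    case True
    have "0 \<le> ?f us" for us using wpos[of "fst p"] wpos[of "snd p"] by simp
    then show ?thesis using True by (simp add: sum_nonneg)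
  next
    case False
    then obtain z where z: "z \<in> A" "z \<in> zone m n e (fst p) (snd p)" by blast
    have t: "triangulation m n (fst p)" "triangulation m n (snd p)" using p by (auto simp: W_def We_def)
    obtain l us where us: "us \<in> chains m n l z" "distinct us" "influence_dist G S A e \<le> 4 * l"
      "\<forall>v\<in>set us. missing m n (fst p) (snd p) v \<and> \<not> crosses e v"
      using zone_chain[OF t z d] by blast
    have kl: "k \<le> l" using k us(3) by linarith
    have sub: "set (take k us) \<subseteq> set us" by (rule set_take_subset)
    have tC: "take k us \<in> C z" unfolding C_def using chains_take[OF us(1) kl] us(2,4) sub by auto
    have nn: "0 \<le> ?f us" for us using wpos[of "fst p"] wpos[of "snd p"] by simp
    have "w (fst p) * w (snd p) = ?f (take k us)" using us(4) sub by auto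
    also have "\<dots> \<le> (\<Sum>us\<in>C z. ?f us)" using member_le_sum[OF tC, of ?f] C(1)[OF z(1)] nn by blast
    also have "\<dots> \<le> (\<Sum>z\<in>A. \<Sum>us\<in>C z. ?f us)"
      using z(1) finA nn by (intro member_le_sum[of z A "\<lambda>z. \<Sum>us\<in>C z. ?f us"]) (auto intro: sum_nonneg)
    finally show ?thesis using False by simp
  qed
  have each: "(\<Sum>p\<in>W \<times> We. if \<forall>v\<in>set us. missing m n (fst p) (snd p) v then w (fst p) * w (snd p) else 0)
      \<le> (1/32) ^ k * (Z * Ze)" if us: "us \<in> C z" for us z
  proof -
    have c: "us \<in> chains m n k z" "distinct us" "\<forall>v\<in>set us. \<not> crosses e v" using us by (auto simp: C_def)
    have units: "v \<in> lattice_edges m n \<and> elen v = 1" if "v \<in> set us" "us \<in> chains m n j z" for v us j z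
      using that
    proof (induction j arbitrary: us z)
      case (Suc j)
      then obtain x xs where "us = x # xs" "x \<in> nbrs m n z" "xs \<in> chains m n j (edge_mid x)" by auto
      then show ?case using Suc.IH[of xs "edge_mid x"] Suc.prems(1) by (auto simp: nbrs_def)
    qed simp
    have "v \<in> lattice_edges m n \<and> elen v = 1 \<and> \<not> crosses e v" if "v \<in> set us" for v
      using units[OF that c(1)] c(3) that by blast
    moreover have "card (set us) = k" using c(2) chains_length[OF c(1)] distinct_card by metis
    ultimately show ?thesis using missing_prob[OF lam finite_set[of us]]
      unfolding W_def We_def w_def Z_def Ze_def by auto
  qed
  have "(\<Sum>p\<in>W \<times> We. if A \<inter> zone m n e (fst p) (snd p) \<noteq> {} then w (fst p) * w (snd p) else 0)
    \<le> (\<Sum>p\<in>W \<times> We. \<Sum>z\<in>A. \<Sum>us\<in>C z. if \<forall>v\<in>set us. missing m n (fst p) (snd p) v then w (fst p) * w (snd p) else 0)"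
    by (rule sum_mono[OF bound])
  also have "\<dots> = (\<Sum>z\<in>A. \<Sum>p\<in>W \<times> We. \<Sum>us\<in>C z. if \<forall>v\<in>set us. missing m n (fst p) (snd p) v then w (fst p) * w (snd p) else 0)"
    by (rule sum.swap)
  also have "\<dots> = (\<Sum>z\<in>A. \<Sum>us\<in>C z. \<Sum>p\<in>W \<times> We. if \<forall>v\<in>set us. missing m n (fst p) (snd p) v then w (fst p) * w (snd p) else 0)"
    by (intro sum.cong refl sum.swap)
  also have "\<dots> \<le> (\<Sum>z\<in>A. \<Sum>us\<in>C z. (1/32) ^ k * (Z * Ze))" by (intro sum_mono each)
  also have "\<dots> = (\<Sum>z\<in>A. real (card (C z)) * ((1/32) ^ k * (Z * Ze)))" by simp
  also have "\<dots> \<le> (\<Sum>z\<in>A. 25 ^ k * ((1/32) ^ k * (Z * Ze)))"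
  proof (rule sum_mono)
    fix z assume "z \<in> A"
    then have "real (card (C z)) \<le> real (25 ^ k)" using C(2) of_nat_le_iff by blast
    then show "real (card (C z)) * ((1/32) ^ k * (Z * Ze)) \<le> 25 ^ k * ((1/32) ^ k * (Z * Ze))"
      using Zpos by (intro mult_right_mono) auto
  qed
  also have "\<dots> = real (card A) * (25 / 32) ^ k * (Z * Ze)" by (simp add: power_divide)
  finally have "(\<Sum>p\<in>W \<times> We. if A \<inter> zone m n e (fst p) (snd p) \<noteq> {} then w (fst p) * w (snd p) else 0) / (Z * Ze)
     \<le> real (card A) * (25 / 32) ^ k"
    using Zpos by (simp add: pos_divide_le_eq)
  then show ?thesis using tv_zone[OF lam(1) el e1 A] unfolding W_def We_def w_def Z_def Ze_def by (rule order_trans[rotated])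
qed

end

lemma tv_dist_le_1: "tv_dist P Q \<le> 1"
  unfolding tv_dist_def
proof (rule cSUP_least)
  show "\<bar>measure_pmf.prob P E - measure_pmf.prob Q E\<bar> \<le> 1" for E
    using measure_pmf.prob_le_1[of P E] measure_pmf.prob_le_1[of Q E]
      measure_nonneg[of "measure_pmf P" E] measure_nonneg[of "measure_pmf Q" E] by linarith
qed simp

lemma tv_dist_le_card:
  assumes "finite A" shows "tv_dist (marginal A P) (marginal A Q) \<le> real (card A)"
proof (cases "A = {}")
  case True
  have "marginal {} R = return_pmf (\<lambda>_. undefined)" for R
    by (simp add: marginal_def restrict_def map_pmf_const)
  then show ?thesis using True by (simp add: tv_dist_def)
next
  case False
  then have "real (card A) \<ge> 1" using assms by (simp add: Suc_le_eq card_gt_0_iff)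
  then show ?thesis using tv_dist_le_1 order_trans by blast
qed

lemma influence_dist_ground:
  assumes G: "triangulation m n G" and e: "e \<in> G"
  shows "influence_dist G S A e = 0"
proof -
  have "influence_region G e = {}" using edge_at_eqI[OF G e] by (simp add: influence_region_def)
  moreover have "convex hull t \<noteq> {}" if "t \<in> triangles S" for t using that by (auto simp: triangles_def)
  ultimately have "{t \<in> triangles S. convex hull t \<subseteq> influence_region G e} = {}" by blast
  then show ?thesis unfolding influence_dist_def triangle_set_dist_def by simp
qed

lemma ground_minimal: "ground_state m n G \<Longrightarrow> minimal_triangulation m n {} G"
  unfolding ground_state_def is_arg_min_def by unfold_locales (auto simp: not_less)

lemma ground_with_minimal: "ground_state_with m n e S \<Longrightarrow> minimal_triangulation m n {e} S"
  unfolding ground_state_with_def is_arg_min_def by unfold_locales (auto simp: not_less)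

theorem theorem1p2:
  shows "\<exists>lam0>0. \<forall>lam::real. 0 < lam \<and> lam < lam0 \<longrightarrow>
    (\<exists>c>0. \<forall>(m::nat) (n::nat) G x e S A.
       m \<ge> 1 \<longrightarrow> n \<ge> 1 \<longrightarrow>
       ground_state m n G \<longrightarrow>
       x \<in> midpoints m n \<longrightarrow>
       e \<in> lattice_edges m n \<longrightarrow> edge_mid e = x \<longrightarrow>
       ground_state_with m n e S \<longrightarrow>
       A \<subseteq> midpoints m n \<longrightarrow>
       tv_dist (marginal A (gibbs m n lam)) (marginal A (gibbs_cond m n lam x e))
         \<le> real (card A) * exp (- c * real (influence_dist G S A e)))"
proof (rule exI[of _ "1 / 2 ^ 49"], intro conjI allI impI)
  fix lam :: real assume "0 < lam \<and> lam < 1 / 2 ^ 49"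
  then have lam: "0 < lam" "lam \<le> 1 / 2 ^ 49" by auto
  define c :: real where "c = ln (32 / 25) / 4"
  have "c > 0" by (simp add: c_def)
  show "\<exists>c>0. \<forall>(m::nat) (n::nat) G x e S A.
       m \<ge> 1 \<longrightarrow> n \<ge> 1 \<longrightarrow> ground_state m n G \<longrightarrow> x \<in> midpoints m n \<longrightarrow>
       e \<in> lattice_edges m n \<longrightarrow> edge_mid e = x \<longrightarrow> ground_state_with m n e S \<longrightarrow> A \<subseteq> midpoints m n \<longrightarrow>
       tv_dist (marginal A (gibbs m n lam)) (marginal A (gibbs_cond m n lam x e))
         \<le> real (card A) * exp (- c * real (influence_dist G S A e))"
  proof (intro exI[of _ c] conjI allI impI)
    fix m n :: nat and G x e S A
    assume mn: "m \<ge> 1" "n \<ge> 1" and G: "ground_state m n G" and e: "e \<in> lattice_edges m n" "edge_mid e = x"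
      and S: "ground_state_with m n e S" and A: "A \<subseteq> midpoints m n"
    interpret G: minimal_triangulation m n "{}" G using ground_minimal[OF G] .
    interpret S: minimal_triangulation m n "{e}" S using ground_with_minimal[OF S] .
    define D where "D = influence_dist G S A e"
    show "tv_dist (marginal A (gibbs m n lam)) (marginal A (gibbs_cond m n lam x e))
         \<le> real (card A) * exp (- c * real (influence_dist G S A e))"
    proof (cases "D = 0")
      case True
      then show ?thesis using tv_dist_le_card[of A] finite_subset[OF A finite_midpoints] by (simp add: D_def)
    next
      case False
      then have eG: "e \<notin> G" using influence_dist_ground[OF G.tri, of e S A] by (auto simp: D_def)
      interpret influence m n G S e using e(1) eG mn by unfold_locales
      define k where "k = (D + 3) div 4"
      have k: "4 * k < D + 4" "D \<le> 4 * k" unfolding k_def by linarith+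
      have "(25 / 32 :: real) ^ k = exp (- (ln (32 / 25) * real k))"
      proof -
        have "exp (- (ln (32 / 25) * real k)) = exp (real k * ln (25 / 32))"
          by (simp add: ln_div algebra_simps)
        then show ?thesis by (simp add: exp_of_nat_mult)
      qed
      also have "\<dots> \<le> exp (- c * real D)"
      proof -
        have "real D \<le> 4 * real k" using k(2) by linarith
        then have "c * real D \<le> c * (4 * real k)" using \<open>c > 0\<close> by (intro mult_left_mono) auto
        then show ?thesis by (simp add: c_def)
      qed
      finally have "real (card A) * (25 / 32) ^ k \<le> real (card A) * exp (- c * real D)" by (intro mult_left_mono) auto
      then show ?thesis using influence_bound[OF lam A, of k] False k(1) e(2) unfolding D_def by auto
    qed
  qed (use \<open>c > 0\<close> in simp_all)
qed simp_all

end
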